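(* Let $n\in\mathbb{N}$ and $r\in(0,+\infty]$. The Fréchet algebra bundles $\mathsf{E}(\mathbb{D}^n_r)$ and $\mathsf{E}(\mathbb{B}^n_r)$ over $\mathbb{C}^\times$ are continuous.
   Context: All algebras are complex, associative and unital. $\mathbb{C}^\times=\mathbb{C}\setminus\{0\}$. Algebras. $W_{n,d}=\{1,\dots,n\}^d$, $W_n=\bigsqcup_{d\ge0}W_{n,d}$, $|\alpha|=d$ for $\alpha\in W_{n,d}$, $\zeta_\alpha=\zeta_{\alpha_1}\cdots\zeta_{\alpha_d}$. $\mathrm{s}(\alpha)=\mathrm{card}\{i\in\{1,\dots,d-1\}:\alpha_i\ne\alpha_{i+1}\}$ if $d=|\alpha|\ge2$, and $\mathrm{s}(\alpha)=|\alpha|-1$ if $|\alpha|\le1$. $\mathcal{F}(\mathbb{D}^n_r)$ (resp. $\mathcal{F}(\mathbb{B}^n_r)$) is the Fréchet algebra of formal series $a=\sum_{\alpha\in W_n}c_\alpha\zeta_\alpha$ in free variables with $\|a\|_{\rho,\tau}=\sum_\alpha|c_\alpha|\rho^{|\alpha|}\tau^{\mathrm{s}(\alpha)+1}<\infty$ for all $\rho\in(0,r)$, $\tau\ge1$ (resp. $\|a\|^\bullet_\rho=\sum_{d\ge0}(\sum_{|\alpha|=d}|c_\alpha|^2)^{1/2}\rho^d<\infty$ for all $\rho\in(0,r)$), topologized by these norms. For $F$ one of these algebras, $\mathcal{O}(\mathbb{C}^\times,F)$ is the Fréchet algebra of holomorphic $F$-valued functions (compact-open topology), $z\in\mathcal{O}(\mathbb{C}^\times)$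 is the coordinate, $I$ is the closed two-sided ideal generated by $\zeta_i\zeta_j-z\zeta_j\zeta_i$ ($i<j$), and $\mathcal{O}(\mathbb{C}^\times,F)/I$ is denoted $\mathcal{O}_{\mathrm{def}}(\mathbb{D}^n_r)$ (resp. $\mathcal{O}_{\mathrm{def}}(\mathbb{B}^n_r)$); it is a Fréchet $\mathcal{O}(\mathbb{C}^\times)$-algebra. Bundles. A family of vector spaces over a set $X$ is a pair $(E,p)$ with $p\colon E\to X$ surjective and a vector space structure on each fiber $E_x=p^{-1}(x)$. If $X$ is a topological space, a prebundle of topological vector spaces over $X$ is a family $(E,p)$ with a topology on $E$ such that $p$ is continuous and open and the zero section, addition $E\times_XE\to E$ and scalar multiplication $\mathbb{C}\times E\to E$ are continuous; $\Gamma(V,E)$ is the space of continuous sections over $V\subset X$. A seminorm on $E$ is a function $E\to[0,+\infty)$ restricting to a seminorm on each fiber. A family $\mathcal{N}=\{\|\cdot\|_\lambda:\lambda\in\Lambda\}$ of seminorms on $E$ is directed if for all $\lambda,\mu$ there are $C>0$, $\nu$ with $\|\cdot\|_\lambda\le C\|\cdot\|_\nu$, $\|\cdot\|_\mu\le C\|\cdot\|_\nu$. A set $S\subset E$ is absolutely convex (absorbing) if each $S\cap E_x$ is so in $E_x$. A locally convex uniform vector structure on $E$ is a family $\mathcal{U}$ of absorbing absolutely convex subsets of $E$ closed under multiplication by nonzero scalars, finite intersections, and passage to larger absolutely convex subsets. For directed $\mathcal{N}$, $\mathcal{U}_{\mathcal{N}}$ is the structure consisting of all absolutely convex sets containing some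 $\{u\in E:\|u\|_\lambda<\varepsilon\}$, $\lambda\in\Lambda$, $\varepsilon>0$. A locally convex bundle is a triple $(E,p,\mathcal{U})$ with $(E,p)$ a prebundle of topological vector spaces and $\mathcal{U}$ a locally convex uniform vector structure such that: each $U\in\mathcal{U}$ contains an open $U_0\in\mathcal{U}$; the sets $s(V)+U=\{s_{p(u)}+u:u\in U,\,p(u)\in V\}$ ($V\subset X$ open, $s\in\Gamma(V,E)$, $U\in\mathcal{U}$ open) form a base of the topology of $E$; and for each $x$ the set of values at $x$ of continuous sections over open neighborhoods of $x$ is dense in $E_x$. It is a Fréchet algebra bundle if moreover each $E_x$ is a Fréchet algebra in the inherited topology, the multiplication $E\times_XE\to E$ is continuous, and for each $U\in\mathcal{U}$ there is $V\in\mathcal{U}$ with $uv\in U$ for all $u,v\in V$ with $p(u)=p(v)$. A directed family $\mathcal{N}$ of seminorms on a prebundle $E$ is admissible if the tubes $\{v\in E:p(v)\in V,\ \|v-s_{p(v)}\|_\lambda<\varepsilon\}$ ($V\subset X$ open, $s\in\Gamma(V,E)$, $\lambda\in\Lambda$, $\varepsilon>0$) are open and form a base of the topology of $E$, and for each $x$ the set of values at $x$ of continuous sections over open neighborhoods of $x$ is dense in $E_x$ for the topology given by the seminorms in $\mathcal{N}$. A locally convex bundle $(E,p,\mathcal{U})$ is continuous if $\mathcal{U}=\mathcal{U}_{\mathcal{N}}$ for some admissible directed family $\mathcal{N}$ of seminorms that are continuous functions on $E$. For a Fréchet $\mathcal{O}(\mathbb{C}^\times)$-algebra $A$ and $q\in\mathbb{C}^\times$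 let $\mathfrak{m}_q=\{f:f(q)=0\}$, $A_q=A/\overline{\mathfrak{m}_qA}$, $u_q$ the class of $u\in A$. $\mathsf{E}(A)=\bigsqcup_qA_q$ with the obvious projection; each continuous seminorm $\|\cdot\|$ on $A$ gives a seminorm on $\mathsf{E}(A)$ (its quotient seminorm on each $A_q$); $\mathcal{U}_A$ is the locally convex uniform vector structure determined by all of these; the topology has as base the sets $\{v:p(v)\in V,\|v-u_{p(v)}\|<\varepsilon\}$ with $V$ open, $u\in A$, $\|\cdot\|$ a continuous seminorm on $A$, $\varepsilon>0$. This is a locally convex algebra bundle. $\mathsf{E}(\mathbb{D}^n_r)=\mathsf{E}(\mathcal{O}_{\mathrm{def}}(\mathbb{D}^n_r))$, $\mathsf{E}(\mathbb{B}^n_r)=\mathsf{E}(\mathcal{O}_{\mathrm{def}}(\mathbb{B}^n_r))$. *)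

theory Defs
  imports "HOL-Analysis.Analysis" "HOL-Algebra.QuotRing" "HOL-Algebra.Module"
begin

section \<open>Complex vector spaces and topological algebras\<close>

definition complex_field :: "complex ring" where
  "complex_field = \<lparr>carrier = UNIV, monoid.mult = (*), one = 1, ring.zero = 0, add = (+)\<rparr>"

text \<open>
  A complex vector space is a \<^locale>\<open>module\<close> over \<^const>\<open>complex_field\<close>; this locale
  ignores the record fields \<open>mult\<close> and \<open>one\<close>. (The locale \<^locale>\<open>algebra\<close> of the library
  is restricted to commutative algebras.)
\<close>

definition complex_algebra :: "(complex, 'a, 'm) module_scheme \<Rightarrow> bool" where
  "complex_algebra M \<longleftrightarrow> ring M \<and> module complex_field M \<and>
     (\<forall>c. \<forall>u\<in>carrier M. \<forall>v\<in>carrier M.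
        c \<odot>\<^bsub>M\<^esub> (u \<otimes>\<^bsub>M\<^esub> v) = (c \<odot>\<^bsub>M\<^esub> u) \<otimes>\<^bsub>M\<^esub> v \<and>
        c \<odot>\<^bsub>M\<^esub> (u \<otimes>\<^bsub>M\<^esub> v) = u \<otimes>\<^bsub>M\<^esub> (c \<odot>\<^bsub>M\<^esub> v))"

definition lin_span :: "(complex, 'a, 'm) module_scheme \<Rightarrow> 'a set \<Rightarrow> 'a set" where
  "lin_span M S = \<Inter>{H. submodule H complex_field M \<and> S \<subseteq> H}"

definition seminorm_on :: "(complex, 'a, 'm) module_scheme \<Rightarrow> ('a \<Rightarrow> real) \<Rightarrow> bool" where
  "seminorm_on M \<nu> \<longleftrightarrow>
     (\<forall>u\<in>carrier M. 0 \<le> \<nu> u) \<and>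
     (\<forall>u\<in>carrier M. \<forall>v\<in>carrier M. \<nu> (u \<oplus>\<^bsub>M\<^esub> v) \<le> \<nu> u + \<nu> v) \<and>
     (\<forall>c. \<forall>u\<in>carrier M. \<nu> (c \<odot>\<^bsub>M\<^esub> u) = cmod c * \<nu> u)"

definition seminorm_topology ::
    "(complex, 'a, 'm) module_scheme \<Rightarrow> ('a \<Rightarrow> real) set \<Rightarrow> 'a topology" where
  "seminorm_topology M P = topology (\<lambda>W. W \<subseteq> carrier M \<and>
     (\<forall>u\<in>W. \<exists>Q \<epsilon>. finite Q \<and> Q \<subseteq> P \<and> 0 < \<epsilon> \<and>
        {v \<in> carrier M. \<forall>\<nu>\<in>Q. \<nu> (v \<ominus>\<^bsub>M\<^esub> u) < \<epsilon>} \<subseteq> W))"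

definition absolutely_convex_in :: "(complex, 'a, 'm) module_scheme \<Rightarrow> 'a set \<Rightarrow> bool" where
  "absolutely_convex_in M S \<longleftrightarrow>
     (\<forall>u\<in>S. \<forall>v\<in>S. \<forall>a b. cmod a + cmod b \<le> 1 \<longrightarrow> a \<odot>\<^bsub>M\<^esub> u \<oplus>\<^bsub>M\<^esub> b \<odot>\<^bsub>M\<^esub> v \<in> S)"

definition absorbing_in :: "(complex, 'a, 'm) module_scheme \<Rightarrow> 'a set \<Rightarrow> bool" where
  "absorbing_in M S \<longleftrightarrow> (\<forall>u\<in>carrier M. \<exists>\<delta>>0. \<forall>c. cmod c \<le> \<delta> \<longrightarrow> c \<odot>\<^bsub>M\<^esub> u \<in> S)"

text \<open>
  Frechet algebras: complete metrizable locally convex unital algebras with jointly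
  continuous multiplication. No submultiplicativity of the seminorms is required.
\<close>

definition frechet_algebra :: "(complex, 'a, 'm) module_scheme \<Rightarrow> 'a topology \<Rightarrow> bool" where
  "frechet_algebra M T \<longleftrightarrow> complex_algebra M \<and>
     (\<exists>P :: nat \<Rightarrow> 'a \<Rightarrow> real.
        (\<forall>k. seminorm_on M (P k)) \<and>
        T = seminorm_topology M (range P) \<and>
        (\<forall>\<sigma>. range \<sigma> \<subseteq> carrier M \<and>
           (\<forall>k. \<forall>\<epsilon>>0. \<exists>N. \<forall>i\<ge>N. \<forall>j\<ge>N. P k (\<sigma> i \<ominus>\<^bsub>M\<^esub> \<sigma> j) < \<epsilon>) \<longrightarrow>
           (\<exists>u. limitin T \<sigma> u sequentially))) \<and>
     Hausdorff_space T \<and>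
     continuous_map (prod_topology T T) T (\<lambda>(u, v). u \<otimes>\<^bsub>M\<^esub> v)"

definition is_base_of :: "'a topology \<Rightarrow> 'a set set \<Rightarrow> bool" where
  "is_base_of T \<B> \<longleftrightarrow> openin T = arbitrary union_of (\<lambda>S. S \<in> \<B>)"


section \<open>Locally convex bundles\<close>

text \<open>
  The total set is the underlying set of the topology \<open>tspace\<close>; \<open>fibre B x\<close> carries the
  linear (and, for algebra bundles, multiplicative) structure of the fiber over \<open>x\<close>.
\<close>

record ('x, 'e) vbundle =
  bspace :: "'x topology"
  tspace :: "'e topology"
  bproj :: "'e \<Rightarrow> 'x"
  fibre :: "'x \<Rightarrow> (complex, 'e) module"
  unif :: "'e set set"

definition total :: "('x, 'e) vbundle \<Rightarrow> 'e set" where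
  "total B = topspace (tspace B)"

definition fibered_square :: "('x, 'e) vbundle \<Rightarrow> ('e \<times> 'e) set" where
  "fibered_square B = {(u, v). u \<in> total B \<and> v \<in> total B \<and> bproj B u = bproj B v}"

definition family_of_vector_spaces :: "('x, 'e) vbundle \<Rightarrow> bool" where
  "family_of_vector_spaces B \<longleftrightarrow>
     bproj B ` total B = topspace (bspace B) \<and>
     (\<forall>x\<in>topspace (bspace B).
        carrier (fibre B x) = {u \<in> total B. bproj B u = x} \<and>
        module complex_field (fibre B x))"

definition prebundle :: "('x, 'e) vbundle \<Rightarrow> bool" where
  "prebundle B \<longleftrightarrow> family_of_vector_spaces B \<and>
     continuous_map (tspace B) (bspace B) (bproj B) \<and>
     open_map (tspace B) (bspace B) (bproj B) \<and>
     continuous_map (bspace B) (tspace B) (\<lambda>x. \<zero>\<^bsub>fibre B x\<^esub>) \<and>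
     continuous_map
       (subtopology (prod_topology (tspace B) (tspace B)) (fibered_square B)) (tspace B)
       (\<lambda>(u, v). u \<oplus>\<^bsub>fibre B (bproj B u)\<^esub> v) \<and>
     continuous_map (prod_topology (euclidean :: complex topology) (tspace B)) (tspace B)
       (\<lambda>(c, u). c \<odot>\<^bsub>fibre B (bproj B u)\<^esub> u)"

definition sections :: "('x, 'e) vbundle \<Rightarrow> 'x set \<Rightarrow> ('x \<Rightarrow> 'e) set" where
  "sections B V = {s. continuous_map (subtopology (bspace B) V) (tspace B) s \<and>
                      (\<forall>x\<in>V. bproj B (s x) = x)}"

definition section_values :: "('x, 'e) vbundle \<Rightarrow> 'x \<Rightarrow> 'e set" where
  "section_values B x = {s x | s V. openin (bspace B) V \<and> x \<in> V \<and> s \<in> sections B V}"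

definition bundle_seminorm :: "('x, 'e) vbundle \<Rightarrow> ('e \<Rightarrow> real) \<Rightarrow> bool" where
  "bundle_seminorm B \<nu> \<longleftrightarrow> (\<forall>x\<in>topspace (bspace B). seminorm_on (fibre B x) \<nu>)"

definition directed_seminorms :: "('x, 'e) vbundle \<Rightarrow> ('e \<Rightarrow> real) set \<Rightarrow> bool" where
  "directed_seminorms B N \<longleftrightarrow> (\<forall>\<nu>\<in>N. bundle_seminorm B \<nu>) \<and>
     (\<forall>\<nu>\<in>N. \<forall>\<mu>\<in>N. \<exists>C>0. \<exists>\<kappa>\<in>N. \<forall>u\<in>total B. \<nu> u \<le> C * \<kappa> u \<and> \<mu> u \<le> C * \<kappa> u)"

definition absolutely_convex_subset :: "('x, 'e) vbundle \<Rightarrow> 'e set \<Rightarrow> bool" where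
  "absolutely_convex_subset B S \<longleftrightarrow> S \<subseteq> total B \<and>
     (\<forall>x\<in>topspace (bspace B). absolutely_convex_in (fibre B x) (S \<inter> carrier (fibre B x)))"

definition absorbing_subset :: "('x, 'e) vbundle \<Rightarrow> 'e set \<Rightarrow> bool" where
  "absorbing_subset B S \<longleftrightarrow> S \<subseteq> total B \<and>
     (\<forall>x\<in>topspace (bspace B). absorbing_in (fibre B x) (S \<inter> carrier (fibre B x)))"

text \<open>The empty intersection counts as a finite intersection, with value the total set.\<close>

definition lc_uniform_vector_structure :: "('x, 'e) vbundle \<Rightarrow> 'e set set \<Rightarrow> bool" where
  "lc_uniform_vector_structure B \<U> \<longleftrightarrow>
     (\<forall>U\<in>\<U>. absolutely_convex_subset B U \<and> absorbing_subset B U) \<and>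
     (\<forall>U\<in>\<U>. \<forall>c. c \<noteq> 0 \<longrightarrow> (\<lambda>u. c \<odot>\<^bsub>fibre B (bproj B u)\<^esub> u) ` U \<in> \<U>) \<and>
     (\<forall>\<F>. finite \<F> \<and> \<F> \<subseteq> \<U> \<longrightarrow> total B \<inter> \<Inter>\<F> \<in> \<U>) \<and>
     (\<forall>U\<in>\<U>. \<forall>S. absolutely_convex_subset B S \<and> U \<subseteq> S \<longrightarrow> S \<in> \<U>)"

definition seminorm_structure :: "('x, 'e) vbundle \<Rightarrow> ('e \<Rightarrow> real) set \<Rightarrow> 'e set set" where
  "seminorm_structure B N =
     {S. absolutely_convex_subset B S \<and> (\<exists>\<nu>\<in>N. \<exists>\<epsilon>>0. {u \<in> total B. \<nu> u < \<epsilon>} \<subseteq> S)}"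

text \<open>The set \<open>s(V) + U\<close>.\<close>

definition translate :: "('x, 'e) vbundle \<Rightarrow> 'x set \<Rightarrow> ('x \<Rightarrow> 'e) \<Rightarrow> 'e set \<Rightarrow> 'e set" where
  "translate B V s U =
     {s (bproj B u) \<oplus>\<^bsub>fibre B (bproj B u)\<^esub> u | u. u \<in> U \<and> bproj B u \<in> V}"

definition locally_convex_bundle :: "('x, 'e) vbundle \<Rightarrow> bool" where
  "locally_convex_bundle B \<longleftrightarrow> prebundle B \<and> lc_uniform_vector_structure B (unif B) \<and>
     (\<forall>U\<in>unif B. \<exists>U0\<in>unif B. openin (tspace B) U0 \<and> U0 \<subseteq> U) \<and>
     is_base_of (tspace B)
       {translate B V s U | V s U. openin (bspace B) V \<and> s \<in> sections B V \<and>
                                   U \<in> unif B \<and> openin (tspace B) U} \<and>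
     (\<forall>x\<in>topspace (bspace B).
        subtopology (tspace B) (carrier (fibre B x)) closure_of section_values B x
          = carrier (fibre B x))"

definition frechet_algebra_bundle :: "('x, 'e) vbundle \<Rightarrow> bool" where
  "frechet_algebra_bundle B \<longleftrightarrow> locally_convex_bundle B \<and>
     (\<forall>x\<in>topspace (bspace B).
        frechet_algebra (fibre B x) (subtopology (tspace B) (carrier (fibre B x)))) \<and>
     continuous_map
       (subtopology (prod_topology (tspace B) (tspace B)) (fibered_square B)) (tspace B)
       (\<lambda>(u, v). u \<otimes>\<^bsub>fibre B (bproj B u)\<^esub> v) \<and>
     (\<forall>U\<in>unif B. \<exists>V\<in>unif B. \<forall>u\<in>V. \<forall>v\<in>V.
        bproj B u = bproj B v \<longrightarrow> u \<otimes>\<^bsub>fibre B (bproj B u)\<^esub> v \<in> U)"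

definition tube :: "('x, 'e) vbundle \<Rightarrow> 'x set \<Rightarrow> ('x \<Rightarrow> 'e) \<Rightarrow> ('e \<Rightarrow> real) \<Rightarrow> real \<Rightarrow> 'e set" where
  "tube B V s \<nu> \<epsilon> =
     {v \<in> total B. bproj B v \<in> V \<and> \<nu> (v \<ominus>\<^bsub>fibre B (bproj B v)\<^esub> s (bproj B v)) < \<epsilon>}"

definition admissible :: "('x, 'e) vbundle \<Rightarrow> ('e \<Rightarrow> real) set \<Rightarrow> bool" where
  "admissible B N \<longleftrightarrow>
     is_base_of (tspace B)
       {tube B V s \<nu> \<epsilon> | V s \<nu> \<epsilon>. openin (bspace B) V \<and> s \<in> sections B V \<and> \<nu> \<in> N \<and> 0 < \<epsilon>} \<and>
     (\<forall>x\<in>topspace (bspace B).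
        seminorm_topology (fibre B x) N closure_of section_values B x = carrier (fibre B x))"

definition continuous_bundle :: "('x, 'e) vbundle \<Rightarrow> bool" where
  "continuous_bundle B \<longleftrightarrow> locally_convex_bundle B \<and>
     (\<exists>N. directed_seminorms B N \<and> admissible B N \<and>
          (\<forall>\<nu>\<in>N. continuous_map (tspace B) euclideanreal \<nu>) \<and>
          unif B = seminorm_structure B N)"


section \<open>Algebras over the holomorphic functions on the punctured plane\<close>

abbreviation punctured_plane :: "complex set" where
  "punctured_plane \<equiv> - {0}"

record 'a topalg = "(complex, 'a) module" +
  topol :: "'a topology"

text \<open>
  In an \<open>oalg\<close>, \<open>act\<close> is the action of the functions holomorphic on the punctured plane.
\<close>

record 'a oalg = "'a topalg" +
  act :: "(complex \<Rightarrow> complex) \<Rightarrow> 'a \<Rightarrow> 'a"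

definition closed_ideal_gen :: "('a, 'm) topalg_scheme \<Rightarrow> 'a set \<Rightarrow> 'a set" where
  "closed_ideal_gen A G = \<Inter>{J. ideal J A \<and> closedin (topol A) J \<and> G \<subseteq> J}"

text \<open>The map of cosets of \<open>J\<close> induced by an operation on representatives.\<close>

definition coset_map :: "('a, 'm) ring_scheme \<Rightarrow> 'a set \<Rightarrow> ('a \<Rightarrow> 'a) \<Rightarrow> 'a set \<Rightarrow> 'a set" where
  "coset_map R J h S = (\<Union>a\<in>S. J +>\<^bsub>R\<^esub> h a)"

definition quotient_algebra ::
    "(complex, 'a, 'm) module_scheme \<Rightarrow> 'a set \<Rightarrow> (complex, 'a set) module" where
  "quotient_algebra A J =
     \<lparr>carrier = carrier (A Quot J),
      monoid.mult = monoid.mult (A Quot J),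
      one = one (A Quot J),
      ring.zero = ring.zero (A Quot J),
      add = add (A Quot J),
      smult = (\<lambda>c. coset_map A J (\<lambda>a. c \<odot>\<^bsub>A\<^esub> a))\<rparr>"

definition quotient_topology :: "('a, 'm) topalg_scheme \<Rightarrow> 'a set \<Rightarrow> 'a set topology" where
  "quotient_topology A J = topology (\<lambda>W. W \<subseteq> carrier (A Quot J) \<and>
     openin (topol A) {a \<in> carrier A. J +>\<^bsub>A\<^esub> a \<in> W})"

definition quotient_oalg :: "'a oalg \<Rightarrow> 'a set \<Rightarrow> 'a set oalg" where
  "quotient_oalg A J = module.extend (quotient_algebra A J)
     \<lparr>topol = quotient_topology A J, act = (\<lambda>f. coset_map A J (act A f))\<rparr>"

text \<open>
  The algebra of holomorphic functions on the punctured plane with values in \<open>F\<close>, with the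
  compact-open topology. Functions are normalized to vanish at the origin.
\<close>

definition holomorphic_into :: "'a topalg \<Rightarrow> (complex \<Rightarrow> 'a) \<Rightarrow> bool" where
  "holomorphic_into F f \<longleftrightarrow>
     (\<forall>z\<in>punctured_plane. f z \<in> carrier F) \<and>
     (\<forall>z\<in>punctured_plane. \<exists>D.
        limitin (topol F) (\<lambda>w. (1 / (w - z)) \<odot>\<^bsub>F\<^esub> (f w \<ominus>\<^bsub>F\<^esub> f z)) D (at z))"

definition hol_carrier :: "'a topalg \<Rightarrow> (complex \<Rightarrow> 'a) set" where
  "hol_carrier F = {f. holomorphic_into F f \<and> f 0 = \<zero>\<^bsub>F\<^esub>}"

definition hol_const :: "'a topalg \<Rightarrow> 'a \<Rightarrow> complex \<Rightarrow> 'a" where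
  "hol_const F a = (\<lambda>z. if z = 0 then \<zero>\<^bsub>F\<^esub> else a)"

definition hol_oalg :: "'a topalg \<Rightarrow> (complex \<Rightarrow> 'a) oalg" where
  "hol_oalg F =
     \<lparr>carrier = hol_carrier F,
      monoid.mult = (\<lambda>f g z. f z \<otimes>\<^bsub>F\<^esub> g z),
      one = hol_const F \<one>\<^bsub>F\<^esub>,
      ring.zero = (\<lambda>z. \<zero>\<^bsub>F\<^esub>),
      add = (\<lambda>f g z. f z \<oplus>\<^bsub>F\<^esub> g z),
      smult = (\<lambda>c f z. c \<odot>\<^bsub>F\<^esub> f z),
      topol = topology_generated_by
        {{f \<in> hol_carrier F. f ` K \<subseteq> W} | K W.
           compact K \<and> K \<subseteq> punctured_plane \<and> openin (topol F) W},
      act = (\<lambda>\<phi> f z. if z = 0 then \<zero>\<^bsub>F\<^esub> else \<phi> z \<odot>\<^bsub>F\<^esub> f z)\<rparr>"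


section \<open>The bundle of an algebra over the punctured plane\<close>

text \<open>\<open>maximal_part A q\<close> is the closure of \<open>\<mm>\<^sub>q A\<close>.\<close>

definition maximal_part :: "'a oalg \<Rightarrow> complex \<Rightarrow> 'a set" where
  "maximal_part A q = topol A closure_of
     lin_span A {act A f a | f a. f holomorphic_on punctured_plane \<and> f q = 0 \<and> a \<in> carrier A}"

definition fibre_algebra :: "'a oalg \<Rightarrow> complex \<Rightarrow> (complex, 'a set) module" where
  "fibre_algebra A q = quotient_algebra A (maximal_part A q)"

text \<open>The copy \<open>{q} \<times> M\<close> of \<open>M\<close> inside a disjoint union.\<close>

definition tagged :: "'x \<Rightarrow> (complex, 'a) module \<Rightarrow> (complex, 'x \<times> 'a) module" where
  "tagged q M =
     \<lparr>carrier = Pair q ` carrier M,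
      monoid.mult = (\<lambda>u v. (q, snd u \<otimes>\<^bsub>M\<^esub> snd v)),
      one = (q, \<one>\<^bsub>M\<^esub>),
      ring.zero = (q, \<zero>\<^bsub>M\<^esub>),
      add = (\<lambda>u v. (q, snd u \<oplus>\<^bsub>M\<^esub> snd v)),
      smult = (\<lambda>c u. (q, c \<odot>\<^bsub>M\<^esub> snd u))\<rparr>"

definition class_at :: "'a oalg \<Rightarrow> 'a \<Rightarrow> complex \<Rightarrow> complex \<times> 'a set" where
  "class_at A u q = (q, maximal_part A q +>\<^bsub>A\<^esub> u)"

definition continuous_seminorm :: "'a oalg \<Rightarrow> ('a \<Rightarrow> real) \<Rightarrow> bool" where
  "continuous_seminorm A \<nu> \<longleftrightarrow> seminorm_on A \<nu> \<and> continuous_map (topol A) euclideanreal \<nu>"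

text \<open>The elements of the fibers are cosets, so the quotient seminorm is an infimum over a set.\<close>

definition quotient_seminorm :: "('a \<Rightarrow> real) \<Rightarrow> complex \<times> 'a set \<Rightarrow> real" where
  "quotient_seminorm \<nu> v = (INF a\<in>snd v. \<nu> a)"

definition E_total :: "'a oalg \<Rightarrow> (complex \<times> 'a set) set" where
  "E_total A = (SIGMA q:punctured_plane. carrier (fibre_algebra A q))"

definition E_basic ::
    "'a oalg \<Rightarrow> complex set \<Rightarrow> 'a \<Rightarrow> ('a \<Rightarrow> real) \<Rightarrow> real \<Rightarrow> (complex \<times> 'a set) set" where
  "E_basic A V u \<nu> \<epsilon> = {v \<in> E_total A. fst v \<in> V \<and>
     quotient_seminorm \<nu> (v \<ominus>\<^bsub>tagged (fst v) (fibre_algebra A (fst v))\<^esub> class_at A u (fst v)) < \<epsilon>}"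

definition E_topology :: "'a oalg \<Rightarrow> (complex \<times> 'a set) topology" where
  "E_topology A = topology (arbitrary union_of (\<lambda>S. S \<in>
     {E_basic A V u \<nu> \<epsilon> | V u \<nu> \<epsilon>.
        openin (top_of_set punctured_plane) V \<and> u \<in> carrier A \<and>
        continuous_seminorm A \<nu> \<and> 0 < \<epsilon>}))"

definition E_bundle :: "'a oalg \<Rightarrow> (complex, complex \<times> 'a set) vbundle" where
  "E_bundle A = (let
     B = \<lparr>bspace = top_of_set punctured_plane,
          tspace = E_topology A,
          bproj = fst,
          fibre = (\<lambda>q. tagged q (fibre_algebra A q)),
          unif = {}\<rparr>
     in B\<lparr>unif := seminorm_structure B (quotient_seminorm ` Collect (continuous_seminorm A))\<rparr>)"


section \<open>Free polydisk and free ball\<close>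

text \<open>A formal series in free variables is the function \<open>\<alpha> \<mapsto> c\<^sub>\<alpha>\<close> of its coefficients.\<close>

type_synonym free_series = "nat list \<Rightarrow> complex"

definition words_of_length :: "nat \<Rightarrow> nat \<Rightarrow> nat list set" where
  "words_of_length n d = {\<alpha>. length \<alpha> = d \<and> set \<alpha> \<subseteq> {1..n}}"

definition words :: "nat \<Rightarrow> nat list set" where
  "words n = (\<Union>d. words_of_length n d)"

definition switches :: "nat list \<Rightarrow> int" where
  "switches \<alpha> =
     (if length \<alpha> \<ge> 2 then int (card {i. i + 1 < length \<alpha> \<and> \<alpha> ! i \<noteq> \<alpha> ! (i + 1)})
      else int (length \<alpha>) - 1)"

definition monomial :: "nat list \<Rightarrow> free_series" where
  "monomial \<alpha> = (\<lambda>\<beta>. if \<beta> = \<alpha> then 1 else 0)"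

definition series_algebra :: "free_series set \<Rightarrow> (free_series \<Rightarrow> real) set \<Rightarrow> free_series topalg" where
  "series_algebra C P = (let
     M = \<lparr>carrier = C,
          monoid.mult = (\<lambda>a b \<gamma>. \<Sum>k\<le>length \<gamma>. a (take k \<gamma>) * b (drop k \<gamma>)),
          one = monomial [],
          ring.zero = (\<lambda>\<alpha>. 0),
          add = (\<lambda>a b \<alpha>. a \<alpha> + b \<alpha>),
          smult = (\<lambda>c a \<alpha>. c * a \<alpha>)\<rparr>
     in module.extend M \<lparr>topol = seminorm_topology M P\<rparr>)"

definition polydisk_term :: "real \<Rightarrow> real \<Rightarrow> free_series \<Rightarrow> nat list \<Rightarrow> real" where
  "polydisk_term \<rho> \<tau> c \<alpha> = cmod (c \<alpha>) * \<rho> ^ length \<alpha> * \<tau> powi (switches \<alpha> + 1)"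

definition ball_term :: "nat \<Rightarrow> real \<Rightarrow> free_series \<Rightarrow> nat \<Rightarrow> real" where
  "ball_term n \<rho> c d = sqrt (\<Sum>\<alpha>\<in>words_of_length n d. (cmod (c \<alpha>))\<^sup>2) * \<rho> ^ d"

definition free_polydisk :: "nat \<Rightarrow> ereal \<Rightarrow> free_series topalg" where
  "free_polydisk n r = series_algebra
     {c. (\<forall>\<alpha>. \<alpha> \<notin> words n \<longrightarrow> c \<alpha> = 0) \<and>
         (\<forall>\<rho> \<tau>. 0 < \<rho> \<and> ereal \<rho> < r \<and> 1 \<le> \<tau> \<longrightarrow> polydisk_term \<rho> \<tau> c summable_on words n)}
     {(\<lambda>c. \<Sum>\<^sub>\<infinity>\<alpha>\<in>words n. polydisk_term \<rho> \<tau> c \<alpha>) | \<rho> \<tau>. 0 < \<rho> \<and> ereal \<rho> < r \<and> 1 \<le> \<tau>}"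

definition free_ball :: "nat \<Rightarrow> ereal \<Rightarrow> free_series topalg" where
  "free_ball n r = series_algebra
     {c. (\<forall>\<alpha>. \<alpha> \<notin> words n \<longrightarrow> c \<alpha> = 0) \<and>
         (\<forall>\<rho>. 0 < \<rho> \<and> ereal \<rho> < r \<longrightarrow> summable (ball_term n \<rho> c))}
     {(\<lambda>c. \<Sum>d. ball_term n \<rho> c d) | \<rho>. 0 < \<rho> \<and> ereal \<rho> < r}"

text \<open>The algebra of \<open>F\<close>-valued functions modulo the relations \<open>\<zeta>\<^sub>i \<zeta>\<^sub>j = z \<zeta>\<^sub>j \<zeta>\<^sub>i\<close>, \<open>i < j\<close>.\<close>

definition commutation_relations :: "nat \<Rightarrow> free_series topalg \<Rightarrow> (complex \<Rightarrow> free_series) set" where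
  "commutation_relations n F = (let H = hol_oalg F; \<zeta> = (\<lambda>i. hol_const F (monomial [i])) in
     {(\<zeta> i \<otimes>\<^bsub>H\<^esub> \<zeta> j) \<ominus>\<^bsub>H\<^esub> act H (\<lambda>z. z) (\<zeta> j \<otimes>\<^bsub>H\<^esub> \<zeta> i) | i j. 1 \<le> i \<and> i < j \<and> j \<le> n})"

definition deformation :: "nat \<Rightarrow> free_series topalg \<Rightarrow> (complex \<Rightarrow> free_series) set oalg" where
  "deformation n F =
     quotient_oalg (hol_oalg F) (closed_ideal_gen (hol_oalg F) (commutation_relations n F))"

definition E_polydisk ::
    "nat \<Rightarrow> ereal \<Rightarrow> (complex, complex \<times> (complex \<Rightarrow> free_series) set set) vbundle" where
  "E_polydisk n r = E_bundle (deformation n (free_polydisk n r))"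

definition E_ball ::
    "nat \<Rightarrow> ereal \<Rightarrow> (complex, complex \<times> (complex \<Rightarrow> free_series) set set) vbundle" where
  "E_ball n r = E_bundle (deformation n (free_ball n r))"

end

theory Submission
  imports Defs "HOL-Library.Function_Algebras"
begin

text \<open>
  Modulo the relations at a fixed \<open>q\<close>, a word \<open>\<alpha>\<close> is \<open>q ^ m(\<alpha>)\<close> times its decreasing
  rearrangement, where \<open>m(\<alpha>)\<close> counts the non-inversions of \<open>\<alpha>\<close>. So the fibre over \<open>q\<close> is the
  quotient of the free algebra \<open>F\<close> by the kernel of the map collecting the coefficients of normal
  forms. The diagonal operators with entries \<open>(q / q') ^ m(\<alpha>)\<close> carry the kernel at \<open>q\<close> onto the
  kernel at \<open>q'\<close> and are close to the identity in bounded degree, while the norm of the part of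
  high degree is uniformly small near a given series. Hence the quotient norms of the fibres are
  jointly continuous in \<open>q\<close> and the representative in \<open>F\<close>, and the total space of the bundle is an
  open quotient of the product of the punctured plane with \<open>F\<close>. Quotient seminorms of continuous
  seminorms vanish over all \<open>q\<close> far from a compact set, so the fibre norms multiplied by cut-off
  functions of \<open>q\<close> generate the given uniform structure, and they are continuous.
\<close>

section \<open>Formal series and normal forms of words\<close>

text \<open>The obstacle is lower semicontinuity. A quotient seminorm on such a bundle is upper
  semicontinuous in \<open>q\<close> because one global lift chosen at \<open>q0\<close> serves all
  nearby \<open>q\<close>; a good lift at a nearby \<open>q\<close>, however, says nothing about
  \<open>q0\<close> by itself. An estimate symmetric in the two points is required, and the diagonal
  operators provide it. They cannot act on whole series: the number of non-inversions grows
  quadratically with the length and the weights of the norms only geometrically, so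
  \<open>(q / q') ^ noninv \<alpha>\<close> is in general unbounded even from one norm to a larger
  one. Hence the cut at a degree \<open>D\<close> and the separate control of tails.

  Before symbols can be used, the closed ideal and the closures of \<open>m_q A\<close>, both
  defined abstractly, have to be computed. Both computations rest on one fact: the truncations of a
  holomorphic function converge to it in the compact-open topology, and each of them is a finite sum
  that the relations rewrite into normal form.

  Polydisk and ball enter only through \<open>graded_series\<close>: norms of homogeneous components
  that are monotone in the moduli of the coefficients and satisfy a Cauchy product estimate.\<close>

definition conv :: "free_series \<Rightarrow> free_series \<Rightarrow> free_series" where
  "conv a b \<gamma> = (\<Sum>k\<le>length \<gamma>. a (take k \<gamma>) * b (drop k \<gamma>))"

text \<open>Polymorphic in the index set: it serves for series indexed by words and for symbols
  indexed by multisets.\<close>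

definition scale :: "complex \<Rightarrow> ('i \<Rightarrow> complex) \<Rightarrow> 'i \<Rightarrow> complex" where
  "scale c a = (\<lambda>i. c * a i)"

lemma scale_apply [simp]: "scale c a i = c * a i"
  by (simp add: scale_def)

lemma scale_add_right: "scale c (a + b) = scale c a + scale c b"
  and scale_add_left: "scale (c + d) a = scale c a + scale d a"
  and scale_scale [simp]: "scale c (scale d a) = scale (c * d) a"
  and scale_one [simp]: "scale 1 a = a"
  and scale_zero_right [simp]: "scale c 0 = 0"
  and scale_zero_left [simp]: "scale 0 a = 0"
  and scale_minus_one: "scale (-1) a = - a"
  by (auto simp: scale_def fun_eq_iff algebra_simps)

lemma sum_fun_apply: "(\<Sum>i\<in>S. f i) x = (\<Sum>i\<in>S. f i x)"
  by (induction S rule: infinite_finite_induct) auto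

lemma conv_Nil [simp]: "conv a b [] = a [] * b []"
  by (simp add: conv_def)

text \<open>Splitting off the cut before the first letter leaves a convolution with the left
  quotient of \<open>a\<close> by \<open>x\<close>. Inductions on the word therefore keep
  \<open>a\<close> arbitrary.\<close>

lemma conv_Cons [simp]: "conv a b (x # \<gamma>) = a [] * b (x # \<gamma>) + conv (\<lambda>\<beta>. a (x # \<beta>)) b \<gamma>"
  by (simp add: conv_def sum.atMost_Suc_shift del: sum.atMost_Suc)

lemma conv_add_left: "conv (a + b) c = conv a c + conv b c"
  and conv_add_right: "conv c (a + b) = conv c a + conv c b"
  and conv_scale_left: "conv (scale k a) b = scale k (conv a b)"
  and conv_scale_right: "conv a (scale k b) = scale k (conv a b)"
  and conv_zero_left [simp]: "conv 0 b = 0"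
  and conv_zero_right [simp]: "conv b 0 = 0"
  by (auto simp: conv_def fun_eq_iff algebra_simps sum.distrib sum_distrib_left)

lemma conv_diff_left: "conv (a - b) c = conv a c - conv b c"
  and conv_diff_right: "conv c (a - b) = conv c a - conv c b"
  by (auto simp: conv_def fun_eq_iff algebra_simps sum_subtractf)

lemma conv_assoc: "conv (conv a b) c = conv a (conv b c)"
proof
  fix \<gamma> show "conv (conv a b) c \<gamma> = conv a (conv b c) \<gamma>"
  proof (induction \<gamma> arbitrary: a)
    case (Cons x \<gamma>)
    have "(\<lambda>\<beta>. conv a b (x # \<beta>)) = scale (a []) (\<lambda>\<beta>. b (x # \<beta>)) + conv (\<lambda>\<beta>. a (x # \<beta>)) b"
      by (auto simp: fun_eq_iff)
    then show ?case
      using Cons.IH by (simp add: conv_add_left conv_scale_left algebra_simps)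
  qed simp
qed

lemma conv_monomial_Nil_left [simp]: "conv (monomial []) a = a"
proof
  fix \<gamma> show "conv (monomial []) a \<gamma> = a \<gamma>"
  proof (cases \<gamma>)
    case (Cons x \<beta>)
    have "(\<lambda>\<beta>. monomial [] (x # \<beta>)) = 0"
      by (auto simp: monomial_def)
    then show ?thesis
      using Cons by (simp add: monomial_def)
  qed (simp add: monomial_def)
qed

lemma conv_monomial_Nil_right [simp]: "conv a (monomial []) = a"
proof
  fix \<gamma> show "conv a (monomial []) \<gamma> = a \<gamma>"
    by (induction \<gamma> arbitrary: a) (auto simp: monomial_def)
qed

lemma conv_monomial_Cons: "conv (monomial (x # \<alpha>)) b (y # \<gamma>) = (if x = y then conv (monomial \<alpha>) b \<gamma> else 0)"
proof -
  have "(\<lambda>\<beta>. monomial (x # \<alpha>) (y # \<beta>)) = (if x = y then monomial \<alpha> else 0)"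
    by (auto simp: monomial_def)
  then show ?thesis
    by (simp add: monomial_def)
qed

lemma conv_monomial [simp]: "conv (monomial \<alpha>) (monomial \<beta>) = monomial (\<alpha> @ \<beta>)"
proof
  fix \<gamma> show "conv (monomial \<alpha>) (monomial \<beta>) \<gamma> = monomial (\<alpha> @ \<beta>) \<gamma>"
  proof (induction \<alpha> arbitrary: \<gamma>)
    case (Cons x \<alpha>)
    show ?case
    proof (cases \<gamma>)
      case (Cons y \<delta>)
      with Cons.IH show ?thesis
        by (simp add: conv_monomial_Cons del: conv_Cons) (auto simp: monomial_def)
    qed (auto simp: monomial_def)
  qed simp
qed

subsection \<open>Non-inversions\<close>

fun noninv :: "nat list \<Rightarrow> nat" where
  "noninv [] = 0"
| "noninv (x # xs) = length (filter ((<) x) xs) + noninv xs"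

text \<open>The number of exchanges \<open>\<zeta>_i \<zeta>_j = q \<zeta>_j \<zeta>_i\<close>
  needed between two adjacent words. It depends only on their contents, which lets normal forms be
  multiplied without remembering the words.\<close>

definition crossings :: "nat multiset \<Rightarrow> nat multiset \<Rightarrow> nat" where
  "crossings M N = (\<Sum>x\<in>#M. size (filter_mset ((<) x) N))"

text \<open>A pair of positions lies in the first factor, in the second, or across the cut.\<close>

lemma noninv_append: "noninv (\<alpha> @ \<beta>) = noninv \<alpha> + noninv \<beta> + crossings (mset \<alpha>) (mset \<beta>)"
  by (induction \<alpha>) (auto simp: crossings_def simp flip: mset_filter)

text \<open>A crude bound suffices: words of length at most \<open>D\<close> then involve only the
  finitely many exponents up to \<open>D * D\<close>, for which powers of \<open>q / q'\<close> have
  to be controlled.\<close>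

lemma noninv_le: "noninv \<alpha> \<le> length \<alpha> * length \<alpha>"
proof (induction \<alpha>)
  case (Cons x \<alpha>)
  have "length (filter ((<) x) \<alpha>) \<le> length \<alpha>"
    by simp
  then show ?case
    using Cons.IH by (simp; linarith)
qed simp

text \<open>Decreasing order is chosen because the relations for \<open>i < j\<close> rewrite
  towards it with nonnegative powers of \<open>z\<close>, so that no inverse of the coordinate
  occurs.\<close>

definition sorted_word :: "nat multiset \<Rightarrow> nat list" where
  "sorted_word M = rev (sorted_list_of_multiset M)"

lemma mset_sorted_word [simp]: "mset (sorted_word M) = M"
  by (simp add: sorted_word_def)

lemma set_sorted_word [simp]: "set (sorted_word M) = set_mset M"
  by (metis mset_sorted_word set_mset_mset)

lemma sorted_word_unique: "sorted (rev \<alpha>) \<Longrightarrow> sorted_word (mset \<alpha>) = \<alpha>"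
  by (metis mset_rev rev_rev_ident sorted_list_of_multiset_mset sorted_sort_id sorted_word_def)

lemma finite_mset_eq [simp]: "finite {\<alpha> :: 'a list. mset \<alpha> = M}"
proof (rule finite_subset)
  show "{\<alpha>. mset \<alpha> = M} \<subseteq> {\<alpha>. set \<alpha> \<subseteq> set_mset M \<and> length \<alpha> = size M}"
    by auto
qed (simp add: finite_lists_length_eq)

lemma finite_submultisets: "finite {N. N \<subseteq># M}"
proof (rule finite_subset)
  show "{N. N \<subseteq># M} \<subseteq> mset ` {\<alpha>. set \<alpha> \<subseteq> set_mset M \<and> length \<alpha> \<le> size M}"
  proof
    fix N assume "N \<in> {N. N \<subseteq># M}"
    then show "N \<in> mset ` {\<alpha>. set \<alpha> \<subseteq> set_mset M \<and> length \<alpha> \<le> size M}"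
      using ex_mset[of N] by (force dest: size_mset_mono mset_subset_eqD)
  qed
qed (simp add: finite_lists_length_le)

subsection \<open>The symbol of a series\<close>

text \<open>
  Modulo the relations \<open>\<zeta>\<^sub>i\<zeta>\<^sub>j = q\<zeta>\<^sub>j\<zeta>\<^sub>i\<close> (\<open>i < j\<close>) the word \<open>\<alpha>\<close> is \<open>q ^ noninv \<alpha>\<close> times its
  decreasing rearrangement. Hence \<open>symb q a M\<close> is the coefficient in normal form of the
  decreasing word with content \<open>M\<close>.
\<close>

definition symb :: "complex \<Rightarrow> free_series \<Rightarrow> nat multiset \<Rightarrow> complex" where
  "symb q a M = (\<Sum>\<alpha> | mset \<alpha> = M. a \<alpha> * q ^ noninv \<alpha>)"

text \<open>The product of quantum affine space in the basis of decreasing monomials: polynomial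
  multiplication twisted by the cocycle \<open>q ^ crossings\<close>.\<close>

definition tmul :: "complex \<Rightarrow> (nat multiset \<Rightarrow> complex) \<Rightarrow> (nat multiset \<Rightarrow> complex) \<Rightarrow> nat multiset \<Rightarrow> complex" where
  "tmul q x y M = (\<Sum>N | N \<subseteq># M. q ^ crossings N (M - N) * x N * y (M - N))"

lemma symb_add: "symb q (a + b) = symb q a + symb q b"
  and symb_diff: "symb q (a - b) = symb q a - symb q b"
  and symb_scale: "symb q (scale c a) = scale c (symb q a)"
  and symb_zero [simp]: "symb q 0 = 0"
  by (auto simp: symb_def fun_eq_iff algebra_simps sum.distrib sum_subtractf sum_distrib_left)

lemma symb_monomial: "symb q (monomial \<alpha>) = (\<lambda>M. if M = mset \<alpha> then q ^ noninv \<alpha> else 0)"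
proof
  fix M
  have "symb q (monomial \<alpha>) M = (\<Sum>\<beta> | mset \<beta> = M. if \<beta> = \<alpha> then q ^ noninv \<alpha> else 0)"
    unfolding symb_def by (intro sum.cong) (auto simp: monomial_def)
  also have "\<dots> = (if M = mset \<alpha> then q ^ noninv \<alpha> else 0)"
    by (subst sum.delta) auto
  finally show "symb q (monomial \<alpha>) M = (if M = mset \<alpha> then q ^ noninv \<alpha> else 0)" .
qed

text \<open>A splitting of a word with content \<open>M\<close> amounts to the content
  \<open>N\<close> of its prefix together with two words of contents \<open>N\<close> and
  \<open>M - N\<close>; \<open>noninv_append\<close> splits the exponent accordingly. Consequently
  the kernel of \<open>symb q\<close> is stable under multiplication from both sides.\<close>

lemma symb_conv: "symb q (conv a b) = tmul q (symb q a) (symb q b)"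
proof
  fix M :: "nat multiset"
  let ?t = "\<lambda>(\<alpha>, \<beta>). a \<alpha> * b \<beta> * q ^ noninv (\<alpha> @ \<beta>)"
  let ?S = "SIGMA \<gamma>:{\<gamma>. mset \<gamma> = M}. {..length \<gamma>}"
  let ?T = "SIGMA N:{N. N \<subseteq># M}. {\<alpha>. mset \<alpha> = N} \<times> {\<beta>. mset \<beta> = M - N}"
  have fin: "finite {N. N \<subseteq># M}"
    by (rule finite_submultisets)
  have "symb q (conv a b) M = (\<Sum>\<gamma> | mset \<gamma> = M. \<Sum>k\<le>length \<gamma>. ?t (take k \<gamma>, drop k \<gamma>))"
    by (simp add: symb_def conv_def sum_distrib_right)
  also have "\<dots> = (\<Sum>(\<gamma>, k)\<in>?S. ?t (take k \<gamma>, drop k \<gamma>))"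
    by (subst sum.Sigma) auto
  also have "\<dots> = (\<Sum>(N, w)\<in>?T. ?t w)"
  proof (rule sum.reindex_bij_witness[where i = "\<lambda>(N, \<alpha>, \<beta>). (\<alpha> @ \<beta>, length \<alpha>)"
        and j = "\<lambda>(\<gamma>, k). (mset (take k \<gamma>), take k \<gamma>, drop k \<gamma>)"])
    fix g assume "g \<in> ?S"
    then obtain \<gamma> k where g: "g = (\<gamma>, k)" "k \<le> length \<gamma>" "M = mset \<gamma>"
      by auto
    have "mset \<gamma> = mset (take k \<gamma>) + mset (drop k \<gamma>)"
      by (simp flip: mset_append)
    then show "(case g of (\<gamma>, k) \<Rightarrow> (mset (take k \<gamma>), take k \<gamma>, drop k \<gamma>)) \<in> ?T"
      using g by simp
  qed (auto simp: subset_mset.add_diff_inverse)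
  also have "\<dots> = (\<Sum>N | N \<subseteq># M. \<Sum>w\<in>{\<alpha>. mset \<alpha> = N} \<times> {\<beta>. mset \<beta> = M - N}. ?t w)"
    using fin by (subst sum.Sigma) auto
  also have "\<dots> = tmul q (symb q a) (symb q b) M"
    unfolding tmul_def
  proof (rule sum.cong)
    fix N assume "N \<in> {N. N \<subseteq># M}"
    have "symb q a N * symb q b (M - N) = (\<Sum>(\<alpha>, \<beta>)\<in>{\<alpha>. mset \<alpha> = N} \<times> {\<beta>. mset \<beta> = M - N}.
            (a \<alpha> * q ^ noninv \<alpha>) * (b \<beta> * q ^ noninv \<beta>))"
      by (simp add: symb_def sum_product sum.cartesian_product)
    then have "q ^ crossings N (M - N) * symb q a N * symb q b (M - N)
        = (\<Sum>w\<in>{\<alpha>. mset \<alpha> = N} \<times> {\<beta>. mset \<beta> = M - N}.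
            q ^ crossings N (M - N) * (case w of (\<alpha>, \<beta>) \<Rightarrow> (a \<alpha> * q ^ noninv \<alpha>) * (b \<beta> * q ^ noninv \<beta>)))"
      by (simp add: sum_distrib_left mult.assoc)
    also have "\<dots> = (\<Sum>w\<in>{\<alpha>. mset \<alpha> = N} \<times> {\<beta>. mset \<beta> = M - N}. ?t w)"
      by (rule sum.cong) (auto simp: noninv_append power_add)
    finally show "(\<Sum>w\<in>{\<alpha>. mset \<alpha> = N} \<times> {\<beta>. mset \<beta> = M - N}. ?t w)
        = q ^ crossings N (M - N) * symb q a N * symb q b (M - N)" ..
  qed simp
  finally show "symb q (conv a b) M = tmul q (symb q a) (symb q b) M" .
qed

definition trunc :: "nat \<Rightarrow> free_series \<Rightarrow> free_series" where
  "trunc D a = (\<lambda>\<alpha>. if length \<alpha> \<le> D then a \<alpha> else 0)"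

lemma trunc_diff: "trunc D (a - b) = trunc D a - trunc D b"
  by (auto simp: trunc_def)

text \<open>All words with content \<open>M\<close> have length \<open>size M\<close>, so truncation
  keeps or removes a whole coefficient. Hence truncation preserves the kernel of the symbol.\<close>

lemma symb_trunc: "symb q (trunc D a) M = (if size M \<le> D then symb q a M else 0)"
  unfolding symb_def trunc_def by (auto intro!: sum.neutral sum.cong simp flip: size_mset)

section \<open>Complex algebras and their quotients\<close>

lemma cring_complex_field: "cring complex_field"
proof (rule cringI)
  show "abelian_group complex_field"
  proof (rule abelian_groupI)
    fix x assume "x \<in> carrier complex_field"
    then show "\<exists>y\<in>carrier complex_field. y \<oplus>\<^bsub>complex_field\<^esub> x = \<zero>\<^bsub>complex_field\<^esub>"
      by (intro bexI[of _ "- x"]) (auto simp: complex_field_def)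
  qed (auto simp: complex_field_def)
  show "Group.comm_monoid complex_field"
    by (rule comm_monoidI) (auto simp: complex_field_def)
qed (auto simp: complex_field_def algebra_simps)

lemma complex_algebraI:
  fixes M :: "(complex, 'a, 'm) module_scheme" (structure)
  assumes closed: "\<zero> \<in> carrier M" "\<one> \<in> carrier M"
      "\<And>u v. u \<in> carrier M \<Longrightarrow> v \<in> carrier M \<Longrightarrow> u \<oplus> v \<in> carrier M"
      "\<And>u v. u \<in> carrier M \<Longrightarrow> v \<in> carrier M \<Longrightarrow> u \<otimes> v \<in> carrier M"
      "\<And>c u. u \<in> carrier M \<Longrightarrow> c \<odot> u \<in> carrier M"
    and add: "\<And>u v. u \<in> carrier M \<Longrightarrow> v \<in> carrier M \<Longrightarrow> u \<oplus> v = v \<oplus> u"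
      "\<And>u v w. u \<in> carrier M \<Longrightarrow> v \<in> carrier M \<Longrightarrow> w \<in> carrier M \<Longrightarrow> (u \<oplus> v) \<oplus> w = u \<oplus> (v \<oplus> w)"
      "\<And>u. u \<in> carrier M \<Longrightarrow> \<zero> \<oplus> u = u"
      "\<And>u. u \<in> carrier M \<Longrightarrow> (-1) \<odot> u \<oplus> u = \<zero>"
    and mult: "\<And>u v w. u \<in> carrier M \<Longrightarrow> v \<in> carrier M \<Longrightarrow> w \<in> carrier M \<Longrightarrow> (u \<otimes> v) \<otimes> w = u \<otimes> (v \<otimes> w)"
      "\<And>u. u \<in> carrier M \<Longrightarrow> \<one> \<otimes> u = u"
      "\<And>u. u \<in> carrier M \<Longrightarrow> u \<otimes> \<one> = u"
      "\<And>u v w. u \<in> carrier M \<Longrightarrow> v \<in> carrier M \<Longrightarrow> w \<in> carrier M \<Longrightarrow> (u \<oplus> v) \<otimes> w = u \<otimes> w \<oplus> v \<otimes> w"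
      "\<And>u v w. u \<in> carrier M \<Longrightarrow> v \<in> carrier M \<Longrightarrow> w \<in> carrier M \<Longrightarrow> w \<otimes> (u \<oplus> v) = w \<otimes> u \<oplus> w \<otimes> v"
    and smult: "\<And>c d u. u \<in> carrier M \<Longrightarrow> (c + d) \<odot> u = c \<odot> u \<oplus> d \<odot> u"
      "\<And>c u v. u \<in> carrier M \<Longrightarrow> v \<in> carrier M \<Longrightarrow> c \<odot> (u \<oplus> v) = c \<odot> u \<oplus> c \<odot> v"
      "\<And>c d u. u \<in> carrier M \<Longrightarrow> (c * d) \<odot> u = c \<odot> (d \<odot> u)"
      "\<And>u. u \<in> carrier M \<Longrightarrow> 1 \<odot> u = u"
      "\<And>c u v. u \<in> carrier M \<Longrightarrow> v \<in> carrier M \<Longrightarrow> c \<odot> (u \<otimes> v) = (c \<odot> u) \<otimes> v"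
      "\<And>c u v. u \<in> carrier M \<Longrightarrow> v \<in> carrier M \<Longrightarrow> c \<odot> (u \<otimes> v) = u \<otimes> (c \<odot> v)"
  shows "complex_algebra M"
proof -
  have ab: "abelian_group M"
  proof (rule abelian_groupI)
    fix u assume "u \<in> carrier M"
    then show "\<exists>v\<in>carrier M. v \<oplus> u = \<zero>"
      using closed(5) add(4) by blast
  qed (fact closed add(1) add(2) add(3))+
  have "Group.monoid M"
    by (rule monoidI) (fact closed mult(1) mult(2) mult(3))+
  with ab have "ring M"
    by (rule ringI) (fact mult(4) mult(5))+
  moreover have "module complex_field M"
    by (rule moduleI[OF cring_complex_field ab]) (simp_all add: complex_field_def closed smult(1-4))
  ultimately show ?thesis
    by (simp add: complex_algebra_def flip: smult(5,6))
qed

lemma complex_algebraD: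
  fixes M :: "(complex, 'a, 'm) module_scheme" (structure)
  assumes "complex_algebra M"
  shows "ring M" and "module complex_field M"
    and "\<And>c u. u \<in> carrier M \<Longrightarrow> c \<odot> u \<in> carrier M"
    and "\<And>c d u. u \<in> carrier M \<Longrightarrow> (c + d) \<odot> u = c \<odot> u \<oplus> d \<odot> u"
    and "\<And>c u v. u \<in> carrier M \<Longrightarrow> v \<in> carrier M \<Longrightarrow> c \<odot> (u \<oplus> v) = c \<odot> u \<oplus> c \<odot> v"
    and "\<And>c d u. u \<in> carrier M \<Longrightarrow> (c * d) \<odot> u = c \<odot> (d \<odot> u)"
    and "\<And>u. u \<in> carrier M \<Longrightarrow> 1 \<odot> u = u"
    and "\<And>c u v. u \<in> carrier M \<Longrightarrow> v \<in> carrier M \<Longrightarrow> c \<odot> (u \<otimes> v) = (c \<odot> u) \<otimes> v"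
    and "\<And>c u v. u \<in> carrier M \<Longrightarrow> v \<in> carrier M \<Longrightarrow> c \<odot> (u \<otimes> v) = u \<otimes> (c \<odot> v)"
proof -
  show r: "ring M" and m: "module complex_field M"
    using assms by (auto simp: complex_algebra_def)
  interpret module complex_field M by (rule m)
  note * = smult_closed smult_l_distr smult_r_distr smult_assoc1 smult_one
  show "\<And>c u. u \<in> carrier M \<Longrightarrow> c \<odot> u \<in> carrier M"
    and "\<And>c d u. u \<in> carrier M \<Longrightarrow> (c + d) \<odot> u = c \<odot> u \<oplus> d \<odot> u"
    and "\<And>c u v. u \<in> carrier M \<Longrightarrow> v \<in> carrier M \<Longrightarrow> c \<odot> (u \<oplus> v) = c \<odot> u \<oplus> c \<odot> v"
    and "\<And>c d u. u \<in> carrier M \<Longrightarrow> (c * d) \<odot> u = c \<odot> (d \<odot> u)"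
    and "\<And>u. u \<in> carrier M \<Longrightarrow> 1 \<odot> u = u"
    using * by (simp_all add: complex_field_def)
  show "\<And>c u v. u \<in> carrier M \<Longrightarrow> v \<in> carrier M \<Longrightarrow> c \<odot> (u \<otimes> v) = (c \<odot> u) \<otimes> v"
    and "\<And>c u v. u \<in> carrier M \<Longrightarrow> v \<in> carrier M \<Longrightarrow> c \<odot> (u \<otimes> v) = u \<otimes> (c \<odot> v)"
    using assms unfolding complex_algebra_def by blast+
qed

lemma smult_zero_left:
  fixes M :: "(complex, 'a, 'm) module_scheme" (structure)
  assumes "module complex_field M" "u \<in> carrier M"
  shows "0 \<odot> u = \<zero>"
proof -
  interpret module complex_field M by (rule assms)
  show ?thesis
    using smult_l_null[OF assms(2)] by (simp add: complex_field_def)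
qed

lemma a_inv_eq_smult:
  fixes M :: "(complex, 'a, 'm) module_scheme" (structure)
  assumes "module complex_field M" "u \<in> carrier M"
  shows "\<ominus> u = (-1) \<odot> u"
proof -
  interpret module complex_field M by (rule assms)
  have c: "(-1) \<odot> u \<in> carrier M"
    using assms by (intro smult_closed) (auto simp: complex_field_def)
  have "(-1) \<odot> u \<oplus> u = 0 \<odot> u"
    using smult_l_distr[of "-1" 1 u] smult_one assms by (simp add: complex_field_def)
  then show ?thesis
    using M.minus_equality[OF _ assms(2) c] smult_zero_left[OF assms] by simp
qed

lemma minus_eq_smult:
  fixes M :: "(complex, 'a, 'm) module_scheme" (structure)
  assumes "module complex_field M" "v \<in> carrier M"
  shows "u \<ominus> v = u \<oplus> (-1) \<odot> v"
  using a_inv_eq_smult[OF assms] by (simp add: a_minus_def)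

text \<open>All axioms are identities, so they pass along a surjection compatible with the
  operations. This is applied to coset maps, to the tagging of fibres, and with \<open>id\<close> to
  records that differ only in further fields.\<close>

lemma complex_algebra_image:
  fixes R :: "(complex, 'a, 'm) module_scheme" and S :: "(complex, 'b, 'l) module_scheme"
  assumes alg: "complex_algebra R" and car: "carrier S = h ` carrier R"
    and add: "\<And>a b. a \<in> carrier R \<Longrightarrow> b \<in> carrier R \<Longrightarrow> h a \<oplus>\<^bsub>S\<^esub> h b = h (a \<oplus>\<^bsub>R\<^esub> b)"
    and mult: "\<And>a b. a \<in> carrier R \<Longrightarrow> b \<in> carrier R \<Longrightarrow> h a \<otimes>\<^bsub>S\<^esub> h b = h (a \<otimes>\<^bsub>R\<^esub> b)"
    and smult: "\<And>c a. a \<in> carrier R \<Longrightarrow> c \<odot>\<^bsub>S\<^esub> h a = h (c \<odot>\<^bsub>R\<^esub> a)"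
    and zero: "\<zero>\<^bsub>S\<^esub> = h \<zero>\<^bsub>R\<^esub>" and one: "\<one>\<^bsub>S\<^esub> = h \<one>\<^bsub>R\<^esub>"
  shows "complex_algebra S"
proof -
  note D = complex_algebraD[OF alg]
  interpret ring R by (rule D)
  have neg: "(-1) \<odot>\<^bsub>R\<^esub> u \<oplus>\<^bsub>R\<^esub> u = \<zero>\<^bsub>R\<^esub>" if "u \<in> carrier R" for u
    using a_inv_eq_smult[OF D(2) that] l_neg[OF that] by simp
  note [simp] = add mult smult zero one D(3)
  show ?thesis
  proof (rule complex_algebraI; (unfold car)?; (elim imageE)?; hypsubst?)
    show "\<zero>\<^bsub>S\<^esub> \<in> h ` carrier R" "\<one>\<^bsub>S\<^esub> \<in> h ` carrier R"
      by auto
  next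
    fix a b assume ab: "a \<in> carrier R" "b \<in> carrier R"
    show "h a \<oplus>\<^bsub>S\<^esub> h b \<in> h ` carrier R" "h a \<otimes>\<^bsub>S\<^esub> h b \<in> h ` carrier R"
      using ab by auto
    show "h a \<oplus>\<^bsub>S\<^esub> h b = h b \<oplus>\<^bsub>S\<^esub> h a"
      using ab by (simp add: a_comm)
    fix c
    show "c \<odot>\<^bsub>S\<^esub> h a \<in> h ` carrier R"
      using ab by simp
    show "c \<odot>\<^bsub>S\<^esub> (h a \<oplus>\<^bsub>S\<^esub> h b) = c \<odot>\<^bsub>S\<^esub> h a \<oplus>\<^bsub>S\<^esub> c \<odot>\<^bsub>S\<^esub> h b"
      using ab by (simp add: D(5))
    show "c \<odot>\<^bsub>S\<^esub> (h a \<otimes>\<^bsub>S\<^esub> h b) = (c \<odot>\<^bsub>S\<^esub> h a) \<otimes>\<^bsub>S\<^esub> h b"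
      using ab D(8)[of a b c] by simp
    show "c \<odot>\<^bsub>S\<^esub> (h a \<otimes>\<^bsub>S\<^esub> h b) = h a \<otimes>\<^bsub>S\<^esub> (c \<odot>\<^bsub>S\<^esub> h b)"
      using ab D(9)[of a b c] by simp
  next
    fix a b c assume abc: "a \<in> carrier R" "b \<in> carrier R" "c \<in> carrier R"
    show "h a \<oplus>\<^bsub>S\<^esub> h b \<oplus>\<^bsub>S\<^esub> h c = h a \<oplus>\<^bsub>S\<^esub> (h b \<oplus>\<^bsub>S\<^esub> h c)"
      using abc by (simp add: a_assoc)
    show "h a \<otimes>\<^bsub>S\<^esub> h b \<otimes>\<^bsub>S\<^esub> h c = h a \<otimes>\<^bsub>S\<^esub> (h b \<otimes>\<^bsub>S\<^esub> h c)"
      using abc by (simp add: m_assoc)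
    show "(h a \<oplus>\<^bsub>S\<^esub> h b) \<otimes>\<^bsub>S\<^esub> h c = h a \<otimes>\<^bsub>S\<^esub> h c \<oplus>\<^bsub>S\<^esub> h b \<otimes>\<^bsub>S\<^esub> h c"
      using abc by (simp add: l_distr)
    show "h c \<otimes>\<^bsub>S\<^esub> (h a \<oplus>\<^bsub>S\<^esub> h b) = h c \<otimes>\<^bsub>S\<^esub> h a \<oplus>\<^bsub>S\<^esub> h c \<otimes>\<^bsub>S\<^esub> h b"
      using abc by (simp add: r_distr)
  next
    fix a c d assume a: "a \<in> carrier R"
    show "\<zero>\<^bsub>S\<^esub> \<oplus>\<^bsub>S\<^esub> h a = h a" "\<one>\<^bsub>S\<^esub> \<otimes>\<^bsub>S\<^esub> h a = h a" "h a \<otimes>\<^bsub>S\<^esub> \<one>\<^bsub>S\<^esub> = h a"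
      using a by simp_all
    show "(- 1) \<odot>\<^bsub>S\<^esub> h a \<oplus>\<^bsub>S\<^esub> h a = \<zero>\<^bsub>S\<^esub>"
      using a neg by simp
    show "(c + d) \<odot>\<^bsub>S\<^esub> h a = c \<odot>\<^bsub>S\<^esub> h a \<oplus>\<^bsub>S\<^esub> d \<odot>\<^bsub>S\<^esub> h a"
      using a by (simp add: D(4))
    show "(c * d) \<odot>\<^bsub>S\<^esub> h a = c \<odot>\<^bsub>S\<^esub> (d \<odot>\<^bsub>S\<^esub> h a)"
      using a by (simp add: D(6))
    show "1 \<odot>\<^bsub>S\<^esub> h a = h a"
      using a by (simp add: D(7))
  qed
qed

text \<open>Makes the cosets of \<open>J\<close> the fibres of \<open>\<phi>\<close>, so that
  computations in the quotient become equalities of values of \<open>\<phi>\<close>. The target is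
  only an additive group; compatibility with products and scalars is required as a congruence, which
  avoids defining an algebra of symbols. The instances are \<open>hsymb\<close> on holomorphic
  functions and \<open>symb_at q\<close> on the deformation algebra.\<close>

locale quotient_presentation =
  fixes R :: "(complex, 'a, 'm) module_scheme" (structure)
    and \<phi> :: "'a \<Rightarrow> 'b :: ab_group_add" and J :: "'a set"
  assumes alg: "complex_algebra R"
    and \<phi>_add: "\<And>a b. a \<in> carrier R \<Longrightarrow> b \<in> carrier R \<Longrightarrow> \<phi> (a \<oplus> b) = \<phi> a + \<phi> b"
    and \<phi>_smult: "\<And>c a b. a \<in> carrier R \<Longrightarrow> b \<in> carrier R \<Longrightarrow> \<phi> a = \<phi> b \<Longrightarrow> \<phi> (c \<odot> a) = \<phi> (c \<odot> b)"
    and \<phi>_mult: "\<And>a a' b b'. a \<in> carrier R \<Longrightarrow> a' \<in> carrier R \<Longrightarrow> b \<in> carrier R \<Longrightarrow> b' \<in> carrier R \<Longrightarrow>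
      \<phi> a = \<phi> a' \<Longrightarrow> \<phi> b = \<phi> b' \<Longrightarrow> \<phi> (a \<otimes> b) = \<phi> (a' \<otimes> b')"
    and J: "J = {a \<in> carrier R. \<phi> a = 0}"
begin

lemma is_ring: "ring R"
  using alg by (rule complex_algebraD)

sublocale ring R by (rule is_ring)

lemma \<phi>_zero: "\<phi> \<zero> = 0"
  using \<phi>_add[of \<zero> \<zero>] by simp

lemma \<phi>_minus: "a \<in> carrier R \<Longrightarrow> b \<in> carrier R \<Longrightarrow> \<phi> (a \<ominus> b) = \<phi> a - \<phi> b"
  using \<phi>_add[of "a \<ominus> b" b] by (simp add: a_minus_def a_assoc l_neg)

lemma ideal_J: "ideal J R"
proof (rule idealI[OF is_ring])
  have neg: "\<phi> (\<ominus> a) = - \<phi> a" if "a \<in> carrier R" for a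
    using \<phi>_minus[OF zero_closed that] that by (simp add: a_minus_def \<phi>_zero)
  show "subgroup J (add_monoid R)"
    by (rule group.subgroupI[OF a_group])
      (auto simp: J \<phi>_add \<phi>_zero neg simp flip: a_inv_def intro!: exI[of _ \<zero>])
  fix a x assume "a \<in> J" "x \<in> carrier R"
  then show "x \<otimes> a \<in> J" "a \<otimes> x \<in> J"
    using \<phi>_mult[of x x a \<zero>] \<phi>_mult[of a \<zero> x x] by (simp_all add: J \<phi>_zero)
qed

lemma coset: "a \<in> carrier R \<Longrightarrow> J +> a = {b \<in> carrier R. \<phi> b = \<phi> a}"
proof (intro equalityI subsetI)
  fix b assume a: "a \<in> carrier R" and b: "b \<in> {b \<in> carrier R. \<phi> b = \<phi> a}"
  then have "b = (b \<ominus> a) \<oplus> a"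
    by (simp add: a_minus_def a_assoc l_neg)
  moreover have "b \<ominus> a \<in> J"
    using a b by (simp add: J \<phi>_minus)
  ultimately show "b \<in> J +> a"
    unfolding a_r_coset_def' by blast
qed (auto simp: a_r_coset_def' J \<phi>_add)

lemma mem_coset: "a \<in> carrier R \<Longrightarrow> b \<in> J +> a \<longleftrightarrow> b \<in> carrier R \<and> \<phi> b = \<phi> a"
  by (simp add: coset)

lemma coset_eq_iff:
  assumes "a \<in> carrier R" "b \<in> carrier R"
  shows "J +> a = J +> b \<longleftrightarrow> \<phi> a = \<phi> b"
proof
  assume "J +> a = J +> b"
  then have "a \<in> J +> b"
    using mem_coset[OF assms(1), of a] assms(1) by simp
  then show "\<phi> a = \<phi> b"
    using assms by (simp add: mem_coset)
qed (simp add: coset assms)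

lemma mem_coset_iff: "a \<in> carrier R \<Longrightarrow> b \<in> J +> a \<longleftrightarrow> b \<in> carrier R \<and> J +> b = J +> a"
  by (metis mem_coset coset_eq_iff)

lemma carrier_Quot: "carrier (R Quot J) = (\<lambda>a. J +> a) ` carrier R"
  unfolding FactRing_def A_RCOSETS_def' by force

lemma quotient_carrier: "carrier (quotient_algebra R J) = (\<lambda>a. J +> a) ` carrier R"
  by (simp add: quotient_algebra_def carrier_Quot)

text \<open>\<open>coset_map\<close> forms a union over all representatives; the congruence makes
  all cosets in this union equal, and there is at least one of them.\<close>

lemma coset_map_coset:
  assumes a: "a \<in> carrier R" and h: "\<And>b. b \<in> carrier R \<Longrightarrow> h b \<in> carrier R"
    and cong: "\<And>b. b \<in> carrier R \<Longrightarrow> \<phi> b = \<phi> a \<Longrightarrow> \<phi> (h b) = \<phi> (h a)"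
  shows "coset_map R J h (J +> a) = J +> h a"
proof -
  have "J +> h b = J +> h a" if "b \<in> J +> a" for b
    using that a h cong[of b] by (simp add: mem_coset coset_eq_iff)
  then have "coset_map R J h (J +> a) = (\<Union>b\<in>J +> a. J +> h a)"
    unfolding coset_map_def by (intro SUP_cong refl)
  moreover have "J +> a \<noteq> {}"
    using mem_coset[of a a] a by auto
  ultimately show ?thesis
    by (simp only: UN_constant if_False)
qed

lemma quotient_smult: "a \<in> carrier R \<Longrightarrow> c \<odot>\<^bsub>quotient_algebra R J\<^esub> (J +> a) = J +> c \<odot> a"
  unfolding quotient_algebra_def module.simps
  by (rule coset_map_coset) (assumption | erule complex_algebraD(3)[OF alg] | rule \<phi>_smult)+

lemma quotient_add:
  assumes "a \<in> carrier R" "b \<in> carrier R"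
  shows "(J +> a) \<oplus>\<^bsub>quotient_algebra R J\<^esub> (J +> b) = J +> (a \<oplus> b)"
proof -
  have "{x \<oplus> y | x y. x \<in> J +> a \<and> y \<in> J +> b} = J +> (a \<oplus> b)"
  proof (intro equalityI subsetI)
    fix z assume z: "z \<in> J +> (a \<oplus> b)"
    then have zc: "z \<in> carrier R" "\<phi> z = \<phi> a + \<phi> b"
      using assms by (auto simp: coset \<phi>_add)
    then have "z = (z \<ominus> b) \<oplus> b"
      using assms by (simp add: a_minus_def a_assoc l_neg)
    moreover have "z \<ominus> b \<in> J +> a" "b \<in> J +> b"
      using zc assms by (auto simp: coset \<phi>_minus)
    ultimately show "z \<in> {x \<oplus> y | x y. x \<in> J +> a \<and> y \<in> J +> b}"
      by (intro CollectI exI conjI)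
  qed (use assms in \<open>auto simp: mem_coset \<phi>_add\<close>)
  moreover have "(J +> a) <+> (J +> b) = {x \<oplus> y | x y. x \<in> J +> a \<and> y \<in> J +> b}"
    unfolding set_add_def' by blast
  ultimately show ?thesis
    by (simp add: quotient_algebra_def FactRing_def)
qed

lemma quotient_mult:
  assumes "a \<in> carrier R" "b \<in> carrier R"
  shows "(J +> a) \<otimes>\<^bsub>quotient_algebra R J\<^esub> (J +> b) = J +> (a \<otimes> b)"
proof -
  have "J +> (x \<otimes> y) = J +> (a \<otimes> b)" if "x \<in> J +> a" "y \<in> J +> b" for x y
    using that assms \<phi>_mult[of x a y b] by (simp add: mem_coset coset_eq_iff)
  then have "(\<Union>x\<in>J +> a. \<Union>y\<in>J +> b. J +> (x \<otimes> y)) = (\<Union>x\<in>J +> a. \<Union>y\<in>J +> b. J +> (a \<otimes> b))"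
    by (intro SUP_cong refl)
  also have "\<dots> = J +> (a \<otimes> b)"
    using mem_coset[of a a] mem_coset[of b b] assms by (auto simp only: UN_constant split: if_splits)
  finally have "(\<Union>x\<in>J +> a. \<Union>y\<in>J +> b. J +> (x \<otimes> y)) = J +> (a \<otimes> b)" .
  then show ?thesis
    by (simp add: quotient_algebra_def FactRing_def rcoset_mult_def)
qed

lemma quotient_zero: "\<zero>\<^bsub>quotient_algebra R J\<^esub> = J +> \<zero>"
  by (simp add: quotient_algebra_def FactRing_def coset \<phi>_zero J)

lemma quotient_one: "\<one>\<^bsub>quotient_algebra R J\<^esub> = J +> \<one>"
  by (simp add: quotient_algebra_def FactRing_def)

lemma complex_algebra_quotient: "complex_algebra (quotient_algebra R J)"
  by (rule complex_algebra_image[OF alg quotient_carrier])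
    (simp_all add: quotient_smult quotient_add quotient_mult quotient_zero quotient_one)

end

lemma tagged_simps:
  "carrier (tagged q M) = Pair q ` carrier M"
  "u \<otimes>\<^bsub>tagged q M\<^esub> v = (q, snd u \<otimes>\<^bsub>M\<^esub> snd v)"
  "u \<oplus>\<^bsub>tagged q M\<^esub> v = (q, snd u \<oplus>\<^bsub>M\<^esub> snd v)"
  "c \<odot>\<^bsub>tagged q M\<^esub> u = (q, c \<odot>\<^bsub>M\<^esub> snd u)"
  "\<one>\<^bsub>tagged q M\<^esub> = (q, \<one>\<^bsub>M\<^esub>)" "\<zero>\<^bsub>tagged q M\<^esub> = (q, \<zero>\<^bsub>M\<^esub>)"
  by (simp_all add: tagged_def)

lemma complex_algebra_tagged: "complex_algebra M \<Longrightarrow> complex_algebra (tagged q M)"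
  by (erule complex_algebra_image[where h = "Pair q"]) (simp_all add: tagged_simps)

section \<open>Final topologies and seminorm topologies\<close>

text \<open>Preimages commute with intersections and unions. This serves the quotient topology of
  the algebra and the topology \<open>TQ\<close> of the bundle.\<close>

lemma openin_final_topology:
  "openin (topology (\<lambda>W. W \<subseteq> S \<and> openin X {x \<in> A. f x \<in> W})) W \<longleftrightarrow>
    W \<subseteq> S \<and> openin X {x \<in> A. f x \<in> W}"
proof -
  have "istopology (\<lambda>W. W \<subseteq> S \<and> openin X {x \<in> A. f x \<in> W})"
    unfolding istopology_def
  proof (intro conjI allI impI)
    fix W W' assume *: "W \<subseteq> S \<and> openin X {x \<in> A. f x \<in> W}" "W' \<subseteq> S \<and> openin X {x \<in> A. f x \<in> W'}"
    have "{x \<in> A. f x \<in> W \<inter> W'} = {x \<in> A. f x \<in> W} \<inter> {x \<in> A. f x \<in> W'}"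
      by auto
    with * show "W \<inter> W' \<subseteq> S" "openin X {x \<in> A. f x \<in> W \<inter> W'}"
      by (auto simp: openin_Int)
  next
    fix K assume *: "\<forall>W\<in>K. W \<subseteq> S \<and> openin X {x \<in> A. f x \<in> W}"
    have "{x \<in> A. f x \<in> \<Union>K} = (\<Union>W\<in>K. {x \<in> A. f x \<in> W})"
      by auto
    with * show "\<Union>K \<subseteq> S" "openin X {x \<in> A. f x \<in> \<Union>K}"
      by (auto intro: openin_Union)
  qed
  then show ?thesis
    by (simp add: topology_inverse')
qed

lemma openin_quotient_topology:
  "openin (quotient_topology A J) W \<longleftrightarrow>
    W \<subseteq> carrier (A Quot J) \<and> openin (topol A) {a \<in> carrier A. J +>\<^bsub>A\<^esub> a \<in> W}"
  unfolding quotient_topology_def by (rule openin_final_topology)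

lemma openin_seminorm_topology:
  "openin (seminorm_topology M P) W \<longleftrightarrow> W \<subseteq> carrier M \<and>
     (\<forall>u\<in>W. \<exists>Q \<epsilon>. finite Q \<and> Q \<subseteq> P \<and> 0 < \<epsilon> \<and>
        {v \<in> carrier M. \<forall>\<nu>\<in>Q. \<nu> (v \<ominus>\<^bsub>M\<^esub> u) < \<epsilon>} \<subseteq> W)"
proof -
  define nbhd where "nbhd u W \<longleftrightarrow> (\<exists>Q \<epsilon>. finite Q \<and> Q \<subseteq> P \<and> 0 < \<epsilon> \<and>
        {v \<in> carrier M. \<forall>\<nu>\<in>Q. \<nu> (v \<ominus>\<^bsub>M\<^esub> u) < \<epsilon>} \<subseteq> W)" for u W
  have mono: "nbhd u W'" if "nbhd u W" "W \<subseteq> W'" for u W W'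
    using that unfolding nbhd_def by (elim exE conjE, intro exI conjI) (assumption | rule subset_trans)+
  have Int: "nbhd u (W \<inter> W')" if W: "nbhd u W" and W': "nbhd u W'" for u W W'
  proof -
    obtain Q \<epsilon> where 1: "finite Q" "Q \<subseteq> P" "0 < \<epsilon>"
        "{v \<in> carrier M. \<forall>\<nu>\<in>Q. \<nu> (v \<ominus>\<^bsub>M\<^esub> u) < \<epsilon>} \<subseteq> W"
      using W unfolding nbhd_def by (elim exE conjE)
    obtain Q' \<epsilon>' where 2: "finite Q'" "Q' \<subseteq> P" "0 < \<epsilon>'"
        "{v \<in> carrier M. \<forall>\<nu>\<in>Q'. \<nu> (v \<ominus>\<^bsub>M\<^esub> u) < \<epsilon>'} \<subseteq> W'"
      using W' unfolding nbhd_def by (elim exE conjE)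
    have "{v \<in> carrier M. \<forall>\<nu>\<in>Q \<union> Q'. \<nu> (v \<ominus>\<^bsub>M\<^esub> u) < min \<epsilon> \<epsilon>'} \<subseteq> W \<inter> W'"
      using 1(4) 2(4) by auto
    with 1(1-3) 2(1-3) show ?thesis
      unfolding nbhd_def by (intro exI[of _ "Q \<union> Q'"] exI[of _ "min \<epsilon> \<epsilon>'"]) auto
  qed
  have "istopology (\<lambda>W. W \<subseteq> carrier M \<and> (\<forall>u\<in>W. nbhd u W))"
    unfolding istopology_def by (auto intro: Int mono)
  then show ?thesis
    unfolding seminorm_topology_def nbhd_def[symmetric] by (simp add: topology_inverse')
qed

lemma topspace_seminorm_topology [simp]: "topspace (seminorm_topology M P) = carrier M"
proof (rule antisym)
  show "topspace (seminorm_topology M P) \<subseteq> carrier M"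
    using openin_seminorm_topology[THEN iffD1, OF openin_topspace] by (rule conjunct1)
  have "openin (seminorm_topology M P) (carrier M)"
    unfolding openin_seminorm_topology
    by (intro conjI ballI exI[of _ "{}"] exI[of _ 1]) auto
  then show "carrier M \<subseteq> topspace (seminorm_topology M P)"
    by (rule openin_subset)
qed

text \<open>Monotonicity in the index lets one seminorm dominate any finite subfamily, so
  neighbourhoods become balls of a single \<open>P i\<close>. The instances are the norms
  \<open>N\<close> on series and \<open>nm\<close> on the fibres.\<close>

locale seminorm_sequence =
  fixes M :: "(complex, 'a, 'm) module_scheme" (structure) and P :: "nat \<Rightarrow> 'a \<Rightarrow> real"
  assumes vector_space: "module complex_field M"
    and seminorm: "\<And>i. seminorm_on M (P i)"
    and increasing: "\<And>i u. u \<in> carrier M \<Longrightarrow> P i u \<le> P (Suc i) u"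
begin

sublocale module complex_field M by (rule vector_space)

lemma seminorm_mono: "u \<in> carrier M \<Longrightarrow> i \<le> j \<Longrightarrow> P i u \<le> P j u"
  by (rule lift_Suc_mono_le[of "\<lambda>i. P i u"]) (auto intro: increasing)

lemma seminorm_zero: "P i \<zero> = 0"
  using seminorm[of i] smult_zero_left[OF vector_space M.zero_closed]
  unfolding seminorm_on_def by (metis M.zero_closed mult_eq_0_iff norm_zero)

lemma seminorm_minus_commute:
  assumes "u \<in> carrier M" "v \<in> carrier M" shows "P i (u \<ominus> v) = P i (v \<ominus> u)"
proof -
  have "u \<ominus> v = (-1) \<odot> (v \<ominus> u)"
    using assms by (simp add: M.minus_add M.minus_minus M.a_comm a_minus_def flip: a_inv_eq_smult[OF vector_space])
  then show ?thesis
    using seminorm[of i] assms by (auto simp: seminorm_on_def)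
qed

lemma seminorm_triangle:
  assumes "u \<in> carrier M" "v \<in> carrier M" "w \<in> carrier M"
  shows "P i (u \<ominus> w) \<le> P i (u \<ominus> v) + P i (v \<ominus> w)"
proof -
  have "u \<ominus> w = (u \<ominus> v) \<oplus> (v \<ominus> w)"
    using assms by (simp add: a_minus_def M.a_assoc M.r_neg1 M.r_neg2)
  then show ?thesis
    using seminorm[of i] assms by (auto simp: seminorm_on_def)
qed

lemma openin_iff:
  "openin (seminorm_topology M (range P)) W \<longleftrightarrow> W \<subseteq> carrier M \<and>
    (\<forall>u\<in>W. \<exists>i. \<exists>\<epsilon>>0. \<forall>v\<in>carrier M. P i (v \<ominus> u) < \<epsilon> \<longrightarrow> v \<in> W)"
proof -
  have "(\<exists>Q \<epsilon>. finite Q \<and> Q \<subseteq> range P \<and> 0 < \<epsilon> \<and> {v \<in> carrier M. \<forall>\<nu>\<in>Q. \<nu> (v \<ominus> u) < \<epsilon>} \<subseteq> W) \<longleftrightarrow>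
      (\<exists>i. \<exists>\<epsilon>>0. \<forall>v\<in>carrier M. P i (v \<ominus> u) < \<epsilon> \<longrightarrow> v \<in> W)" (is "?L \<longleftrightarrow> ?R")
    if u: "u \<in> carrier M" for u
  proof
    assume ?L
    then obtain Q \<epsilon> where Q: "finite Q" "Q \<subseteq> range P" "0 < \<epsilon>"
      "{v \<in> carrier M. \<forall>\<nu>\<in>Q. \<nu> (v \<ominus> u) < \<epsilon>} \<subseteq> W"
      by (elim exE conjE)
    then obtain I where I: "finite I" "Q = P ` I"
      by (meson finite_subset_image)
    obtain k where k: "\<forall>i\<in>I. i \<le> k"
      using I(1) finite_nat_set_iff_bounded_le by blast
    have "v \<in> W" if v: "v \<in> carrier M" "P k (v \<ominus> u) < \<epsilon>" for v
    proof -
      have "P i (v \<ominus> u) < \<epsilon>" if "i \<in> I" for i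
        using seminorm_mono[of "v \<ominus> u" i k] k that v u by force
      then show ?thesis
        using Q(4) I(2) v(1) by blast
    qed
    with Q(3) show ?R
      by (intro exI[of _ k] exI[of _ \<epsilon>]) simp
  next
    assume ?R
    then obtain i \<epsilon> where "\<epsilon> > 0" "\<forall>v\<in>carrier M. P i (v \<ominus> u) < \<epsilon> \<longrightarrow> v \<in> W"
      by (elim exE conjE)
    then show ?L
      by (intro exI[of _ "{P i}"] exI[of _ \<epsilon>]) auto
  qed
  then show ?thesis
    unfolding openin_seminorm_topology by (intro conj_cong refl ball_cong) (simp add: subset_iff)
qed

lemma openin_ball:
  assumes u: "u \<in> carrier M"
  shows "openin (seminorm_topology M (range P)) {v \<in> carrier M. P i (v \<ominus> u) < \<epsilon>}"
  unfolding openin_iff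
proof (intro conjI ballI)
  fix v assume v: "v \<in> {v \<in> carrier M. P i (v \<ominus> u) < \<epsilon>}"
  have "P i (w \<ominus> u) < \<epsilon>" if "w \<in> carrier M" "P i (w \<ominus> v) < \<epsilon> - P i (v \<ominus> u)" for w
    using seminorm_triangle[of w v u i] u v that by auto
  with v show "\<exists>j. \<exists>\<delta>>0. \<forall>w\<in>carrier M. P j (w \<ominus> v) < \<delta> \<longrightarrow> w \<in> {v \<in> carrier M. P i (v \<ominus> u) < \<epsilon>}"
    by (intro exI[of _ i] exI[of _ "\<epsilon> - P i (v \<ominus> u)"]) auto
qed auto

lemma limitin_iff:
  "limitin (seminorm_topology M (range P)) f u F \<longleftrightarrow>
    u \<in> carrier M \<and> (\<forall>i. \<forall>\<epsilon>>0. \<forall>\<^sub>F x in F. f x \<in> carrier M \<and> P i (f x \<ominus> u) < \<epsilon>)"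
proof (intro iffI conjI allI impI)
  assume *: "limitin (seminorm_topology M (range P)) f u F"
  then show u: "u \<in> carrier M"
    by (auto simp: limitin_def)
  fix i and \<epsilon> :: real assume "\<epsilon> > 0"
  then have "u \<in> {v \<in> carrier M. P i (v \<ominus> u) < \<epsilon>}"
    using u by (simp add: a_minus_def M.r_neg seminorm_zero)
  then have "\<forall>\<^sub>F x in F. f x \<in> {v \<in> carrier M. P i (v \<ominus> u) < \<epsilon>}"
    using * openin_ball[OF u] unfolding limitin_def by blast
  then show "\<forall>\<^sub>F x in F. f x \<in> carrier M \<and> P i (f x \<ominus> u) < \<epsilon>"
    by simp
next
  assume *: "u \<in> carrier M \<and> (\<forall>i. \<forall>\<epsilon>>0. \<forall>\<^sub>F x in F. f x \<in> carrier M \<and> P i (f x \<ominus> u) < \<epsilon>)"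
  show "limitin (seminorm_topology M (range P)) f u F"
    unfolding limitin_def
  proof (intro conjI allI impI)
    fix W assume "openin (seminorm_topology M (range P)) W \<and> u \<in> W"
    then obtain i \<epsilon> where "\<epsilon> > 0" "\<forall>v\<in>carrier M. P i (v \<ominus> u) < \<epsilon> \<longrightarrow> v \<in> W"
      by (auto simp: openin_iff)
    with * have "\<forall>\<^sub>F x in F. f x \<in> carrier M \<and> P i (f x \<ominus> u) < \<epsilon>"
      by simp
    then show "\<forall>\<^sub>F x in F. f x \<in> W"
      by (rule eventually_mono) (simp add: \<open>\<forall>v\<in>carrier M. P i (v \<ominus> u) < \<epsilon> \<longrightarrow> v \<in> W\<close>)
  qed (use * in simp)
qed

lemma Hausdorff:
  assumes "\<And>u. u \<in> carrier M \<Longrightarrow> (\<And>i. P i u = 0) \<Longrightarrow> u = \<zero>"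
  shows "Hausdorff_space (seminorm_topology M (range P))"
  unfolding Hausdorff_space_def
proof (intro allI impI)
  fix u v assume uv: "u \<in> topspace (seminorm_topology M (range P)) \<and>
    v \<in> topspace (seminorm_topology M (range P)) \<and> u \<noteq> v"
  then have c: "u \<in> carrier M" "v \<in> carrier M"
    by auto
  have "u = (u \<ominus> v) \<oplus> v"
    using c by (simp add: a_minus_def M.a_assoc M.l_neg)
  then have "u \<ominus> v \<noteq> \<zero>"
    using uv c by auto
  then obtain i where "P i (u \<ominus> v) \<noteq> 0"
    using assms[of "u \<ominus> v"] c by auto
  moreover have "0 \<le> P i (u \<ominus> v)"
    using seminorm[of i] c by (auto simp: seminorm_on_def)
  ultimately have pos: "0 < P i (u \<ominus> v)"
    by simp
  let ?C = "\<lambda>x. {w \<in> carrier M. P i (w \<ominus> x) < P i (u \<ominus> v) / 2}"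
  have "disjnt (?C u) (?C v)"
    unfolding disjnt_iff
  proof (intro allI notI)
    fix w assume "w \<in> ?C u \<and> w \<in> ?C v"
    then show False
      using seminorm_triangle[of u w v i] seminorm_minus_commute[of u w i] c by auto
  qed
  moreover have "u \<in> ?C u" "v \<in> ?C v"
    using pos c by (simp_all add: a_minus_def M.r_neg seminorm_zero)
  ultimately show "\<exists>U V. openin (seminorm_topology M (range P)) U \<and>
      openin (seminorm_topology M (range P)) V \<and> u \<in> U \<and> v \<in> V \<and> disjnt U V"
    using openin_ball[OF c(1), of i "P i (u \<ominus> v) / 2"] openin_ball[OF c(2), of i "P i (u \<ominus> v) / 2"]
    by blast
qed

end

section \<open>Graded algebras of free series\<close>

lemma mem_words_of_length: "\<alpha> \<in> words_of_length n d \<longleftrightarrow> length \<alpha> = d \<and> set \<alpha> \<subseteq> {1..n}"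
  by (simp add: words_of_length_def)

lemma mem_words: "\<alpha> \<in> words n \<longleftrightarrow> set \<alpha> \<subseteq> {1..n}"
  by (auto simp: words_def mem_words_of_length)

lemma finite_words_of_length: "finite (words_of_length n d)"
  unfolding words_of_length_def using finite_lists_length_eq[of "{1..n}" d] by (simp add: conj_commute)

text \<open>\<open>p i d\<close> is the \<open>i\<close>-th norm of the homogeneous component of
  degree \<open>d\<close>. By \<open>p_mono\<close> it depends only on the moduli of the
  coefficients of words of length \<open>d\<close>, and monotonically so: diagonal operators then
  have norm at most the supremum of their entries. \<open>p_coeff\<close> makes coefficients
  continuous, and \<open>p_conv\<close> turns into submultiplicativity after summation over
  \<open>d\<close>.\<close>

locale graded_series =
  fixes n :: nat and p :: "nat \<Rightarrow> nat \<Rightarrow> free_series \<Rightarrow> real"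
  assumes p_nonneg: "0 \<le> p i d a"
    and p_add: "p i d (a + b) \<le> p i d a + p i d b"
    and p_mono: "0 \<le> K \<Longrightarrow> (\<And>\<alpha>. \<alpha> \<in> words_of_length n d \<Longrightarrow> cmod (a \<alpha>) \<le> K * cmod (b \<alpha>)) \<Longrightarrow>
      p i d a \<le> K * p i d b"
    and p_coeff: "\<exists>K\<ge>0. \<forall>a. \<forall>\<alpha>\<in>words_of_length n d. cmod (a \<alpha>) \<le> K * p i d a"
    and p_conv: "p i d (conv a b) \<le> (\<Sum>j\<le>d. p i j a * p i (d - j) b)"
    and p_incr: "p i d a \<le> p (Suc i) d a"
begin

definition Car :: "free_series set" where
  "Car = {a. (\<forall>\<alpha>. \<alpha> \<notin> words n \<longrightarrow> a \<alpha> = 0) \<and> (\<forall>i. summable (\<lambda>d. p i d a))}"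

definition N :: "nat \<Rightarrow> free_series \<Rightarrow> real" where
  "N i a = (\<Sum>d. p i d a)"

lemma Car_summable: "a \<in> Car \<Longrightarrow> summable (\<lambda>d. p i d a)"
  and Car_support: "a \<in> Car \<Longrightarrow> \<alpha> \<notin> words n \<Longrightarrow> a \<alpha> = 0"
  by (simp_all add: Car_def)

lemma p_eq_0: "(\<And>\<alpha>. \<alpha> \<in> words_of_length n d \<Longrightarrow> a \<alpha> = 0) \<Longrightarrow> p i d a = 0"
  using p_mono[of 0 d a a i] p_nonneg[of i d a] by simp

text \<open>Homogeneity comes from \<open>p_mono\<close> used twice, with the factors
  \<open>cmod c\<close> and \<open>1 / cmod c\<close>.\<close>

lemma p_scale: "p i d (scale c a) = cmod c * p i d a"
proof (rule antisym)
  show "p i d (scale c a) \<le> cmod c * p i d a"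
    by (rule p_mono) (simp_all add: norm_mult)
  show "cmod c * p i d a \<le> p i d (scale c a)"
  proof (cases "c = 0")
    case False
    then have "p i d a \<le> (1 / cmod c) * p i d (scale c a)"
      by (intro p_mono) (simp_all add: norm_mult)
    with False show ?thesis
      by (simp add: field_simps)
  qed (simp add: p_nonneg)
qed

lemma p_le_N: "a \<in> Car \<Longrightarrow> p i d a \<le> N i a"
  unfolding N_def using sum_le_suminf[OF Car_summable, of a "{d}" i] by (simp add: p_nonneg)

lemma N_nonneg: "a \<in> Car \<Longrightarrow> 0 \<le> N i a"
  unfolding N_def by (rule suminf_nonneg[OF Car_summable]) (simp_all add: p_nonneg)

text \<open>Termwise use of \<open>p_mono\<close>: the space is solid, and bounded diagonal
  operators act on it. Truncation and the transport between fibres are special cases.\<close>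

lemma
  assumes a: "a \<in> Car" and K: "0 \<le> K" and le: "\<And>\<alpha>. cmod (b \<alpha>) \<le> K * cmod (a \<alpha>)"
  shows Car_dominated: "b \<in> Car" and N_dominated: "N i b \<le> K * N i a"
proof -
  have p: "p i d b \<le> K * p i d a" for i d
    using K le by (rule p_mono)
  have s: "summable (\<lambda>d. p i d b)" for i
  proof (rule summable_comparison_test')
    show "summable (\<lambda>d. K * p i d a)"
      by (intro summable_mult Car_summable a)
    show "norm (p i d b) \<le> K * p i d a" if "d \<ge> 0" for d
      using p[of i d] by (simp add: p_nonneg)
  qed
  have "b \<alpha> = 0" if "\<alpha> \<notin> words n" for \<alpha>
    using le[of \<alpha>] Car_support[OF a that] by simp
  with s show "b \<in> Car"
    by (simp add: Car_def)
  show "N i b \<le> K * N i a"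
    unfolding N_def suminf_mult[OF Car_summable[OF a], symmetric]
    by (intro suminf_le p s summable_mult Car_summable a)
qed

lemma
  assumes a: "a \<in> Car" and b: "b \<in> Car"
  shows Car_add: "a + b \<in> Car" and N_add: "N i (a + b) \<le> N i a + N i b"
proof -
  have s: "summable (\<lambda>d. p i d a + p i d b)" for i
    by (intro summable_add Car_summable a b)
  have s': "summable (\<lambda>d. p i d (a + b))" for i
    using p_add by (intro summable_comparison_test'[OF s]) (simp add: p_nonneg)
  then show "a + b \<in> Car"
    using a b by (simp add: Car_def)
  show "N i (a + b) \<le> N i a + N i b"
    unfolding N_def suminf_add[OF Car_summable[OF a] Car_summable[OF b]]
    by (intro suminf_le p_add s s')
qed

lemma Car_scale: "a \<in> Car \<Longrightarrow> scale c a \<in> Car"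
  by (rule Car_dominated[of a "cmod c"]) (auto simp: norm_mult)

lemma N_scale: "a \<in> Car \<Longrightarrow> N i (scale c a) = cmod c * N i a"
  by (simp add: N_def p_scale suminf_mult Car_summable)

lemma Car_finite:
  assumes "\<And>\<alpha>. \<alpha> \<notin> words n \<Longrightarrow> a \<alpha> = 0" "\<And>\<alpha>. D < length \<alpha> \<Longrightarrow> a \<alpha> = 0"
  shows "a \<in> Car"
proof -
  have "summable (\<lambda>d. p i d a)" for i
    by (rule summable_finite[of "{..D}"]) (auto intro!: p_eq_0 assms simp: mem_words_of_length)
  with assms show ?thesis
    by (simp add: Car_def)
qed

lemma Car_zero: "0 \<in> Car"
  by (rule Car_finite[of _ 0]) auto

lemma Car_monomial: "\<alpha> \<in> words n \<Longrightarrow> monomial \<alpha> \<in> Car"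
  by (rule Car_finite[of _ "length \<alpha>"]) (auto simp: monomial_def)

lemma N_zero: "N i 0 = 0"
  using N_scale[OF Car_zero, of i 0] by simp

lemma Car_uminus: "a \<in> Car \<Longrightarrow> - a \<in> Car"
  using Car_scale[of a "-1"] by (simp add: scale_minus_one)

lemma N_uminus: "a \<in> Car \<Longrightarrow> N i (- a) = N i a"
  using N_scale[of a i "-1"] by (simp add: scale_minus_one)

lemma Car_diff: "a \<in> Car \<Longrightarrow> b \<in> Car \<Longrightarrow> a - b \<in> Car"
  using Car_add[of a "- b"] by (simp add: Car_uminus)

lemma N_diff: "a \<in> Car \<Longrightarrow> b \<in> Car \<Longrightarrow> N i (a - b) \<le> N i a + N i b"
  using N_add[of a "- b" i] by (simp add: Car_uminus N_uminus)

lemma N_minus_commute: "a \<in> Car \<Longrightarrow> b \<in> Car \<Longrightarrow> N i (a - b) = N i (b - a)"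
  using N_uminus[of "a - b" i] by (simp add: Car_diff)

lemma N_triangle: "a \<in> Car \<Longrightarrow> b \<in> Car \<Longrightarrow> c \<in> Car \<Longrightarrow> N i (a - c) \<le> N i (a - b) + N i (b - c)"
  using N_add[of "a - b" "b - c" i] by (simp add: Car_diff)

lemma N_incr: "a \<in> Car \<Longrightarrow> N i a \<le> N (Suc i) a"
  unfolding N_def by (intro suminf_le p_incr Car_summable)

lemma Car_sum: "(\<And>x. x \<in> S \<Longrightarrow> f x \<in> Car) \<Longrightarrow> (\<Sum>x\<in>S. f x) \<in> Car"
  by (induction S rule: infinite_finite_induct) (auto simp: Car_zero Car_add)

text \<open>\<open>p_conv\<close> compares the components of the product with the Cauchy product of
  two absolutely convergent series.\<close>

lemma
  assumes a: "a \<in> Car" and b: "b \<in> Car"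
  shows Car_conv: "conv a b \<in> Car" and N_conv: "N i (conv a b) \<le> N i a * N i b"
proof -
  have na: "summable (\<lambda>d. norm (p i d a))" and nb: "summable (\<lambda>d. norm (p i d b))" for i
    using Car_summable[OF a, of i] Car_summable[OF b, of i] by (simp_all add: p_nonneg)
  have s: "summable (\<lambda>d. p i d (conv a b))" for i
    using p_conv by (intro summable_comparison_test'[OF summable_Cauchy_product[OF na nb]]) (simp add: p_nonneg)
  have "conv a b \<gamma> = 0" if "\<gamma> \<notin> words n" for \<gamma>
    unfolding conv_def
  proof (rule sum.neutral, rule ballI)
    fix k
    have "set \<gamma> = set (take k \<gamma>) \<union> set (drop k \<gamma>)"
      by (metis append_take_drop_id set_append)
    then have "take k \<gamma> \<notin> words n \<or> drop k \<gamma> \<notin> words n"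
      using that by (auto simp: mem_words)
    then show "a (take k \<gamma>) * b (drop k \<gamma>) = 0"
      using Car_support a b by auto
  qed
  with s show "conv a b \<in> Car"
    by (simp add: Car_def)
  show "N i (conv a b) \<le> N i a * N i b"
    unfolding N_def Cauchy_product[OF na nb]
    by (intro suminf_le p_conv s summable_Cauchy_product na nb)
qed

lemma N_coeff: "\<exists>K\<ge>0. \<forall>a\<in>Car. cmod (a \<alpha>) \<le> K * N i a"
proof (cases "\<alpha> \<in> words n")
  case True
  obtain K where K: "K \<ge> 0" "\<And>a. cmod (a \<alpha>) \<le> K * p i (length \<alpha>) a"
    using p_coeff[of "length \<alpha>" i] True by (auto simp: mem_words mem_words_of_length)
  have "cmod (a \<alpha>) \<le> K * N i a" if "a \<in> Car" for a
    using order_trans[OF K(2) mult_left_mono[OF p_le_N[OF that] K(1)]] .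
  with K(1) show ?thesis
    by blast
qed (auto intro!: exI[of _ 0] simp: Car_support)

subsection \<open>Truncation\<close>

lemma Car_trunc: "a \<in> Car \<Longrightarrow> trunc D a \<in> Car"
  by (rule Car_dominated[of a 1]) (auto simp: trunc_def)

lemma N_trunc_le: "a \<in> Car \<Longrightarrow> N i (trunc D a) \<le> N i a"
  using N_dominated[of a 1 "trunc D a" i] by (auto simp: trunc_def)

definition tail :: "nat \<Rightarrow> nat \<Rightarrow> free_series \<Rightarrow> real" where
  "tail i D a = N i (a - trunc D a)"

lemma tail_antimono:
  assumes "a \<in> Car" "D \<le> D'" shows "tail i D' a \<le> tail i D a"
proof -
  have "N i (a - trunc D' a) \<le> 1 * N i (a - trunc D a)"
    using assms by (intro N_dominated Car_diff Car_trunc) (auto simp: trunc_def)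
  then show ?thesis
    by (simp add: tail_def)
qed

text \<open>The tail is subadditive and bounded by the norm. One degree \<open>D\<close> therefore
  controls the tails of all series near a given one.\<close>

lemma tail_perturb:
  assumes "a \<in> Car" "b \<in> Car" shows "tail i D a \<le> tail i D b + N i (a - b)"
proof -
  have "a - trunc D a = (b - trunc D b) + ((a - b) - trunc D (a - b))"
    unfolding trunc_diff by simp
  moreover have "N i ((a - b) - trunc D (a - b)) \<le> 1 * N i (a - b)"
    using assms by (intro N_dominated Car_diff) (auto simp: trunc_def)
  moreover have "N i ((b - trunc D b) + ((a - b) - trunc D (a - b))) \<le>
      N i (b - trunc D b) + N i ((a - b) - trunc D (a - b))"
    using assms by (intro N_add Car_diff Car_trunc)
  ultimately show ?thesis
    unfolding tail_def by (metis (no_types) add_left_mono mult_1 order_trans)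
qed

lemma tail_small:
  assumes a: "a \<in> Car" and e: "0 < e"
  shows "\<exists>D. tail i D a < e"
proof -
  obtain D where D: "\<And>m. m \<ge> D \<Longrightarrow> norm (\<Sum>d. p i (d + m) a) < e"
    using suminf_exist_split[OF e Car_summable[OF a, of i]] by blast
  have low: "p i d (a - trunc D a) = 0" if "d \<le> D" for d
    using that by (intro p_eq_0) (simp add: trunc_def mem_words_of_length)
  have high: "p i (d + Suc D) (a - trunc D a) \<le> p i (d + Suc D) a" for d
    using p_mono[of 1 "d + Suc D" "a - trunc D a" a i] by (simp add: trunc_def mem_words_of_length)
  have s: "summable (\<lambda>d. p i d (a - trunc D a))"
    by (intro Car_summable Car_diff Car_trunc a)
  \<comment> \<open>Truncation keeps degree \<open>D\<close> itself, so the remainder starts at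
    \<open>Suc D\<close>.\<close>
  have "tail i D a = (\<Sum>d. p i (d + Suc D) (a - trunc D a))"
    unfolding tail_def N_def by (subst suminf_split_initial_segment[OF s, of "Suc D"]) (simp add: low)
  also have "\<dots> \<le> (\<Sum>d. p i (d + Suc D) a)"
    by (intro suminf_le high summable_ignore_initial_segment s Car_summable a)
  also have "\<dots> < e"
    using D[of "Suc D"] by simp
  finally show ?thesis
    by blast
qed

subsection \<open>Completeness\<close>

text \<open>In one degree only finitely many words occur, so \<open>p i d\<close> is controlled by
  finitely many coefficients and coefficientwise convergence is enough.\<close>

lemma p_limit_le:
  assumes lim: "\<And>\<alpha>. \<alpha> \<in> words_of_length n d \<Longrightarrow> (\<lambda>l. f l \<alpha>) \<longlonglongrightarrow> a \<alpha>"
  shows "(\<lambda>l. p i d (b - f l)) \<longlonglongrightarrow> p i d (b - a)"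
proof -
  let ?W = "words_of_length n d"
  have fin: "finite ?W"
    by (rule finite_words_of_length)
  have bound: "p i d c \<le> (\<Sum>\<alpha>\<in>?W. cmod (c \<alpha>) * p i d (monomial \<alpha>))" for c
  proof -
    have "p i d (\<Sum>\<alpha>\<in>S. scale (c \<alpha>) (monomial \<alpha>)) \<le> (\<Sum>\<alpha>\<in>S. cmod (c \<alpha>) * p i d (monomial \<alpha>))"
      if "finite S" for S
      using that
    proof induction
      case empty
      show ?case by (simp add: p_eq_0)
    next
      case (insert \<alpha> S)
      have "p i d (\<Sum>\<alpha>\<in>insert \<alpha> S. scale (c \<alpha>) (monomial \<alpha>))
          \<le> p i d (scale (c \<alpha>) (monomial \<alpha>)) + p i d (\<Sum>\<alpha>\<in>S. scale (c \<alpha>) (monomial \<alpha>))"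
        unfolding sum.insert[OF insert.hyps] by (rule p_add)
      also have "\<dots> \<le> cmod (c \<alpha>) * p i d (monomial \<alpha>) + (\<Sum>\<alpha>\<in>S. cmod (c \<alpha>) * p i d (monomial \<alpha>))"
        using insert.IH by (simp only: p_scale add_left_mono)
      finally show ?case
        unfolding sum.insert[OF insert.hyps] .
    qed
    note this[OF fin]
    \<comment> \<open>\<open>c\<close> and the finite sum agree on the words of length
      \<open>d\<close>, the only ones that \<open>p i d\<close> sees.\<close>
    moreover have "p i d c \<le> 1 * p i d (\<Sum>\<alpha>\<in>?W. scale (c \<alpha>) (monomial \<alpha>))"
      by (rule p_mono) (simp_all add: sum_fun_apply monomial_def sum.delta'[OF fin] if_distrib cong: if_cong)
    ultimately show ?thesis
      by simp
  qed
  have pdiff: "\<bar>p i d (b - f l) - p i d (b - a)\<bar> \<le> p i d (f l - a)" for l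
  proof -
    have "p i d (a - f l) = p i d (f l - a)"
      using p_scale[of i d "-1" "f l - a"] by (simp add: scale_minus_one)
    then show ?thesis
      using p_add[of i d "b - f l" "f l - a"] p_add[of i d "b - a" "a - f l"] by simp
  qed
  have "(\<lambda>l. \<Sum>\<alpha>\<in>?W. cmod (f l \<alpha> - a \<alpha>) * p i d (monomial \<alpha>)) \<longlonglongrightarrow> (\<Sum>\<alpha>\<in>?W. cmod (a \<alpha> - a \<alpha>) * p i d (monomial \<alpha>))"
    by (intro tendsto_intros lim)
  then have "(\<lambda>l. \<Sum>\<alpha>\<in>?W. cmod (f l \<alpha> - a \<alpha>) * p i d (monomial \<alpha>)) \<longlonglongrightarrow> 0"
    by simp
  then have "(\<lambda>l. p i d (b - f l) - p i d (b - a)) \<longlonglongrightarrow> 0"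
    using order_trans[OF pdiff bound] by (elim Lim_null_comparison[rotated]) (simp add: fun_diff_def)
  then show ?thesis
    by (simp add: LIM_zero_iff)
qed

text \<open>The limit is taken coefficientwise. Partial sums of the norms pass to it degree by
  degree, which bounds the full norm as in Fatou's lemma.\<close>

lemma Car_complete:
  fixes f :: "nat \<Rightarrow> free_series"
  assumes f: "\<And>m. f m \<in> Car"
    and cauchy: "\<And>i e. 0 < e \<Longrightarrow> \<exists>M. \<forall>m\<ge>M. \<forall>l\<ge>M. N i (f m - f l) < e"
  shows "\<exists>a\<in>Car. \<forall>i. \<forall>e>0. \<exists>M. \<forall>m\<ge>M. N i (f m - a) < e"
proof -
  have "Cauchy (\<lambda>m. f m \<alpha>)" for \<alpha>
  proof (rule metric_CauchyI)
    fix e :: real assume e: "0 < e"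
    obtain K where K: "K \<ge> 0" "\<And>a. a \<in> Car \<Longrightarrow> cmod (a \<alpha>) \<le> K * N 0 a"
      using N_coeff by blast
    obtain M where M: "\<And>m l. m \<ge> M \<Longrightarrow> l \<ge> M \<Longrightarrow> N 0 (f m - f l) < e / (K + 1)"
      using cauchy[of "e / (K + 1)" 0] e K(1) by auto
    have "dist (f m \<alpha>) (f l \<alpha>) < e" if "m \<ge> M" "l \<ge> M" for m l
    proof -
      have "dist (f m \<alpha>) (f l \<alpha>) \<le> K * N 0 (f m - f l)"
        using K(2)[OF Car_diff[OF f f], of m l] by (simp add: dist_norm)
      also have "\<dots> \<le> K * (e / (K + 1))"
        using M[OF that] K(1) by (intro mult_left_mono) auto
      also have "\<dots> < e"
        using e K(1) by (simp add: field_simps)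
      finally show ?thesis .
    qed
    then show "\<exists>M. \<forall>m\<ge>M. \<forall>l\<ge>M. dist (f m \<alpha>) (f l \<alpha>) < e"
      by blast
  qed
  then have "\<exists>a. \<forall>\<alpha>. (\<lambda>m. f m \<alpha>) \<longlonglongrightarrow> a \<alpha>"
    using Cauchy_convergent convergent_def by (intro choice) blast
  then obtain a where a: "\<And>\<alpha>. (\<lambda>m. f m \<alpha>) \<longlonglongrightarrow> a \<alpha>"
    by blast
  have supp: "a \<alpha> = 0" if "\<alpha> \<notin> words n" for \<alpha>
    using a[of \<alpha>] Car_support[OF f that] by (simp add: LIMSEQ_const_iff)
  have part: "(\<Sum>d<D. p i d (f m - a)) \<le> e" if M: "\<And>m l. m \<ge> M \<Longrightarrow> l \<ge> M \<Longrightarrow> N i (f m - f l) < e" "m \<ge> M" for i e M m D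
  proof (rule tendsto_upperbound)
    show "(\<lambda>l. \<Sum>d<D. p i d (f m - f l)) \<longlonglongrightarrow> (\<Sum>d<D. p i d (f m - a))"
      by (intro tendsto_sum p_limit_le a)
    have "(\<Sum>d<D. p i d (f m - f l)) \<le> N i (f m - f l)" for l
      unfolding N_def by (intro sum_le_suminf Car_summable Car_diff f) (auto simp: p_nonneg)
    then show "\<forall>\<^sub>F l in sequentially. (\<Sum>d<D. p i d (f m - f l)) \<le> e"
      using M by (intro eventually_sequentiallyI[of M]) (meson less_imp_le order_trans)
  qed simp
  have sum: "summable (\<lambda>d. p i d (f m - a))" if M: "\<And>m l. m \<ge> M \<Longrightarrow> l \<ge> M \<Longrightarrow> N i (f m - f l) < e" "m \<ge> M" for i e M m
  proof (rule bounded_imp_summable)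
    show "(\<Sum>d\<le>D. p i d (f m - a)) \<le> e" for D
      using part[OF M, where D = "Suc D"] by (simp add: lessThan_Suc_atMost)
  qed (simp add: p_nonneg)
  have "summable (\<lambda>d. p i d a)" for i
  proof -
    obtain M where M: "\<And>m l. m \<ge> M \<Longrightarrow> l \<ge> M \<Longrightarrow> N i (f m - f l) < 1"
      using cauchy[of 1 i] by auto
    have "norm (p i d a) \<le> p i d (f M) + p i d (f M - a)" for d
      using p_add[of i d "f M" "scale (-1) (f M - a)"] p_scale[of i d "-1" "f M - a"]
      by (simp add: scale_minus_one p_nonneg)
    moreover have "summable (\<lambda>d. p i d (f M - a))"
      by (rule sum[where e = 1, OF M order_refl])
    then have "summable (\<lambda>d. p i d (f M) + p i d (f M - a))"
      by (rule summable_add[OF Car_summable[OF f]])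
    ultimately show ?thesis
      by (rule summable_comparison_test'[where N = 0, rotated])
  qed
  with supp have aC: "a \<in> Car"
    by (simp add: Car_def)
  have "\<exists>M. \<forall>m\<ge>M. N i (f m - a) < e" if e: "0 < e" for i e
  proof -
    obtain M where M: "\<And>m l. m \<ge> M \<Longrightarrow> l \<ge> M \<Longrightarrow> N i (f m - f l) < e / 2"
      using cauchy[of "e / 2" i] e by auto
    have "N i (f m - a) \<le> e / 2" if "m \<ge> M" for m
      unfolding N_def by (rule suminf_le_const) (use sum[OF M that] part[OF M that] in auto)
    with e show ?thesis
      by (intro exI[of _ M]) fastforce
  qed
  with aC show ?thesis
    by blast
qed

text \<open>\<open>series_algebra\<close> builds its topology from the record without the field
  \<open>topol\<close>. This is that record; facts on seminorms are proved for it and carried over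
  to \<open>F\<close>.\<close>

definition VF :: "(complex, free_series) module" where
  "VF = \<lparr>carrier = Car, monoid.mult = conv, one = monomial [], ring.zero = 0, add = (+), smult = scale\<rparr>"

definition F :: "free_series topalg" where
  "F = series_algebra Car (range N)"

lemma VF_simps [simp]:
  "carrier VF = Car" "a \<otimes>\<^bsub>VF\<^esub> b = conv a b" "\<one>\<^bsub>VF\<^esub> = monomial []" "\<zero>\<^bsub>VF\<^esub> = 0" "a \<oplus>\<^bsub>VF\<^esub> b = a + b"
  "c \<odot>\<^bsub>VF\<^esub> a = scale c a"
  by (simp_all add: VF_def)

lemma series_algebra_Car: "series_algebra Car P = module.extend VF \<lparr>topol = seminorm_topology VF P\<rparr>"
proof -
  have "VF = \<lparr>carrier = Car,
          monoid.mult = (\<lambda>a b \<gamma>. \<Sum>k\<le>length \<gamma>. a (take k \<gamma>) * b (drop k \<gamma>)),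
          one = monomial [],
          ring.zero = (\<lambda>\<alpha>. 0),
          add = (\<lambda>a b \<alpha>. a \<alpha> + b \<alpha>),
          smult = (\<lambda>c a \<alpha>. c * a \<alpha>)\<rparr>"
    by (auto simp: VF_def conv_def scale_def fun_eq_iff)
  then show ?thesis
    by (simp add: series_algebra_def Let_def)
qed

lemma F_eq: "F = module.extend VF \<lparr>topol = seminorm_topology VF (range N)\<rparr>"
  by (simp add: F_def series_algebra_Car)

lemma F_simps [simp]:
  "carrier F = Car" "a \<otimes>\<^bsub>F\<^esub> b = conv a b" "\<one>\<^bsub>F\<^esub> = monomial []" "\<zero>\<^bsub>F\<^esub> = 0" "a \<oplus>\<^bsub>F\<^esub> b = a + b"
  "c \<odot>\<^bsub>F\<^esub> a = scale c a" "topol F = seminorm_topology VF (range N)"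
  by (simp_all add: F_eq VF_def module.extend_def)

lemma complex_algebra_VF: "complex_algebra VF"
  by (rule complex_algebraI)
    (simp_all add: Car_zero Car_monomial mem_words Car_add Car_conv Car_scale add_ac scale_minus_one
      conv_assoc conv_add_left conv_add_right scale_add_left scale_add_right conv_scale_left conv_scale_right)

lemma complex_algebra_F: "complex_algebra F"
  by (rule complex_algebra_image[OF complex_algebra_VF, of _ id]) simp_all

lemma VF_minus [simp]: "b \<in> Car \<Longrightarrow> a \<ominus>\<^bsub>VF\<^esub> b = a - b"
  using minus_eq_smult[OF complex_algebraD(2)[OF complex_algebra_VF], of b a] by (simp add: scale_minus_one)

lemma F_minus [simp]: "b \<in> Car \<Longrightarrow> a \<ominus>\<^bsub>F\<^esub> b = a - b"
  using minus_eq_smult[OF complex_algebraD(2)[OF complex_algebra_F], of b a] by (simp add: scale_minus_one)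

sublocale seminorm_sequence VF N
proof (rule seminorm_sequence.intro)
  show "Module.module complex_field VF"
    using complex_algebra_VF by (rule complex_algebraD)
  show "seminorm_on VF (N i)" for i
    by (simp add: seminorm_on_def N_nonneg N_add N_scale)
qed (simp add: N_incr)

lemma N_mono: "a \<in> Car \<Longrightarrow> i \<le> j \<Longrightarrow> N i a \<le> N j a"
  using seminorm_mono by simp

abbreviation TF :: "free_series topology" where
  "TF \<equiv> seminorm_topology VF (range N)"

lemma openin_TF: "openin TF W \<longleftrightarrow> W \<subseteq> Car \<and> (\<forall>a\<in>W. \<exists>i. \<exists>e>0. \<forall>b\<in>Car. N i (b - a) < e \<longrightarrow> b \<in> W)"
proof -
  have "openin TF W \<longleftrightarrow> W \<subseteq> Car \<and> (\<forall>a\<in>W. \<exists>i. \<exists>e>0. \<forall>b\<in>Car. N i (b \<ominus>\<^bsub>VF\<^esub> a) < e \<longrightarrow> b \<in> W)"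
    using openin_iff by simp
  then show ?thesis
    by (auto simp: subset_iff)
qed

lemma openin_TF_ball: "a \<in> Car \<Longrightarrow> openin TF {b \<in> Car. N i (b - a) < e}"
  using openin_ball[of a i e] by simp

lemma limitin_TF: "limitin TF f a G \<longleftrightarrow>
    a \<in> Car \<and> (\<forall>i. \<forall>e>0. \<forall>\<^sub>F x in G. f x \<in> Car \<and> N i (f x - a) < e)"
proof -
  have "limitin TF f a G \<longleftrightarrow> a \<in> Car \<and> (\<forall>i. \<forall>e>0. \<forall>\<^sub>F x in G. f x \<in> Car \<and> N i (f x \<ominus>\<^bsub>VF\<^esub> a) < e)"
    using limitin_iff by simp
  then show ?thesis
    by (auto cong: conj_cong)
qed

section \<open>Quotient norms\<close>

text \<open>The quotient norm of the class of \<open>a\<close> modulo the kernel of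
  \<open>symb q\<close>. It is a function of \<open>q\<close> and of a representative in the fixed
  space \<open>Car\<close>, which gives joint continuity a meaning although the quotients vary with
  \<open>q\<close>.\<close>

definition Q :: "nat \<Rightarrow> complex \<Rightarrow> free_series \<Rightarrow> real" where
  "Q i q a = Inf {N i b | b. b \<in> Car \<and> symb q b = symb q a}"

lemma Q_bdd: "bdd_below {N i b | b. b \<in> Car \<and> symb q b = symb q a}"
  by (rule bdd_belowI[of _ 0]) (auto simp: N_nonneg)

lemma Q_le: "b \<in> Car \<Longrightarrow> symb q b = symb q a \<Longrightarrow> Q i q a \<le> N i b"
  unfolding Q_def by (intro cInf_lower Q_bdd) auto

lemma Q_le_self: "a \<in> Car \<Longrightarrow> Q i q a \<le> N i a"
  by (rule Q_le) simp_all

lemma Q_greatest: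
  "a \<in> Car \<Longrightarrow> (\<And>b. b \<in> Car \<Longrightarrow> symb q b = symb q a \<Longrightarrow> x \<le> N i b) \<Longrightarrow> x \<le> Q i q a"
  unfolding Q_def by (rule cInf_greatest) auto

lemma Q_nonneg: "a \<in> Car \<Longrightarrow> 0 \<le> Q i q a"
  by (rule Q_greatest) (auto simp: N_nonneg)

lemma Q_lessE:
  assumes "Q i q a < e" "a \<in> Car"
  obtains b where "b \<in> Car" "symb q b = symb q a" "N i b < e"
  using Q_greatest[of a q e i] assms by (meson not_le)

lemma Q_cong: "symb q a = symb q b \<Longrightarrow> Q i q a = Q i q b"
  by (simp add: Q_def)

lemma Q_zero [simp]: "Q i q 0 = 0"
  using Q_le_self[OF Car_zero, of i q] Q_nonneg[OF Car_zero, of i q] by (simp add: N_zero)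

lemma Q_add:
  assumes a: "a \<in> Car" and b: "b \<in> Car" shows "Q i q (a + b) \<le> Q i q a + Q i q b"
proof (rule field_le_epsilon)
  fix e :: real assume "0 < e"
  obtain a' where a': "a' \<in> Car" "symb q a' = symb q a" "N i a' < Q i q a + e / 2"
    using Q_lessE[OF _ a, of i q "Q i q a + e / 2"] \<open>0 < e\<close> by auto
  obtain b' where b': "b' \<in> Car" "symb q b' = symb q b" "N i b' < Q i q b + e / 2"
    using Q_lessE[OF _ b, of i q "Q i q b + e / 2"] \<open>0 < e\<close> by auto
  from a' b' have "Q i q (a + b) \<le> N i (a' + b')" "N i (a' + b') \<le> N i a' + N i b'"
    by (auto intro!: Q_le Car_add N_add simp: symb_add)
  with \<open>N i a' < _\<close> \<open>N i b' < _\<close> show "Q i q (a + b) \<le> Q i q a + Q i q b + e"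
    by simp
qed

lemma Q_scale_le:
  assumes a: "a \<in> Car" shows "Q i q (scale c a) \<le> cmod c * Q i q a"
proof (cases "c = 0")
  case False
  have "Q i q (scale c a) / cmod c \<le> Q i q a"
  proof (rule Q_greatest[OF a])
    fix b assume b: "b \<in> Car" "symb q b = symb q a"
    then have "Q i q (scale c a) \<le> N i (scale c b)"
      by (intro Q_le Car_scale) (simp_all add: symb_scale)
    with b False show "Q i q (scale c a) / cmod c \<le> N i b"
      by (simp add: N_scale field_simps)
  qed
  with False show ?thesis
    by (simp add: field_simps)
qed simp

lemma Q_scale:
  assumes a: "a \<in> Car" shows "Q i q (scale c a) = cmod c * Q i q a"
proof (cases "c = 0")
  case False
  have "Q i q a \<le> cmod (1 / c) * Q i q (scale c a)"
    using Q_scale_le[OF Car_scale[OF a], of i q "1 / c" c] False by simp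
  with False Q_scale_le[OF a, of i q c] show ?thesis
    by (simp add: norm_divide field_simps)
qed simp

text \<open>Products of lifts are lifts of the product by \<open>symb_conv\<close>. The infimum is
  taken over one factor at a time, and vanishing factors are separated because of the
  divisions.\<close>

lemma Q_conv:
  assumes a: "a \<in> Car" and b: "b \<in> Car" shows "Q i q (conv a b) \<le> Q i q a * Q i q b"
proof -
  have *: "Q i q (conv a b) \<le> N i a' * N i b'"
    if "a' \<in> Car" "symb q a' = symb q a" "b' \<in> Car" "symb q b' = symb q b" for a' b'
  proof -
    have "Q i q (conv a b) \<le> N i (conv a' b')"
      using that by (intro Q_le Car_conv) (simp_all add: symb_conv)
    with N_conv[of a' b' i] that show ?thesis
      by linarith
  qed
  have **: "Q i q (conv a b) \<le> N i a' * Q i q b" if a': "a' \<in> Car" "symb q a' = symb q a" for a'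
  proof (cases "N i a' = 0")
    case True
    with *[OF a' b refl] show ?thesis by simp
  next
    case False
    then have pos: "0 < N i a'"
      using N_nonneg[OF a'(1), of i] by simp
    have "Q i q (conv a b) / N i a' \<le> Q i q b"
      using *[OF a'] pos by (intro Q_greatest b) (simp add: field_simps)
    with pos show ?thesis
      by (simp add: field_simps)
  qed
  show ?thesis
  proof (cases "Q i q b = 0")
    case True
    with **[OF a refl] show ?thesis by simp
  next
    case False
    then have pos: "0 < Q i q b"
      using Q_nonneg[OF b, of i q] by simp
    have "Q i q (conv a b) / Q i q b \<le> Q i q a"
      using ** pos by (intro Q_greatest a) (simp add: field_simps)
    with pos show ?thesis
      by (simp add: field_simps)
  qed
qed

lemma Q_incr: "a \<in> Car \<Longrightarrow> Q i q a \<le> Q (Suc i) q a"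
  by (rule Q_greatest) (auto intro: order_trans[OF Q_le N_incr])

text \<open>A coefficient of the symbol is a finite linear combination of coefficients of the
  series, and each of these is continuous for any \<open>N i\<close>.\<close>

lemma symb_le_N: "\<exists>K\<ge>0. \<forall>a\<in>Car. cmod (symb q a M) \<le> K * N i a"
proof -
  obtain K where K: "\<And>\<alpha>. K \<alpha> \<ge> 0" "\<And>\<alpha> a. a \<in> Car \<Longrightarrow> cmod (a \<alpha>) \<le> K \<alpha> * N i a"
    using N_coeff[of _ i] by metis
  let ?K = "\<Sum>\<alpha> | mset \<alpha> = M. K \<alpha> * cmod q ^ noninv \<alpha>"
  have "cmod (symb q a M) \<le> ?K * N i a" if "a \<in> Car" for a
  proof -
    have "cmod (symb q a M) \<le> (\<Sum>\<alpha> | mset \<alpha> = M. cmod (a \<alpha>) * cmod q ^ noninv \<alpha>)"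
      unfolding symb_def by (rule order_trans[OF norm_sum]) (simp add: norm_mult norm_power)
    also have "\<dots> \<le> (\<Sum>\<alpha> | mset \<alpha> = M. (K \<alpha> * N i a) * cmod q ^ noninv \<alpha>)"
      by (intro sum_mono mult_right_mono K that) simp
    also have "\<dots> = ?K * N i a"
      by (simp add: sum_distrib_left mult_ac)
    finally show ?thesis .
  qed
  then show ?thesis
    using K(1) by (intro exI[of _ ?K]) (auto intro!: sum_nonneg)
qed

text \<open>All lifts \<open>b\<close> of the class have the same symbol, and
  \<open>cmod (symb q a M) \<le> K * N i b\<close> for each of them. So a single index
  \<open>i\<close> already separates the classes.\<close>

lemma Q_eq_0:
  assumes a: "a \<in> Car" and "Q i q a = 0" shows "symb q a = 0"
proof
  fix M
  obtain K where K: "K \<ge> 0" "\<And>a. a \<in> Car \<Longrightarrow> cmod (symb q a M) \<le> K * N i a"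
    using symb_le_N by blast
  have "cmod (symb q a M) / (K + 1) \<le> Q i q a"
  proof (rule Q_greatest[OF a])
    fix b assume b: "b \<in> Car" "symb q b = symb q a"
    have "cmod (symb q a M) \<le> K * N i b"
      using K(2)[OF b(1)] b(2) by simp
    also have "\<dots> \<le> (K + 1) * N i b"
      using N_nonneg[OF b(1), of i] by (intro mult_right_mono) auto
    finally show "cmod (symb q a M) / (K + 1) \<le> N i b"
      using K(1) by (simp add: field_simps)
  qed
  with assms(2) K(1) show "symb q a M = 0 M"
    by (simp add: field_simps)
qed

text \<open>
  The diagonal map with entries \<open>(q / q') ^ noninv \<alpha>\<close> carries the kernel of the symbol at \<open>q\<close>
  onto the kernel of the symbol at \<open>q'\<close>, and is close to the identity in bounded degree.
\<close>

lemma Q_compare: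
  assumes q: "q' \<noteq> 0" and a: "a \<in> Car" and a': "a' \<in> Car"
    and \<theta>: "\<And>m. m \<le> D * D \<Longrightarrow> cmod (1 - (q / q') ^ m) \<le> \<theta>"
  shows "Q i q' a' \<le> (1 + \<theta>) * Q i q a + \<theta> * N i a + N i (a' - a) + tail i D a'"
proof -
  \<comment> \<open>Beyond degree \<open>D\<close> the entries are replaced by zero: there the
    powers need not be bounded, and the tail of \<open>a'\<close> is carried separately.\<close>
  define t where "t \<alpha> = (if length \<alpha> \<le> D then (q / q') ^ noninv \<alpha> else 0)" for \<alpha>
  have \<theta>0: "0 \<le> \<theta>"
    using \<theta>[of 0] by simp
  have t1: "cmod (1 - t \<alpha>) \<le> \<theta>" if "length \<alpha> \<le> D" for \<alpha>
  proof -
    have "noninv \<alpha> \<le> D * D"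
      using noninv_le[of \<alpha>] mult_mono[OF that that] by simp
    with \<theta> that show ?thesis
      by (simp add: t_def)
  qed
  have t2: "cmod (t \<alpha>) \<le> 1 + \<theta>" for \<alpha>
  proof (cases "length \<alpha> \<le> D")
    case True
    have "cmod (t \<alpha>) = cmod (1 - (1 - t \<alpha>))"
      by simp
    also have "\<dots> \<le> 1 + \<theta>"
      using norm_triangle_ineq4[of 1 "1 - t \<alpha>"] t1[OF True] by simp
    finally show ?thesis .
  qed (use \<theta>0 in \<open>simp add: t_def\<close>)
  \<comment> \<open>\<open>(q / q') ^ m * q' ^ m = q ^ m\<close> for the exponent of each word of
    length at most \<open>D\<close>.\<close>
  have symb_t: "symb q' (\<lambda>\<alpha>. t \<alpha> * c \<alpha>) = symb q (trunc D c)" for c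
    unfolding symb_def t_def trunc_def using q
    by (intro ext sum.cong) (auto simp: power_divide)
  have *: "Q i q' a' - (\<theta> * N i a + N i (a' - a) + tail i D a') \<le> (1 + \<theta>) * N i b"
    if b: "b \<in> Car" "symb q b = symb q a" for b
  proof -
    \<comment> \<open>The competitor for the class of \<open>a'\<close> at \<open>q'\<close> is the
      sum of the tail of \<open>a'\<close>, the low part of \<open>a' - a\<close>, the transported
      lift \<open>b\<close>, and the low part of the defect \<open>(1 - t) a\<close> of the
      transport. It differs from \<open>a'\<close> by the transport of \<open>b - a\<close>, whose
      symbol at \<open>q'\<close> vanishes.\<close>
    let ?x = "a' - trunc D a'" and ?y = "trunc D (a' - a)"
    let ?u = "\<lambda>\<alpha>. t \<alpha> * b \<alpha>" and ?v = "\<lambda>\<alpha>. (if length \<alpha> \<le> D then 1 - t \<alpha> else 0) * a \<alpha>"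
    have u: "?u \<in> Car" "N i ?u \<le> (1 + \<theta>) * N i b"
      using t2 \<theta>0 by (auto intro!: Car_dominated[OF b(1), of "1 + \<theta>"] N_dominated b
          simp: norm_mult mult_right_mono)
    have v: "?v \<in> Car" "N i ?v \<le> \<theta> * N i a"
      using t1 \<theta>0 by (auto intro!: Car_dominated[OF a, of \<theta>] N_dominated a simp: norm_mult mult_right_mono)
    have eq: "?x + ?y + ?u + ?v = a' + (\<lambda>\<alpha>. t \<alpha> * (b - a) \<alpha>)"
      by (auto simp: trunc_def t_def algebra_simps)
    have "symb q (trunc D (b - a)) = 0"
      using b(2) by (simp add: fun_eq_iff symb_trunc symb_diff)
    then have z: "symb q' (\<lambda>\<alpha>. t \<alpha> * (b - a) \<alpha>) = 0"
      using symb_t[of "b - a"] by (rule trans[rotated])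
    have "symb q' (?x + ?y + ?u + ?v) = symb q' a'"
      unfolding eq symb_add z by simp
    moreover have xy: "?x \<in> Car" "?y \<in> Car" "?x + ?y \<in> Car" "?x + ?y + ?u \<in> Car" "?x + ?y + ?u + ?v \<in> Car"
      using a a' u v by (auto intro!: Car_add Car_diff Car_trunc)
    ultimately have "Q i q' a' \<le> N i (?x + ?y + ?u + ?v)"
      by (intro Q_le)
    also have "\<dots> \<le> N i ?x + N i ?y + N i ?u + N i ?v"
      using N_add[OF xy(4) v(1), of i] N_add[OF xy(3) u(1), of i] N_add[OF xy(1,2), of i] by linarith
    also have "\<dots> \<le> tail i D a' + N i (a' - a) + (1 + \<theta>) * N i b + \<theta> * N i a"
      using N_trunc_le[OF Car_diff[OF a' a], of i D] u(2) v(2) by (simp add: tail_def)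
    finally show ?thesis
      by simp
  qed
  have "(Q i q' a' - (\<theta> * N i a + N i (a' - a) + tail i D a')) / (1 + \<theta>) \<le> Q i q a"
    using * \<theta>0 by (intro Q_greatest a) (simp add: field_simps)
  then show ?thesis
    using \<theta>0 by (simp add: field_simps)
qed

text \<open>\<open>Q_compare\<close> is used in both directions between \<open>(q, a)\<close> and
  \<open>(q0, a0)\<close>. The degree \<open>D\<close> must be chosen first, from the tail of
  \<open>a0\<close>; only then are there finitely many exponents \<open>m \<le> D * D\<close> for
  which the powers of \<open>q / q0\<close> and \<open>q0 / q\<close> have to be near
  \<open>1\<close>.\<close>

lemma Q_continuous:
  assumes q0: "q0 \<noteq> 0" and a0: "a0 \<in> Car" and e: "0 < e"
  shows "\<exists>\<delta>>0. \<exists>\<eta>>0. \<forall>q a. q \<noteq> 0 \<longrightarrow> dist q q0 < \<delta> \<longrightarrow> a \<in> Car \<longrightarrow> N i (a - a0) < \<eta> \<longrightarrow>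
    \<bar>Q i q a - Q i q0 a0\<bar> < e"
proof -
  obtain D where D: "tail i D a0 < e / 4"
    using tail_small[OF a0, of "e / 4" i] e by auto
  \<comment> \<open>\<open>L\<close> bounds the norms of all series within distance
    \<open>\<eta> \<le> 1\<close> of \<open>a0\<close>. With these constants the errors add up to at
    most \<open>10 / 16\<close> of \<open>e\<close> in the worse direction.\<close>
  define L where "L = N i a0 + 1"
  define \<eta> where "\<eta> = min 1 (e / 16)"
  define \<theta> where "\<theta> = e / (8 * L)"
  have L: "0 < L" "L \<ge> 1"
    using N_nonneg[OF a0, of i] by (simp_all add: L_def)
  have \<theta>: "0 < \<theta>" and \<theta>L: "\<theta> * L = e / 8"
    using e L by (simp_all add: \<theta>_def)
  have \<eta>: "0 < \<eta>" "\<eta> \<le> 1" "\<eta> \<le> e / 16"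
    using e by (auto simp: \<eta>_def)
  have "\<forall>\<^sub>F q in nhds q0. cmod (1 - (q / q0) ^ m) < \<theta>" for m
  proof -
    have "((\<lambda>q. cmod (1 - (q / q0) ^ m)) \<longlongrightarrow> cmod (1 - (q0 / q0) ^ m)) (nhds q0)"
      using q0 by (intro tendsto_intros) (auto simp: tendsto_def eventually_nhds)
    then show ?thesis
      using \<theta> q0 by (auto dest!: order_tendstoD(2)[where a = \<theta>])
  qed
  moreover have "\<forall>\<^sub>F q in nhds q0. cmod (1 - (q0 / q) ^ m) < \<theta>" for m
  proof -
    have "((\<lambda>q. cmod (1 - (q0 / q) ^ m)) \<longlongrightarrow> cmod (1 - (q0 / q0) ^ m)) (nhds q0)"
      using q0 by (intro tendsto_intros) (auto simp: tendsto_def eventually_nhds)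
    then show ?thesis
      using \<theta> q0 by (auto dest!: order_tendstoD(2)[where a = \<theta>])
  qed
  ultimately have "\<forall>\<^sub>F q in nhds q0. \<forall>m\<in>{..D * D}. cmod (1 - (q / q0) ^ m) < \<theta> \<and> cmod (1 - (q0 / q) ^ m) < \<theta>"
    by (intro eventually_ball_finite) (auto intro: eventually_conj)
  then obtain \<delta> where \<delta>: "\<delta> > 0"
    and near: "\<And>q m. dist q q0 < \<delta> \<Longrightarrow> m \<le> D * D \<Longrightarrow> cmod (1 - (q / q0) ^ m) < \<theta> \<and> cmod (1 - (q0 / q) ^ m) < \<theta>"
    unfolding eventually_nhds_metric by auto
  have "\<bar>Q i q a - Q i q0 a0\<bar> < e"
    if q: "q \<noteq> 0" "dist q q0 < \<delta>" and a: "a \<in> Car" "N i (a - a0) < \<eta>" for q a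
  proof -
    have Na: "N i a \<le> L"
      using N_add[OF Car_diff[OF a(1) a0] a0, of i] a(2) \<eta>(2) by (simp add: L_def)
    have Na0: "N i a0 \<le> L"
      by (simp add: L_def)
    have small: "\<theta> * x \<le> e / 8" if "x \<le> L" for x
      using mult_left_mono[OF that, of \<theta>] \<theta> \<theta>L by simp
    have "Q i q0 a0 \<le> (1 + \<theta>) * Q i q a + \<theta> * N i a + N i (a0 - a) + tail i D a0"
      by (rule Q_compare[OF q0 a(1) a0]) (use near[OF q(2)] in \<open>auto intro: less_imp_le\<close>)
    then have 1: "Q i q0 a0 - Q i q a < e"
      using small[OF Na] small[of "Q i q a"] Q_le_self[OF a(1), of i q] Na a(2) \<eta> D
        N_minus_commute[OF a(1) a0, of i]
      by (simp add: algebra_simps)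
    have "Q i q a \<le> (1 + \<theta>) * Q i q0 a0 + \<theta> * N i a0 + N i (a - a0) + tail i D a"
      by (rule Q_compare[OF q(1) a0 a(1)]) (use near[OF q(2)] in \<open>auto intro: less_imp_le\<close>)
    then have 2: "Q i q a - Q i q0 a0 < e"
      using small[OF Na0] small[of "Q i q0 a0"] Q_le_self[OF a0, of i q0] Na0 a(2) \<eta> D
        tail_perturb[OF a(1) a0, of i D]
      by (simp add: algebra_simps)
    from 1 2 show ?thesis
      by simp
  qed
  with \<delta> \<eta>(1) show ?thesis
    by blast
qed

section \<open>Holomorphic functions with values in a graded algebra\<close>

abbreviation H :: "(complex \<Rightarrow> free_series) oalg" where
  "H \<equiv> hol_oalg F"

abbreviation HC :: "(complex \<Rightarrow> free_series) set" where
  "HC \<equiv> hol_carrier F"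

abbreviation TH :: "(complex \<Rightarrow> free_series) topology" where
  "TH \<equiv> topol H"

definition hmul :: "(complex \<Rightarrow> free_series) \<Rightarrow> (complex \<Rightarrow> free_series) \<Rightarrow> complex \<Rightarrow> free_series" where
  "hmul f g = (\<lambda>z. conv (f z) (g z))"

text \<open>Elementary tensors of a scalar function and a series. The value at \<open>0\<close>
  follows the normalization of \<open>hol_carrier\<close>.\<close>

definition hmon :: "(complex \<Rightarrow> complex) \<Rightarrow> free_series \<Rightarrow> complex \<Rightarrow> free_series" where
  "hmon \<phi> a = (\<lambda>z. if z = 0 then 0 else scale (\<phi> z) a)"

lemma limitin_TF_iff:
  assumes "\<And>x. f x \<in> Car" "a \<in> Car"
  shows "limitin TF f a G \<longleftrightarrow> (\<forall>i. ((\<lambda>x. N i (f x - a)) \<longlongrightarrow> 0) G)"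
proof -
  have "\<bar>N i (f x - a)\<bar> = N i (f x - a)" for i x
    using assms by (simp add: N_nonneg Car_diff)
  then show ?thesis
    using assms by (simp add: limitin_TF tendsto_iff)
qed

text \<open>Unfolds the limit in \<open>TF\<close> into one limit for each norm. Membership in
  \<open>Car\<close> is settled first, since the subtraction of the record is rewritten to the
  pointwise one only there.\<close>

lemma HC_iff: "f \<in> HC \<longleftrightarrow> f 0 = 0 \<and> (\<forall>z. f z \<in> Car) \<and>
   (\<forall>z. z \<noteq> 0 \<longrightarrow> (\<exists>D\<in>Car. \<forall>i. ((\<lambda>w. N i (scale (1 / (w - z)) (f w - f z) - D)) \<longlongrightarrow> 0) (at z)))"
  (is "_ \<longleftrightarrow> ?R")
proof -
  have car: "(\<forall>z\<in>punctured_plane. f z \<in> Car) \<longleftrightarrow> (\<forall>z. f z \<in> Car)" if "f 0 = 0"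
    using that Car_zero by (metis ComplI singletonD)
  have lim: "(\<exists>D. limitin TF (\<lambda>w. scale (1 / (w - z)) (f w \<ominus>\<^bsub>F\<^esub> f z)) D (at z)) \<longleftrightarrow>
      (\<exists>D\<in>Car. \<forall>i. ((\<lambda>w. N i (scale (1 / (w - z)) (f w - f z) - D)) \<longlongrightarrow> 0) (at z))"
    if c: "\<forall>z. f z \<in> Car" for z
  proof -
    have "limitin TF (\<lambda>w. scale (1 / (w - z)) (f w - f z)) D (at z) \<longleftrightarrow>
        D \<in> Car \<and> (\<forall>i. ((\<lambda>w. N i (scale (1 / (w - z)) (f w - f z) - D)) \<longlongrightarrow> 0) (at z))" for D
    proof (cases "D \<in> Car")
      case True
      then show ?thesis
        using c by (simp add: limitin_TF_iff Car_scale Car_diff)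
    next
      case False
      then show ?thesis
        by (auto dest: limitin_topspace)
    qed
    then show ?thesis
      using c by auto
  qed
  show ?thesis
    unfolding hol_carrier_def holomorphic_into_def mem_Collect_eq F_simps
  proof (cases "f 0 = 0 \<and> (\<forall>z. f z \<in> Car)")
    case True
    then show "((\<forall>z\<in>punctured_plane. f z \<in> Car) \<and> (\<forall>z\<in>punctured_plane. \<exists>D.
        limitin TF (\<lambda>w. scale (1 / (w - z)) (f w \<ominus>\<^bsub>F\<^esub> f z)) D (at z))) \<and> f 0 = 0 \<longleftrightarrow> ?R"
      using lim by (simp only: simp_thms ball_simps Ball_def Compl_iff singleton_iff)
  next
    case False
    then show "((\<forall>z\<in>punctured_plane. f z \<in> Car) \<and> (\<forall>z\<in>punctured_plane. \<exists>D.
        limitin TF (\<lambda>w. scale (1 / (w - z)) (f w \<ominus>\<^bsub>F\<^esub> f z)) D (at z))) \<and> f 0 = 0 \<longleftrightarrow> ?R"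
      using car by blast
  qed
qed

lemma HC_Car: "f \<in> HC \<Longrightarrow> f z \<in> Car"
  and HC_zero_at_0: "f \<in> HC \<Longrightarrow> f 0 = 0"
  by (simp_all add: HC_iff)

lemma HC_derivative:
  assumes "f \<in> HC" "z \<noteq> 0"
  obtains D where "D \<in> Car" "\<And>i. ((\<lambda>w. N i (scale (1 / (w - z)) (f w - f z) - D)) \<longlongrightarrow> 0) (at z)"
  using assms by (auto simp: HC_iff)

lemma HC_tendsto:
  assumes f: "f \<in> HC" and z: "z \<noteq> 0"
  shows "((\<lambda>w. N i (f w - f z)) \<longlongrightarrow> 0) (at z)"
proof -
  obtain D where D: "D \<in> Car" "\<And>i. ((\<lambda>w. N i (scale (1 / (w - z)) (f w - f z) - D)) \<longlongrightarrow> 0) (at z)"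
    using HC_derivative[OF f z] by blast
  have bound: "norm (N i (f w - f z)) \<le> cmod (w - z) * (N i (scale (1 / (w - z)) (f w - f z) - D) + N i D)"
    if "w \<noteq> z" for w
  proof -
    let ?d = "scale (1 / (w - z)) (f w - f z)"
    have c: "f w - f z \<in> Car" "?d \<in> Car"
      using f by (simp_all add: HC_Car Car_diff Car_scale)
    have "N i (f w - f z) = cmod (w - z) * N i ?d"
      using that c by (simp add: N_scale norm_divide)
    also have "\<dots> \<le> cmod (w - z) * (N i (?d - D) + N i D)"
      using N_add[OF Car_diff[OF c(2) D(1)] D(1), of i] by (intro mult_left_mono) auto
    finally show ?thesis
      using c by (simp add: N_nonneg)
  qed
  have "((\<lambda>w. cmod (w - z) * (N i (scale (1 / (w - z)) (f w - f z) - D) + N i D)) \<longlongrightarrow> cmod (z - z) * (0 + N i D)) (at z)"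
    by (intro tendsto_intros D)
  then have "((\<lambda>w. cmod (w - z) * (N i (scale (1 / (w - z)) (f w - f z) - D) + N i D)) \<longlongrightarrow> 0) (at z)"
    by simp
  moreover have "\<forall>\<^sub>F w in at z. norm (N i (f w - f z)) \<le> cmod (w - z) * (N i (scale (1 / (w - z)) (f w - f z) - D) + N i D)"
    unfolding eventually_at by (intro exI[of _ 1] conjI ballI impI bound) simp_all
  ultimately show ?thesis
    by (rule Lim_null_comparison[rotated])
qed

lemma HC_near:
  assumes f: "f \<in> HC" and z: "z \<noteq> 0" and e: "0 < e"
  shows "\<exists>\<delta>>0. \<forall>w. dist w z < \<delta> \<longrightarrow> N i (f w - f z) < e"
proof -
  have "\<forall>\<^sub>F w in at z. N i (f w - f z) < e"
    using HC_tendsto[OF f z] e by (rule order_tendstoD)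
  then obtain \<delta> where \<delta>: "\<delta> > 0" "\<And>w. w \<noteq> z \<Longrightarrow> dist w z < \<delta> \<Longrightarrow> N i (f w - f z) < e"
    unfolding eventually_at by auto
  have "N i (f w - f z) < e" if "dist w z < \<delta>" for w
    using \<delta>(2)[OF _ that] e by (cases "w = z") (auto simp: N_zero)
  with \<delta>(1) show ?thesis
    by blast
qed

lemma HC_add:
  assumes f: "f \<in> HC" and g: "g \<in> HC" shows "f + g \<in> HC"
proof -
  have "\<exists>D\<in>Car. \<forall>i. ((\<lambda>w. N i (scale (1 / (w - z)) ((f + g) w - (f + g) z) - D)) \<longlongrightarrow> 0) (at z)"
    if z: "z \<noteq> 0" for z
  proof -
    obtain D where D: "D \<in> Car" "\<And>i. ((\<lambda>w. N i (scale (1 / (w - z)) (f w - f z) - D)) \<longlongrightarrow> 0) (at z)"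
      using HC_derivative[OF f z] by blast
    obtain E where E: "E \<in> Car" "\<And>i. ((\<lambda>w. N i (scale (1 / (w - z)) (g w - g z) - E)) \<longlongrightarrow> 0) (at z)"
      using HC_derivative[OF g z] by blast
    have "((\<lambda>w. N i (scale (1 / (w - z)) ((f + g) w - (f + g) z) - (D + E))) \<longlongrightarrow> 0) (at z)" for i
    proof (rule Lim_null_comparison)
      have "N i (scale (1 / (w - z)) ((f + g) w - (f + g) z) - (D + E))
          \<le> N i (scale (1 / (w - z)) (f w - f z) - D) + N i (scale (1 / (w - z)) (g w - g z) - E)"
        and "0 \<le> N i (scale (1 / (w - z)) ((f + g) w - (f + g) z) - (D + E))" for w
      proof -
        have eq: "scale (1 / (w - z)) ((f + g) w - (f + g) z) - (D + E)
            = (scale (1 / (w - z)) (f w - f z) - D) + (scale (1 / (w - z)) (g w - g z) - E)"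
          by (auto simp: fun_eq_iff algebra_simps)
        have c: "scale (1 / (w - z)) (f w - f z) - D \<in> Car" "scale (1 / (w - z)) (g w - g z) - E \<in> Car"
          using f g D E by (simp_all add: HC_Car Car_diff Car_scale)
        show "N i (scale (1 / (w - z)) ((f + g) w - (f + g) z) - (D + E))
            \<le> N i (scale (1 / (w - z)) (f w - f z) - D) + N i (scale (1 / (w - z)) (g w - g z) - E)"
          unfolding eq by (rule N_add[OF c])
        show "0 \<le> N i (scale (1 / (w - z)) ((f + g) w - (f + g) z) - (D + E))"
          unfolding eq by (rule N_nonneg[OF Car_add[OF c]])
      qed
      then show "\<forall>\<^sub>F w in at z. norm (N i (scale (1 / (w - z)) ((f + g) w - (f + g) z) - (D + E)))
          \<le> N i (scale (1 / (w - z)) (f w - f z) - D) + N i (scale (1 / (w - z)) (g w - g z) - E)"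
        by (intro always_eventually allI) (simp only: real_norm_def abs_of_nonneg)
      show "((\<lambda>w. N i (scale (1 / (w - z)) (f w - f z) - D) + N i (scale (1 / (w - z)) (g w - g z) - E)) \<longlongrightarrow> 0) (at z)"
        using tendsto_add[OF D(2) E(2)] by simp
    qed
    then show ?thesis
      using Car_add[OF D(1) E(1)] by blast
  qed
  moreover have "(f + g) 0 = 0"
    using HC_zero_at_0[OF f] HC_zero_at_0[OF g] by (simp only: plus_fun_apply add_0_left)
  moreover have "(f + g) z \<in> Car" for z
    unfolding plus_fun_apply[of f g z] by (rule Car_add[OF HC_Car[OF f] HC_Car[OF g]])
  ultimately show ?thesis
    unfolding HC_iff by blast
qed

text \<open>The product rule with the usual three error terms; continuity of \<open>g\<close>
  handles the factor that is still evaluated at \<open>w\<close>.\<close>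

lemma HC_hmul:
  assumes f: "f \<in> HC" and g: "g \<in> HC" shows "hmul f g \<in> HC"
proof -
  have "\<exists>D\<in>Car. \<forall>i. ((\<lambda>w. N i (scale (1 / (w - z)) (hmul f g w - hmul f g z) - D)) \<longlongrightarrow> 0) (at z)"
    if z: "z \<noteq> 0" for z
  proof -
    obtain D where D: "D \<in> Car" "\<And>i. ((\<lambda>w. N i (scale (1 / (w - z)) (f w - f z) - D)) \<longlongrightarrow> 0) (at z)"
      using HC_derivative[OF f z] by blast
    obtain E where E: "E \<in> Car" "\<And>i. ((\<lambda>w. N i (scale (1 / (w - z)) (g w - g z) - E)) \<longlongrightarrow> 0) (at z)"
      using HC_derivative[OF g z] by blast
    let ?G = "conv D (g z) + conv (f z) E"
    have "((\<lambda>w. N i (scale (1 / (w - z)) (hmul f g w - hmul f g z) - ?G)) \<longlongrightarrow> 0) (at z)" for i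
    proof (rule Lim_null_comparison)
      let ?a = "\<lambda>w. scale (1 / (w - z)) (f w - f z) - D"
      let ?b = "\<lambda>w. scale (1 / (w - z)) (g w - g z) - E"
      let ?c = "\<lambda>w. g w - g z"
      let ?B = "\<lambda>w. N i (?a w) * (N i (?c w) + N i (g z)) + N i D * N i (?c w) + N i (f z) * N i (?b w)"
      have "norm (N i (scale (1 / (w - z)) (hmul f g w - hmul f g z) - ?G)) \<le> ?B w" for w
      proof -
        have "hmul f g w - hmul f g z = conv (f w - f z) (g w) + conv (f z) (g w - g z)"
          by (simp add: hmul_def conv_diff_left conv_diff_right)
        then have "scale (1 / (w - z)) (hmul f g w - hmul f g z)
            = conv (scale (1 / (w - z)) (f w - f z)) (g w) + conv (f z) (scale (1 / (w - z)) (g w - g z))"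
          by (simp only: scale_add_right conv_scale_left conv_scale_right)
        then have eq: "scale (1 / (w - z)) (hmul f g w - hmul f g z) - ?G
            = (conv (?a w) (g w) + conv D (?c w)) + conv (f z) (?b w)"
          by (simp only: conv_diff_left conv_diff_right algebra_simps)
        have c: "?a w \<in> Car" "?b w \<in> Car" "?c w \<in> Car" "g w \<in> Car" "g z \<in> Car" "f z \<in> Car"
          using f g D E by (simp_all add: HC_Car Car_diff Car_scale)
        note cc = Car_conv[OF c(1) c(4)] Car_conv[OF D(1) c(3)] Car_conv[OF c(6) c(2)]
        have "N i (g w) \<le> N i (?c w) + N i (g z)"
          using N_add[OF c(3) c(5), of i] by simp
        then have "N i (conv (?a w) (g w)) \<le> N i (?a w) * (N i (?c w) + N i (g z))"
          using N_conv[OF c(1) c(4), of i] mult_left_mono[OF _ N_nonneg[OF c(1)]] order_trans by blast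
        moreover have "N i ((conv (?a w) (g w) + conv D (?c w)) + conv (f z) (?b w))
            \<le> N i (conv (?a w) (g w)) + N i (conv D (?c w)) + N i (conv (f z) (?b w))"
          using N_add[OF cc(1,2), of i] N_add[OF Car_add[OF cc(1,2)] cc(3), of i] by linarith
        moreover have "0 \<le> N i ((conv (?a w) (g w) + conv D (?c w)) + conv (f z) (?b w))"
          by (intro N_nonneg Car_add cc)
        ultimately show ?thesis
          unfolding eq using N_conv[OF D(1) c(3), of i] N_conv[OF c(6) c(2), of i]
          by (simp only: real_norm_def abs_of_nonneg) (linarith?)
      qed
      then show "\<forall>\<^sub>F w in at z. norm (N i (scale (1 / (w - z)) (hmul f g w - hmul f g z) - ?G)) \<le> ?B w"
        by (intro always_eventually allI)
      have "(?B \<longlongrightarrow> 0 * (0 + N i (g z)) + N i D * 0 + N i (f z) * 0) (at z)"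
        by (intro tendsto_intros D E HC_tendsto[OF g z])
      then show "(?B \<longlongrightarrow> 0) (at z)"
        by simp
    qed
    moreover have "?G \<in> Car"
      using f g D E by (intro Car_add Car_conv) (simp_all add: HC_Car)
    ultimately show ?thesis
      by blast
  qed
  moreover have "hmul f g 0 = 0"
    unfolding hmul_def HC_zero_at_0[OF f] by (rule conv_zero_left)
  moreover have "hmul f g z \<in> Car" for z
    unfolding hmul_def by (rule Car_conv[OF HC_Car[OF f] HC_Car[OF g]])
  ultimately show ?thesis
    unfolding HC_iff by blast
qed

lemma HC_hmon:
  assumes \<phi>: "\<phi> holomorphic_on punctured_plane" and a: "a \<in> Car"
  shows "hmon \<phi> a \<in> HC"
proof -
  have "\<exists>D\<in>Car. \<forall>i. ((\<lambda>w. N i (scale (1 / (w - z)) (hmon \<phi> a w - hmon \<phi> a z) - D)) \<longlongrightarrow> 0) (at z)"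
    if z: "z \<noteq> 0" for z
  proof -
    have "\<phi> field_differentiable at z"
      using \<phi> z by (intro holomorphic_on_imp_differentiable_at[OF \<phi>]) auto
    then obtain d where "(\<phi> has_field_derivative d) (at z)"
      by (auto simp: field_differentiable_def)
    then have d: "((\<lambda>w. (\<phi> w - \<phi> z) / (w - z)) \<longlongrightarrow> d) (at z)"
      by (simp add: has_field_derivative_iff)
    \<comment> \<open>Near \<open>z\<close> the exceptional value of \<open>hmon\<close> at
      \<open>0\<close> is not met.\<close>
    have ev: "\<forall>\<^sub>F w in at z. w \<noteq> 0"
      using z by (intro eventually_at_in_open'[of "- {0}" z, simplified]) auto
    have "((\<lambda>w. N i (scale (1 / (w - z)) (hmon \<phi> a w - hmon \<phi> a z) - scale d a)) \<longlongrightarrow> 0) (at z)" for i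
    proof (rule Lim_transform_eventually)
      have "((\<lambda>w. cmod ((\<phi> w - \<phi> z) / (w - z) - d) * N i a) \<longlongrightarrow> cmod (d - d) * N i a) (at z)"
        by (intro tendsto_intros d)
      then show "((\<lambda>w. cmod ((\<phi> w - \<phi> z) / (w - z) - d) * N i a) \<longlongrightarrow> 0) (at z)"
        by simp
      show "\<forall>\<^sub>F w in at z. cmod ((\<phi> w - \<phi> z) / (w - z) - d) * N i a
          = N i (scale (1 / (w - z)) (hmon \<phi> a w - hmon \<phi> a z) - scale d a)"
        using ev
      proof eventually_elim
        case (elim w)
        have "scale (1 / (w - z)) (hmon \<phi> a w - hmon \<phi> a z) - scale d a = scale ((\<phi> w - \<phi> z) / (w - z) - d) a"
          using elim z by (auto simp: hmon_def fun_eq_iff diff_divide_distrib algebra_simps)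
        then show ?case
          by (simp only: N_scale[OF a])
      qed
    qed
    then show ?thesis
      using Car_scale[OF a] by blast
  qed
  moreover have "hmon \<phi> a 0 = 0"
    by (simp add: hmon_def)
  moreover have "hmon \<phi> a z \<in> Car" for z
    using a by (cases "z = 0") (simp_all add: hmon_def Car_scale Car_zero)
  ultimately show ?thesis
    unfolding HC_iff by blast
qed

lemma HC_zero: "0 \<in> HC"
proof -
  have "hmon (\<lambda>_. 0) 0 = 0"
    by (auto simp: hmon_def)
  then show ?thesis
    using HC_hmon[of "\<lambda>_. 0" 0] Car_zero by simp
qed

lemma HC_sum: "(\<And>x. x \<in> S \<Longrightarrow> f x \<in> HC) \<Longrightarrow> (\<Sum>x\<in>S. f x) \<in> HC"
  by (induction S rule: infinite_finite_induct) (auto simp: HC_zero HC_add)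

lemma H_simps [simp]:
  "carrier H = HC" "\<zero>\<^bsub>H\<^esub> = 0" "f \<oplus>\<^bsub>H\<^esub> g = f + g" "f \<otimes>\<^bsub>H\<^esub> g = hmul f g"
  "\<one>\<^bsub>H\<^esub> = hmon (\<lambda>_. 1) (monomial [])"
  by (auto simp: hol_oalg_def hmul_def hmon_def hol_const_def fun_eq_iff)

text \<open>Functions act as their multiples of the unit, so closure of \<open>HC\<close> under the
  action reduces to \<open>HC_hmul\<close>; likewise for complex scalars.\<close>

lemma H_act: "f \<in> HC \<Longrightarrow> act H \<phi> f = hmul (hmon \<phi> (monomial [])) f"
  by (auto simp: hol_oalg_def hmul_def hmon_def fun_eq_iff conv_scale_left)

lemma H_smult: "f \<in> HC \<Longrightarrow> c \<odot>\<^bsub>H\<^esub> f = hmul (hmon (\<lambda>_. c) (monomial [])) f"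
  by (auto simp: hol_oalg_def hmul_def hmon_def fun_eq_iff conv_scale_left HC_zero_at_0)

lemma hmul_hmon: "z \<noteq> 0 \<Longrightarrow> hmul (hmon \<phi> (monomial [])) f z = scale (\<phi> z) (f z)"
  by (simp add: hmul_def hmon_def conv_scale_left)

lemma hmul_hmon_hmon: "hmul (hmon \<phi> a) (hmon \<psi> b) = hmon (\<lambda>z. \<phi> z * \<psi> z) (conv a b)"
  by (auto simp: hmul_def hmon_def fun_eq_iff conv_scale_left conv_scale_right)

lemma hol_const_eq: "hol_const F a = hmon (\<lambda>_. 1) a"
  by (auto simp: hol_const_def hmon_def)

lemma monomial_Nil_Car: "monomial [] \<in> Car"
  by (simp add: Car_monomial mem_words)

lemma HC_act: "\<phi> holomorphic_on punctured_plane \<Longrightarrow> f \<in> HC \<Longrightarrow> act H \<phi> f \<in> HC"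
  by (simp add: H_act HC_hmul HC_hmon monomial_Nil_Car)

lemma hmul_apply: "hmul f g z = conv (f z) (g z)"
  by (simp add: hmul_def)

lemma complex_algebra_H: "complex_algebra H"
proof (rule complex_algebraI, unfold H_simps)
  show "hmon (\<lambda>_. 1) (monomial []) \<in> HC"
    by (simp add: HC_hmon monomial_Nil_Car)
  have eqI: "f = g" if "f 0 = g 0" "\<And>z. z \<noteq> 0 \<Longrightarrow> f z = g z" for f g :: "complex \<Rightarrow> free_series"
    using that by (metis ext)
  fix f g assume f: "f \<in> HC" and g: "g \<in> HC"
  show "f + g \<in> HC" "hmul f g \<in> HC"
    using f g by (simp_all add: HC_add HC_hmul)
  note 0 = HC_zero_at_0[OF f] HC_zero_at_0[OF g]
  have sm: "c \<odot>\<^bsub>H\<^esub> f = (\<lambda>z. scale c (f z))" for c and f :: "complex \<Rightarrow> free_series"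
    by (auto simp: hol_oalg_def)
  show "c \<odot>\<^bsub>H\<^esub> f \<in> HC" for c
    using H_smult[OF f] by (simp add: HC_hmul HC_hmon f monomial_Nil_Car)
  show "(-1) \<odot>\<^bsub>H\<^esub> f + f = 0"
    by (auto simp: sm fun_eq_iff)
  show "hmul (hmon (\<lambda>_. 1) (monomial [])) f = f" "hmul f (hmon (\<lambda>_. 1) (monomial [])) = f"
    by (rule eqI; simp add: hmul_def hmon_def 0)+
  show "(c + d) \<odot>\<^bsub>H\<^esub> f = c \<odot>\<^bsub>H\<^esub> f + d \<odot>\<^bsub>H\<^esub> f" "(c * d) \<odot>\<^bsub>H\<^esub> f = c \<odot>\<^bsub>H\<^esub> (d \<odot>\<^bsub>H\<^esub> f)"
    "1 \<odot>\<^bsub>H\<^esub> f = f" "c \<odot>\<^bsub>H\<^esub> (f + g) = c \<odot>\<^bsub>H\<^esub> f + c \<odot>\<^bsub>H\<^esub> g" for c d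
    by (auto simp: sm fun_eq_iff algebra_simps)
  show "c \<odot>\<^bsub>H\<^esub> (hmul f g) = hmul (c \<odot>\<^bsub>H\<^esub> f) g" "c \<odot>\<^bsub>H\<^esub> (hmul f g) = hmul f (c \<odot>\<^bsub>H\<^esub> g)" for c
    by (auto simp: sm hmul_def conv_scale_left conv_scale_right)
  fix h assume h: "h \<in> HC"
  show "hmul (hmul f g) h = hmul f (hmul g h)" "hmul (f + g) h = hmul f h + hmul g h"
    "hmul h (f + g) = hmul h f + hmul h g"
    by (auto simp: hmul_def conv_assoc conv_add_left conv_add_right)
qed (auto simp: HC_zero add_ac)

lemma H_smult_apply: "(c \<odot>\<^bsub>H\<^esub> f) z = scale c (f z)"
  by (auto simp: hol_oalg_def)

lemma H_minus: "g \<in> HC \<Longrightarrow> f \<ominus>\<^bsub>H\<^esub> g = f - g"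
  using minus_eq_smult[OF complex_algebraD(2)[OF complex_algebra_H], of g f]
  by (auto simp: fun_eq_iff H_smult_apply)

lemma HC_diff: "f \<in> HC \<Longrightarrow> g \<in> HC \<Longrightarrow> f - g \<in> HC"
  using complex_algebraD(3)[OF complex_algebra_H, of g "-1"] HC_add[of f "(-1) \<odot>\<^bsub>H\<^esub> g"]
  by (simp add: H_smult_apply scale_minus_one plus_fun_def fun_diff_def)

text \<open>Coefficients are continuous functionals, so differentiability passes to them. This
  supplies the scalar functions in the normal forms below.\<close>

lemma HC_coeff_holomorphic:
  assumes f: "f \<in> HC" shows "(\<lambda>z. f z \<alpha>) holomorphic_on punctured_plane"
proof -
  have "(\<lambda>z. f z \<alpha>) field_differentiable at z" if z: "z \<noteq> 0" for z
  proof -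
    obtain D where D: "D \<in> Car" "\<And>i. ((\<lambda>w. N i (scale (1 / (w - z)) (f w - f z) - D)) \<longlongrightarrow> 0) (at z)"
      using HC_derivative[OF f z] by blast
    obtain K where K: "K \<ge> 0" "\<And>a. a \<in> Car \<Longrightarrow> cmod (a \<alpha>) \<le> K * N 0 a"
      using N_coeff by blast
    have "((\<lambda>w. (f w \<alpha> - f z \<alpha>) / (w - z) - D \<alpha>) \<longlongrightarrow> 0) (at z)"
    proof (rule Lim_null_comparison)
      have "cmod ((f w \<alpha> - f z \<alpha>) / (w - z) - D \<alpha>) \<le> K * N 0 (scale (1 / (w - z)) (f w - f z) - D)" for w
        using K(2)[of "scale (1 / (w - z)) (f w - f z) - D"] f D(1) by (simp add: HC_Car Car_diff Car_scale)
      then show "\<forall>\<^sub>F w in at z. cmod ((f w \<alpha> - f z \<alpha>) / (w - z) - D \<alpha>) \<le> K * N 0 (scale (1 / (w - z)) (f w - f z) - D)"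
        by (intro always_eventually allI)
      show "((\<lambda>w. K * N 0 (scale (1 / (w - z)) (f w - f z) - D)) \<longlongrightarrow> 0) (at z)"
        using tendsto_mult_left[OF D(2), of K 0] by simp
    qed
    then have "((\<lambda>z. f z \<alpha>) has_field_derivative D \<alpha>) (at z)"
      by (simp add: has_field_derivative_iff LIM_zero_iff)
    then show ?thesis
      by (auto simp: field_differentiable_def)
  qed
  then show ?thesis
    by (auto simp: holomorphic_on_def intro: field_differentiable_at_within)
qed

lemma HC_symb_holomorphic:
  assumes f: "f \<in> HC" shows "(\<lambda>z. symb z (f z) M) holomorphic_on punctured_plane"
  unfolding symb_def by (intro holomorphic_intros HC_coeff_holomorphic f)

definition htrunc :: "nat \<Rightarrow> (complex \<Rightarrow> free_series) \<Rightarrow> complex \<Rightarrow> free_series" where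
  "htrunc D f = (\<lambda>z. trunc D (f z))"

definition short_words :: "nat \<Rightarrow> nat list set" where
  "short_words D = {\<alpha> \<in> words n. length \<alpha> \<le> D}"

lemma finite_short_words: "finite (short_words D)"
  unfolding short_words_def mem_words by (rule finite_lists_length_le) simp

text \<open>There are finitely many words of length at most \<open>D\<close>. The relations can be
  applied to such a finite sum word by word, while the holomorphic coefficients pass through as
  scalars.\<close>

lemma htrunc_eq_sum:
  assumes f: "f \<in> HC"
  shows "htrunc D f = (\<Sum>\<alpha>\<in>short_words D. hmon (\<lambda>z. f z \<alpha>) (monomial \<alpha>))"
proof (rule ext, rule ext)
  fix z \<beta>
  have "(\<Sum>\<alpha>\<in>short_words D. hmon (\<lambda>z. f z \<alpha>) (monomial \<alpha>)) z \<beta>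
      = (\<Sum>\<alpha>\<in>short_words D. if \<beta> = \<alpha> then f z \<alpha> else 0)"
    unfolding sum_fun_apply using HC_zero_at_0[OF f]
    by (intro sum.cong) (auto simp: hmon_def monomial_def)
  also have "\<dots> = (if \<beta> \<in> short_words D then f z \<beta> else 0)"
    using finite_short_words by (simp add: sum.delta)
  also have "\<dots> = htrunc D f z \<beta>"
    using Car_support[OF HC_Car[OF f]] by (auto simp: htrunc_def trunc_def short_words_def)
  finally show "htrunc D f z \<beta> = (\<Sum>\<alpha>\<in>short_words D. hmon (\<lambda>z. f z \<alpha>) (monomial \<alpha>)) z \<beta>" ..
qed

lemma HC_htrunc: "f \<in> HC \<Longrightarrow> htrunc D f \<in> HC"
  by (auto simp: htrunc_eq_sum short_words_def intro!: HC_sum HC_hmon HC_coeff_holomorphic Car_monomial)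

subsection \<open>The compact-open topology\<close>

definition basic_open :: "complex set \<Rightarrow> free_series set \<Rightarrow> (complex \<Rightarrow> free_series) set" where
  "basic_open K W = {f \<in> HC. f ` K \<subseteq> W}"

lemma TH_eq: "TH = topology_generated_by
    {basic_open K W | K W. compact K \<and> K \<subseteq> punctured_plane \<and> openin TF W}"
  by (simp add: hol_oalg_def basic_open_def)

lemma topspace_TH [simp]: "topspace TH = HC"
proof -
  have "HC = basic_open {} {}"
    by (simp add: basic_open_def)
  moreover have "basic_open K W \<subseteq> HC" for K W
    by (auto simp: basic_open_def)
  ultimately show ?thesis
    unfolding TH_eq topology_generated_by_topspace
    by (intro equalityI Sup_least Sup_upper) (auto intro!: exI[of _ "{} :: complex set"])
qed

lemma openin_basic_open: "compact K \<Longrightarrow> K \<subseteq> punctured_plane \<Longrightarrow> openin TF W \<Longrightarrow> openin TH (basic_open K W)"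
  unfolding TH_eq by (rule topology_generated_by_Basis) blast

lemma TH_induct [consumes 1, case_names Empty Int UN Basis]:
  assumes "openin TH U" and "R {}" and "\<And>a b. R a \<Longrightarrow> R b \<Longrightarrow> R (a \<inter> b)"
    and "\<And>K. (\<And>k. k \<in> K \<Longrightarrow> R k) \<Longrightarrow> R (\<Union>K)"
    and "\<And>K W. compact K \<Longrightarrow> K \<subseteq> punctured_plane \<Longrightarrow> openin TF W \<Longrightarrow> R (basic_open K W)"
  shows "R U"
  using openin_topology_generated_by[OF assms(1)[unfolded TH_eq]]
  by (induction rule: generate_topology_on.induct) (use assms in auto)

text \<open>For fixed \<open>z\<close> some degree has a small tail, and by
  \<open>tail_perturb\<close> it serves all \<open>w\<close> near \<open>z\<close>; a finite cover
  makes it uniform on a compact set. General open sets follow along their generation from basic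
  ones. This density of finite sums computes both the closed ideal and the fibres.\<close>

lemma htrunc_eventually:
  assumes f: "f \<in> HC" and "openin TH U" "f \<in> U"
  shows "\<exists>D0. \<forall>D\<ge>D0. htrunc D f \<in> U"
  using assms(2,3)
proof (induction rule: TH_induct)
  case (Int a b)
  then obtain D1 D2 where "\<forall>D\<ge>D1. htrunc D f \<in> a" "\<forall>D\<ge>D2. htrunc D f \<in> b"
    by auto
  then show ?case
    by (intro exI[of _ "max D1 D2"]) auto
next
  case (Basis K W)
  have loc: "\<exists>\<delta>>0. \<exists>D0. \<forall>w. dist w z < \<delta> \<longrightarrow> (\<forall>D\<ge>D0. trunc D (f w) \<in> W)" if z: "z \<in> K" for z
  proof -
    have z0: "z \<noteq> 0" and "f z \<in> W"
      using z Basis by (auto simp: basic_open_def)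
    obtain i e where e: "e > 0" and ball: "\<And>b. b \<in> Car \<Longrightarrow> N i (b - f z) < e \<Longrightarrow> b \<in> W"
      using bspec[OF conjunct2[OF openin_TF[THEN iffD1, OF Basis.hyps(3)]] \<open>f z \<in> W\<close>] by blast
    obtain \<delta> where \<delta>: "\<delta> > 0" "\<And>w. dist w z < \<delta> \<Longrightarrow> N i (f w - f z) < e / 4"
      using HC_near[OF f z0, of "e / 4" i] e by auto
    obtain D0 where D0: "tail i D0 (f z) < e / 4"
      using tail_small[OF HC_Car[OF f], of "e / 4" i z] e by auto
    have "trunc D (f w) \<in> W" if w: "dist w z < \<delta>" and D: "D \<ge> D0" for w D
    proof (rule ball)
      show c: "trunc D (f w) \<in> Car"
        by (intro Car_trunc HC_Car f)
      have "N i (trunc D (f w) - f w) = tail i D (f w)"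
        unfolding tail_def by (rule N_minus_commute[OF c HC_Car[OF f]])
      also have "\<dots> \<le> tail i D (f z) + N i (f w - f z)"
        by (intro tail_perturb HC_Car f)
      also have "\<dots> < e / 4 + e / 4"
        using tail_antimono[OF HC_Car[OF f] D, of i z] D0 \<delta>(2)[OF w] by linarith
      finally show "N i (trunc D (f w) - f z) < e"
        using N_triangle[OF c HC_Car[OF f, of w] HC_Car[OF f, of z], of i] \<delta>(2)[OF w] e by linarith
    qed
    with \<delta>(1) show ?thesis
      by blast
  qed
  then obtain \<delta> D0 where \<delta>: "\<And>z. z \<in> K \<Longrightarrow> \<delta> z > (0::real)"
    and D0: "\<And>z w D. z \<in> K \<Longrightarrow> dist w z < \<delta> z \<Longrightarrow> D \<ge> D0 z \<Longrightarrow> trunc D (f w) \<in> W"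
    by metis
  obtain Z where Z: "Z \<subseteq> K" "finite Z" "K \<subseteq> (\<Union>z\<in>Z. ball z (\<delta> z))"
  proof (rule compactE_image[OF Basis.hyps(1), of K "\<lambda>z. ball z (\<delta> z)"])
    show "K \<subseteq> (\<Union>z\<in>K. ball z (\<delta> z))"
      using \<delta> by force
  qed auto
  obtain D1 where D1: "\<forall>z\<in>Z. D0 z \<le> D1"
    using finite_nat_set_iff_bounded_le[of "D0 ` Z"] Z(2) by auto
  have "htrunc D f \<in> basic_open K W" if D: "D \<ge> D1" for D
  proof -
    have "trunc D (f w) \<in> W" if w: "w \<in> K" for w
    proof -
      obtain z where z: "z \<in> Z" "dist z w < \<delta> z"
        using subsetD[OF Z(3) w] by auto
      then show ?thesis
        using D0[of z w D] subsetD[OF Z(1) z(1)] D1 D by (force simp: dist_commute)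
    qed
    then show ?thesis
      using HC_htrunc[OF f] by (auto simp: basic_open_def htrunc_def)
  qed
  then show ?case
    by blast
next
  case (UN \<K>)
  then obtain X where X: "X \<in> \<K>" "f \<in> X"
    by blast
  then obtain D0 where "\<forall>D\<ge>D0. htrunc D f \<in> X"
    using UN.IH by blast
  with X(1) show ?case
    by blast
qed simp

text \<open>A basic open set prescribes one target for a whole compact set, whereas \<open>f\<close>
  varies on \<open>K\<close>. Therefore \<open>K\<close> is cut into finitely many compact pieces on
  each of which \<open>f\<close> stays within \<open>e / 2\<close> of one value.\<close>

lemma uniform_nbhd:
  assumes f: "f \<in> HC" and K: "compact K" "K \<subseteq> punctured_plane" and e: "0 < e"
  obtains U where "openin TH U" "f \<in> U" "\<And>g z. g \<in> U \<Longrightarrow> z \<in> K \<Longrightarrow> N i (g z - f z) < e"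
proof -
  have "\<exists>\<delta>>0. \<forall>w. dist w z < \<delta> \<longrightarrow> N i (f w - f z) < e / 2" if "z \<in> K" for z
    using that K e by (intro HC_near f) auto
  then obtain \<delta> where \<delta>: "\<And>z. z \<in> K \<Longrightarrow> \<delta> z > (0::real)"
      "\<And>z w. z \<in> K \<Longrightarrow> dist w z < \<delta> z \<Longrightarrow> N i (f w - f z) < e / 2"
    by metis
  obtain Z where Z: "Z \<subseteq> K" "finite Z" "K \<subseteq> (\<Union>z\<in>Z. ball z (\<delta> z / 2))"
  proof (rule compactE_image[OF K(1), of K "\<lambda>z. ball z (\<delta> z / 2)"])
    show "K \<subseteq> (\<Union>z\<in>K. ball z (\<delta> z / 2))"
      using \<delta>(1) by force
  qed auto
  let ?K = "\<lambda>z. K \<inter> cball z (\<delta> z / 2)"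
  let ?W = "\<lambda>z. {b \<in> Car. N i (b - f z) < e / 2}"
  \<comment> \<open>The factor \<open>HC\<close> covers the case that \<open>K\<close>, and with it
    \<open>Z\<close>, is empty.\<close>
  let ?U = "HC \<inter> (\<Inter>z\<in>Z. basic_open (?K z) (?W z))"
  show thesis
  proof
    have op: "openin TH (basic_open (?K z) (?W z))" for z
      using K by (intro openin_basic_open openin_TF_ball HC_Car f compact_Int_closed) auto
    have "openin TH HC"
      using openin_topspace[of TH] by simp
    with op show "openin TH ?U"
      using Z(2) by (cases "Z = {}") (auto intro!: openin_Int openin_INT2)
    have "f \<in> basic_open (?K z) (?W z)" if "z \<in> Z" for z
    proof -
      have "N i (f w - f z) < e / 2" if "dist z w \<le> \<delta> z / 2" for w
        using \<delta>(2)[of z w] \<delta>(1)[of z] \<open>z \<in> Z\<close> Z(1) that by (force simp: dist_commute)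
      then show ?thesis
        using f by (auto simp: basic_open_def HC_Car)
    qed
    with f show "f \<in> ?U"
      by auto
    fix g w assume g: "g \<in> ?U" and w: "w \<in> K"
    then obtain z where z: "z \<in> Z" "dist z w < \<delta> z / 2"
      using Z(3) by auto
    have gH: "g \<in> HC"
      using g by simp
    have "N i (g w - f z) < e / 2"
    proof -
      have "g ` ?K z \<subseteq> ?W z"
        using g z(1) by (simp add: basic_open_def)
      moreover have "w \<in> ?K z"
        using w z(2) by simp
      ultimately have "g w \<in> ?W z"
        by (rule subsetD[OF _ imageI])
      then show ?thesis
        by simp
    qed
    moreover have "N i (f z - f w) < e / 2"
    proof -
      have "dist w z < \<delta> z"
        using z \<delta>(1)[of z] Z(1) by (auto simp: dist_commute)
      then show ?thesis
        using \<delta>(2)[of z w] z(1) Z(1) N_minus_commute[OF HC_Car[OF f, of z] HC_Car[OF f, of w], of i] by auto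
    qed
    ultimately show "N i (g w - f w) < e"
      using N_triangle[OF HC_Car[OF gH, of w] HC_Car[OF f, of z] HC_Car[OF f, of w], of i] by linarith
  qed
qed

text \<open>Finite intersections are absorbed by the union of the compact sets and the larger norm.
  A basic set with nonempty \<open>K\<close> that contains the zero function has zero in its target,
  hence a ball around it.\<close>

lemma nbhd_zero_contains_ball:
  assumes "openin TH U" "0 \<in> U"
  shows "\<exists>K i e. compact K \<and> K \<subseteq> punctured_plane \<and> 0 < e \<and> (\<forall>f\<in>HC. (\<forall>z\<in>K. N i (f z) < e) \<longrightarrow> f \<in> U)"
  using assms
proof (induction rule: TH_induct)
  case (Int a b)
  have ab: "0 \<in> a" "0 \<in> b"
    using Int.prems by (rule IntD1, rule IntD2)
  obtain K i e where 1: "compact K" "K \<subseteq> punctured_plane" "0 < e"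
      "\<forall>f\<in>HC. (\<forall>z\<in>K. N i (f z) < e) \<longrightarrow> f \<in> a"
    using Int.IH(1)[OF ab(1)] by (elim exE conjE)
  obtain K' i' e' where 2: "compact K'" "K' \<subseteq> punctured_plane" "0 < e'"
      "\<forall>f\<in>HC. (\<forall>z\<in>K'. N i' (f z) < e') \<longrightarrow> f \<in> b"
    using Int.IH(2)[OF ab(2)] by (elim exE conjE)
  have "f \<in> a \<inter> b" if f: "f \<in> HC" and small: "\<forall>z\<in>K \<union> K'. N (max i i') (f z) < min e e'" for f
  proof -
    have le: "N i (f z) \<le> N (max i i') (f z)" "N i' (f z) \<le> N (max i i') (f z)" for z
      by (rule N_mono[OF HC_Car[OF f]], simp)+
    have "\<forall>z\<in>K. N i (f z) < e" "\<forall>z\<in>K'. N i' (f z) < e'"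
      using le small by (auto intro: le_less_trans)
    with 1(4) 2(4) f show ?thesis
      by auto
  qed
  then show ?case
    using 1(1-3) 2(1-3)
    by (intro exI[of _ "K \<union> K'"] exI[of _ "max i i'"] exI[of _ "min e e'"])
      (simp add: compact_Un)
next
  case (Basis K W)
  show ?case
  proof (cases "K = {}")
    case True
    then show ?thesis
      by (intro exI[of _ K] exI[of _ 0] exI[of _ 1]) (auto simp: basic_open_def)
  next
    case False
    then obtain k where "k \<in> K"
      by blast
    moreover have "(0 :: complex \<Rightarrow> free_series) ` K \<subseteq> W"
      using Basis.prems unfolding basic_open_def mem_Collect_eq by (rule conjunct2)
    ultimately have "(0 :: complex \<Rightarrow> free_series) k \<in> W"
      by (rule subsetD[OF _ imageI, rotated])
    then have "0 \<in> W"
      unfolding zero_fun_apply[of k] .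
    obtain i e where "e > 0" "\<And>b. b \<in> Car \<Longrightarrow> N i (b - 0) < e \<Longrightarrow> b \<in> W"
      using bspec[OF conjunct2[OF openin_TF[THEN iffD1, OF Basis.hyps(3)]] \<open>0 \<in> W\<close>] by blast
    then show ?thesis
      using Basis.hyps(1,2) by (intro exI[of _ K] exI[of _ i] exI[of _ e]) (auto simp: basic_open_def HC_Car)
  qed
next
  case (UN \<K>)
  then obtain X where X: "X \<in> \<K>" "0 \<in> X"
    by blast
  obtain K i e where "compact K" "K \<subseteq> punctured_plane" "0 < e"
      "\<forall>f\<in>HC. (\<forall>z\<in>K. N i (f z) < e) \<longrightarrow> f \<in> X"
    using UN.IH[OF X] by (elim exE conjE)
  then show ?case
    using X(1) by (intro exI[of _ K] exI[of _ i] exI[of _ e]) auto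
qed simp

text \<open>Evaluation at \<open>q\<close> followed by a coefficient of the symbol is continuous,
  and a nonzero coefficient stays nonzero nearby.\<close>

lemma closedin_symb_zero:
  assumes q: "q \<noteq> 0" shows "closedin TH {f \<in> HC. symb q (f q) = 0}"
proof -
  have "openin TH (HC - {f \<in> HC. symb q (f q) = 0})"
  proof (subst openin_subopen, intro ballI)
    fix f assume "f \<in> HC - {f \<in> HC. symb q (f q) = 0}"
    then obtain M where f: "f \<in> HC" and M: "symb q (f q) M \<noteq> 0"
      by (auto simp: fun_eq_iff)
    obtain K where K: "K \<ge> 0" "\<And>a. a \<in> Car \<Longrightarrow> cmod (symb q a M) \<le> K * N 0 a"
      using symb_le_N by blast
    let ?e = "cmod (symb q (f q) M) / (K + 1)"
    have e: "0 < ?e"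
      using M K(1) by simp
    obtain U where U: "openin TH U" "f \<in> U" "\<And>g z. g \<in> U \<Longrightarrow> z \<in> {q} \<Longrightarrow> N 0 (g z - f z) < ?e"
      by (rule uniform_nbhd[OF f, of "{q}" ?e 0]) (use q e in auto)
    have "symb q (g q) \<noteq> 0" if g: "g \<in> U" for g
    proof
      assume g0: "symb q (g q) = 0"
      have gH: "g \<in> HC"
        using openin_subset[OF U(1)] g by auto
      have "cmod (symb q (f q) M) = cmod (symb q (g q - f q) M)"
        using g0 by (simp add: symb_diff)
      also have "\<dots> \<le> K * N 0 (g q - f q)"
        by (intro K(2) Car_diff HC_Car gH f)
      also have "\<dots> \<le> K * ?e"
        using U(3)[OF g, of q] K(1) by (intro mult_left_mono) auto
      also have "\<dots> < cmod (symb q (f q) M)"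
        using M K(1) by (simp add: field_simps)
      finally show False
        by simp
    qed
    then show "\<exists>T. openin TH T \<and> f \<in> T \<and> T \<subseteq> HC - {f \<in> HC. symb q (f q) = 0}"
      using U openin_subset[OF U(1)] by auto
  qed
  then show ?thesis
    by (auto simp: closedin_def)
qed

section \<open>The deformation algebra\<close>

definition hsymb :: "(complex \<Rightarrow> free_series) \<Rightarrow> complex \<Rightarrow> nat multiset \<Rightarrow> complex" where
  "hsymb f = (\<lambda>z. if z = 0 then 0 else symb z (f z))"

definition Ker :: "(complex \<Rightarrow> free_series) set" where
  "Ker = {f \<in> HC. hsymb f = 0}"

definition RI :: "(complex \<Rightarrow> free_series) set" where
  "RI = closed_ideal_gen H (commutation_relations n F)"

lemma hsymb_eq_iff: "hsymb f = hsymb g \<longleftrightarrow> (\<forall>z. z \<noteq> 0 \<longrightarrow> symb z (f z) = symb z (g z))"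
  by (auto simp: hsymb_def fun_eq_iff)

lemma hsymb_eq_0_iff: "hsymb f = 0 \<longleftrightarrow> (\<forall>z. z \<noteq> 0 \<longrightarrow> symb z (f z) = 0)"
  by (auto simp: hsymb_def fun_eq_iff)

lemma hsymb_add: "hsymb (f + g) = hsymb f + hsymb g"
  by (auto simp: hsymb_def fun_eq_iff symb_add)

lemma hsymb_presentation: "J = Ker \<Longrightarrow> quotient_presentation H hsymb J"
proof (rule quotient_presentation.intro[OF complex_algebra_H])
  show "J = Ker \<Longrightarrow> J = {a \<in> carrier H. hsymb a = 0}"
    by (simp add: Ker_def)
next
  fix c a b assume "hsymb a = hsymb b"
  then show "hsymb (c \<odot>\<^bsub>H\<^esub> a) = hsymb (c \<odot>\<^bsub>H\<^esub> b)"
    by (simp add: hsymb_eq_iff H_smult_apply symb_scale)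
next
  fix a a' b b' assume "hsymb a = hsymb a'" "hsymb b = hsymb b'"
  then show "hsymb (a \<otimes>\<^bsub>H\<^esub> b) = hsymb (a' \<otimes>\<^bsub>H\<^esub> b')"
    by (simp add: hsymb_eq_iff hmul_apply symb_conv)
qed (simp add: hsymb_add)

lemma closedin_Ker: "closedin TH Ker"
proof -
  have "closedin TH (\<Inter>q\<in>punctured_plane. {f \<in> HC. symb q (f q) = 0})"
    by (intro closedin_INT closedin_symb_zero) (auto intro: exI[of _ 1])
  moreover have "(\<Inter>q\<in>punctured_plane. {f \<in> HC. symb q (f q) = 0}) = Ker"
    by (auto simp: Ker_def hsymb_eq_0_iff intro: exI[of _ 1])
  ultimately show ?thesis
    by simp
qed

definition rel :: "nat \<Rightarrow> nat \<Rightarrow> complex \<Rightarrow> free_series" where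
  "rel i j = hmon (\<lambda>_. 1) (monomial [i, j]) - hmon (\<lambda>z. z) (monomial [j, i])"

lemma commutation_relations_eq: "commutation_relations n F = {rel i j | i j. 1 \<le> i \<and> i < j \<and> j \<le> n}"
proof -
  have eq: "(hol_const F (monomial [i]) \<otimes>\<^bsub>H\<^esub> hol_const F (monomial [j])) \<ominus>\<^bsub>H\<^esub>
      act H (\<lambda>z. z) (hol_const F (monomial [j]) \<otimes>\<^bsub>H\<^esub> hol_const F (monomial [i])) = rel i j"
    if "1 \<le> i \<and> i < j \<and> j \<le> n" for i j
  proof -
    have "hmon (\<lambda>_. 1) (monomial [j, i]) \<in> HC" "hmon (\<lambda>z. z) (monomial [j, i]) \<in> HC"
      using that by (auto intro!: HC_hmon Car_monomial holomorphic_intros simp: mem_words)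
    then show ?thesis
      by (simp add: hol_const_eq hmul_hmon_hmon H_act H_minus rel_def)
  qed
  then show ?thesis
    unfolding commutation_relations_def Let_def by (metis (no_types, lifting))
qed

lemma rel_Ker: "1 \<le> i \<Longrightarrow> i < j \<Longrightarrow> j \<le> n \<Longrightarrow> rel i j \<in> Ker"
proof -
  assume ij: "1 \<le> i" "i < j" "j \<le> n"
  have "rel i j \<in> HC"
    unfolding rel_def using ij
    by (intro HC_diff HC_hmon Car_monomial holomorphic_intros) (auto simp: mem_words)
  moreover have "symb z (rel i j z) = 0" if "z \<noteq> 0" for z
    using that ij by (auto simp: rel_def hmon_def symb_diff symb_scale symb_monomial fun_eq_iff add_mset_commute)
  ultimately show ?thesis
    by (simp add: Ker_def hsymb_eq_0_iff)
qed

text \<open>Ensures that the family whose intersection is \<open>RI\<close> is not empty, and that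
  \<open>RI\<close> lies in the kernel of the symbol.\<close>

lemma Ker_mem_family:
  "Ker \<in> {J. ideal J H \<and> closedin TH J \<and> commutation_relations n F \<subseteq> J}"
  using quotient_presentation.ideal_J[OF hsymb_presentation[OF refl]] closedin_Ker rel_Ker
  by (auto simp: commutation_relations_eq)

lemma RI_subset_Ker: "RI \<subseteq> Ker"
  unfolding RI_def closed_ideal_gen_def using Ker_mem_family by blast

lemma ideal_RI: "ideal RI H"
  unfolding RI_def closed_ideal_gen_def
  using Ker_mem_family by (intro ring.i_Intersect complex_algebraD(1)[OF complex_algebra_H]) auto

lemma closedin_RI: "closedin TH RI"
  unfolding RI_def closed_ideal_gen_def using Ker_mem_family by (intro closedin_Inter) auto

lemma rel_RI: "1 \<le> i \<Longrightarrow> i < j \<Longrightarrow> j \<le> n \<Longrightarrow> rel i j \<in> RI"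
  unfolding RI_def closed_ideal_gen_def commutation_relations_eq by blast

lemma RI_zero: "0 \<in> RI"
  using additive_subgroup.zero_closed[OF ideal.axioms(1)[OF ideal_RI]] by simp

lemma RI_add: "f \<in> RI \<Longrightarrow> g \<in> RI \<Longrightarrow> f + g \<in> RI"
  using additive_subgroup.a_closed[OF ideal.axioms(1)[OF ideal_RI]] by simp

lemma RI_hmul_left: "f \<in> RI \<Longrightarrow> g \<in> HC \<Longrightarrow> hmul g f \<in> RI"
  using ideal.I_l_closed[OF ideal_RI] by simp

lemma RI_hmul_right: "f \<in> RI \<Longrightarrow> g \<in> HC \<Longrightarrow> hmul f g \<in> RI"
  using ideal.I_r_closed[OF ideal_RI] by simp

lemma RI_sum: "(\<And>x. x \<in> S \<Longrightarrow> f x \<in> RI) \<Longrightarrow> (\<Sum>x\<in>S. f x) \<in> RI"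
  by (induction S rule: infinite_finite_induct) (auto simp: RI_zero RI_add)

subsection \<open>Reduction to normal form\<close>

text \<open>Congruence modulo the relations between two words with functional coefficients; powers
  of \<open>z\<close> accumulate in the coefficient of the rewritten word.\<close>

definition eqv :: "(complex \<Rightarrow> complex) \<Rightarrow> nat list \<Rightarrow> (complex \<Rightarrow> complex) \<Rightarrow> nat list \<Rightarrow> bool" where
  "eqv \<phi> \<alpha> \<psi> \<beta> \<longleftrightarrow> hmon \<phi> (monomial \<alpha>) - hmon \<psi> (monomial \<beta>) \<in> RI"

lemma eqv_refl: "eqv \<phi> \<alpha> \<phi> \<alpha>"
  by (simp add: eqv_def RI_zero)

lemma eqv_trans: "eqv \<phi> \<alpha> \<psi> \<beta> \<Longrightarrow> eqv \<psi> \<beta> \<theta> \<gamma> \<Longrightarrow> eqv \<phi> \<alpha> \<theta> \<gamma>"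
  unfolding eqv_def by (drule (1) RI_add) simp

lemma hmul_diff_right: "hmul h (f - g) = hmul h f - hmul h g"
  and hmul_diff_left: "hmul (f - g) h = hmul f h - hmul g h"
  by (auto simp: hmul_def conv_diff_left conv_diff_right fun_eq_iff)

lemma eqv_left:
  assumes "eqv \<phi> \<alpha> \<psi> \<beta>" "\<theta> holomorphic_on punctured_plane" "\<gamma> \<in> words n"
  shows "eqv (\<lambda>z. \<theta> z * \<phi> z) (\<gamma> @ \<alpha>) (\<lambda>z. \<theta> z * \<psi> z) (\<gamma> @ \<beta>)"
  using RI_hmul_left[OF assms(1)[unfolded eqv_def] HC_hmon[OF assms(2) Car_monomial[OF assms(3)]]]
  by (simp add: eqv_def hmul_diff_right hmul_hmon_hmon)

lemma eqv_right:
  assumes "eqv \<phi> \<alpha> \<psi> \<beta>" "\<gamma> \<in> words n"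
  shows "eqv \<phi> (\<alpha> @ \<gamma>) \<psi> (\<beta> @ \<gamma>)"
  using RI_hmul_right[OF assms(1)[unfolded eqv_def] HC_hmon[OF holomorphic_on_const Car_monomial[OF assms(2)]], of 1]
  by (simp add: eqv_def hmul_diff_left hmul_hmon_hmon)

fun dins :: "nat \<Rightarrow> nat list \<Rightarrow> nat list" where
  "dins x [] = [x]"
| "dins x (y # ys) = (if x < y then y # dins x ys else x # y # ys)"

lemma mset_dins [simp]: "mset (dins x ys) = add_mset x (mset ys)"
  by (induction ys) auto

lemma set_dins [simp]: "set (dins x ys) = insert x (set ys)"
  by (induction ys) auto

lemma sorted_dins: "sorted (rev ys) \<Longrightarrow> sorted (rev (dins x ys))"
  by (induction ys) (auto simp: sorted_append)

text \<open>In a decreasing word the letters larger than \<open>x\<close> come first. Moving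
  \<open>x\<close> to the right past each of them costs one factor \<open>z\<close>, and it stops at
  the first letter that is not larger.\<close>

lemma eqv_dins:
  assumes "x # ys \<in> words n" "sorted (rev ys)"
  shows "eqv (\<lambda>_. 1) (x # ys) (\<lambda>z. z ^ length (filter ((<) x) ys)) (dins x ys)"
  using assms
proof (induction ys)
  case (Cons y ys)
  show ?case
  proof (cases "x < y")
    case True
    have "eqv (\<lambda>_. 1) [x, y] (\<lambda>z. z) [y, x]"
      using Cons.prems(1) True by (auto simp: eqv_def mem_words simp flip: rel_def intro!: rel_RI)
    then have "eqv (\<lambda>_. 1) ([x, y] @ ys) (\<lambda>z. z) ([y, x] @ ys)"
      using Cons.prems(1) by (intro eqv_right) (auto simp: mem_words)
    moreover have "eqv (\<lambda>z. z * 1) ([y] @ (x # ys))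
        (\<lambda>z. z * z ^ length (filter ((<) x) ys)) ([y] @ dins x ys)"
      using Cons by (intro eqv_left holomorphic_intros) (auto simp: mem_words sorted_append)
    ultimately show ?thesis
      using True by (auto elim: eqv_trans)
  next
    case False
    \<comment> \<open>All letters of \<open>ys\<close> are at most \<open>y\<close>, so none of them
      exceeds \<open>x\<close>.\<close>
    then have "filter ((<) x) ys = []"
      using Cons.prems(2) by (auto simp: filter_empty_conv sorted_append)
    with False show ?thesis
      by (simp add: eqv_refl)
  qed
qed (simp add: eqv_refl)

lemma length_filter_mset: "length (filter P xs) = size (filter_mset P (mset xs))"
  by (simp flip: mset_filter)

text \<open>Insertion sort from the right. The sorted rest has the same content as
  \<open>\<alpha>\<close>, so inserting \<open>x\<close> costs exactly the non-inversions that
  \<open>x\<close> contributes to the word.\<close>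

lemma eqv_sorted:
  assumes "\<alpha> \<in> words n"
  shows "eqv (\<lambda>_. 1) \<alpha> (\<lambda>z. z ^ noninv \<alpha>) (sorted_word (mset \<alpha>))"
  using assms
proof (induction \<alpha>)
  case Nil
  show ?case
    using sorted_word_unique[of "[]"] by (simp add: eqv_refl)
next
  case (Cons x \<alpha>)
  let ?s = "sorted_word (mset \<alpha>)"
  have s: "sorted (rev ?s)"
    by (simp add: sorted_word_def)
  have xs: "x # ?s \<in> words n" "[x] \<in> words n" "\<alpha> \<in> words n"
    using Cons.prems by (auto simp: mem_words)
  have d: "dins x ?s = sorted_word (mset (x # \<alpha>))"
    using sorted_word_unique[OF sorted_dins[OF s, of x]] by simp
  have "eqv (\<lambda>z. 1 * 1) ([x] @ \<alpha>) (\<lambda>z. 1 * z ^ noninv \<alpha>) ([x] @ ?s)"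
    using Cons.IH[OF xs(3)] xs(2) by (intro eqv_left holomorphic_intros)
  moreover have "eqv (\<lambda>z. z ^ noninv \<alpha> * 1) ([] @ (x # ?s))
      (\<lambda>z. z ^ noninv \<alpha> * z ^ length (filter ((<) x) ?s)) ([] @ dins x ?s)"
    using eqv_dins[OF xs(1) s] by (intro eqv_left holomorphic_intros) (auto simp: mem_words)
  moreover have "length (filter ((<) x) ?s) = length (filter ((<) x) \<alpha>)"
    unfolding length_filter_mset by simp
  ultimately show ?case
    unfolding d by (auto simp: power_add mult.commute elim: eqv_trans)
qed

text \<open>The coefficient functions are those of the symbol of \<open>f\<close>. So the sum
  vanishes if the symbol vanishes identically, and every coefficient function vanishes at a point
  \<open>q\<close> where the symbol does.\<close>

definition nform :: "nat \<Rightarrow> (complex \<Rightarrow> free_series) \<Rightarrow> complex \<Rightarrow> free_series" where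
  "nform D f = (\<Sum>M\<in>mset ` short_words D. hmon (\<lambda>z. symb z (f z) M) (monomial (sorted_word M)))"

lemma htrunc_nform:
  assumes f: "f \<in> HC" shows "htrunc D f - nform D f \<in> RI"
proof -
  let ?t = "\<lambda>\<alpha>. hmon (\<lambda>z. f z \<alpha> * z ^ noninv \<alpha>) (monomial (sorted_word (mset \<alpha>)))"
  have "nform D f = (\<Sum>\<alpha>\<in>short_words D. ?t \<alpha>)"
  proof (rule ext)
    fix z
    \<comment> \<open>Rearrangements of a short word are short words, so the sum over all words of
      content \<open>M\<close> in \<open>symb\<close> runs inside
      \<open>short_words D\<close>.\<close>
    have group: "{\<alpha>. mset \<alpha> = M} = {\<alpha> \<in> short_words D. mset \<alpha> = M}" if M: "M \<in> mset ` short_words D" for M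
    proof -
      obtain \<beta> where \<beta>: "\<beta> \<in> short_words D" "M = mset \<beta>"
        using M by blast
      have "\<alpha> \<in> short_words D" if "mset \<alpha> = mset \<beta>" for \<alpha>
        using \<beta>(1) mset_eq_setD[OF that] mset_eq_length[OF that] by (simp add: short_words_def mem_words)
      with \<beta>(2) show ?thesis
        by auto
    qed
    have "nform D f z = (\<Sum>M\<in>mset ` short_words D. hmon (\<lambda>z. symb z (f z) M) (monomial (sorted_word M)) z)"
      by (simp add: nform_def sum_fun_apply)
    also have "\<dots> = (\<Sum>M\<in>mset ` short_words D. \<Sum>\<alpha> | \<alpha> \<in> short_words D \<and> mset \<alpha> = M. ?t \<alpha> z)"
    proof (rule sum.cong[OF refl])
      fix M assume M: "M \<in> mset ` short_words D"
      have "hmon (\<lambda>z. symb z (f z) M) (monomial (sorted_word M)) z = (\<Sum>\<alpha> | mset \<alpha> = M. ?t \<alpha> z)"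
      proof
        fix \<beta>
        show "hmon (\<lambda>z. symb z (f z) M) (monomial (sorted_word M)) z \<beta> = (\<Sum>\<alpha> | mset \<alpha> = M. ?t \<alpha> z) \<beta>"
          by (simp add: hmon_def symb_def sum_fun_apply sum_distrib_right)
      qed
      then show "hmon (\<lambda>z. symb z (f z) M) (monomial (sorted_word M)) z
          = (\<Sum>\<alpha> | \<alpha> \<in> short_words D \<and> mset \<alpha> = M. ?t \<alpha> z)"
        using group[OF M] by simp
    qed
    also have "\<dots> = (\<Sum>\<alpha>\<in>short_words D. ?t \<alpha> z)"
      by (rule sum.group) (auto simp: finite_short_words)
    finally show "nform D f z = (\<Sum>\<alpha>\<in>short_words D. ?t \<alpha>) z"
      by (simp add: sum_fun_apply)
  qed
  then have "htrunc D f - nform D f = (\<Sum>\<alpha>\<in>short_words D. hmon (\<lambda>z. f z \<alpha>) (monomial \<alpha>) - ?t \<alpha>)"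
    by (simp add: htrunc_eq_sum[OF f] sum_subtractf)
  also have "\<dots> \<in> RI"
  proof (rule RI_sum)
    fix \<alpha> assume \<alpha>: "\<alpha> \<in> short_words D"
    then have "eqv (\<lambda>z. f z \<alpha> * 1) ([] @ \<alpha>) (\<lambda>z. f z \<alpha> * z ^ noninv \<alpha>) ([] @ sorted_word (mset \<alpha>))"
      by (intro eqv_left eqv_sorted HC_coeff_holomorphic f) (auto simp: short_words_def mem_words)
    then show "hmon (\<lambda>z. f z \<alpha>) (monomial \<alpha>) - ?t \<alpha> \<in> RI"
      by (simp add: eqv_def)
  qed
  finally show ?thesis .
qed

text \<open>If the symbol vanishes identically, so do all normal forms, and every truncation lies in
  \<open>RI\<close>. Truncations converge to the function and \<open>RI\<close> is closed.\<close>

lemma RI_eq_Ker: "RI = Ker"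
proof
  show "Ker \<subseteq> RI"
  proof
    fix f assume "f \<in> Ker"
    then have f: "f \<in> HC" and s: "\<And>z. z \<noteq> 0 \<Longrightarrow> symb z (f z) = 0"
      by (auto simp: Ker_def hsymb_eq_0_iff)
    have "hmon (\<lambda>z. symb z (f z) M) a = 0" for M a
      using s by (auto simp: hmon_def fun_eq_iff)
    then have trunc: "htrunc D f \<in> RI" for D
      using htrunc_nform[OF f, of D] by (simp add: nform_def)
    show "f \<in> RI"
    proof (rule ccontr)
      assume "f \<notin> RI"
      then have "f \<in> HC - RI" "openin TH (HC - RI)"
        using f closedin_RI by (auto simp: closedin_def)
      then show False
        using htrunc_eventually[OF f] trunc by blast
    qed
  qed
qed (rule RI_subset_Ker)

sublocale HQ: quotient_presentation H hsymb RI
  by (rule hsymb_presentation[OF RI_eq_Ker])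

abbreviation A :: "(complex \<Rightarrow> free_series) set oalg" where
  "A \<equiv> deformation n F"

definition cl :: "(complex \<Rightarrow> free_series) \<Rightarrow> (complex \<Rightarrow> free_series) set" where
  "cl f = RI +>\<^bsub>H\<^esub> f"

lemma A_fields:
  "carrier A = carrier (quotient_algebra H RI)"
  "monoid.mult A = monoid.mult (quotient_algebra H RI)" "\<one>\<^bsub>A\<^esub> = \<one>\<^bsub>quotient_algebra H RI\<^esub>"
  "\<zero>\<^bsub>A\<^esub> = \<zero>\<^bsub>quotient_algebra H RI\<^esub>" "add A = add (quotient_algebra H RI)"
  "smult A = smult (quotient_algebra H RI)"
  "topol A = quotient_topology H RI" "act A = (\<lambda>\<phi>. coset_map H RI (act H \<phi>))"
  by (simp_all add: deformation_def quotient_oalg_def module.extend_def RI_def)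

lemma A_carrier: "carrier A = cl ` HC"
  by (simp add: A_fields HQ.quotient_carrier cl_def[abs_def])

lemma
  assumes "f \<in> HC" "g \<in> HC"
  shows A_add: "cl f \<oplus>\<^bsub>A\<^esub> cl g = cl (f + g)" and A_mult: "cl f \<otimes>\<^bsub>A\<^esub> cl g = cl (hmul f g)"
    and A_smult: "c \<odot>\<^bsub>A\<^esub> cl f = cl (c \<odot>\<^bsub>H\<^esub> f)"
  using assms HQ.quotient_add[of f g] HQ.quotient_mult[of f g] HQ.quotient_smult[of f c]
  by (simp_all add: A_fields cl_def)

lemma A_zero: "\<zero>\<^bsub>A\<^esub> = cl 0"
  using HQ.quotient_zero by (simp add: A_fields cl_def)

lemma complex_algebra_A: "complex_algebra A"
  by (rule complex_algebra_image[OF HQ.complex_algebra_quotient, of _ id]) (simp_all add: A_fields)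

lemma cl_eq_iff: "f \<in> HC \<Longrightarrow> g \<in> HC \<Longrightarrow> cl f = cl g \<longleftrightarrow> (\<forall>z. z \<noteq> 0 \<longrightarrow> symb z (f z) = symb z (g z))"
  using HQ.coset_eq_iff[of f g] by (simp add: cl_def hsymb_eq_iff)

lemma cl_eqI: "f \<in> HC \<Longrightarrow> g \<in> HC \<Longrightarrow> f - g \<in> RI \<Longrightarrow> cl f = cl g"
  by (simp add: cl_eq_iff RI_eq_Ker Ker_def hsymb_eq_0_iff symb_diff)

lemma mem_cl: "f \<in> HC \<Longrightarrow> g \<in> cl f \<longleftrightarrow> g \<in> HC \<and> cl g = cl f"
  using HQ.mem_coset_iff[of f g] by (simp add: cl_def)

lemma A_act:
  assumes \<phi>: "\<phi> holomorphic_on punctured_plane" and f: "f \<in> HC"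
  shows "act A \<phi> (cl f) = cl (act H \<phi> f)"
  unfolding A_fields cl_def
proof (rule HQ.coset_map_coset)
  show "b \<in> carrier H \<Longrightarrow> act H \<phi> b \<in> carrier H" for b
    using \<phi> by (simp add: HC_act)
  show "hsymb (act H \<phi> b) = hsymb (act H \<phi> f)" if "b \<in> carrier H" "hsymb b = hsymb f" for b
    using that f by (simp add: hsymb_eq_iff H_act hmul_hmon symb_scale)
qed (simp add: f)

lemma openin_A: "openin (topol A) W \<longleftrightarrow> W \<subseteq> cl ` HC \<and> openin TH {f \<in> HC. cl f \<in> W}"
  unfolding A_fields(7) openin_quotient_topology HQ.carrier_Quot H_simps cl_def ..

lemma topspace_A [simp]: "topspace (topol A) = cl ` HC"
proof -
  have "{f \<in> HC. cl f \<in> cl ` HC} = topspace TH"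
    by auto
  then have "openin (topol A) (cl ` HC)"
    unfolding openin_A using openin_topspace[of TH] by (simp del: topspace_TH)
  then have "cl ` HC \<subseteq> topspace (topol A)"
    by (rule openin_subset)
  moreover have "topspace (topol A) \<subseteq> cl ` HC"
    using openin_A[THEN iffD1, OF openin_topspace] by (rule conjunct1)
  ultimately show ?thesis
    by (rule antisym[rotated])
qed

lemma closedin_A:
  assumes "W \<subseteq> cl ` HC" "closedin TH {f \<in> HC. cl f \<in> W}" shows "closedin (topol A) W"
proof -
  have "{f \<in> HC. cl f \<in> cl ` HC - W} = HC - {f \<in> HC. cl f \<in> W}"
    by auto
  then show ?thesis
    using assms by (auto simp: closedin_def openin_A)
qed

subsection \<open>The fibres\<close>

text \<open>Defined through a chosen representative; for \<open>q \<noteq> 0\<close> all members of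
  a class have the same symbol at \<open>q\<close>, as \<open>symb_at_cl\<close> shows.\<close>

definition symb_at :: "complex \<Rightarrow> (complex \<Rightarrow> free_series) set \<Rightarrow> nat multiset \<Rightarrow> complex" where
  "symb_at q X = symb q ((SOME f. f \<in> X) q)"

lemma symb_at_cl: "q \<noteq> 0 \<Longrightarrow> f \<in> HC \<Longrightarrow> symb_at q (cl f) = symb q (f q)"
proof -
  assume q: "q \<noteq> 0" and f: "f \<in> HC"
  have "f \<in> cl f"
    using f by (simp add: mem_cl)
  then have "(SOME g. g \<in> cl f) \<in> cl f"
    by (rule someI[where P = "\<lambda>g. g \<in> cl f"])
  then have "(SOME g. g \<in> cl f) \<in> HC" "cl (SOME g. g \<in> cl f) = cl f"
    using mem_cl[OF f] by blast+
  then show ?thesis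
    unfolding symb_at_def using q cl_eq_iff[OF _ f] by blast
qed

definition MP :: "complex \<Rightarrow> (complex \<Rightarrow> free_series) set set" where
  "MP q = {X \<in> carrier A. symb_at q X = 0}"

lemma MP_presentation: "q \<noteq> 0 \<Longrightarrow> quotient_presentation A (symb_at q) (MP q)"
proof (rule quotient_presentation.intro[OF complex_algebra_A], unfold A_carrier)
  assume q: "q \<noteq> 0"
  note [simp] = symb_at_cl[OF q]
  fix a b assume ab: "a \<in> cl ` HC" "b \<in> cl ` HC"
  then obtain f g where [simp]: "a = cl f" "f \<in> HC" "b = cl g" "g \<in> HC"
    by auto
  show "symb_at q (a \<oplus>\<^bsub>A\<^esub> b) = symb_at q a + symb_at q b"
    by (simp add: A_add HC_add symb_add)
  have "c \<odot>\<^bsub>H\<^esub> h \<in> HC" if "h \<in> HC" for c h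
    using complex_algebraD(3)[OF complex_algebra_H] that by simp
  then show "symb_at q a = symb_at q b \<Longrightarrow> symb_at q (c \<odot>\<^bsub>A\<^esub> a) = symb_at q (c \<odot>\<^bsub>A\<^esub> b)" for c
    by (simp add: A_smult[where g = f] A_smult[where g = g] H_smult_apply symb_scale)
  fix a' b' assume "a' \<in> cl ` HC" "b' \<in> cl ` HC"
  then obtain f' g' where [simp]: "a' = cl f'" "f' \<in> HC" "b' = cl g'" "g' \<in> HC"
    by auto
  show "symb_at q a = symb_at q a' \<Longrightarrow> symb_at q b = symb_at q b' \<Longrightarrow> symb_at q (a \<otimes>\<^bsub>A\<^esub> b) = symb_at q (a' \<otimes>\<^bsub>A\<^esub> b')"
    by (simp add: A_mult HC_hmul hmul_apply symb_conv)
qed (simp add: MP_def A_carrier)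

lemma closedin_MP:
  assumes q: "q \<noteq> 0" shows "closedin (topol A) (MP q)"
proof (rule closedin_A)
  show "MP q \<subseteq> cl ` HC"
    by (auto simp: MP_def A_carrier)
  have "{f \<in> HC. cl f \<in> MP q} = {f \<in> HC. symb q (f q) = 0}"
    using q by (auto simp: MP_def A_carrier symb_at_cl)
  then show "closedin TH {f \<in> HC. cl f \<in> MP q}"
    using closedin_symb_zero[OF q] by simp
qed

lemma submodule_MP:
  assumes q: "q \<noteq> 0" shows "submodule (MP q) complex_field A"
proof -
  interpret quotient_presentation A "symb_at q" "MP q"
    by (rule MP_presentation[OF q])
  have s: "symb_at q (c \<odot>\<^bsub>A\<^esub> X) = 0" if "X \<in> carrier A" "symb_at q X = 0" for c X
  proof -
    have "symb_at q (c \<odot>\<^bsub>A\<^esub> X) = symb_at q (c \<odot>\<^bsub>A\<^esub> \<zero>\<^bsub>A\<^esub>)"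
      using that by (intro \<phi>_smult) (auto simp: \<phi>_zero)
    also have "c \<odot>\<^bsub>A\<^esub> \<zero>\<^bsub>A\<^esub> = \<zero>\<^bsub>A\<^esub>"
      using A_smult[OF HC_zero HC_zero, of c] by (simp add: A_zero H_smult[OF HC_zero] hmul_def zero_fun_def[symmetric])
    finally show ?thesis
      unfolding \<phi>_zero .
  qed
  note D = complex_algebraD[OF complex_algebra_A]
  show ?thesis
  proof (rule module.submoduleI[OF D(2)])
    fix X assume X: "X \<in> MP q"
    then show "\<ominus>\<^bsub>A\<^esub> X \<in> MP q"
      using a_inv_eq_smult[OF D(2), of X] s D(3) by (simp add: MP_def)
  qed (auto simp: MP_def \<phi>_zero \<phi>_add D(3) s)
qed

text \<open>The generators have symbol zero at \<open>q\<close>, and this is a closed linear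
  condition. Conversely, a class with vanishing symbol at \<open>q\<close> is the limit of its
  normal forms, and each term there is the action of a function vanishing at \<open>q\<close> on a
  constant monomial.\<close>

lemma maximal_part_eq:
  assumes q: "q \<noteq> 0" shows "maximal_part A q = MP q"
proof -
  define G where "G = {act A \<phi> X | \<phi> X. \<phi> holomorphic_on punctured_plane \<and> \<phi> q = 0 \<and> X \<in> carrier A}"
  have "G \<subseteq> MP q"
  proof
    fix Y assume "Y \<in> G"
    then obtain \<phi> f where \<phi>: "\<phi> holomorphic_on punctured_plane" "\<phi> q = 0" and f: "f \<in> HC"
        and Y: "Y = act A \<phi> (cl f)"
      by (auto simp: G_def A_carrier)
    have "act H \<phi> f \<in> HC"
      using \<phi>(1) f by (rule HC_act)
    moreover have "symb q (act H \<phi> f q) = 0"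
      using q f \<phi>(2) by (simp add: H_act hmul_hmon)
    ultimately show "Y \<in> MP q"
      unfolding Y A_act[OF \<phi>(1) f] using q by (simp add: MP_def A_carrier symb_at_cl)
  qed
  then have "lin_span A G \<subseteq> MP q"
    unfolding lin_span_def using submodule_MP[OF q] by blast
  then have "topol A closure_of lin_span A G \<subseteq> MP q"
    using closedin_MP[OF q] by (rule closure_of_minimal)
  moreover have "MP q \<subseteq> topol A closure_of lin_span A G"
  proof
    fix X assume "X \<in> MP q"
    then obtain f where f: "f \<in> HC" "X = cl f" "symb q (f q) = 0"
      using q by (auto simp: MP_def A_carrier symb_at_cl)
    have span: "cl (\<Sum>M\<in>S. hmon (\<lambda>z. symb z (f z) M) (monomial (sorted_word M))) \<in> lin_span A G"
      if S: "finite S" "\<And>M. M \<in> S \<Longrightarrow> set_mset M \<subseteq> {1..n}" for S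
      unfolding lin_span_def
    proof (rule InterI, clarify)
      fix L assume L: "submodule L complex_field A" and GL: "G \<subseteq> L"
      have L0: "\<zero>\<^bsub>A\<^esub> \<in> L" and Ladd: "\<And>x y. x \<in> L \<Longrightarrow> y \<in> L \<Longrightarrow> x \<oplus>\<^bsub>A\<^esub> y \<in> L"
        using subgroup.one_closed[OF submodule.axioms(1)[OF L]] subgroup.m_closed[OF submodule.axioms(1)[OF L]]
        by simp_all
      show "cl (\<Sum>M\<in>S. hmon (\<lambda>z. symb z (f z) M) (monomial (sorted_word M))) \<in> L"
        using S
      proof (induction S rule: finite_induct)
        case empty
        show ?case
          using L0 unfolding sum.empty A_zero .
      next
        case (insert M S)
        let ?\<phi> = "\<lambda>z. symb z (f z) M"
        let ?a = "monomial (sorted_word M)"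
        have a: "monomial (sorted_word M') \<in> Car" if "set_mset M' \<subseteq> {1..n}" for M'
          using that by (intro Car_monomial) (simp add: mem_words)
        have a1: "hmon (\<lambda>_. 1) ?a \<in> HC"
          using insert.prems by (intro HC_hmon a) auto
        have "act H ?\<phi> (hmon (\<lambda>_. 1) ?a) = hmon ?\<phi> ?a"
          using a1 by (simp add: H_act hmul_hmon_hmon)
        then have "cl (hmon ?\<phi> ?a) = act A ?\<phi> (cl (hmon (\<lambda>_. 1) ?a))"
          by (simp add: A_act[OF HC_symb_holomorphic[OF f(1)] a1])
        then have "cl (hmon ?\<phi> ?a) = act A ?\<phi> (cl (hmon (\<lambda>_. 1) ?a)) \<and> ?\<phi> holomorphic_on punctured_plane \<and>
            ?\<phi> q = 0 \<and> cl (hmon (\<lambda>_. 1) ?a) \<in> carrier A"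
          using f(3) a1 HC_symb_holomorphic[OF f(1), of M] by (simp add: A_carrier)
        then have "cl (hmon ?\<phi> ?a) \<in> G"
          unfolding G_def mem_Collect_eq by (intro exI)
        then have "cl (hmon ?\<phi> ?a) \<in> L"
          using GL by blast
        moreover have "hmon ?\<phi> ?a \<in> HC"
          using insert.prems by (intro HC_hmon HC_symb_holomorphic f a) auto
        moreover have "(\<Sum>M\<in>S. hmon (\<lambda>z. symb z (f z) M) (monomial (sorted_word M))) \<in> HC"
          using insert.prems by (intro HC_sum HC_hmon HC_symb_holomorphic f a) auto
        moreover have "cl (\<Sum>M\<in>S. hmon (\<lambda>z. symb z (f z) M) (monomial (sorted_word M))) \<in> L"
          using insert.prems by (intro insert.IH) simp
        ultimately show ?case
          unfolding sum.insert[OF insert.hyps] by (metis (no_types, lifting) A_add Ladd)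
      qed
    qed
    show "X \<in> topol A closure_of lin_span A G"
      unfolding in_closure_of
    proof (intro conjI allI impI)
      show "X \<in> topspace (topol A)"
        using f by simp
      fix T assume T: "X \<in> T \<and> openin (topol A) T"
      then obtain D where D: "htrunc D f \<in> {f \<in> HC. cl f \<in> T}"
        using htrunc_eventually[OF f(1), of "{f \<in> HC. cl f \<in> T}"] f by (auto simp: openin_A)
      have set: "set_mset M \<subseteq> {1..n}" if "M \<in> mset ` short_words D" for M
        using that by (auto simp: short_words_def mem_words)
      have "cl (nform D f) \<in> lin_span A G"
        unfolding nform_def by (rule span) (use set finite_short_words in auto)
      moreover have "nform D f \<in> HC"
        unfolding nform_def using set
        by (intro HC_sum HC_hmon HC_symb_holomorphic f Car_monomial) (auto simp: mem_words)
      then have "cl (nform D f) = cl (htrunc D f)"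
        using cl_eqI[OF HC_htrunc[OF f(1)] _ htrunc_nform[OF f(1)]] by metis
      ultimately show "\<exists>Y. Y \<in> lin_span A G \<and> Y \<in> T"
        using D by auto
    qed
  qed
  ultimately show ?thesis
    unfolding maximal_part_def G_def by blast
qed

section \<open>Points of the bundle and the operations in its fibres\<close>

abbreviation hc :: "free_series \<Rightarrow> complex \<Rightarrow> free_series" where
  "hc \<equiv> hmon (\<lambda>_. 1)"

lemma hc_HC: "a \<in> Car \<Longrightarrow> hc a \<in> HC"
  by (simp add: HC_hmon)

lemma hc_apply: "q \<noteq> 0 \<Longrightarrow> hc a q = a"
  by (simp add: hmon_def)

definition pt :: "complex \<Rightarrow> free_series \<Rightarrow> complex \<times> (complex \<Rightarrow> free_series) set set" where
  "pt q a = class_at A (cl (hc a)) q"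

lemma fst_pt [simp]: "fst (pt q a) = q"
  by (simp add: pt_def class_at_def)

text \<open>The symbol at \<open>q\<close> sees only the value of \<open>f\<close> at
  \<open>q\<close>. Hence points of the bundle can be written with constant functions, and the fibre
  becomes the quotient of \<open>Car\<close> by the kernel of \<open>symb q\<close>.\<close>

lemma class_at_cl:
  assumes q: "q \<noteq> 0" and f: "f \<in> HC" shows "class_at A (cl f) q = pt q (f q)"
proof -
  interpret quotient_presentation A "symb_at q" "MP q"
    by (rule MP_presentation[OF q])
  have g: "hc (f q) \<in> HC"
    using f by (simp add: hc_HC HC_Car)
  have "MP q +>\<^bsub>A\<^esub> cl f = MP q +>\<^bsub>A\<^esub> cl (hc (f q))"
    using f g q by (subst coset_eq_iff) (simp_all add: A_carrier symb_at_cl hc_apply)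
  then show ?thesis
    using q by (simp add: pt_def class_at_def maximal_part_eq)
qed

lemma pt_eq_iff:
  assumes q: "q \<noteq> 0" and a: "a \<in> Car" and b: "b \<in> Car"
  shows "pt q a = pt q' b \<longleftrightarrow> q = q' \<and> symb q a = symb q b"
proof -
  interpret quotient_presentation A "symb_at q" "MP q"
    by (rule MP_presentation[OF q])
  have "MP q +>\<^bsub>A\<^esub> cl (hc a) = MP q +>\<^bsub>A\<^esub> cl (hc b) \<longleftrightarrow> symb q a = symb q b"
    using q a b by (subst coset_eq_iff) (simp_all add: A_carrier symb_at_cl hc_apply hc_HC)
  then show ?thesis
    using q by (cases "q = q'") (simp_all add: pt_def class_at_def maximal_part_eq)
qed

lemma snd_pt:
  assumes q: "q \<noteq> 0" and a: "a \<in> Car"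
  shows "snd (pt q a) = {cl f | f. f \<in> HC \<and> symb q (f q) = symb q a}"
proof -
  interpret quotient_presentation A "symb_at q" "MP q"
    by (rule MP_presentation[OF q])
  have "MP q +>\<^bsub>A\<^esub> cl (hc a) = {X \<in> carrier A. symb_at q X = symb_at q (cl (hc a))}"
    using a by (intro coset) (simp add: A_carrier hc_HC)
  also have "symb_at q (cl (hc a)) = symb q a"
    using q a by (simp add: symb_at_cl hc_HC hc_apply)
  also have "{X \<in> carrier A. symb_at q X = symb q a} = {cl f | f. f \<in> HC \<and> symb q (f q) = symb q a}"
    unfolding A_carrier by (auto simp: symb_at_cl[OF q])
  finally show ?thesis
    using q by (simp add: pt_def class_at_def maximal_part_eq)
qed

abbreviation fib :: "complex \<Rightarrow> (complex, complex \<times> (complex \<Rightarrow> free_series) set set) module" where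
  "fib q \<equiv> tagged q (fibre_algebra A q)"

text \<open>Constant representatives hide the two layers of cosets; later computations in the fibres
  use \<open>pt\<close> alone.\<close>

lemma
  assumes q: "q \<noteq> 0"
  shows fib_carrier: "carrier (fib q) = pt q ` Car"
    and complex_algebra_fib: "complex_algebra (fib q)"
    and fib_zero: "\<zero>\<^bsub>fib q\<^esub> = pt q 0"
    and fib_add: "\<And>a b. a \<in> Car \<Longrightarrow> b \<in> Car \<Longrightarrow> pt q a \<oplus>\<^bsub>fib q\<^esub> pt q b = pt q (a + b)"
    and fib_mult: "\<And>a b. a \<in> Car \<Longrightarrow> b \<in> Car \<Longrightarrow> pt q a \<otimes>\<^bsub>fib q\<^esub> pt q b = pt q (conv a b)"
    and fib_smult: "\<And>c a. a \<in> Car \<Longrightarrow> c \<odot>\<^bsub>fib q\<^esub> pt q a = pt q (scale c a)"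
proof -
  interpret quotient_presentation A "symb_at q" "MP q"
    by (rule MP_presentation[OF q])
  have fa: "fibre_algebra A q = quotient_algebra A (MP q)"
    using q by (simp add: fibre_algebra_def maximal_part_eq)
  have cls: "(q, MP q +>\<^bsub>A\<^esub> cl f) = pt q (f q)" if "f \<in> HC" for f
    using class_at_cl[OF q that] q by (simp add: class_at_def maximal_part_eq)
  have pt: "pt q a = (q, MP q +>\<^bsub>A\<^esub> cl (hc a))" for a
    using q by (simp add: pt_def class_at_def maximal_part_eq)
  have car: "cl (hc a) \<in> carrier A" if "a \<in> Car" for a
    using that by (simp add: A_carrier hc_HC)
  show "carrier (fib q) = pt q ` Car"
  proof -
    have "carrier (fib q) = (\<lambda>f. pt q (f q)) ` HC"
      unfolding tagged_simps fa quotient_carrier A_carrier image_image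
      by (intro image_cong refl cls)
    also have "\<dots> = pt q ` (\<lambda>f. f q) ` HC"
      by (simp add: image_image)
    also have "(\<lambda>f. f q) ` HC = Car"
    proof
      show "Car \<subseteq> (\<lambda>f. f q) ` HC"
      proof
        fix a assume a: "a \<in> Car"
        show "a \<in> (\<lambda>f. f q) ` HC"
          by (rule image_eqI[where x = "hc a"]) (simp_all add: hc_apply[OF q] hc_HC[OF a])
      qed
    qed (auto simp: HC_Car)
    finally show ?thesis .
  qed
  show "complex_algebra (fib q)"
    unfolding fa by (rule complex_algebra_tagged[OF complex_algebra_quotient])
  show "\<zero>\<^bsub>fib q\<^esub> = pt q 0"
    using cls[OF HC_zero] by (simp add: tagged_simps fa quotient_zero A_zero)
  fix a b assume a: "a \<in> Car" and b: "b \<in> Car"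
  show "pt q a \<oplus>\<^bsub>fib q\<^esub> pt q b = pt q (a + b)"
    using cls[OF HC_add[OF hc_HC hc_HC], OF a b] q a b
    by (simp add: tagged_simps fa quotient_add car pt A_add hc_HC hc_apply)
  show "pt q a \<otimes>\<^bsub>fib q\<^esub> pt q b = pt q (conv a b)"
    using cls[OF HC_hmul[OF hc_HC hc_HC], OF a b] q a b
    by (simp add: tagged_simps fa quotient_mult car pt A_mult hc_HC hc_apply hmul_apply)
  fix c
  have "c \<odot>\<^bsub>H\<^esub> hc a \<in> HC"
    using complex_algebraD(3)[OF complex_algebra_H, of "hc a" c] a by (simp add: hc_HC)
  from cls[OF this] show "c \<odot>\<^bsub>fib q\<^esub> pt q a = pt q (scale c a)"
    using q a by (simp add: tagged_simps fa quotient_smult car pt A_smult[OF hc_HC hc_HC] hc_HC hc_apply H_smult_apply)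
qed

lemma fib_minus:
  assumes q: "q \<noteq> 0" and "a \<in> Car" "b \<in> Car"
  shows "pt q a \<ominus>\<^bsub>fib q\<^esub> pt q b = pt q (a - b)"
  using assms minus_eq_smult[OF complex_algebraD(2)[OF complex_algebra_fib[OF q]], of "pt q b" "pt q a"]
  by (simp add: fib_carrier fib_smult fib_add Car_scale scale_minus_one Car_uminus)

lemma E_total_eq: "E_total A = {pt q a | q a. q \<noteq> 0 \<and> a \<in> Car}"
proof -
  have "(q, X) \<in> E_total A \<longleftrightarrow> q \<noteq> 0 \<and> (q, X) \<in> carrier (fib q)" for q X
    by (auto simp: E_total_def tagged_simps)
  then have iff: "v \<in> E_total A \<longleftrightarrow> fst v \<noteq> 0 \<and> v \<in> carrier (fib (fst v))" for v
    by (cases v) simp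
  show ?thesis
  proof (intro equalityI subsetI)
    fix v assume "v \<in> E_total A"
    then have "fst v \<noteq> 0" "v \<in> pt (fst v) ` Car"
      using iff[of v] fib_carrier by auto
    then show "v \<in> {pt q a | q a. q \<noteq> 0 \<and> a \<in> Car}"
      by blast
  next
    fix v assume "v \<in> {pt q a | q a. q \<noteq> 0 \<and> a \<in> Car}"
    then obtain q a where "q \<noteq> 0" "a \<in> Car" "v = pt q a"
      by blast
    then show "v \<in> E_total A"
      unfolding iff by (simp add: fib_carrier)
  qed
qed

lemma E_totalE:
  assumes "v \<in> E_total A" obtains q a where "q \<noteq> 0" "a \<in> Car" "v = pt q a"
  using assms by (auto simp: E_total_eq)

lemma pt_E_total: "q \<noteq> 0 \<Longrightarrow> a \<in> Car \<Longrightarrow> pt q a \<in> E_total A"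
  by (auto simp: E_total_eq)

section \<open>Seminorms on the bundle\<close>

text \<open>The choice of a representative is harmless since \<open>Q\<close> depends only on the
  symbol. No cut-off is present: these norms describe a single fibre, but their balls need not
  belong to the uniform structure.\<close>

definition nm :: "nat \<Rightarrow> complex \<times> (complex \<Rightarrow> free_series) set set \<Rightarrow> real" where
  "nm i v = Q i (fst v) (SOME a. a \<in> Car \<and> v = pt (fst v) a)"

lemma nm_pt:
  assumes q: "q \<noteq> 0" and a: "a \<in> Car" shows "nm i (pt q a) = Q i q a"
proof -
  let ?b = "SOME b. b \<in> Car \<and> pt q a = pt q b"
  have "?b \<in> Car \<and> pt q a = pt q ?b"
    by (rule someI[where P = "\<lambda>b. b \<in> Car \<and> pt q a = pt q b" and x = a]) (simp add: a)
  then have "symb q a = symb q ?b"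
    using pt_eq_iff[OF q a] by blast
  then show ?thesis
    unfolding nm_def fst_pt by (rule Q_cong[OF sym])
qed

text \<open>
  Continuous cut-offs, positive exactly where \<open>|q| + 1 / |q| < k\<close>; the value at \<open>0\<close> is set
  separately because \<open>1 / 0 = 0\<close>.
\<close>

definition cut :: "nat \<Rightarrow> complex \<Rightarrow> real" where
  "cut k q = (if q = 0 then 0 else max 0 (real k - cmod q - 1 / cmod q))"

lemma cut_nonneg: "0 \<le> cut k q"
  by (simp add: cut_def)

lemma cut_le: "cut k q \<le> real k"
proof -
  have "0 \<le> 1 / cmod q" "0 \<le> cmod q"
    by simp_all
  then have "real k - cmod q - 1 / cmod q \<le> real k"
    by linarith
  then show ?thesis
    unfolding cut_def by (simp only: max.bounded_iff split: if_split) simp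
qed

lemma cut_mono: "k \<le> l \<Longrightarrow> cut k q \<le> cut l q"
  by (auto simp: cut_def)

lemma cut_Suc: "cut k q \<noteq> 0 \<Longrightarrow> 1 \<le> cut (Suc k) q"
  by (auto simp: cut_def max_def split: if_splits)

lemma continuous_cut: "continuous_on punctured_plane (cut k)"
proof -
  have "continuous_on punctured_plane (\<lambda>q. max 0 (real k - cmod q - 1 / cmod q))"
    by (intro continuous_intros) auto
  then show ?thesis
    by (rule continuous_on_eq) (auto simp: cut_def)
qed

text \<open>The inner radius uses \<open>real k + 1\<close> because \<open>1 / 0 = 0\<close>: for
  \<open>k = 0\<close> the set is then empty instead of \<open>{0}\<close>.\<close>

definition annulus :: "nat \<Rightarrow> complex set" where
  "annulus k = cball 0 (real k) - ball 0 (1 / (real k + 1))"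

lemma compact_annulus: "compact (annulus k)" and annulus_punctured: "annulus k \<subseteq> punctured_plane"
  unfolding annulus_def by (auto intro: compact_diff)

lemma cut_eq_0: "q \<notin> annulus k \<Longrightarrow> cut k q = 0"
proof (cases "q = 0")
  case False
  assume "q \<notin> annulus k"
  then have "real k < cmod q \<or> cmod q < 1 / (real k + 1)"
    by (auto simp: annulus_def)
  moreover have "real k + 1 < 1 / cmod q" if "cmod q < 1 / (real k + 1)"
    using that False by (simp add: field_simps)
  moreover have "0 < 1 / cmod q" "0 < cmod q"
    using False by simp_all
  ultimately have "real k - cmod q - 1 / cmod q \<le> 0"
    by linarith
  then show ?thesis
    by (simp add: cut_def)
qed (simp add: cut_def)

definition bn :: "nat \<Rightarrow> nat \<Rightarrow> complex \<times> (complex \<Rightarrow> free_series) set set \<Rightarrow> real" where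
  "bn k i v = cut k (fst v) * nm i v"

definition BN :: "(complex \<times> (complex \<Rightarrow> free_series) set set \<Rightarrow> real) set" where
  "BN = {bn k i | k i. True}"

lemma bn_pt: "q \<noteq> 0 \<Longrightarrow> a \<in> Car \<Longrightarrow> bn k i (pt q a) = cut k q * Q i q a"
  by (simp add: bn_def nm_pt)

lemma bn_mono:
  assumes "k \<le> l" "i \<le> j" "v \<in> E_total A" shows "bn k i v \<le> bn l j v"
proof -
  obtain q a where v: "q \<noteq> 0" "a \<in> Car" "v = pt q a"
    using assms(3) by (rule E_totalE)
  have "Q i q a \<le> Q j q a"
    using assms(2) by (rule lift_Suc_mono_le[of "\<lambda>i. Q i q a", rotated]) (rule Q_incr[OF v(2)])
  then show ?thesis
    unfolding v(3) bn_pt[OF v(1,2)] by (intro mult_mono cut_mono assms cut_nonneg Q_nonneg v)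
qed

section \<open>Comparison of quotient seminorms with the cut-off fibre norms\<close>

lemma quotient_seminorm_pt:
  assumes q: "q \<noteq> 0" and a: "a \<in> Car"
  shows "quotient_seminorm \<nu> (pt q a) = Inf {\<nu> (cl f) | f. f \<in> HC \<and> symb q (f q) = symb q a}"
proof -
  have "\<nu> ` {cl f | f. f \<in> HC \<and> symb q (f q) = symb q a} = {\<nu> (cl f) | f. f \<in> HC \<and> symb q (f q) = symb q a}"
    by auto
  then show ?thesis
    using assms by (simp add: quotient_seminorm_def snd_pt)
qed

lemma
  assumes \<nu>: "seminorm_on A \<nu>" and q: "q \<noteq> 0" and a: "a \<in> Car"
  shows quotient_seminorm_le: "f \<in> HC \<Longrightarrow> symb q (f q) = symb q a \<Longrightarrow> quotient_seminorm \<nu> (pt q a) \<le> \<nu> (cl f)"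
    and quotient_seminorm_ge: "(\<And>f. f \<in> HC \<Longrightarrow> symb q (f q) = symb q a \<Longrightarrow> x \<le> \<nu> (cl f)) \<Longrightarrow>
      x \<le> quotient_seminorm \<nu> (pt q a)"
proof -
  have "bdd_below {\<nu> (cl f) | f. f \<in> HC \<and> symb q (f q) = symb q a}"
    using \<nu> by (intro bdd_belowI[of _ 0]) (auto simp: seminorm_on_def A_carrier)
  then show "f \<in> HC \<Longrightarrow> symb q (f q) = symb q a \<Longrightarrow> quotient_seminorm \<nu> (pt q a) \<le> \<nu> (cl f)"
    unfolding quotient_seminorm_pt[OF q a] by (intro cInf_lower) auto
  have "hc a \<in> HC" "symb q (hc a q) = symb q a"
    using q a by (simp_all add: hc_HC hc_apply)
  then have "{\<nu> (cl f) | f. f \<in> HC \<and> symb q (f q) = symb q a} \<noteq> {}"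
    by blast
  then show "(\<And>f. f \<in> HC \<Longrightarrow> symb q (f q) = symb q a \<Longrightarrow> x \<le> \<nu> (cl f)) \<Longrightarrow>
      x \<le> quotient_seminorm \<nu> (pt q a)"
    unfolding quotient_seminorm_pt[OF q a] by (rule cInf_greatest) auto
qed

text \<open>The open unit ball of \<open>\<nu>\<close> contains a ball around zero for one compact
  set and one norm; homogeneity turns this into a bound.\<close>

lemma continuous_seminorm_bounded:
  assumes "continuous_seminorm A \<nu>"
  shows "\<exists>K i C. compact K \<and> K \<subseteq> punctured_plane \<and> 0 < C \<and>
    (\<forall>f\<in>HC. \<forall>t\<ge>0. (\<forall>z\<in>K. N i (f z) \<le> t) \<longrightarrow> \<nu> (cl f) \<le> C * t)"
proof -
  have sem: "seminorm_on A \<nu>" and cont: "continuous_map (topol A) euclideanreal \<nu>"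
    using assms by (auto simp: continuous_seminorm_def)
  have sc: "\<nu> (cl (c \<odot>\<^bsub>H\<^esub> f)) = cmod c * \<nu> (cl f)" if "f \<in> HC" for c f
    using sem that unfolding seminorm_on_def A_carrier by (metis A_smult imageI)
  have "openin (topol A) {X \<in> topspace (topol A). \<nu> X \<in> {..<1}}"
    using cont by (rule openin_continuous_map_preimage) simp
  then have op: "openin TH {f \<in> HC. cl f \<in> {X \<in> topspace (topol A). \<nu> X \<in> {..<1}}}" (is "openin TH ?U")
    unfolding openin_A by blast
  have "0 \<odot>\<^bsub>H\<^esub> 0 = (0 :: complex \<Rightarrow> free_series)"
    by (rule ext) (simp add: H_smult_apply)
  then have "\<nu> (cl 0) = 0"
    using sc[OF HC_zero, of 0] by simp
  then have "0 \<in> ?U"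
    using HC_zero by (auto intro: imageI)
  from nbhd_zero_contains_ball[OF op this] obtain K i e where
    K: "compact K" "K \<subseteq> punctured_plane" "0 < e" "\<forall>f\<in>HC. (\<forall>z\<in>K. N i (f z) < e) \<longrightarrow> f \<in> ?U"
    by (elim exE conjE)
  have "\<nu> (cl f) \<le> 1 / e * t" if f: "f \<in> HC" and t: "0 \<le> t" and le: "\<forall>z\<in>K. N i (f z) \<le> t" for f t
  proof -
    \<comment> \<open>Scaling by \<open>e / s\<close> with \<open>s > t\<close> makes the strict
      inequality available, also when \<open>t = 0\<close>; afterwards \<open>s\<close> decreases to
      \<open>t\<close>.\<close>
    have "\<nu> (cl f) \<le> s / e" if s: "t < s" for s
    proof -
      let ?c = "complex_of_real (e / s)"
      have s0: "0 < s" "cmod ?c = e / s"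
        using s t K(3) by (simp_all add: norm_divide)
      have cH: "?c \<odot>\<^bsub>H\<^esub> f \<in> HC"
        using complex_algebraD(3)[OF complex_algebra_H, of f ?c] f by simp
      have "N i ((?c \<odot>\<^bsub>H\<^esub> f) z) < e" if "z \<in> K" for z
      proof -
        have "N i ((?c \<odot>\<^bsub>H\<^esub> f) z) = e / s * N i (f z)"
          unfolding H_smult_apply N_scale[OF HC_Car[OF f]] s0(2) ..
        also have "\<dots> \<le> e / s * t"
          using bspec[OF le that] s0 K(3) by (intro mult_left_mono) auto
        also have "\<dots> < e"
          using s s0 K(3) by (simp add: field_simps)
        finally show ?thesis .
      qed
      then have "\<nu> (cl (?c \<odot>\<^bsub>H\<^esub> f)) < 1"
        using K(4) cH by auto
      then have "e / s * \<nu> (cl f) < 1"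
        unfolding sc[OF f] s0(2) .
      then show ?thesis
        using s0(1) K(3) by (simp add: field_simps)
    qed
    then have "\<nu> (cl f) * e \<le> s" if "t < s" for s
      using K(3) that by (simp add: pos_le_divide_eq)
    then have "\<nu> (cl f) * e \<le> t"
      by (rule dense_ge)
    then show ?thesis
      using K(3) by (simp add: field_simps)
  qed
  then show ?thesis
    using K(1-3) by (intro exI[of _ K] exI[of _ i] exI[of _ "1 / e"]) simp
qed

text \<open>
  Away from a large annulus the quotient seminorms vanish: a constant lift may be multiplied by
  a high power of \<open>z / q\<close> or \<open>q / z\<close>.
\<close>

lemma quotient_seminorm_dominated:
  assumes \<nu>: "continuous_seminorm A \<nu>"
  obtains k i C where "0 < C" "\<And>v. v \<in> E_total A \<Longrightarrow> quotient_seminorm \<nu> v \<le> C * bn k i v"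
proof -
  have sem: "seminorm_on A \<nu>"
    using \<nu> by (simp add: continuous_seminorm_def)
  obtain K i C where K: "compact K" "K \<subseteq> punctured_plane" "0 < C"
    and "\<forall>f\<in>HC. \<forall>t\<ge>0. (\<forall>z\<in>K. N i (f z) \<le> t) \<longrightarrow> \<nu> (cl f) \<le> C * t"
    using continuous_seminorm_bounded[OF \<nu>] by (elim exE conjE)
  then have bound: "\<nu> (cl f) \<le> C * t" if "f \<in> HC" "0 \<le> t" "\<And>z. z \<in> K \<Longrightarrow> N i (f z) \<le> t" for f t
    using that by blast
  have "bounded ((\<lambda>z. cmod z + 1 / cmod z) ` K)"
    using K(1,2) by (intro compact_imp_bounded compact_continuous_image continuous_intros) auto
  then obtain R0 where R0: "\<And>z. z \<in> K \<Longrightarrow> cmod z + 1 / cmod z \<le> R0"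
    by (force simp: bounded_iff)
  \<comment> \<open>\<open>R\<close> bounds both \<open>cmod z\<close> and \<open>1 / cmod z\<close>
    on \<open>K\<close>; the maximum with \<open>1\<close> keeps it positive even when
    \<open>K\<close> is empty.\<close>
  define R where "R = max 1 R0"
  have R: "1 \<le> R" "cmod z \<le> R" "1 / cmod z \<le> R" if "z \<in> K" for z
  proof -
    have "0 < cmod z" "0 < 1 / cmod z"
      using that K(2) by auto
    then show "1 \<le> R" "cmod z \<le> R" "1 / cmod z \<le> R"
      using R0[OF that] max.cobounded1[of 1 R0] max.cobounded2[of R0 1] unfolding R_def by linarith+
  qed
  have R1: "1 \<le> R"
    by (simp add: R_def)
  \<comment> \<open>This gives \<open>cut k q \<ge> 1\<close> whenever \<open>cmod q\<close> and
    \<open>1 / cmod q\<close> are at most \<open>R\<close>.\<close>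
  obtain k where k: "2 * R + 1 \<le> real k"
    using real_arch_simple by blast
  have near: "quotient_seminorm \<nu> (pt q a) \<le> C * Q i q a" if q: "q \<noteq> 0" and a: "a \<in> Car" for q a
  proof -
    have "quotient_seminorm \<nu> (pt q a) / C \<le> Q i q a"
    proof (rule Q_greatest[OF a])
      fix b assume b: "b \<in> Car" "symb q b = symb q a"
      have "quotient_seminorm \<nu> (pt q a) \<le> \<nu> (cl (hc b))"
        using q a b by (intro quotient_seminorm_le sem) (simp_all add: hc_HC hc_apply)
      also have "\<dots> \<le> C * N i b"
        using K(2) by (intro bound hc_HC b N_nonneg) (auto simp: hmon_def)
      finally show "quotient_seminorm \<nu> (pt q a) / C \<le> N i b"
        using K(3) by (simp add: field_simps)
    qed
    then show ?thesis
      using K(3) by (simp add: field_simps)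
  qed
  have far: "quotient_seminorm \<nu> (pt q a) \<le> 0"
    if q: "q \<noteq> 0" and a: "a \<in> Car" and h: "h holomorphic_on punctured_plane" "h q = 1"
      and x: "0 \<le> x" "x < 1" "\<And>z. z \<in> K \<Longrightarrow> cmod (h z) \<le> x" for q a h x
  proof (rule tendsto_lowerbound)
    show "(\<lambda>m. C * (x ^ m * N i a)) \<longlonglongrightarrow> 0"
      using tendsto_mult_right_zero[OF tendsto_mult_left_zero[OF LIMSEQ_power_zero[of x]], of C "N i a"] x by simp
    have "quotient_seminorm \<nu> (pt q a) \<le> C * (x ^ m * N i a)" for m
    proof -
      let ?f = "hmon (\<lambda>z. h z ^ m) a"
      have f: "?f \<in> HC"
        using h(1) a by (intro HC_hmon holomorphic_intros)
      have "quotient_seminorm \<nu> (pt q a) \<le> \<nu> (cl ?f)"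
        using q a h(2) f by (intro quotient_seminorm_le sem) (simp_all add: hmon_def)
      also have "\<dots> \<le> C * (x ^ m * N i a)"
      proof (rule bound[OF f])
        show "0 \<le> x ^ m * N i a"
          using x(1) a by (simp add: N_nonneg)
        fix z assume z: "z \<in> K"
        then have "N i (?f z) = cmod (h z) ^ m * N i a"
          using K(2) a by (auto simp: hmon_def N_scale norm_power)
        also have "\<dots> \<le> x ^ m * N i a"
          using x(3)[OF z] a by (intro mult_right_mono power_mono N_nonneg) auto
        finally show "N i (?f z) \<le> x ^ m * N i a" .
      qed
      finally show ?thesis .
    qed
    then show "\<forall>\<^sub>F m in sequentially. quotient_seminorm \<nu> (pt q a) \<le> C * (x ^ m * N i a)"
      by (intro always_eventually allI)
  qed simp
  have "quotient_seminorm \<nu> (pt q a) \<le> C * bn k i (pt q a)" if q: "q \<noteq> 0" and a: "a \<in> Car" for q a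
  proof -
    have nonneg: "0 \<le> C * bn k i (pt q a)"
      using K(3) q a by (simp add: bn_pt cut_nonneg Q_nonneg)
    consider "cmod q \<le> R" "1 / cmod q \<le> R" | "R < cmod q" | "R < 1 / cmod q"
      by linarith
    then show ?thesis
    proof cases
      case 1
      then have "1 \<le> cut k q"
        using k q by (simp add: cut_def)
      then have "1 * Q i q a \<le> bn k i (pt q a)"
        unfolding bn_pt[OF q a] by (intro mult_right_mono Q_nonneg a)
      then show ?thesis
        using near[OF q a] K(3) by (smt (verit) mult_left_mono)
    next
      case 2
      have "quotient_seminorm \<nu> (pt q a) \<le> 0"
      proof (rule far[OF q a, of "\<lambda>z. z / q" "R / cmod q"])
        show "cmod (z / q) \<le> R / cmod q" if "z \<in> K" for z
          using R(2)[OF that] by (simp add: norm_divide divide_right_mono)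
      qed (use 2 q R1 in \<open>auto intro!: holomorphic_intros simp: field_simps\<close>)
      with nonneg show ?thesis
        by linarith
    next
      case 3
      have "quotient_seminorm \<nu> (pt q a) \<le> 0"
      proof (rule far[OF q a, of "\<lambda>z. q / z" "R * cmod q"])
        show "cmod (q / z) \<le> R * cmod q" if "z \<in> K" for z
          using mult_right_mono[OF R(3)[OF that], of "cmod q"] by (simp add: norm_divide)
        show "R * cmod q < 1"
          using 3 q by (simp add: field_simps)
      qed (use q R1 in \<open>auto intro!: holomorphic_intros\<close>)
      with nonneg show ?thesis
        by linarith
    qed
  qed
  then have "quotient_seminorm \<nu> v \<le> C * bn k i v" if "v \<in> E_total A" for v
    using that by (auto elim: E_totalE)
  with K(3) show thesis
    by (rule that)
qed

lemma HC_bounded: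
  assumes f: "f \<in> HC" and K: "compact K" "K \<subseteq> punctured_plane"
  obtains B where "\<And>z. z \<in> K \<Longrightarrow> N i (f z) \<le> B"
proof -
  have "continuous_on K (\<lambda>z. N i (f z))"
    unfolding continuous_on_def
  proof
    fix z assume z: "z \<in> K"
    have "((\<lambda>w. N i (f w - f z)) \<longlongrightarrow> 0) (at z within K)"
      using z K(2) by (intro tendsto_mono[OF at_le[OF subset_UNIV] HC_tendsto[OF f]]) auto
    then have "((\<lambda>w. N i (f w) - N i (f z)) \<longlongrightarrow> 0) (at z within K)"
    proof (rule Lim_null_comparison[rotated])
      have "norm (N i (f w) - N i (f z)) \<le> N i (f w - f z)" for w
        using N_add[OF Car_diff[OF HC_Car[OF f, of w] HC_Car[OF f, of z]] HC_Car[OF f, of z], of i]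
          N_add[OF Car_diff[OF HC_Car[OF f, of z] HC_Car[OF f, of w]] HC_Car[OF f, of w], of i]
          N_minus_commute[OF HC_Car[OF f, of w] HC_Car[OF f, of z], of i] by simp
      then show "\<forall>\<^sub>F w in at z within K. norm (N i (f w) - N i (f z)) \<le> N i (f w - f z)"
        by (intro always_eventually allI)
    qed
    then show "((\<lambda>z. N i (f z)) \<longlongrightarrow> N i (f z)) (at z within K)"
      by (simp add: LIM_zero_iff)
  qed
  then have "bounded ((\<lambda>z. N i (f z)) ` K)"
    using K(1) by (intro compact_imp_bounded compact_continuous_image)
  then obtain B where "\<And>z. z \<in> K \<Longrightarrow> norm (N i (f z)) \<le> B"
    by (auto simp: bounded_iff)
  then show thesis
    by (intro that[of B]) (simp add: N_nonneg HC_Car f)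
qed

text \<open>A seminorm on the algebra built from the cut-off norms of all fibres at once. Its
  quotient seminorm dominates \<open>bn k i\<close>, which gives the counterpart to the domination
  proved above.\<close>

definition supn :: "nat \<Rightarrow> nat \<Rightarrow> (complex \<Rightarrow> free_series) set \<Rightarrow> real" where
  "supn k i X = (SUP q. cut k q * Q i q ((SOME f. f \<in> X) q))"

lemma supn_cl:
  assumes f: "f \<in> HC" shows "supn k i (cl f) = (SUP q. cut k q * Q i q (f q))"
proof -
  have "f \<in> cl f"
    using f by (simp add: mem_cl)
  then have "(SOME g. g \<in> cl f) \<in> cl f"
    by (rule someI[where P = "\<lambda>g. g \<in> cl f"])
  then have g: "(SOME g. g \<in> cl f) \<in> HC" "cl (SOME g. g \<in> cl f) = cl f"
    using mem_cl[OF f] by blast+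
  have "cut k q * Q i q ((SOME g. g \<in> cl f) q) = cut k q * Q i q (f q)" for q
  proof (cases "q = 0")
    case False
    then have "symb q ((SOME g. g \<in> cl f) q) = symb q (f q)"
      using g(2) cl_eq_iff[OF g(1) f] by blast
    then show ?thesis
      using Q_cong by metis
  qed (simp add: cut_def)
  then show ?thesis
    unfolding supn_def by (intro SUP_cong refl)
qed

text \<open>\<open>cut k\<close> vanishes off a compact annulus and \<open>f\<close> is bounded on
  it, so the supremum is one of a bounded set.\<close>

lemma
  assumes f: "f \<in> HC"
  shows supn_upper: "cut k q * Q i q (f q) \<le> supn k i (cl f)"
    and supn_least: "(\<And>q. cut k q * Q i q (f q) \<le> x) \<Longrightarrow> supn k i (cl f) \<le> x"
proof -
  obtain B where B: "\<And>z. z \<in> annulus k \<Longrightarrow> N i (f z) \<le> B"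
    using HC_bounded[OF f compact_annulus annulus_punctured] by blast
  have "cut k q * Q i q (f q) \<le> real k * max B 0" for q
  proof (cases "q \<in> annulus k")
    case True
    then have "Q i q (f q) \<le> max B 0"
      using Q_le_self[OF HC_Car[OF f], of i q q] B[OF True] by simp
    then show ?thesis
      by (intro mult_mono cut_le) (simp_all add: Q_nonneg HC_Car[OF f])
  qed (simp add: cut_eq_0)
  then have "bdd_above (range (\<lambda>q. cut k q * Q i q (f q)))"
    by (intro bdd_aboveI[of _ "real k * max B 0"]) auto
  then show "cut k q * Q i q (f q) \<le> supn k i (cl f)"
    unfolding supn_cl[OF f] by (intro cSUP_upper) auto
  show "(\<And>q. cut k q * Q i q (f q) \<le> x) \<Longrightarrow> supn k i (cl f) \<le> x"
    unfolding supn_cl[OF f] by (intro cSUP_least) auto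
qed

lemma seminorm_supn: "seminorm_on A (supn k i)"
  unfolding seminorm_on_def A_carrier
proof (intro conjI ballI allI; elim imageE; hypsubst)
  fix f assume f: "f \<in> HC"
  show "0 \<le> supn k i (cl f)"
    using supn_upper[OF f, of k 0 i] by (simp add: cut_def)
next
  fix f g assume f: "f \<in> HC" and g: "g \<in> HC"
  have "cut k q * Q i q ((f + g) q) \<le> supn k i (cl f) + supn k i (cl g)" for q
  proof -
    have "cut k q * Q i q ((f + g) q) \<le> cut k q * (Q i q (f q) + Q i q (g q))"
      unfolding plus_fun_apply[of f g q] by (intro mult_left_mono Q_add cut_nonneg HC_Car[OF f] HC_Car[OF g])
    then show ?thesis
      using supn_upper[OF f, of k q i] supn_upper[OF g, of k q i] by (simp add: distrib_left)
  qed
  then show "supn k i (cl f \<oplus>\<^bsub>A\<^esub> cl g) \<le> supn k i (cl f) + supn k i (cl g)"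
    unfolding A_add[OF f g] by (intro supn_least HC_add f g)
next
  fix c f assume f: "f \<in> HC"
  have cH: "d \<odot>\<^bsub>H\<^esub> g \<in> HC" if "g \<in> HC" for d g
    using complex_algebraD(3)[OF complex_algebra_H, of g d] that by simp
  have eq: "cut k q * Q i q ((d \<odot>\<^bsub>H\<^esub> g) q) = cmod d * (cut k q * Q i q (g q))" if "g \<in> HC" for d g q
    unfolding H_smult_apply Q_scale[OF HC_Car[OF that]] by simp
  have le: "supn k i (cl (d \<odot>\<^bsub>H\<^esub> g)) \<le> cmod d * supn k i (cl g)" if "g \<in> HC" for d g
    by (rule supn_least[OF cH[OF that]]) (simp add: eq[OF that] mult_left_mono supn_upper[OF that])
  show "supn k i (c \<odot>\<^bsub>A\<^esub> cl f) = cmod c * supn k i (cl f)"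
    unfolding A_smult[OF f f]
  proof (cases "c = 0")
    case True
    then have "\<And>q. cut k q * Q i q ((c \<odot>\<^bsub>H\<^esub> f) q) = 0"
      using eq[OF f, of _ c] by simp
    then have "supn k i (cl (c \<odot>\<^bsub>H\<^esub> f)) = (SUP q :: complex. 0)"
      unfolding supn_cl[OF cH[OF f]] by (intro SUP_cong refl)
    then show "supn k i (cl (c \<odot>\<^bsub>H\<^esub> f)) = cmod c * supn k i (cl f)"
      using True by simp
  next
    case False
    have "(1 / c) \<odot>\<^bsub>H\<^esub> (c \<odot>\<^bsub>H\<^esub> f) = f"
      using False by (intro ext) (simp add: H_smult_apply)
    then have "supn k i (cl f) \<le> cmod (1 / c) * supn k i (cl (c \<odot>\<^bsub>H\<^esub> f))"
      using le[OF cH[OF f], of "1 / c" c] by simp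
    then show "supn k i (cl (c \<odot>\<^bsub>H\<^esub> f)) = cmod c * supn k i (cl f)"
      using le[OF f, of c] False by (simp add: norm_divide field_simps)
  qed
qed

text \<open>Only the annulus matters because \<open>cut k\<close> vanishes off it, and
  \<open>cut k q \<le> real k\<close> yields the factor.\<close>

lemma supn_diff:
  assumes f: "f \<in> HC" and g: "g \<in> HC" and e: "0 \<le> e" and le: "\<And>z. z \<in> annulus k \<Longrightarrow> N i (f z - g z) \<le> e"
  shows "supn k i (cl f) \<le> supn k i (cl g) + real k * e"
proof (rule supn_least[OF f])
  fix q
  show "cut k q * Q i q (f q) \<le> supn k i (cl g) + real k * e"
  proof (cases "q \<in> annulus k")
    case True
    have c: "f q - g q \<in> Car" "g q \<in> Car"
      using f g by (simp_all add: HC_Car Car_diff)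
    have "Q i q (f q) \<le> Q i q (f q - g q) + Q i q (g q)"
      using Q_add[OF c, of i q] by simp
    also have "\<dots> \<le> e + Q i q (g q)"
      using Q_le_self[OF c(1), of i q] le[OF True] by simp
    finally have "cut k q * Q i q (f q) \<le> cut k q * (e + Q i q (g q))"
      by (intro mult_left_mono cut_nonneg)
    also have "\<dots> = cut k q * e + cut k q * Q i q (g q)"
      by (rule distrib_left)
    also have "\<dots> \<le> real k * e + supn k i (cl g)"
      by (intro add_mono mult_right_mono cut_le e supn_upper g)
    finally show ?thesis
      by simp
  next
    case False
    have "0 \<le> supn k i (cl g)"
      using supn_upper[OF g, of k 0 i] by (simp add: cut_def)
    with False e show ?thesis
      by (simp add: cut_eq_0)
  qed
qed

lemma continuous_seminorm_supn: "continuous_seminorm A (supn k i)"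
proof -
  have "openin (topol A) {X \<in> cl ` HC. supn k i X \<in> V}" if V: "open V" for V
    unfolding openin_A
  proof (intro conjI)
    show "openin TH {f \<in> HC. cl f \<in> {X \<in> cl ` HC. supn k i X \<in> V}}"
    proof (subst openin_subopen, intro ballI)
      fix f assume "f \<in> {f \<in> HC. cl f \<in> {X \<in> cl ` HC. supn k i X \<in> V}}"
      then have f: "f \<in> HC" and fV: "supn k i (cl f) \<in> V"
        by auto
      obtain e where e: "0 < e" "\<And>x. dist x (supn k i (cl f)) < e \<Longrightarrow> x \<in> V"
        using V fV by (auto simp: open_dist)
      let ?e = "e / (real k + 1)"
      have e': "0 < ?e" "real k * ?e < e"
        using e(1) by (simp_all add: field_simps)
      obtain U where U: "openin TH U" "f \<in> U" "\<And>g z. g \<in> U \<Longrightarrow> z \<in> annulus k \<Longrightarrow> N i (g z - f z) < ?e"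
        using uniform_nbhd[OF f compact_annulus annulus_punctured e'(1)] by blast
      have "supn k i (cl g) \<in> V" if g: "g \<in> U" for g
      proof (rule e(2))
        have gH: "g \<in> HC"
          using openin_subset[OF U(1)] g by auto
        have le: "N i (g z - f z) \<le> ?e" "N i (f z - g z) \<le> ?e" if "z \<in> annulus k" for z
          using U(3)[OF g that] N_minus_commute[OF HC_Car[OF f, of z] HC_Car[OF gH, of z], of i] by simp_all
        show "dist (supn k i (cl g)) (supn k i (cl f)) < e"
          using supn_diff[where k = k, OF gH f less_imp_le[OF e'(1)] le(1)]
            supn_diff[where k = k, OF f gH less_imp_le[OF e'(1)] le(2)] e'(2)
          unfolding dist_real_def by linarith
      qed
      then show "\<exists>T. openin TH T \<and> f \<in> T \<and> T \<subseteq> {f \<in> HC. cl f \<in> {X \<in> cl ` HC. supn k i X \<in> V}}"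
        using U(1,2) openin_subset[OF U(1)] by (intro exI[of _ U]) auto
    qed
  qed auto
  then have "continuous_map (topol A) euclideanreal (supn k i)"
    by (auto simp: continuous_map_def)
  then show ?thesis
    using seminorm_supn by (simp add: continuous_seminorm_def)
qed

text \<open>Every lift of the point has the same value of \<open>Q\<close> at \<open>q\<close>, and
  this value enters the supremum.\<close>

lemma bn_le_quotient_seminorm: "v \<in> E_total A \<Longrightarrow> bn k i v \<le> quotient_seminorm (supn k i) v"
proof (elim E_totalE)
  fix q a assume q: "q \<noteq> 0" and a: "a \<in> Car" and v: "v = pt q a"
  show "bn k i v \<le> quotient_seminorm (supn k i) v"
    unfolding v bn_pt[OF q a]
  proof (rule quotient_seminorm_ge[OF seminorm_supn q a])
    fix f assume f: "f \<in> HC" "symb q (f q) = symb q a"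
    show "cut k q * Q i q a \<le> supn k i (cl f)"
      using supn_upper[OF f(1), of k q i] Q_cong[OF f(2), of i] by simp
  qed
qed

section \<open>The topology of the bundle\<close>

abbreviation XF :: "(complex \<times> free_series) topology" where
  "XF \<equiv> prod_topology (top_of_set punctured_plane) TF"

lemma openin_XF:
  "openin XF S \<longleftrightarrow> S \<subseteq> punctured_plane \<times> Car \<and> (\<forall>q0 a0. (q0, a0) \<in> S \<longrightarrow>
    (\<exists>\<delta>>0. \<exists>i. \<exists>e>0. \<forall>q a. q \<noteq> 0 \<longrightarrow> dist q q0 < \<delta> \<longrightarrow> a \<in> Car \<longrightarrow> N i (a - a0) < e \<longrightarrow> (q, a) \<in> S))"
proof (intro iffI conjI allI impI)
  assume S: "openin XF S"
  then show "S \<subseteq> punctured_plane \<times> Car"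
    using openin_subset by fastforce
  fix q0 a0 assume "(q0, a0) \<in> S"
  from S[unfolded openin_prod_topology_alt, rule_format, OF this]
  obtain U V where UV: "openin (top_of_set punctured_plane) U" "openin TF V" "q0 \<in> U" "a0 \<in> V" "U \<times> V \<subseteq> S"
    by (elim exE conjE)
  obtain T where T: "open T" "U = punctured_plane \<inter> T"
    using UV(1) by (auto simp: openin_open)
  obtain \<delta> where \<delta>: "\<delta> > 0" "\<And>q. dist q q0 < \<delta> \<Longrightarrow> q \<in> T"
    using T UV(3) by (auto simp: open_dist)
  obtain i e where e: "e > 0" "\<forall>b\<in>Car. N i (b - a0) < e \<longrightarrow> b \<in> V"
    using bspec[OF conjunct2[OF openin_TF[THEN iffD1, OF UV(2)]] UV(4)] by blast
  have "(q, a) \<in> S" if "q \<noteq> 0" "dist q q0 < \<delta>" "a \<in> Car" "N i (a - a0) < e" for q a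
    using that \<delta>(2) e(2) T(2) UV(5) by auto
  with \<delta>(1) e(1) show "\<exists>\<delta>>0. \<exists>i. \<exists>e>0. \<forall>q a. q \<noteq> 0 \<longrightarrow> dist q q0 < \<delta> \<longrightarrow> a \<in> Car \<longrightarrow> N i (a - a0) < e \<longrightarrow> (q, a) \<in> S"
    by blast
next
  assume S: "S \<subseteq> punctured_plane \<times> Car \<and> (\<forall>q0 a0. (q0, a0) \<in> S \<longrightarrow>
    (\<exists>\<delta>>0. \<exists>i. \<exists>e>0. \<forall>q a. q \<noteq> 0 \<longrightarrow> dist q q0 < \<delta> \<longrightarrow> a \<in> Car \<longrightarrow> N i (a - a0) < e \<longrightarrow> (q, a) \<in> S))"
  show "openin XF S"
    unfolding openin_prod_topology_alt
  proof (intro allI impI)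
    fix q0 a0 assume m: "(q0, a0) \<in> S"
    with S have qa: "q0 \<noteq> 0" "a0 \<in> Car"
      by auto
    from S m obtain \<delta> i e where *: "\<delta> > 0" "e > 0"
      "\<forall>q a. q \<noteq> 0 \<longrightarrow> dist q q0 < \<delta> \<longrightarrow> a \<in> Car \<longrightarrow> N i (a - a0) < e \<longrightarrow> (q, a) \<in> S"
      by blast
    show "\<exists>U V. openin (top_of_set punctured_plane) U \<and> openin TF V \<and> q0 \<in> U \<and> a0 \<in> V \<and> U \<times> V \<subseteq> S"
    proof (intro exI conjI)
      show "openin (top_of_set punctured_plane) (punctured_plane \<inter> ball q0 \<delta>)"
        by auto
      show "openin TF {b \<in> Car. N i (b - a0) < e}"
        by (rule openin_TF_ball[OF qa(2)])
    qed (use qa * in \<open>auto simp: N_zero dist_commute\<close>)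
  qed
qed

text \<open>The final topology for the map \<open>pt\<close>, a concrete model of the bundle
  topology; \<open>E_topology_eq\<close> identifies the two. Openness is thereby tested on pairs of
  a base point and a series.\<close>

definition TQ :: "(complex \<times> (complex \<Rightarrow> free_series) set set) topology" where
  "TQ = topology (\<lambda>W. W \<subseteq> E_total A \<and> openin XF {x \<in> punctured_plane \<times> Car. pt (fst x) (snd x) \<in> W})"

lemma openin_TQ: "openin TQ W \<longleftrightarrow> W \<subseteq> E_total A \<and> (\<forall>q0 a0. q0 \<noteq> 0 \<longrightarrow> a0 \<in> Car \<longrightarrow> pt q0 a0 \<in> W \<longrightarrow>
    (\<exists>\<delta>>0. \<exists>i. \<exists>e>0. \<forall>q a. q \<noteq> 0 \<longrightarrow> dist q q0 < \<delta> \<longrightarrow> a \<in> Car \<longrightarrow> N i (a - a0) < e \<longrightarrow> pt q a \<in> W))"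
proof -
  have "openin TQ W \<longleftrightarrow> W \<subseteq> E_total A \<and> openin XF {x \<in> punctured_plane \<times> Car. pt (fst x) (snd x) \<in> W}"
    unfolding TQ_def by (rule openin_final_topology)
  also have "\<dots> \<longleftrightarrow> W \<subseteq> E_total A \<and> (\<forall>q0 a0. q0 \<noteq> 0 \<longrightarrow> a0 \<in> Car \<longrightarrow> pt q0 a0 \<in> W \<longrightarrow>
    (\<exists>\<delta>>0. \<exists>i. \<exists>e>0. \<forall>q a. q \<noteq> 0 \<longrightarrow> dist q q0 < \<delta> \<longrightarrow> a \<in> Car \<longrightarrow> N i (a - a0) < e \<longrightarrow> pt q a \<in> W))"
    unfolding openin_XF by (simp add: subset_iff imp_conjL)
  finally show ?thesis .
qed

lemma topspace_TQ [simp]: "topspace TQ = E_total A"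
proof (rule antisym)
  show "topspace TQ \<subseteq> E_total A"
    using openin_TQ[THEN iffD1, OF openin_topspace] by (rule conjunct1)
  have "openin TQ (E_total A)"
    unfolding openin_TQ by (auto intro!: exI[of _ 1] pt_E_total)
  then show "E_total A \<subseteq> topspace TQ"
    by (rule openin_subset)
qed

lemma Q_lift:
  assumes "a \<in> Car" "a0 \<in> Car" "Q i q (a - a0) < e"
  obtains b where "b \<in> Car" "symb q b = symb q a" "N i (b - a0) < e"
proof -
  obtain c where c: "c \<in> Car" "symb q c = symb q (a - a0)" "N i c < e"
    using Q_lessE[OF assms(3) Car_diff[OF assms(1,2)]] .
  show thesis
    by (rule that[of "c + a0"]) (use assms c in \<open>simp_all add: Car_add symb_add symb_diff\<close>)
qed

text \<open>Membership in \<open>W\<close> depends only on the class: a series that is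
  \<open>Q\<close>-close to \<open>a0\<close> may be replaced by a lift of the same class that is
  \<open>N\<close>-close.\<close>

lemma TQ_nbhd:
  assumes W: "openin TQ W" and q0: "q0 \<noteq> 0" and a0: "a0 \<in> Car" and m: "pt q0 a0 \<in> W"
  shows "\<exists>\<delta>>0. \<exists>i. \<exists>e>0. \<forall>q a. q \<noteq> 0 \<longrightarrow> dist q q0 < \<delta> \<longrightarrow> a \<in> Car \<longrightarrow> Q i q (a - a0) < e \<longrightarrow> pt q a \<in> W"
proof -
  obtain \<delta> i e where *: "\<delta> > 0" "e > 0"
      "\<And>q a. q \<noteq> 0 \<Longrightarrow> dist q q0 < \<delta> \<Longrightarrow> a \<in> Car \<Longrightarrow> N i (a - a0) < e \<Longrightarrow> pt q a \<in> W"
    using W q0 a0 m unfolding openin_TQ by metis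
  have "pt q a \<in> W" if q: "q \<noteq> 0" "dist q q0 < \<delta>" and a: "a \<in> Car" "Q i q (a - a0) < e" for q a
  proof -
    obtain b where b: "b \<in> Car" "symb q b = symb q a" "N i (b - a0) < e"
      using Q_lift[OF a(1) a0 a(2)] .
    then have "pt q b = pt q a"
      using pt_eq_iff[OF q(1) b(1) a(1), of q] by simp
    with *(3)[OF q b(1,3)] show ?thesis
      by simp
  qed
  with *(1,2) show ?thesis
    by blast
qed

lemma Q_small_nbhd:
  assumes q0: "q0 \<noteq> 0" and h0: "h0 \<in> Car" and s: "symb q0 h0 = 0" and e: "0 < e"
  shows "\<exists>\<delta>>0. \<exists>\<eta>>0. \<forall>q h. q \<noteq> 0 \<longrightarrow> dist q q0 < \<delta> \<longrightarrow> h \<in> Car \<longrightarrow> N i (h - h0) < \<eta> \<longrightarrow> Q i q h < e"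
proof -
  have "Q i q0 h0 = 0"
    using Q_cong[of q0 h0 0 i] s by simp
  moreover obtain \<delta> \<eta> where "\<delta> > 0" "\<eta> > 0"
      "\<forall>q a. q \<noteq> 0 \<longrightarrow> dist q q0 < \<delta> \<longrightarrow> a \<in> Car \<longrightarrow> N i (a - h0) < \<eta> \<longrightarrow> \<bar>Q i q a - Q i q0 h0\<bar> < e"
    using Q_continuous[OF q0 h0 e, of i] by (elim exE conjE)
  ultimately show ?thesis
    by (intro exI[of _ \<delta>] conjI exI[of _ \<eta>]) (simp_all add: abs_less_iff)
qed

text \<open>The kernel moves with \<open>q\<close>, so the kernel element \<open>a0 - a1\<close> at
  \<open>q0\<close> need not be one at \<open>q\<close>. Continuity of \<open>Q\<close> still makes
  its class at \<open>q\<close> small, and \<open>Q_lift\<close> then finds a representative near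
  \<open>a1\<close>.\<close>

lemma openin_pt_image:
  assumes S: "openin XF S" shows "openin TQ {pt q a | q a. (q, a) \<in> S}"
  unfolding openin_TQ
proof (intro conjI allI impI)
  have sub: "S \<subseteq> punctured_plane \<times> Car"
    using openin_subset[OF S] by simp
  then show "{pt q a | q a. (q, a) \<in> S} \<subseteq> E_total A"
    by (auto intro!: pt_E_total)
  fix q0 a0 assume q0: "q0 \<noteq> 0" and a0: "a0 \<in> Car" and "pt q0 a0 \<in> {pt q a | q a. (q, a) \<in> S}"
  then obtain q1 a1 where m': "pt q0 a0 = pt q1 a1" "(q1, a1) \<in> S"
    by blast
  then have a1: "a1 \<in> Car"
    using sub by auto
  then have m: "(q0, a1) \<in> S" "symb q0 a0 = symb q0 a1"
    using m' pt_eq_iff[OF q0 a0 a1] by auto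
  obtain \<delta> i e where *: "\<delta> > 0" "e > 0"
      "\<And>q a. q \<noteq> 0 \<Longrightarrow> dist q q0 < \<delta> \<Longrightarrow> a \<in> Car \<Longrightarrow> N i (a - a1) < e \<Longrightarrow> (q, a) \<in> S"
    using S m(1) unfolding openin_XF by metis
  have "symb q0 (a0 - a1) = 0"
    using m(2) by (simp add: symb_diff)
  then obtain \<delta>' \<eta> where **: "\<delta>' > 0" "\<eta> > 0"
      "\<And>q h. q \<noteq> 0 \<Longrightarrow> dist q q0 < \<delta>' \<Longrightarrow> h \<in> Car \<Longrightarrow> N i (h - (a0 - a1)) < \<eta> \<Longrightarrow> Q i q h < e"
    using Q_small_nbhd[OF q0 Car_diff[OF a0 a1] _ *(2), of i] by metis
  have "pt q a \<in> {pt q a | q a. (q, a) \<in> S}"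
    if q: "q \<noteq> 0" "dist q q0 < min \<delta> \<delta>'" and a: "a \<in> Car" "N i (a - a0) < \<eta>" for q a
  proof -
    have "Q i q (a - a1) < e"
      using a q by (intro **(3) Car_diff a1) (simp_all add: algebra_simps)
    then obtain b where b: "b \<in> Car" "symb q b = symb q a" "N i (b - a1) < e"
      using Q_lift[OF a(1) a1] by blast
    then have "pt q a = pt q b" "(q, b) \<in> S"
      using pt_eq_iff[OF q(1) a(1) b(1), of q] *(3)[of q b] q by auto
    then show ?thesis
      by blast
  qed
  with *(1) **(1,2) show "\<exists>\<delta>>0. \<exists>i. \<exists>e>0. \<forall>q a. q \<noteq> 0 \<longrightarrow> dist q q0 < \<delta> \<longrightarrow> a \<in> Car \<longrightarrow>
      N i (a - a0) < e \<longrightarrow> pt q a \<in> {pt q a | q a. (q, a) \<in> S}"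
    by (intro exI[of _ "min \<delta> \<delta>'"] conjI exI[of _ i] exI[of _ \<eta>]) auto
qed

lemma openin_pt_box:
  assumes q0: "q0 \<noteq> 0" and a0: "a0 \<in> Car"
  shows "openin TQ {pt q a | q a. q \<noteq> 0 \<and> dist q q0 < \<delta> \<and> a \<in> Car \<and> N i (a - a0) < e}"
proof -
  have "openin XF ((punctured_plane \<inter> ball q0 \<delta>) \<times> {b \<in> Car. N i (b - a0) < e})"
    using openin_TF_ball[OF a0] by (intro openin_prod_Times_iff[THEN iffD2]) auto
  from openin_pt_image[OF this] show ?thesis
    by (simp add: dist_commute conj_ac)
qed

subsection \<open>Comparison with the defining base\<close>

text \<open>One lift \<open>g\<close> of \<open>a\<close> is kept fixed, and the infimum runs over
  the lifts of \<open>b\<close> only.\<close>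

lemma quotient_seminorm_add_le:
  assumes \<nu>: "seminorm_on A \<nu>" and q: "q \<noteq> 0" and a: "a \<in> Car" and b: "b \<in> Car"
    and g: "g \<in> HC" "symb q (g q) = symb q a"
  shows "quotient_seminorm \<nu> (pt q (a + b)) \<le> \<nu> (cl g) + quotient_seminorm \<nu> (pt q b)"
proof -
  have "quotient_seminorm \<nu> (pt q (a + b)) - \<nu> (cl g) \<le> quotient_seminorm \<nu> (pt q b)"
  proof (rule quotient_seminorm_ge[OF \<nu> q b])
    fix f assume f: "f \<in> HC" "symb q (f q) = symb q b"
    have "quotient_seminorm \<nu> (pt q (a + b)) \<le> \<nu> (cl (g + f))"
      using f g by (intro quotient_seminorm_le[OF \<nu> q Car_add[OF a b]] HC_add) (simp_all add: symb_add)
    also have "\<dots> \<le> \<nu> (cl g) + \<nu> (cl f)"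
      using \<nu> f g A_add[OF g(1) f(1)] unfolding seminorm_on_def A_carrier by (metis imageI)
    finally show "quotient_seminorm \<nu> (pt q (a + b)) - \<nu> (cl g) \<le> \<nu> (cl f)"
      by simp
  qed
  then show ?thesis
    by simp
qed

lemma E_basic_eq:
  assumes V: "V \<subseteq> punctured_plane" and f: "f \<in> HC"
  shows "E_basic A V (cl f) \<nu> e = {pt q a | q a. q \<in> V \<and> a \<in> Car \<and> quotient_seminorm \<nu> (pt q (a - f q)) < e}"
proof -
  have "pt q a \<ominus>\<^bsub>fib q\<^esub> class_at A (cl f) q = pt q (a - f q)" if "q \<noteq> 0" "a \<in> Car" for q a
    using that f by (simp add: class_at_cl fib_minus HC_Car)
  then have iff: "pt q a \<in> E_basic A V (cl f) \<nu> e \<longleftrightarrow> q \<in> V \<and> quotient_seminorm \<nu> (pt q (a - f q)) < e"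
    if "q \<noteq> 0" "a \<in> Car" for q a
    using that by (simp add: E_basic_def pt_E_total)
  have "E_basic A V (cl f) \<nu> e \<subseteq> E_total A"
    by (auto simp: E_basic_def)
  note sub = this
  show ?thesis
  proof (intro equalityI subsetI)
    fix v assume v: "v \<in> E_basic A V (cl f) \<nu> e"
    then obtain q a where "q \<noteq> 0" "a \<in> Car" "v = pt q a"
      using sub E_totalE by blast
    with v iff show "v \<in> {pt q a | q a. q \<in> V \<and> a \<in> Car \<and> quotient_seminorm \<nu> (pt q (a - f q)) < e}"
      by blast
  next
    fix v assume "v \<in> {pt q a | q a. q \<in> V \<and> a \<in> Car \<and> quotient_seminorm \<nu> (pt q (a - f q)) < e}"
    then obtain q a where *: "v = pt q a" "q \<in> V" "a \<in> Car" "quotient_seminorm \<nu> (pt q (a - f q)) < e"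
      by blast
    then have "q \<noteq> 0"
      using V by auto
    with * iff show "v \<in> E_basic A V (cl f) \<nu> e"
      by simp
  qed
qed

text \<open>One global lift \<open>g\<close> with \<open>\<nu> (cl g) < e\<close> serves all points
  near \<open>q0\<close>: what remains after subtracting it has vanishing class at
  \<open>q0\<close>, hence small fibre norm nearby, and \<open>quotient_seminorm_dominated\<close>
  turns this into a small quotient seminorm.\<close>

lemma openin_E_basic:
  assumes V: "openin (top_of_set punctured_plane) V" and f: "f \<in> HC" and \<nu>: "continuous_seminorm A \<nu>"
  shows "openin TQ (E_basic A V (cl f) \<nu> e)"
  unfolding openin_TQ
proof (intro conjI allI impI)
  have sem: "seminorm_on A \<nu>"
    using \<nu> by (simp add: continuous_seminorm_def)
  have Vp: "V \<subseteq> punctured_plane"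
    using openin_subset[OF V] by simp
  show "E_basic A V (cl f) \<nu> e \<subseteq> E_total A"
    by (auto simp: E_basic_def)
  fix q0 a0 assume q0: "q0 \<noteq> 0" and a0: "a0 \<in> Car" and "pt q0 a0 \<in> E_basic A V (cl f) \<nu> e"
  then have m: "q0 \<in> V" "quotient_seminorm \<nu> (pt q0 (a0 - f q0)) < e"
    using f by (simp_all add: E_basic_def class_at_cl fib_minus HC_Car)
  have c0: "a0 - f q0 \<in> Car"
    using a0 f by (simp add: Car_diff HC_Car)
  obtain g where g: "g \<in> HC" "symb q0 (g q0) = symb q0 (a0 - f q0)" "\<nu> (cl g) < e"
    using quotient_seminorm_ge[OF sem q0 c0, of e] m(2) by (meson not_le)
  obtain k i C where C: "0 < C" "\<And>v. v \<in> E_total A \<Longrightarrow> quotient_seminorm \<nu> v \<le> C * bn k i v"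
    using quotient_seminorm_dominated[OF \<nu>] by metis
  \<comment> \<open>Chosen so that an error \<open>Q < x\<close> costs at most
    \<open>C * (real k * x)\<close>, less than the gap \<open>e - \<nu> (cl g)\<close>;
    \<open>real k + 1\<close> allows \<open>k = 0\<close>.\<close>
  define x where "x = (e - \<nu> (cl g)) / (C * (real k + 1))"
  have Ck: "0 < C * (real k + 1)"
    using C(1) by simp
  then have x: "0 < x" and "C * (real k + 1) * x = e - \<nu> (cl g)"
    using g(3) C(1) by (simp_all add: x_def)
  then have Cx: "C * (real k * x) < e - \<nu> (cl g)"
    using mult_pos_pos[OF C(1) x] by (simp add: algebra_simps)
  let ?h = "\<lambda>q a. (a - f q) - g q"
  have hC: "?h q a \<in> Car" if "a \<in> Car" for q a
    using that f g by (simp add: Car_diff HC_Car)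
  have "symb q0 (?h q0 a0) = 0"
    using g(2) by (simp add: symb_diff)
  then obtain \<delta>1 \<eta> where 1: "\<delta>1 > 0" "\<eta> > 0"
      "\<And>q h. q \<noteq> 0 \<Longrightarrow> dist q q0 < \<delta>1 \<Longrightarrow> h \<in> Car \<Longrightarrow> N i (h - ?h q0 a0) < \<eta> \<Longrightarrow> Q i q h < x"
    using Q_small_nbhd[OF q0 hC[OF a0] _ x, of q0 i] by metis
  obtain \<delta>2 where 2: "\<delta>2 > 0" "\<And>q. dist q q0 < \<delta>2 \<Longrightarrow> N i (f q - f q0) < \<eta> / 3"
    using HC_near[OF f q0, of "\<eta> / 3" i] 1(2) by auto
  obtain \<delta>3 where 3: "\<delta>3 > 0" "\<And>q. dist q q0 < \<delta>3 \<Longrightarrow> N i (g q - g q0) < \<eta> / 3"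
    using HC_near[OF g(1) q0, of "\<eta> / 3" i] 1(2) by auto
  obtain T where T: "open T" "V = punctured_plane \<inter> T"
    using V by (auto simp: openin_open)
  obtain \<delta>4 where 4: "\<delta>4 > 0" "\<And>q. dist q q0 < \<delta>4 \<Longrightarrow> q \<in> T"
    using T m(1) by (auto simp: open_dist)
  let ?\<delta> = "min (min \<delta>1 \<delta>2) (min \<delta>3 \<delta>4)"
  have "pt q a \<in> E_basic A V (cl f) \<nu> e"
    if q: "q \<noteq> 0" "dist q q0 < ?\<delta>" and a: "a \<in> Car" "N i (a - a0) < \<eta> / 3" for q a
  proof -
    have c: "a - a0 \<in> Car" "f q - f q0 \<in> Car" "g q - g q0 \<in> Car" "g q \<in> Car"
      using a a0 f g by (simp_all add: Car_diff HC_Car)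
    have eq: "?h q a - ?h q0 a0 = (a - a0) - (f q - f q0) - (g q - g q0)"
      by (simp add: algebra_simps)
    have "N i (?h q a - ?h q0 a0) \<le> N i (a - a0) + N i (f q - f q0) + N i (g q - g q0)"
      unfolding eq using N_diff[OF c(1,2), of i] N_diff[OF Car_diff[OF c(1,2)] c(3), of i] by linarith
    then have "N i (?h q a - ?h q0 a0) < \<eta>"
      using a(2) 2(2)[of q] 3(2)[of q] q(2) by simp
    then have "Q i q (?h q a) < x"
      using q by (intro 1(3) hC a) auto
    then have "bn k i (pt q (?h q a)) \<le> real k * x"
      unfolding bn_pt[OF q(1) hC[OF a(1)]]
      by (intro mult_mono cut_le) (simp_all add: Q_nonneg hC a)
    then have "quotient_seminorm \<nu> (pt q (?h q a)) \<le> C * (real k * x)"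
      using C(2)[OF pt_E_total[OF q(1) hC[OF a(1)]]] C(1) by (smt (verit) mult_left_mono)
    moreover have "quotient_seminorm \<nu> (pt q (g q + ?h q a)) \<le> \<nu> (cl g) + quotient_seminorm \<nu> (pt q (?h q a))"
      by (rule quotient_seminorm_add_le[OF sem q(1) c(4) hC[OF a(1)] g(1)]) simp
    ultimately have "quotient_seminorm \<nu> (pt q (a - f q)) < e"
      using Cx by simp
    moreover have "q \<in> V"
      using q 4(2)[of q] T(2) by auto
    ultimately show ?thesis
      unfolding E_basic_eq[OF Vp f] using a(1) by blast
  qed
  moreover have "?\<delta> > 0" "\<eta> / 3 > 0"
    using 1 2 3 4 by auto
  ultimately show "\<exists>\<delta>>0. \<exists>i. \<exists>e'>0. \<forall>q a. q \<noteq> 0 \<longrightarrow> dist q q0 < \<delta> \<longrightarrow> a \<in> Car \<longrightarrow> N i (a - a0) < e' \<longrightarrow>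
      pt q a \<in> E_basic A V (cl f) \<nu> e"
    by blast
qed

text \<open>A cut-off larger than \<open>1\<close> near \<open>q0\<close> makes
  \<open>bn k i\<close> dominate the fibre norm without cut-off there.\<close>

lemma cut_nbhd:
  assumes q0: "q0 \<noteq> 0" and \<delta>: "0 < \<delta>"
  obtains k V where "openin (top_of_set punctured_plane) V" "q0 \<in> V" "\<And>q. q \<in> V \<Longrightarrow> dist q q0 < \<delta> \<and> 1 < cut k q"
proof -
  obtain k where k: "cmod q0 + 1 / cmod q0 + 1 < real k"
    using reals_Archimedean2 by blast
  let ?V = "{q \<in> punctured_plane. cut k q \<in> {1<..}} \<inter> ball q0 \<delta>"
  have "openin (top_of_set punctured_plane) (punctured_plane \<inter> cut k -` {1<..})"
    using continuous_cut by (rule continuous_openin_preimage_gen) simp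
  then have "openin (top_of_set punctured_plane) {q \<in> punctured_plane. cut k q \<in> {1<..}}"
    by (simp add: vimage_def Int_def)
  then have "openin (top_of_set punctured_plane) ?V"
    by (rule openin_Int_open) simp
  moreover have "q0 \<in> ?V"
    using q0 \<delta> k by (simp add: cut_def)
  ultimately show thesis
    by (rule that[of ?V k]) (auto simp: dist_commute)
qed

lemma TQ_bn_nbhd:
  assumes W: "openin TQ W" and q0: "q0 \<noteq> 0" and a0: "a0 \<in> Car" and m: "pt q0 a0 \<in> W"
  obtains k i e V where "openin (top_of_set punctured_plane) V" "q0 \<in> V" "0 < e"
    "\<And>q a. q \<in> V \<Longrightarrow> a \<in> Car \<Longrightarrow> bn k i (pt q (a - a0)) < e \<Longrightarrow> pt q a \<in> W"
proof -
  obtain \<delta> i e where *: "\<delta> > 0" "e > 0"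
      "\<And>q a. q \<noteq> 0 \<Longrightarrow> dist q q0 < \<delta> \<Longrightarrow> a \<in> Car \<Longrightarrow> Q i q (a - a0) < e \<Longrightarrow> pt q a \<in> W"
    using TQ_nbhd[OF W q0 a0 m] by metis
  obtain k V where V: "openin (top_of_set punctured_plane) V" "q0 \<in> V" "\<And>q. q \<in> V \<Longrightarrow> dist q q0 < \<delta> \<and> 1 < cut k q"
    using cut_nbhd[OF q0 *(1)] by metis
  show thesis
  proof (rule that[OF V(1,2) *(2), of k i])
    fix q a assume q: "q \<in> V" and a: "a \<in> Car" and lt: "bn k i (pt q (a - a0)) < e"
    have q': "q \<noteq> 0"
      using q openin_subset[OF V(1)] by auto
    have c: "a - a0 \<in> Car"
      using a a0 by (rule Car_diff)
    have "1 * Q i q (a - a0) \<le> cut k q * Q i q (a - a0)"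
      using V(3)[OF q] by (intro mult_right_mono Q_nonneg c) auto
    then have "Q i q (a - a0) < e"
      using lt bn_pt[OF q' c] by simp
    then show "pt q a \<in> W"
      using q' V(3)[OF q] a by (intro *(3)) auto
  qed
qed

lemma supn_zero: "supn k i (cl 0) = 0"
proof -
  have "0 \<odot>\<^bsub>H\<^esub> 0 = (0 :: complex \<Rightarrow> free_series)"
    by (rule ext) (simp add: H_smult_apply)
  then have "0 \<odot>\<^bsub>A\<^esub> cl 0 = cl 0"
    using A_smult[OF HC_zero HC_zero, of 0] by simp
  moreover have "cl 0 \<in> carrier A"
    unfolding A_carrier by (rule imageI[OF HC_zero])
  ultimately show ?thesis
    using seminorm_supn[of k i] unfolding seminorm_on_def by (metis mult_eq_0_iff norm_zero)
qed

text \<open>The defining base sets are open by \<open>openin_E_basic\<close>. Conversely, an open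
  set contains a \<open>bn k i\<close> ball around a constant section, and since the quotient
  seminorm of \<open>supn k i\<close> is larger, the base set that it defines is smaller
  still.\<close>

lemma E_topology_eq: "E_topology A = TQ"
proof -
  let ?P = "\<lambda>S. S \<in> {E_basic A V u \<nu> \<epsilon> | V u \<nu> \<epsilon>.
        openin (top_of_set punctured_plane) V \<and> u \<in> carrier A \<and> continuous_seminorm A \<nu> \<and> 0 < \<epsilon>}"
  have "openin TQ = arbitrary union_of ?P"
    unfolding openin_topology_base_unique
  proof (intro conjI allI impI)
    fix S assume "?P S"
    then show "openin TQ S"
      by (auto simp: A_carrier intro!: openin_E_basic)
  next
    fix W v assume "openin TQ W \<and> v \<in> W"
    then have W: "openin TQ W" and vW: "v \<in> W"
      by auto
    then have "v \<in> E_total A"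
      using openin_subset[OF W] by auto
    then obtain q0 a0 where q0: "q0 \<noteq> 0" and a0: "a0 \<in> Car" and v: "v = pt q0 a0"
      by (rule E_totalE)
    obtain k i e V where V: "openin (top_of_set punctured_plane) V" "q0 \<in> V" "0 < e"
        "\<And>q a. q \<in> V \<Longrightarrow> a \<in> Car \<Longrightarrow> bn k i (pt q (a - a0)) < e \<Longrightarrow> pt q a \<in> W"
      using TQ_bn_nbhd[OF W q0 a0] vW v by metis
    have Vp: "V \<subseteq> punctured_plane"
      using openin_subset[OF V(1)] by simp
    let ?S = "E_basic A V (cl (hc a0)) (supn k i) e"
    have S: "?S = {pt q a | q a. q \<in> V \<and> a \<in> Car \<and> quotient_seminorm (supn k i) (pt q (a - hc a0 q)) < e}"
      by (rule E_basic_eq[OF Vp hc_HC[OF a0]])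
    have "?P ?S"
      by (intro CollectI exI conjI, rule refl)
        (use V a0 in \<open>simp_all add: A_carrier hc_HC continuous_seminorm_supn\<close>)
    moreover have "v \<in> ?S"
    proof -
      have "quotient_seminorm (supn k i) (pt q0 0) \<le> supn k i (cl 0)"
        by (rule quotient_seminorm_le[OF seminorm_supn q0 Car_zero HC_zero]) simp
      then have "quotient_seminorm (supn k i) (pt q0 (a0 - hc a0 q0)) < e"
        using V(3) q0 by (simp add: supn_zero hc_apply)
      then show ?thesis
        unfolding S v using V(2) a0 by blast
    qed
    moreover have "?S \<subseteq> W"
    proof
      fix w assume "w \<in> ?S"
      then obtain q a where w: "w = pt q a" "q \<in> V" "a \<in> Car" "quotient_seminorm (supn k i) (pt q (a - hc a0 q)) < e"
        unfolding S by blast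
      have q: "q \<noteq> 0"
        using w(2) Vp by auto
      have "bn k i (pt q (a - a0)) \<le> quotient_seminorm (supn k i) (pt q (a - a0))"
        using q w(3) a0 by (intro bn_le_quotient_seminorm pt_E_total Car_diff)
      then show "w \<in> W"
        using w V(4) q by (simp add: hc_apply)
    qed
    ultimately show "\<exists>S. ?P S \<and> v \<in> S \<and> S \<subseteq> W"
      by blast
  qed
  then show ?thesis
    unfolding E_topology_def by (metis openin_inverse)
qed

section \<open>The bundle\<close>

abbreviation B :: "(complex, complex \<times> (complex \<Rightarrow> free_series) set set) vbundle" where
  "B \<equiv> E_bundle A"

lemma B_simps [simp]:
  "bspace B = top_of_set punctured_plane" "tspace B = TQ" "bproj B = fst" "fibre B q = fib q"
  "total B = E_total A"
  by (simp_all add: E_bundle_def Let_def E_topology_eq total_def)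

lemma fib_carrier_iff: "q \<noteq> 0 \<Longrightarrow> v \<in> carrier (fib q) \<longleftrightarrow> v \<in> E_total A \<and> fst v = q"
  by (auto simp: fib_carrier E_total_eq)

lemma seminorm_bn: "q \<noteq> 0 \<Longrightarrow> seminorm_on (fib q) (bn k i)"
  unfolding seminorm_on_def fib_carrier
proof (intro conjI ballI allI; elim imageE; hypsubst)
  fix a b c assume q: "q \<noteq> 0" and a: "a \<in> Car"
  show "0 \<le> bn k i (pt q a)"
    using q a by (simp add: bn_pt cut_nonneg Q_nonneg)
  show "bn k i (c \<odot>\<^bsub>fib q\<^esub> pt q a) = cmod c * bn k i (pt q a)"
    using q a by (simp add: fib_smult bn_pt Car_scale Q_scale)
  assume b: "b \<in> Car"
  show "bn k i (pt q a \<oplus>\<^bsub>fib q\<^esub> pt q b) \<le> bn k i (pt q a) + bn k i (pt q b)"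
    using q a b mult_left_mono[OF Q_add[OF a b] cut_nonneg, of k q i q]
    by (simp add: fib_add bn_pt Car_add distrib_left)
qed

lemma bn_BN: "bn k i \<in> BN"
  by (auto simp: BN_def)

text \<open>\<open>bn\<close> increases in both indices, so the pair of maxima dominates.\<close>

lemma directed_BN: "directed_seminorms B BN"
  unfolding directed_seminorms_def
proof (intro conjI ballI)
  fix \<nu> assume "\<nu> \<in> BN"
  then show "bundle_seminorm B \<nu>"
    using seminorm_bn by (auto simp: BN_def bundle_seminorm_def)
next
  fix \<nu> \<mu> assume "\<nu> \<in> BN" "\<mu> \<in> BN"
  then obtain k i l j where eq: "\<nu> = bn k i" "\<mu> = bn l j"
    by (auto simp: BN_def)
  have "\<forall>u\<in>total B. \<nu> u \<le> 1 * bn (max k l) (max i j) u \<and> \<mu> u \<le> 1 * bn (max k l) (max i j) u"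
    unfolding eq using bn_mono by simp
  then show "\<exists>C>0. \<exists>\<kappa>\<in>BN. \<forall>u\<in>total B. \<nu> u \<le> C * \<kappa> u \<and> \<mu> u \<le> C * \<kappa> u"
    using bn_BN by (intro exI[of _ 1] conjI bexI[of _ "bn (max k l) (max i j)"]) simp_all
qed

text \<open>Each family dominates the other up to constants, by
  \<open>quotient_seminorm_dominated\<close> and \<open>bn_le_quotient_seminorm\<close>.\<close>

lemma unif_eq: "unif B = seminorm_structure B BN"
proof -
  have "unif B = seminorm_structure B (quotient_seminorm ` Collect (continuous_seminorm A))"
    by (simp add: E_bundle_def Let_def seminorm_structure_def absolutely_convex_subset_def total_def)
  also have "\<dots> = seminorm_structure B BN"
    unfolding seminorm_structure_def B_simps
  proof (intro Collect_cong conj_cong refl iffI)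
    fix S assume "\<exists>\<nu>\<in>quotient_seminorm ` Collect (continuous_seminorm A). \<exists>\<epsilon>>0. {u \<in> E_total A. \<nu> u < \<epsilon>} \<subseteq> S"
    then obtain \<nu> \<epsilon> where \<nu>: "continuous_seminorm A \<nu>" "0 < \<epsilon>" "{u \<in> E_total A. quotient_seminorm \<nu> u < \<epsilon>} \<subseteq> S"
      by blast
    obtain k i C where C: "0 < C" "\<And>v. v \<in> E_total A \<Longrightarrow> quotient_seminorm \<nu> v \<le> C * bn k i v"
      using quotient_seminorm_dominated[OF \<nu>(1)] by metis
    have "{u \<in> E_total A. bn k i u < \<epsilon> / C} \<subseteq> S"
    proof
      fix u assume u: "u \<in> {u \<in> E_total A. bn k i u < \<epsilon> / C}"
      then have "C * bn k i u < \<epsilon>"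
        using C(1) by (simp add: field_simps)
      then show "u \<in> S"
        using C(2)[of u] u \<nu>(3) by force
    qed
    then show "\<exists>\<nu>\<in>BN. \<exists>\<epsilon>>0. {u \<in> E_total A. \<nu> u < \<epsilon>} \<subseteq> S"
      using C(1) \<nu>(2) by (intro bexI[OF _ bn_BN] exI[of _ "\<epsilon> / C"]) auto
  next
    fix S assume "\<exists>\<nu>\<in>BN. \<exists>\<epsilon>>0. {u \<in> E_total A. \<nu> u < \<epsilon>} \<subseteq> S"
    then obtain k i \<epsilon> where *: "0 < \<epsilon>" "{u \<in> E_total A. bn k i u < \<epsilon>} \<subseteq> S"
      by (auto simp: BN_def)
    have "{u \<in> E_total A. quotient_seminorm (supn k i) u < \<epsilon>} \<subseteq> S"
      using *(2) bn_le_quotient_seminorm[of _ k i] by force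
    then show "\<exists>\<nu>\<in>quotient_seminorm ` Collect (continuous_seminorm A). \<exists>\<epsilon>>0. {u \<in> E_total A. \<nu> u < \<epsilon>} \<subseteq> S"
      using *(1) continuous_seminorm_supn by blast
  qed
  finally show ?thesis .
qed

subsection \<open>Continuity of the operations\<close>

text \<open>The images of boxes under \<open>pt\<close> are open, so continuity can be checked on
  representatives. On the fibered square both arguments share the base point, and the operation on
  representatives is the same for all \<open>q\<close>.\<close>

lemma continuous_fibered:
  assumes op: "\<And>a b. a \<in> Car \<Longrightarrow> b \<in> Car \<Longrightarrow> op a b \<in> Car"
    and cont: "\<And>a0 b0 i e. a0 \<in> Car \<Longrightarrow> b0 \<in> Car \<Longrightarrow> (0::real) < e \<Longrightarrow> \<exists>\<eta>>0. \<forall>a\<in>Car. \<forall>b\<in>Car.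
      N i (a - a0) < \<eta> \<longrightarrow> N i (b - b0) < \<eta> \<longrightarrow> N i (op a b - op a0 b0) < e"
    and g: "\<And>q a b. q \<noteq> 0 \<Longrightarrow> a \<in> Car \<Longrightarrow> b \<in> Car \<Longrightarrow> g (pt q a) (pt q b) = pt q (op a b)"
  shows "continuous_map (subtopology (prod_topology TQ TQ) (fibered_square B)) TQ (\<lambda>(u, v). g u v)"
  unfolding continuous_map_def
proof (intro conjI funcsetI allI impI)
  let ?X = "subtopology (prod_topology TQ TQ) (fibered_square B)"
  have rep: "\<exists>q a b. q \<noteq> 0 \<and> a \<in> Car \<and> b \<in> Car \<and> w = (pt q a, pt q b)" if wX: "w \<in> topspace ?X" for w
  proof -
    obtain u v where w: "w = (u, v)" "u \<in> E_total A" "v \<in> E_total A" "fst u = fst v"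
      using wX by (cases w) (simp add: fibered_square_def)
    obtain q a where u: "q \<noteq> 0" "a \<in> Car" "u = pt q a"
      using w(2) by (rule E_totalE)
    obtain q' b where v: "q' \<noteq> 0" "b \<in> Car" "v = pt q' b"
      using w(3) by (rule E_totalE)
    with w u show ?thesis
      by auto
  qed
  show "(case w of (u, v) \<Rightarrow> g u v) \<in> topspace TQ" if "w \<in> topspace ?X" for w
    using rep[OF that] by (auto simp: g pt_E_total op)
  fix W assume W: "openin TQ W"
  show "openin ?X {w \<in> topspace ?X. (case w of (u, v) \<Rightarrow> g u v) \<in> W}"
  proof (subst openin_subopen, intro ballI)
    fix w assume w: "w \<in> {w \<in> topspace ?X. (case w of (u, v) \<Rightarrow> g u v) \<in> W}"
    then obtain q0 a0 b0 where q0: "q0 \<noteq> 0" and a0: "a0 \<in> Car" and b0: "b0 \<in> Car" and w_eq: "w = (pt q0 a0, pt q0 b0)"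
      using rep by blast
    have "pt q0 (op a0 b0) \<in> W"
      using w by (simp add: w_eq g q0 a0 b0)
    then obtain \<delta> i e where *: "\<delta> > 0" "e > 0"
        "\<And>q a. q \<noteq> 0 \<Longrightarrow> dist q q0 < \<delta> \<Longrightarrow> a \<in> Car \<Longrightarrow> N i (a - op a0 b0) < e \<Longrightarrow> pt q a \<in> W"
      using W q0 op[OF a0 b0] unfolding openin_TQ by metis
    obtain \<eta> where \<eta>: "\<eta> > 0" "\<And>a b. a \<in> Car \<Longrightarrow> b \<in> Car \<Longrightarrow> N i (a - a0) < \<eta> \<Longrightarrow> N i (b - b0) < \<eta> \<Longrightarrow>
        N i (op a b - op a0 b0) < e"
      using cont[OF a0 b0 *(2), of i] by blast
    let ?box = "\<lambda>c. {pt q a | q a. q \<noteq> 0 \<and> dist q q0 < \<delta> \<and> a \<in> Car \<and> N i (a - c) < \<eta>}"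
    have "openin (prod_topology TQ TQ) (?box a0 \<times> ?box b0)"
      using openin_pt_box[OF q0 a0] openin_pt_box[OF q0 b0] by (simp add: openin_prod_Times_iff)
    then have "openin ?X (fibered_square B \<inter> (?box a0 \<times> ?box b0))"
      by (rule openin_subtopology_Int2)
    moreover have "w \<in> fibered_square B \<inter> (?box a0 \<times> ?box b0)"
    proof -
      have "pt q0 c \<in> ?box c" if "c \<in> Car" for c
        using q0 that *(1) \<eta>(1) by (intro CollectI exI[of _ q0] exI[of _ c] conjI) (simp_all add: N_zero)
      then show ?thesis
        unfolding w_eq using q0 a0 b0 by (simp add: fibered_square_def pt_E_total)
    qed
    moreover have "fibered_square B \<inter> (?box a0 \<times> ?box b0) \<subseteq> {w \<in> topspace ?X. (case w of (u, v) \<Rightarrow> g u v) \<in> W}"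
    proof
      fix x assume x: "x \<in> fibered_square B \<inter> (?box a0 \<times> ?box b0)"
      then obtain q a q' b where ab: "x = (pt q a, pt q' b)" "q \<noteq> 0" "dist q q0 < \<delta>" "a \<in> Car" "N i (a - a0) < \<eta>"
          "q' \<noteq> 0" "b \<in> Car" "N i (b - b0) < \<eta>"
        by blast
      then have qq: "q' = q"
        using x by (simp add: fibered_square_def)
      have "pt q (op a b) \<in> W"
        using ab by (intro *(3) op \<eta>(2))
      then show "x \<in> {w \<in> topspace ?X. (case w of (u, v) \<Rightarrow> g u v) \<in> W}"
        using ab x unfolding qq by (simp add: g fibered_square_def pt_E_total)
    qed
    ultimately show "\<exists>T. openin ?X T \<and> w \<in> T \<and> T \<subseteq> {w \<in> topspace ?X. (case w of (u, v) \<Rightarrow> g u v) \<in> W}"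
      by blast
  qed
qed

lemma continuous_add:
  "continuous_map (subtopology (prod_topology TQ TQ) (fibered_square B)) TQ (\<lambda>(u, v). u \<oplus>\<^bsub>fib (fst u)\<^esub> v)"
proof (rule continuous_fibered[where op = "\<lambda>a b. a + b"])
  fix a0 b0 i and e :: real assume c: "a0 \<in> Car" "b0 \<in> Car" "0 < e"
  have "N i (a + b - (a0 + b0)) < e" if "a \<in> Car" "b \<in> Car" "N i (a - a0) < e / 2" "N i (b - b0) < e / 2" for a b
    using N_add[OF Car_diff[OF that(1) c(1)] Car_diff[OF that(2) c(2)], of i] that(3,4)
    by (simp add: algebra_simps)
  with c(3) show "\<exists>\<eta>>0. \<forall>a\<in>Car. \<forall>b\<in>Car. N i (a - a0) < \<eta> \<longrightarrow> N i (b - b0) < \<eta> \<longrightarrow> N i (a + b - (a0 + b0)) < e"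
    by (intro exI[of _ "e / 2"]) simp
qed (simp_all add: Car_add fib_add)

lemma continuous_minus:
  "continuous_map (subtopology (prod_topology TQ TQ) (fibered_square B)) TQ (\<lambda>(u, v). u \<ominus>\<^bsub>fib (fst u)\<^esub> v)"
proof (rule continuous_fibered[where op = "\<lambda>a b. a - b"])
  fix a0 b0 i and e :: real assume c: "a0 \<in> Car" "b0 \<in> Car" "0 < e"
  have "N i (a - b - (a0 - b0)) < e" if "a \<in> Car" "b \<in> Car" "N i (a - a0) < e / 2" "N i (b - b0) < e / 2" for a b
    using N_diff[OF Car_diff[OF that(1) c(1)] Car_diff[OF that(2) c(2)], of i] that(3,4)
    by (simp add: algebra_simps)
  with c(3) show "\<exists>\<eta>>0. \<forall>a\<in>Car. \<forall>b\<in>Car. N i (a - a0) < \<eta> \<longrightarrow> N i (b - b0) < \<eta> \<longrightarrow> N i (a - b - (a0 - b0)) < e"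
    by (intro exI[of _ "e / 2"]) simp
qed (simp_all add: Car_diff fib_minus)

lemma continuous_mult:
  "continuous_map (subtopology (prod_topology TQ TQ) (fibered_square B)) TQ (\<lambda>(u, v). u \<otimes>\<^bsub>fib (fst u)\<^esub> v)"
proof (rule continuous_fibered[where op = conv])
  fix a0 b0 i and e :: real assume c: "a0 \<in> Car" "b0 \<in> Car" "0 < e"
  \<comment> \<open>The constants come from the decomposition
    \<open>(a - a0) b + a0 (b - b0)\<close> together with
    \<open>N i b \<le> N i b0 + 1\<close>.\<close>
  define L where "L = N i a0 + N i b0 + 1"
  have L: "0 < L"
    using N_nonneg[OF c(1), of i] N_nonneg[OF c(2), of i] by (simp add: L_def)
  define \<eta> where "\<eta> = min 1 (e / (2 * L))"
  have \<eta>: "0 < \<eta>" "\<eta> \<le> 1" "\<eta> * L \<le> e / 2"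
    using L c(3) by (auto simp: \<eta>_def min_def field_simps)
  have "N i (conv a b - conv a0 b0) < e" if ab: "a \<in> Car" "b \<in> Car" "N i (a - a0) < \<eta>" "N i (b - b0) < \<eta>" for a b
  proof -
    have d: "a - a0 \<in> Car" "b - b0 \<in> Car"
      using ab c by (simp_all add: Car_diff)
    have b: "N i b \<le> N i b0 + 1"
      using N_add[OF d(2) c(2), of i] ab(4) \<eta>(2) by simp
    have "conv a b - conv a0 b0 = conv (a - a0) b + conv a0 (b - b0)"
      by (simp add: conv_diff_left conv_diff_right)
    then have "N i (conv a b - conv a0 b0) \<le> N i (conv (a - a0) b) + N i (conv a0 (b - b0))"
      using N_add[OF Car_conv[OF d(1) ab(2)] Car_conv[OF c(1) d(2)], of i] by simp
    also have "\<dots> \<le> N i (a - a0) * N i b + N i a0 * N i (b - b0)"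
      by (intro add_mono N_conv d ab c)
    also have "\<dots> \<le> \<eta> * (N i b0 + 1) + N i a0 * \<eta>"
      using ab b \<eta>(1) by (intro add_mono mult_mono) (auto simp: N_nonneg c d)
    also have "\<dots> = \<eta> * L"
      by (simp add: L_def algebra_simps)
    finally show ?thesis
      using \<eta>(3) c(3) by simp
  qed
  with \<eta>(1) show "\<exists>\<eta>>0. \<forall>a\<in>Car. \<forall>b\<in>Car. N i (a - a0) < \<eta> \<longrightarrow> N i (b - b0) < \<eta> \<longrightarrow> N i (conv a b - conv a0 b0) < e"
    by blast
qed (simp_all add: Car_conv fib_mult)

lemma continuous_smult:
  "continuous_map (prod_topology euclidean TQ) TQ (\<lambda>(c, u). c \<odot>\<^bsub>fib (fst u)\<^esub> u)"
  unfolding continuous_map_def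
proof (intro conjI funcsetI allI impI)
  let ?X = "prod_topology (euclidean :: complex topology) TQ"
  have rep: "\<exists>c q a. q \<noteq> 0 \<and> a \<in> Car \<and> w = (c, pt q a)" if "w \<in> topspace ?X" for w
    using that by (cases w) (auto elim!: E_totalE)
  show "(case w of (c, u) \<Rightarrow> c \<odot>\<^bsub>fib (fst u)\<^esub> u) \<in> topspace TQ" if "w \<in> topspace ?X" for w
    using rep[OF that] by (auto simp: fib_smult pt_E_total Car_scale)
  fix W assume W: "openin TQ W"
  show "openin ?X {w \<in> topspace ?X. (case w of (c, u) \<Rightarrow> c \<odot>\<^bsub>fib (fst u)\<^esub> u) \<in> W}"
  proof (subst openin_subopen, intro ballI)
    fix w assume w: "w \<in> {w \<in> topspace ?X. (case w of (c, u) \<Rightarrow> c \<odot>\<^bsub>fib (fst u)\<^esub> u) \<in> W}"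
    then obtain c0 q0 a0 where q0: "q0 \<noteq> 0" and a0: "a0 \<in> Car" and w_eq: "w = (c0, pt q0 a0)"
      using rep by blast
    have "pt q0 (scale c0 a0) \<in> W"
      using w by (simp add: w_eq fib_smult q0 a0)
    then obtain \<delta> i e where *: "\<delta> > 0" "e > 0"
        "\<And>q a. q \<noteq> 0 \<Longrightarrow> dist q q0 < \<delta> \<Longrightarrow> a \<in> Car \<Longrightarrow> N i (a - scale c0 a0) < e \<Longrightarrow> pt q a \<in> W"
      using W q0 Car_scale[OF a0] unfolding openin_TQ by metis
    define L where "L = cmod c0 + 1 + N i a0"
    define \<eta> where "\<eta> = min 1 (e / (2 * L))"
    have L: "0 < L"
      using N_nonneg[OF a0, of i] norm_ge_zero[of c0] unfolding L_def by linarith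
    have \<eta>: "0 < \<eta>" "\<eta> \<le> 1" "\<eta> * L \<le> e / 2"
      using L *(2) by (auto simp: \<eta>_def min_def field_simps)
    let ?box = "{pt q a | q a. q \<noteq> 0 \<and> dist q q0 < \<delta> \<and> a \<in> Car \<and> N i (a - a0) < \<eta>}"
    have "openin ?X (ball c0 \<eta> \<times> ?box)"
      using openin_pt_box[OF q0 a0] by (simp add: openin_prod_Times_iff)
    moreover have "w \<in> ball c0 \<eta> \<times> ?box"
    proof -
      have "pt q0 a0 \<in> ?box"
        using q0 a0 *(1) \<eta>(1) by (intro CollectI exI[of _ q0] exI[of _ a0] conjI) (simp_all add: N_zero)
      then show ?thesis
        unfolding w_eq using \<eta>(1) by simp
    qed
    moreover have "ball c0 \<eta> \<times> ?box \<subseteq> {w \<in> topspace ?X. (case w of (c, u) \<Rightarrow> c \<odot>\<^bsub>fib (fst u)\<^esub> u) \<in> W}"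
    proof
      fix x assume "x \<in> ball c0 \<eta> \<times> ?box"
      then obtain c q a where x: "x = (c, pt q a)" "dist c0 c < \<eta>" "q \<noteq> 0" "dist q q0 < \<delta>" "a \<in> Car" "N i (a - a0) < \<eta>"
        by auto
      have d: "a - a0 \<in> Car"
        using x a0 by (simp add: Car_diff)
      have cc: "cmod (c - c0) < \<eta>"
        using x(2) by (simp add: dist_norm norm_minus_commute)
      then have c: "cmod c \<le> cmod c0 + 1"
        using norm_triangle_sub[of c c0] \<eta>(2) by linarith
      have "scale c a - scale c0 a0 = scale c (a - a0) + scale (c - c0) a0"
        by (auto simp: fun_eq_iff algebra_simps)
      then have "N i (scale c a - scale c0 a0) \<le> cmod c * N i (a - a0) + cmod (c - c0) * N i a0"
        using N_add[OF Car_scale[OF d] Car_scale[OF a0], of i c "c - c0"] N_scale[OF d, of i c] N_scale[OF a0, of i "c - c0"]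
        by simp
      also have "\<dots> \<le> (cmod c0 + 1) * \<eta> + \<eta> * N i a0"
        using c cc x(6) \<eta>(1) by (intro add_mono mult_mono) (auto simp: N_nonneg a0 d)
      also have "\<dots> = \<eta> * L"
        by (simp add: L_def algebra_simps)
      finally have "N i (scale c a - scale c0 a0) < e"
        using \<eta>(3) *(2) by simp
      then have "pt q (scale c a) \<in> W"
        using x by (intro *(3) Car_scale)
      then show "x \<in> {w \<in> topspace ?X. (case w of (c, u) \<Rightarrow> c \<odot>\<^bsub>fib (fst u)\<^esub> u) \<in> W}"
        using x by (simp add: fib_smult pt_E_total)
    qed
    ultimately show "\<exists>T. openin ?X T \<and> w \<in> T \<and> T \<subseteq> {w \<in> topspace ?X. (case w of (c, u) \<Rightarrow> c \<odot>\<^bsub>fib (fst u)\<^esub> u) \<in> W}"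
      by blast
  qed
qed

text \<open>Constant sections pass through every point of the bundle. They give the zero section,
  the centres of small tubes and the density of section values.\<close>

lemma continuous_section:
  assumes a: "a \<in> Car"
  shows "continuous_map (top_of_set punctured_plane) TQ (\<lambda>q. pt q a)"
  unfolding continuous_map_def
proof (intro conjI funcsetI allI impI)
  fix W assume W: "openin TQ W"
  show "openin (top_of_set punctured_plane) {q \<in> topspace (top_of_set punctured_plane). pt q a \<in> W}"
  proof (subst openin_subopen, intro ballI)
    fix q0 assume "q0 \<in> {q \<in> topspace (top_of_set punctured_plane). pt q a \<in> W}"
    then have q0: "q0 \<noteq> 0" "pt q0 a \<in> W"
      by auto
    then obtain \<delta> i e where *: "\<delta> > 0" "e > 0"
        "\<And>q b. q \<noteq> 0 \<Longrightarrow> dist q q0 < \<delta> \<Longrightarrow> b \<in> Car \<Longrightarrow> N i (b - a) < e \<Longrightarrow> pt q b \<in> W"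
      using W a unfolding openin_TQ by metis
    have "punctured_plane \<inter> ball q0 \<delta> \<subseteq> {q \<in> topspace (top_of_set punctured_plane). pt q a \<in> W}"
      using *(2,3) a by (auto simp: dist_commute N_zero)
    then show "\<exists>T. openin (top_of_set punctured_plane) T \<and> q0 \<in> T \<and>
        T \<subseteq> {q \<in> topspace (top_of_set punctured_plane). pt q a \<in> W}"
      using q0 *(1) by (intro exI[of _ "punctured_plane \<inter> ball q0 \<delta>"]) auto
  qed
qed (auto simp: pt_E_total a)

lemma continuous_fst: "continuous_map TQ (top_of_set punctured_plane) fst"
  unfolding continuous_map_def
proof (intro conjI funcsetI allI impI)
  show "v \<in> topspace TQ \<Longrightarrow> fst v \<in> topspace (top_of_set punctured_plane)" for v
    by (auto elim!: E_totalE)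
  fix V assume "openin (top_of_set punctured_plane) V"
  then obtain T where T: "open T" "V = punctured_plane \<inter> T"
    by (auto simp: openin_open)
  show "openin TQ {v \<in> topspace TQ. fst v \<in> V}"
    unfolding openin_TQ
  proof (intro conjI allI impI)
    fix q0 a0 assume q0: "q0 \<noteq> 0" and "a0 \<in> Car" and "pt q0 a0 \<in> {v \<in> topspace TQ. fst v \<in> V}"
    then have "q0 \<in> T"
      using T(2) by simp
    then obtain \<delta> where "\<delta> > 0" "\<And>q. dist q q0 < \<delta> \<Longrightarrow> q \<in> T"
      using T(1) by (auto simp: open_dist)
    then show "\<exists>\<delta>>0. \<exists>i. \<exists>e>0. \<forall>q a. q \<noteq> 0 \<longrightarrow> dist q q0 < \<delta> \<longrightarrow> a \<in> Car \<longrightarrow> N i (a - a0) < e \<longrightarrow>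
        pt q a \<in> {v \<in> topspace TQ. fst v \<in> V}"
      using T(2) by (intro exI[of _ \<delta>] conjI exI[of _ 0] exI[of _ 1]) (auto simp: pt_E_total)
  qed auto
qed

lemma open_fst: "open_map TQ (top_of_set punctured_plane) fst"
  unfolding open_map_def
proof (intro allI impI)
  fix W assume W: "openin TQ W"
  show "openin (top_of_set punctured_plane) (fst ` W)"
  proof (subst openin_subopen, intro ballI)
    fix q0 assume "q0 \<in> fst ` W"
    then obtain a0 where q0: "q0 \<noteq> 0" "a0 \<in> Car" "pt q0 a0 \<in> W"
      using openin_subset[OF W] by (auto elim!: E_totalE dest!: subsetD)
    then obtain \<delta> i e where *: "\<delta> > 0" "e > 0"
        "\<And>q b. q \<noteq> 0 \<Longrightarrow> dist q q0 < \<delta> \<Longrightarrow> b \<in> Car \<Longrightarrow> N i (b - a0) < e \<Longrightarrow> pt q b \<in> W"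
      using W unfolding openin_TQ by metis
    have "punctured_plane \<inter> ball q0 \<delta> \<subseteq> fst ` W"
    proof
      fix q assume "q \<in> punctured_plane \<inter> ball q0 \<delta>"
      then have "pt q a0 \<in> W"
        using *(2) q0(2) by (intro *(3)) (auto simp: dist_commute N_zero)
      then show "q \<in> fst ` W"
        by (rule rev_image_eqI) simp
    qed
    then show "\<exists>T. openin (top_of_set punctured_plane) T \<and> q0 \<in> T \<and> T \<subseteq> fst ` W"
      using q0 *(1) by (intro exI[of _ "punctured_plane \<inter> ball q0 \<delta>"]) auto
  qed
qed

lemma prebundle_B: "prebundle B"
  unfolding prebundle_def family_of_vector_spaces_def B_simps
proof (intro conjI ballI)
  show "fst ` E_total A = topspace (top_of_set punctured_plane)"
  proof (intro equalityI subsetI)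
    fix q assume "q \<in> topspace (top_of_set punctured_plane)"
    then show "q \<in> fst ` E_total A"
      by (intro image_eqI[of _ _ "pt q 0"] pt_E_total Car_zero) simp_all
  qed (auto elim!: E_totalE)
  fix q assume "q \<in> topspace (top_of_set punctured_plane)"
  then have q: "q \<noteq> 0"
    by simp
  show "carrier (fib q) = {u \<in> E_total A. fst u = q}"
    using fib_carrier_iff[OF q] by blast
  show "Module.module complex_field (fib q)"
    by (rule complex_algebraD(2)[OF complex_algebra_fib[OF q]])
next
  have "\<zero>\<^bsub>fib q\<^esub> = pt q 0" if "q \<noteq> 0" for q
    using fib_zero[OF that] .
  then show "continuous_map (top_of_set punctured_plane) TQ (\<lambda>q. \<zero>\<^bsub>fib q\<^esub>)"
    by (intro continuous_map_eq[OF continuous_section[OF Car_zero]]) simp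
qed (fact continuous_fst open_fst continuous_add continuous_smult)+

lemma continuous_bn: "continuous_map TQ euclideanreal (bn k i)"
  unfolding continuous_map_def
proof (intro conjI funcsetI allI impI)
  fix V :: "real set" assume "openin euclideanreal V"
  then have V: "open V"
    by simp
  show "openin TQ {v \<in> topspace TQ. bn k i v \<in> V}"
    unfolding openin_TQ
  proof (intro conjI allI impI)
    fix q0 a0 assume q0: "q0 \<noteq> 0" and a0: "a0 \<in> Car" and "pt q0 a0 \<in> {v \<in> topspace TQ. bn k i v \<in> V}"
    then have "cut k q0 * Q i q0 a0 \<in> V"
      by (simp add: bn_pt)
    then obtain e where e: "e > 0" "\<And>x. dist x (cut k q0 * Q i q0 a0) < e \<Longrightarrow> x \<in> V"
      using V by (auto simp: open_dist)
    \<comment> \<open>One half of \<open>e\<close> is spent on the change of \<open>Q\<close>,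
      weighted by \<open>cut k q \<le> real k\<close>, the other on the change of the cut-off,
      weighted by \<open>Q i q0 a0\<close>; the added \<open>1\<close> excludes zero
      denominators.\<close>
    define e1 where "e1 = e / (2 * (real k + 1))"
    define e2 where "e2 = e / (2 * (Q i q0 a0 + 1))"
    have Q0: "0 \<le> Q i q0 a0"
      by (rule Q_nonneg[OF a0])
    have half: "x * (e / (2 * x)) = e / 2" if "0 < x" for x
      using that by (simp add: field_simps)
    have e1: "0 < e1" "(real k + 1) * e1 = e / 2" and e2: "0 < e2" "(Q i q0 a0 + 1) * e2 = e / 2"
      using e(1) Q0 half[of "real k + 1"] half[of "Q i q0 a0 + 1"] by (simp_all add: e1_def e2_def add_nonneg_pos)
    obtain \<delta>1 \<eta> where 1: "\<delta>1 > 0" "\<eta> > 0" "\<forall>q a. q \<noteq> 0 \<longrightarrow> dist q q0 < \<delta>1 \<longrightarrow> a \<in> Car \<longrightarrow> N i (a - a0) < \<eta> \<longrightarrow>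
        \<bar>Q i q a - Q i q0 a0\<bar> < e1"
      using Q_continuous[OF q0 a0 e1(1), of i] by (elim exE conjE)
    obtain \<delta>2 where 2: "\<delta>2 > 0" "\<And>q. q \<noteq> 0 \<Longrightarrow> dist q q0 < \<delta>2 \<Longrightarrow> dist (cut k q) (cut k q0) < e2"
      using continuous_cut[of k] q0 e2(1) unfolding continuous_on_iff by (metis ComplI singletonD)
    have "pt q a \<in> {v \<in> topspace TQ. bn k i v \<in> V}"
      if q: "q \<noteq> 0" "dist q q0 < min \<delta>1 \<delta>2" and a: "a \<in> Car" "N i (a - a0) < \<eta>" for q a
    proof -
      have "\<bar>Q i q a - Q i q0 a0\<bar> < e1" "\<bar>cut k q - cut k q0\<bar> < e2"
        using 1(3) 2(2)[OF q(1)] q a by (auto simp: dist_real_def)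
      then have "\<bar>cut k q * (Q i q a - Q i q0 a0)\<bar> \<le> (real k + 1) * e1" "\<bar>(cut k q - cut k q0) * Q i q0 a0\<bar> < (Q i q0 a0 + 1) * e2"
      proof -
        assume lt: "\<bar>Q i q a - Q i q0 a0\<bar> < e1" "\<bar>cut k q - cut k q0\<bar> < e2"
        show "\<bar>cut k q * (Q i q a - Q i q0 a0)\<bar> \<le> (real k + 1) * e1"
          unfolding abs_mult using lt cut_le[of k q] cut_nonneg[of k q] by (intro mult_mono) auto
        have "\<bar>(cut k q - cut k q0) * Q i q0 a0\<bar> \<le> Q i q0 a0 * e2"
          using mult_left_mono[OF less_imp_le[OF lt(2)] Q0] Q0 by (simp add: abs_mult mult.commute)
        then show "\<bar>(cut k q - cut k q0) * Q i q0 a0\<bar> < (Q i q0 a0 + 1) * e2"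
          using e2(1) by (simp add: distrib_right)
      qed
      moreover have "cut k q * Q i q a - cut k q0 * Q i q0 a0 =
          cut k q * (Q i q a - Q i q0 a0) + (cut k q - cut k q0) * Q i q0 a0"
        by (simp add: algebra_simps)
      ultimately have "dist (cut k q * Q i q a) (cut k q0 * Q i q0 a0) < e"
        using e1(2) e2(2) unfolding dist_real_def by linarith
      then show ?thesis
        using e(2) q(1) a(1) by (simp add: bn_pt pt_E_total)
    qed
    then show "\<exists>\<delta>>0. \<exists>i'. \<exists>e>0. \<forall>q a. q \<noteq> 0 \<longrightarrow> dist q q0 < \<delta> \<longrightarrow> a \<in> Car \<longrightarrow> N i' (a - a0) < e \<longrightarrow>
        pt q a \<in> {v \<in> topspace TQ. bn k i v \<in> V}"
      using 1(1,2) 2(1) by (intro exI[of _ "min \<delta>1 \<delta>2"] conjI exI[of _ i] exI[of _ \<eta>]) auto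
  qed auto
qed simp

section \<open>Shifts by sections, translates and tubes\<close>

lemma minus_E_total:
  "u \<in> E_total A \<Longrightarrow> v \<in> E_total A \<Longrightarrow> fst u = fst v \<Longrightarrow> u \<ominus>\<^bsub>fib (fst u)\<^esub> v \<in> E_total A \<and> fst (u \<ominus>\<^bsub>fib (fst u)\<^esub> v) = fst u"
  by (auto elim!: E_totalE simp: fib_minus pt_E_total Car_diff)

lemma section_E_total:
  assumes V: "openin (top_of_set punctured_plane) V" and s: "s \<in> sections B V" and q: "q \<in> V"
  shows "s q \<in> E_total A" "fst (s q) = q"
proof -
  have "continuous_map (subtopology (top_of_set punctured_plane) V) TQ s"
    using s by (simp add: sections_def)
  then have "s ` topspace (subtopology (top_of_set punctured_plane) V) \<subseteq> topspace TQ"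
    by (rule continuous_map_image_subset_topspace)
  moreover have "q \<in> topspace (subtopology (top_of_set punctured_plane) V)"
    using q openin_subset[OF V] by auto
  ultimately show "s q \<in> E_total A"
    by auto
  show "fst (s q) = q"
    using s q by (simp add: sections_def)
qed

text \<open>Over \<open>V\<close> the shift is continuous, being fibrewise subtraction applied to
  the identity and to \<open>s\<close> composed with the projection. This treats arbitrary
  continuous sections, for which no explicit form is at hand.\<close>

lemma openin_section_shift:
  assumes V: "openin (top_of_set punctured_plane) V" and s: "s \<in> sections B V" and U: "openin TQ U"
  shows "openin TQ {v \<in> E_total A. fst v \<in> V \<and> v \<ominus>\<^bsub>fib (fst v)\<^esub> s (fst v) \<in> U}"
proof -
  define P where "P = {v \<in> E_total A. fst v \<in> V}"
  have P: "openin TQ P"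
    using openin_continuous_map_preimage[OF continuous_fst V] by (simp add: P_def)
  let ?X = "subtopology TQ P"
  have top: "topspace ?X = P"
    by (auto simp: P_def)
  have fst: "continuous_map ?X (subtopology (top_of_set punctured_plane) V) fst"
    by (intro continuous_map_into_subtopology continuous_map_from_subtopology continuous_fst) (auto simp: P_def)
  have "continuous_map (subtopology (top_of_set punctured_plane) V) TQ s"
    using s by (simp add: sections_def)
  then have "continuous_map ?X TQ (s \<circ> fst)"
    by (rule continuous_map_compose[OF fst])
  moreover have "continuous_map ?X TQ (\<lambda>v. v)"
    by (rule continuous_map_from_subtopology[OF continuous_map_id[unfolded id_def]])
  ultimately have "continuous_map ?X (prod_topology TQ TQ) (\<lambda>v. (v, (s \<circ> fst) v))"
    by (intro continuous_map_pairedI)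
  moreover have "(\<lambda>v. (v, (s \<circ> fst) v)) \<in> topspace ?X \<rightarrow> fibered_square B"
    unfolding top using section_E_total[OF V s] by (auto simp: fibered_square_def P_def)
  ultimately have "continuous_map ?X (subtopology (prod_topology TQ TQ) (fibered_square B)) (\<lambda>v. (v, (s \<circ> fst) v))"
    by (rule continuous_map_into_subtopology)
  from continuous_map_compose[OF this continuous_minus]
  have "continuous_map ?X TQ (\<lambda>v. v \<ominus>\<^bsub>fib (fst v)\<^esub> s (fst v))"
    by (simp add: o_def)
  then have "openin ?X {v \<in> topspace ?X. v \<ominus>\<^bsub>fib (fst v)\<^esub> s (fst v) \<in> U}"
    using U by (rule openin_continuous_map_preimage)
  then have "openin TQ {v \<in> P. v \<ominus>\<^bsub>fib (fst v)\<^esub> s (fst v) \<in> U}"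
    unfolding top using openin_trans_full[OF _ P] by blast
  then show ?thesis
    by (simp add: P_def conj_assoc)
qed

text \<open>Adding the section undoes the shift, so a translate is a preimage and
  \<open>openin_section_shift\<close> applies to it.\<close>

lemma translate_eq:
  assumes V: "openin (top_of_set punctured_plane) V" and s: "s \<in> sections B V" and U: "U \<subseteq> E_total A"
  shows "translate B V s U = {v \<in> E_total A. fst v \<in> V \<and> v \<ominus>\<^bsub>fib (fst v)\<^esub> s (fst v) \<in> U}"
proof (intro equalityI subsetI)
  fix v assume "v \<in> translate B V s U"
  then obtain u where u: "u \<in> U" "fst u \<in> V" "v = s (fst u) \<oplus>\<^bsub>fib (fst u)\<^esub> u"
    by (auto simp: translate_def)
  obtain q a where a: "q \<noteq> 0" "a \<in> Car" "u = pt q a"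
    using u(1) U by (blast elim: E_totalE)
  have "q \<in> V"
    using a u(2) by simp
  then obtain b where b: "b \<in> Car" "s q = pt q b"
    using section_E_total[OF V s] by (metis E_totalE fst_pt)
  have "v = pt q (b + a)"
    using u(3) a b by (simp add: fib_add)
  then show "v \<in> {v \<in> E_total A. fst v \<in> V \<and> v \<ominus>\<^bsub>fib (fst v)\<^esub> s (fst v) \<in> U}"
    using a b \<open>q \<in> V\<close> u(1) by (simp add: pt_E_total Car_add fib_minus)
next
  fix v assume v: "v \<in> {v \<in> E_total A. fst v \<in> V \<and> v \<ominus>\<^bsub>fib (fst v)\<^esub> s (fst v) \<in> U}"
  then obtain q a where a: "q \<noteq> 0" "a \<in> Car" "v = pt q a"
    by (blast elim: E_totalE)
  have "q \<in> V"
    using a v by simp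
  then obtain b where b: "b \<in> Car" "s q = pt q b"
    using section_E_total[OF V s] by (metis E_totalE fst_pt)
  have "pt q (a - b) \<in> U"
    using v a b by (simp add: fib_minus)
  moreover have "v = s (fst (pt q (a - b))) \<oplus>\<^bsub>fib (fst (pt q (a - b)))\<^esub> pt q (a - b)"
    using a b by (simp add: fib_add Car_diff)
  ultimately show "v \<in> translate B V s U"
    unfolding translate_def B_simps using \<open>q \<in> V\<close> fst_pt by (intro CollectI exI[of _ "pt q (a - b)"]) simp
qed

definition ubox :: "nat \<Rightarrow> nat \<Rightarrow> real \<Rightarrow> (complex \<times> (complex \<Rightarrow> free_series) set set) set" where
  "ubox k i e = {u \<in> E_total A. bn k i u < e}"

lemma ubox_subset: "ubox k i e \<subseteq> E_total A"
  by (auto simp: ubox_def)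

lemma openin_ubox: "openin TQ (ubox k i e)"
  using openin_continuous_map_preimage[OF continuous_bn, of "{..<e}" k i] by (simp add: ubox_def)

lemma tube_eq:
  assumes V: "openin (top_of_set punctured_plane) V" and s: "s \<in> sections B V"
  shows "tube B V s (bn k i) e = {v \<in> E_total A. fst v \<in> V \<and> v \<ominus>\<^bsub>fib (fst v)\<^esub> s (fst v) \<in> ubox k i e}"
  unfolding tube_def ubox_def B_simps
  using minus_E_total section_E_total[OF V s] by (intro Collect_cong) (metis (no_types, lifting) mem_Collect_eq)

lemma const_section: "openin (top_of_set punctured_plane) V \<Longrightarrow> a \<in> Car \<Longrightarrow> (\<lambda>q. pt q a) \<in> sections B V"
  unfolding sections_def B_simps by (simp add: continuous_map_from_subtopology continuous_section)

text \<open>Tubes around arbitrary sections are open by the shift. To fit a tube into a given open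
  set, the constant section through the point is used as its centre.\<close>

lemma tube_base: "is_base_of TQ
  {tube B V s \<nu> \<epsilon> | V s \<nu> \<epsilon>. openin (top_of_set punctured_plane) V \<and> s \<in> sections B V \<and> \<nu> \<in> BN \<and> 0 < \<epsilon>}"
  unfolding is_base_of_def openin_topology_base_unique
proof (intro conjI allI impI)
  fix S assume "S \<in> {tube B V s \<nu> \<epsilon> | V s \<nu> \<epsilon>. openin (top_of_set punctured_plane) V \<and> s \<in> sections B V \<and> \<nu> \<in> BN \<and> 0 < \<epsilon>}"
  then obtain V s k i \<epsilon> where V: "openin (top_of_set punctured_plane) V" and s: "s \<in> sections B V"
      and S: "S = tube B V s (bn k i) \<epsilon>"
    by (auto simp: BN_def)
  show "openin TQ S"
    unfolding S tube_eq[OF V s] by (rule openin_section_shift[OF V s openin_ubox])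
next
  fix W v assume "openin TQ W \<and> v \<in> W"
  then have W: "openin TQ W" and vW: "v \<in> W"
    by auto
  then have "v \<in> E_total A"
    using openin_subset[OF W] by auto
  then obtain q0 a0 where q0: "q0 \<noteq> 0" and a0: "a0 \<in> Car" and v: "v = pt q0 a0"
    by (rule E_totalE)
  obtain k i e V where V: "openin (top_of_set punctured_plane) V" "q0 \<in> V" "0 < e"
      "\<And>q a. q \<in> V \<Longrightarrow> a \<in> Car \<Longrightarrow> bn k i (pt q (a - a0)) < e \<Longrightarrow> pt q a \<in> W"
    using TQ_bn_nbhd[OF W q0 a0] vW v by metis
  let ?S = "tube B V (\<lambda>q. pt q a0) (bn k i) e"
  have s: "(\<lambda>q. pt q a0) \<in> sections B V"
    by (rule const_section[OF V(1) a0])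
  have "v \<in> ?S"
    using V(2,3) q0 a0 v by (simp add: tube_def fib_minus pt_E_total bn_pt Car_zero)
  moreover have "?S \<subseteq> W"
  proof
    fix w assume w: "w \<in> ?S"
    then have "w \<in> E_total A"
      by (simp add: tube_def)
    then obtain q a where a: "q \<noteq> 0" "a \<in> Car" "w = pt q a"
      by (rule E_totalE)
    then show "w \<in> W"
      using w V(4) a0 by (simp add: tube_def fib_minus)
  qed
  moreover have "?S \<in> {tube B V s \<nu> \<epsilon> | V s \<nu> \<epsilon>. openin (top_of_set punctured_plane) V \<and> s \<in> sections B V \<and> \<nu> \<in> BN \<and> 0 < \<epsilon>}"
    by (intro CollectI exI conjI, rule refl) (use V s bn_BN in simp_all)
  ultimately show "\<exists>S. S \<in> {tube B V s \<nu> \<epsilon> | V s \<nu> \<epsilon>. openin (top_of_set punctured_plane) V \<and> s \<in> sections B V \<and> \<nu> \<in> BN \<and> 0 < \<epsilon>} \<and> v \<in> S \<and> S \<subseteq> W"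
    by blast
qed

text \<open>Every point lies on a constant section, so the density of section values is
  immediate.\<close>

lemma fib_subset_section_values:
  assumes q: "q \<noteq> 0" shows "carrier (fib q) \<subseteq> section_values B q"
proof
  fix v assume "v \<in> carrier (fib q)"
  then obtain a where a: "a \<in> Car" "v = pt q a"
    using q by (auto simp: fib_carrier)
  have "openin (bspace B) punctured_plane" "q \<in> punctured_plane" "(\<lambda>q. pt q a) \<in> sections B punctured_plane"
    using q a by (auto intro!: const_section)
  then show "v \<in> section_values B q"
    unfolding section_values_def a(2)
    by (intro CollectI exI[of _ "\<lambda>q. pt q a"] exI[of _ punctured_plane] conjI refl)
qed

lemma closure_of_section_values:
  assumes q: "q \<noteq> 0" and top: "topspace T = carrier (fib q)"
  shows "T closure_of section_values B q = carrier (fib q)"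
proof (rule antisym)
  show "T closure_of section_values B q \<subseteq> carrier (fib q)"
    using closure_of_subset_topspace[of T] top by simp
  show "carrier (fib q) \<subseteq> T closure_of section_values B q"
    using closure_of_subset_Int[of T "section_values B q"] top fib_subset_section_values[OF q] by auto
qed

lemma topspace_fib: "q \<noteq> 0 \<Longrightarrow> topspace (subtopology TQ (carrier (fib q))) = carrier (fib q)"
  by (auto simp: fib_carrier_iff)

lemma admissible_BN: "admissible B BN"
  unfolding admissible_def B_simps using tube_base
  by (auto intro!: closure_of_section_values)

subsection \<open>The uniform structure\<close>

lemma mem_unif: "S \<in> unif B \<longleftrightarrow> absolutely_convex_subset B S \<and> (\<exists>k i e. 0 < e \<and> ubox k i e \<subseteq> S)"
  unfolding unif_eq seminorm_structure_def ubox_def BN_def B_simps by blast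

lemma absolutely_convexD:
  assumes S: "absolutely_convex_subset B S" and q: "q \<noteq> 0"
    and u: "a \<in> Car" "pt q a \<in> S" and v: "b \<in> Car" "pt q b \<in> S" and cd: "cmod c + cmod d \<le> 1"
  shows "pt q (scale c a + scale d b) \<in> S"
proof -
  have "absolutely_convex_in (fib q) (S \<inter> carrier (fib q))"
    using S q by (simp add: absolutely_convex_subset_def)
  moreover have "pt q a \<in> S \<inter> carrier (fib q)" "pt q b \<in> S \<inter> carrier (fib q)"
    using u v q by (simp_all add: fib_carrier)
  ultimately have "c \<odot>\<^bsub>fib q\<^esub> pt q a \<oplus>\<^bsub>fib q\<^esub> d \<odot>\<^bsub>fib q\<^esub> pt q b \<in> S"
    using cd unfolding absolutely_convex_in_def by blast
  then show ?thesis
    using q u v by (simp add: fib_smult fib_add Car_scale)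
qed

lemma absolutely_convexI:
  assumes sub: "S \<subseteq> E_total A"
    and conv: "\<And>q a b c d. q \<noteq> 0 \<Longrightarrow> a \<in> Car \<Longrightarrow> b \<in> Car \<Longrightarrow> pt q a \<in> S \<Longrightarrow> pt q b \<in> S \<Longrightarrow> cmod c + cmod d \<le> 1 \<Longrightarrow>
      pt q (scale c a + scale d b) \<in> S"
  shows "absolutely_convex_subset B S"
  unfolding absolutely_convex_subset_def absolutely_convex_in_def B_simps
proof (intro conjI ballI allI impI)
  fix q u v and c d :: complex
  assume q: "q \<in> topspace (top_of_set punctured_plane)" and "u \<in> S \<inter> carrier (fib q)" "v \<in> S \<inter> carrier (fib q)"
    and cd: "cmod c + cmod d \<le> 1"
  then obtain a b where ab: "a \<in> Car" "u = pt q a" "u \<in> S" "b \<in> Car" "v = pt q b" "v \<in> S"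
    by (auto simp: fib_carrier)
  then show "c \<odot>\<^bsub>fib q\<^esub> u \<oplus>\<^bsub>fib q\<^esub> d \<odot>\<^bsub>fib q\<^esub> v \<in> S \<inter> carrier (fib q)"
    using q cd conv[of q a b c d] by (simp add: fib_smult fib_add Car_scale fib_carrier Car_add)
qed (use sub in auto)

lemma absolutely_convex_ubox: "absolutely_convex_subset B (ubox k i e)"
proof (rule absolutely_convexI[OF ubox_subset])
  fix q a b and c d :: complex
  assume q: "q \<noteq> 0" and a: "a \<in> Car" and b: "b \<in> Car" and u: "pt q a \<in> ubox k i e" "pt q b \<in> ubox k i e"
    and cd: "cmod c + cmod d \<le> 1"
  let ?m = "max (bn k i (pt q a)) (bn k i (pt q b))"
  have m: "?m < e" "0 \<le> ?m"
    using u seminorm_bn[OF q, of k i] a q by (auto simp: ubox_def seminorm_on_def fib_carrier le_max_iff_disj)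
  have "Q i q (scale c a + scale d b) \<le> cmod c * Q i q a + cmod d * Q i q b"
    using Q_add[OF Car_scale[OF a] Car_scale[OF b], of i q c d] by (simp add: Q_scale a b)
  then have "bn k i (pt q (scale c a + scale d b)) \<le> cmod c * bn k i (pt q a) + cmod d * bn k i (pt q b)"
    using mult_left_mono[OF _ cut_nonneg, of _ _ k q] q a b
    by (fastforce simp: bn_pt Car_add Car_scale algebra_simps)
  also have "\<dots> \<le> cmod c * ?m + cmod d * ?m"
    by (intro add_mono mult_left_mono) auto
  also have "\<dots> = (cmod c + cmod d) * ?m"
    by (simp add: distrib_right)
  also have "\<dots> \<le> 1 * ?m"
    using cd m(2) by (rule mult_right_mono)
  finally have "bn k i (pt q (scale c a + scale d b)) < e"
    using m(1) by linarith
  then show "pt q (scale c a + scale d b) \<in> ubox k i e"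
    using q a b by (simp add: ubox_def pt_E_total Car_add Car_scale)
qed

lemma ubox_unif: "0 < e \<Longrightarrow> ubox k i e \<in> unif B"
  using absolutely_convex_ubox by (auto simp: mem_unif)

lemma Int_unif:
  assumes "S \<in> unif B" "T \<in> unif B" shows "S \<inter> T \<in> unif B"
proof -
  obtain k i e where 1: "0 < e" "ubox k i e \<subseteq> S"
    using assms(1) by (auto simp: mem_unif)
  obtain l j d where 2: "0 < d" "ubox l j d \<subseteq> T"
    using assms(2) by (auto simp: mem_unif)
  have "ubox (max k l) (max i j) (min e d) \<subseteq> ubox k i e \<inter> ubox l j d"
    using bn_mono[of k "max k l" i "max i j"] bn_mono[of l "max k l" j "max i j"]
    by (fastforce simp: ubox_def)
  moreover have "absolutely_convex_subset B (S \<inter> T)"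
    using assms absolutely_convexD[of S] absolutely_convexD[of T]
    by (intro absolutely_convexI) (auto simp: mem_unif absolutely_convex_subset_def)
  ultimately show ?thesis
    using 1 2 unfolding mem_unif by (intro conjI exI[of _ "max k l"] exI[of _ "max i j"] exI[of _ "min e d"]) auto
qed

lemma E_total_unif: "E_total A \<in> unif B"
  unfolding mem_unif using ubox_subset
  by (intro conjI absolutely_convexI exI[of _ 0] exI[of _ 1]) (auto simp: pt_E_total Car_add Car_scale)

lemma absorbing_unif:
  assumes "S \<in> unif B" shows "absorbing_subset B S"
  unfolding absorbing_subset_def absorbing_in_def B_simps
proof (intro conjI ballI)
  show "S \<subseteq> E_total A"
    using assms by (simp add: mem_unif absolutely_convex_subset_def)
  obtain k i e where S: "0 < e" "ubox k i e \<subseteq> S"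
    using assms by (auto simp: mem_unif)
  fix q u assume "q \<in> topspace (top_of_set punctured_plane)" and u: "u \<in> carrier (fib q)"
  then have q: "q \<noteq> 0"
    by simp
  then obtain a where a: "a \<in> Car" "u = pt q a"
    using u by (auto simp: fib_carrier)
  let ?m = "bn k i u"
  have m: "0 \<le> ?m"
    using seminorm_bn[OF q] u by (auto simp: seminorm_on_def)
  have "c \<odot>\<^bsub>fib q\<^esub> u \<in> S \<inter> carrier (fib q)" if c: "cmod c \<le> e / (?m + 1)" for c
  proof -
    have "bn k i (c \<odot>\<^bsub>fib q\<^esub> u) = cmod c * ?m"
      using seminorm_bn[OF q] u by (auto simp: seminorm_on_def)
    also have "\<dots> \<le> e / (?m + 1) * ?m"
      by (rule mult_right_mono[OF c m])
    also have "\<dots> < e"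
      using m S(1) by (simp add: field_simps)
    finally show ?thesis
      using S(2) a q by (auto simp: ubox_def fib_smult pt_E_total Car_scale fib_carrier)
  qed
  then show "\<exists>\<delta>>0. \<forall>c. cmod c \<le> \<delta> \<longrightarrow> c \<odot>\<^bsub>fib q\<^esub> u \<in> S \<inter> carrier (fib q)"
    using m S(1) by (intro exI[of _ "e / (?m + 1)"]) simp
qed

lemma scale_unif:
  assumes S: "S \<in> unif B" and c: "c \<noteq> 0"
  shows "(\<lambda>u. c \<odot>\<^bsub>fib (fst u)\<^esub> u) ` S \<in> unif B" (is "?T \<in> _")
proof -
  have sub: "S \<subseteq> E_total A" and ac: "absolutely_convex_subset B S"
    using S by (auto simp: mem_unif absolutely_convex_subset_def)
  \<comment> \<open>A point has many representatives, so equality of points is translated into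
    equality of symbols before scaling back by \<open>1 / c\<close>.\<close>
  have iff: "pt q a \<in> ?T \<longleftrightarrow> pt q (scale (1 / c) a) \<in> S" if q: "q \<noteq> 0" and a: "a \<in> Car" for q a
  proof
    assume "pt q a \<in> ?T"
    then obtain u where u: "u \<in> S" "pt q a = c \<odot>\<^bsub>fib (fst u)\<^esub> u"
      by blast
    then obtain q' b where b: "q' \<noteq> 0" "b \<in> Car" "u = pt q' b"
      using sub by (blast elim: E_totalE)
    have "pt q a = pt q' (scale c b)"
      using u b by (simp add: fib_smult)
    then have "q' = q" "symb q a = symb q (scale c b)"
      using pt_eq_iff[OF q a Car_scale[OF b(2)]] by auto
    then have "symb q (scale (1 / c) a) = symb q b"
      using c by (simp add: symb_scale)
    then have "pt q (scale (1 / c) a) = pt q b"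
      using pt_eq_iff[OF q Car_scale[OF a] b(2)] by simp
    then show "pt q (scale (1 / c) a) \<in> S"
      using u(1) b(3) \<open>q' = q\<close> by simp
  next
    assume m: "pt q (scale (1 / c) a) \<in> S"
    have "pt q a = c \<odot>\<^bsub>fib (fst (pt q (scale (1 / c) a)))\<^esub> pt q (scale (1 / c) a)"
      using q a c by (simp add: fib_smult Car_scale)
    then show "pt q a \<in> ?T"
      using m by (rule image_eqI)
  qed
  have "?T \<subseteq> E_total A"
    using sub by (auto elim!: E_totalE dest!: subsetD simp: fib_smult pt_E_total Car_scale)
  then have "absolutely_convex_subset B ?T"
  proof (rule absolutely_convexI)
    fix q a b and x y :: complex
    assume q: "q \<noteq> 0" and a: "a \<in> Car" and b: "b \<in> Car" and m: "pt q a \<in> ?T" "pt q b \<in> ?T" and xy: "cmod x + cmod y \<le> 1"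
    have "pt q (scale x (scale (1 / c) a) + scale y (scale (1 / c) b)) \<in> S"
      using m iff[OF q a] iff[OF q b] q a b xy by (intro absolutely_convexD[OF ac]) (simp_all add: Car_scale)
    also have "scale x (scale (1 / c) a) + scale y (scale (1 / c) b) = scale (1 / c) (scale x a + scale y b)"
      by (simp add: scale_add_right mult.commute)
    finally show "pt q (scale x a + scale y b) \<in> ?T"
      using iff[OF q Car_add[OF Car_scale[OF a] Car_scale[OF b]]] by blast
  qed
  moreover obtain k i e where e: "0 < e" "ubox k i e \<subseteq> S"
    using S by (auto simp: mem_unif)
  have "ubox k i (cmod c * e) \<subseteq> ?T"
  proof
    fix u assume u: "u \<in> ubox k i (cmod c * e)"
    then obtain q a where a: "q \<noteq> 0" "a \<in> Car" "u = pt q a"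
      using ubox_subset by (blast elim: E_totalE)
    have "pt q (scale (1 / c) a) \<in> ubox k i e"
      using u a c by (simp add: ubox_def bn_pt Car_scale pt_E_total Q_scale norm_divide field_simps)
    then show "u \<in> ?T"
      using iff[OF a(1,2)] e(2) a(3) by auto
  qed
  moreover have "0 < cmod c * e"
    using c e(1) by simp
  ultimately show ?thesis
    unfolding mem_unif by blast
qed

lemma lc_structure_B: "lc_uniform_vector_structure B (unif B)"
  unfolding lc_uniform_vector_structure_def B_simps
proof (intro conjI ballI allI impI)
  fix \<F> assume "finite \<F> \<and> \<F> \<subseteq> unif B"
  then have "finite \<F>" "\<F> \<subseteq> unif B"
    by auto
  then show "E_total A \<inter> \<Inter>\<F> \<in> unif B"
  proof (induction \<F> rule: finite_induct)
    case empty
    show ?case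
      using E_total_unif by simp
  next
    case (insert U \<F>)
    then have "U \<inter> (E_total A \<inter> \<Inter>\<F>) \<in> unif B"
      by (auto intro: Int_unif[of U "E_total A \<inter> \<Inter>\<F>"])
    then show ?case
      by (simp only: Inter_insert Int_left_commute)
  qed
next
  fix U assume "U \<in> unif B"
  then show "absolutely_convex_subset B U" "absorbing_subset B U"
    using absorbing_unif by (auto simp: mem_unif)
next
  fix U S assume "U \<in> unif B" "absolutely_convex_subset B S \<and> U \<subseteq> S"
  then show "S \<in> unif B"
    unfolding mem_unif by blast
qed (rule scale_unif)

text \<open>A tube for \<open>bn k i\<close> is the translate of the open set \<open>ubox\<close>,
  so the base of tubes consists of members of the required base.\<close>

lemma locally_convex_B: "locally_convex_bundle B"
  unfolding locally_convex_bundle_def B_simps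
proof (intro conjI ballI prebundle_B lc_structure_B)
  fix U assume "U \<in> unif B"
  then obtain k i e where "0 < e" "ubox k i e \<subseteq> U"
    by (auto simp: mem_unif)
  then show "\<exists>U0\<in>unif B. openin TQ U0 \<and> U0 \<subseteq> U"
    by (intro bexI[OF _ ubox_unif] conjI openin_ubox)
next
  show "is_base_of TQ {translate B V s U | V s U. openin (top_of_set punctured_plane) V \<and> s \<in> sections B V \<and>
      U \<in> unif B \<and> openin TQ U}"
    unfolding is_base_of_def openin_topology_base_unique
  proof (intro conjI allI impI)
    fix S assume "S \<in> {translate B V s U | V s U. openin (top_of_set punctured_plane) V \<and> s \<in> sections B V \<and>
      U \<in> unif B \<and> openin TQ U}"
    then obtain V s U where V: "openin (top_of_set punctured_plane) V" and s: "s \<in> sections B V"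
        and U: "U \<in> unif B" "openin TQ U" and S: "S = translate B V s U"
      unfolding mem_Collect_eq by (elim exE conjE)
    have "U \<subseteq> E_total A"
      using openin_subset[OF U(2)] by simp
    then show "openin TQ S"
      unfolding S by (simp only: translate_eq[OF V s] openin_section_shift[OF V s U(2)])
  next
    fix W v assume "openin TQ W \<and> v \<in> W"
    then obtain S where S: "S \<in> {tube B V s \<nu> \<epsilon> | V s \<nu> \<epsilon>. openin (top_of_set punctured_plane) V \<and> s \<in> sections B V \<and> \<nu> \<in> BN \<and> 0 < \<epsilon>}"
        and vS: "v \<in> S" "S \<subseteq> W"
      using tube_base[unfolded is_base_of_def openin_topology_base_unique, THEN conjunct2, rule_format, of W v]
      by (elim exE conjE) blast
    then obtain V s k i \<epsilon> where V: "openin (top_of_set punctured_plane) V" and s: "s \<in> sections B V"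
        and e: "0 < \<epsilon>" and S_eq: "S = tube B V s (bn k i) \<epsilon>"
      by (auto simp: BN_def)
    have "S = translate B V s (ubox k i \<epsilon>)"
      unfolding S_eq tube_eq[OF V s] translate_eq[OF V s ubox_subset] ..
    with vS V s e show "\<exists>S. S \<in> {translate B V s U | V s U. openin (top_of_set punctured_plane) V \<and> s \<in> sections B V \<and>
        U \<in> unif B \<and> openin TQ U} \<and> v \<in> S \<and> S \<subseteq> W"
      by (intro exI[of _ S] conjI CollectI exI[of _ V] exI[of _ s] exI[of _ "ubox k i \<epsilon>"] ubox_unif openin_ubox)
  qed
next
  fix q assume "q \<in> topspace (top_of_set punctured_plane)"
  then have "q \<noteq> 0"
    by simp
  then show "subtopology TQ (carrier (fib q)) closure_of section_values B q = carrier (fib q)"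
    by (intro closure_of_section_values topspace_fib)
qed

lemma continuous_bundle_B: "continuous_bundle B"
  unfolding continuous_bundle_def
proof (intro conjI locally_convex_B exI[of _ BN] directed_BN admissible_BN unif_eq ballI)
  fix \<nu> assume "\<nu> \<in> BN"
  then show "continuous_map (tspace B) euclideanreal \<nu>"
    using continuous_bn by (auto simp: BN_def)
qed

subsection \<open>The fibres are Frechet algebras\<close>

text \<open>On a single fibre the cut-off is left out: \<open>bn k i\<close> vanishes there for
  small \<open>k\<close>, whereas the \<open>nm i\<close> form one increasing sequence.\<close>

lemma seminorm_sequence_fib:
  assumes q: "q \<noteq> 0" shows "seminorm_sequence (fib q) nm"
proof (rule seminorm_sequence.intro)
  show "Module.module complex_field (fib q)"
    by (rule complex_algebraD(2)[OF complex_algebra_fib[OF q]])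
  show "nm i u \<le> nm (Suc i) u" if "u \<in> carrier (fib q)" for i u
    using that q by (auto simp: fib_carrier nm_pt Q_incr)
  show "seminorm_on (fib q) (nm i)" for i
    unfolding seminorm_on_def fib_carrier[OF q]
  proof (intro conjI ballI allI; elim imageE; hypsubst)
    fix a b c assume a: "a \<in> Car"
    show "0 \<le> nm i (pt q a)" "nm i (c \<odot>\<^bsub>fib q\<^esub> pt q a) = cmod c * nm i (pt q a)"
      using q a by (simp_all add: nm_pt Q_nonneg fib_smult Car_scale Q_scale)
    assume b: "b \<in> Car"
    show "nm i (pt q a \<oplus>\<^bsub>fib q\<^esub> pt q b) \<le> nm i (pt q a) + nm i (pt q b)"
      using q a b by (simp add: nm_pt fib_add Car_add Q_add)
  qed
qed

lemma openin_nm_ball: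
  assumes a0: "a0 \<in> Car"
  shows "openin TQ {pt q a | q a. q \<noteq> 0 \<and> a \<in> Car \<and> Q i q (a - a0) < e}"
proof -
  have "openin XF {x \<in> punctured_plane \<times> Car. Q i (fst x) (snd x - a0) < e}"
    unfolding openin_XF
  proof (intro conjI allI impI)
    fix q1 a1 assume "(q1, a1) \<in> {x \<in> punctured_plane \<times> Car. Q i (fst x) (snd x - a0) < e}"
    then have m: "q1 \<noteq> 0" "a1 \<in> Car" "Q i q1 (a1 - a0) < e"
      by auto
    let ?e = "e - Q i q1 (a1 - a0)"
    have e0: "0 < ?e"
      using m(3) by simp
    obtain \<delta> \<eta> where *: "\<delta> > 0" "\<eta> > 0" "\<forall>q a. q \<noteq> 0 \<longrightarrow> dist q q1 < \<delta> \<longrightarrow> a \<in> Car \<longrightarrow> N i (a - (a1 - a0)) < \<eta> \<longrightarrow>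
        \<bar>Q i q a - Q i q1 (a1 - a0)\<bar> < ?e"
      using Q_continuous[OF m(1) Car_diff[OF m(2) a0] e0, of i] by (elim exE conjE)
    have "Q i q (a - a0) < e" if q: "q \<noteq> 0" "dist q q1 < \<delta>" and a: "a \<in> Car" "N i (a - a1) < \<eta>" for q a
    proof -
      have "\<bar>Q i q (a - a0) - Q i q1 (a1 - a0)\<bar> < ?e"
        using q a a0 by (intro *(3)[rule_format]) (simp_all add: Car_diff)
      then show ?thesis
        by linarith
    qed
    with *(1,2) show "\<exists>\<delta>>0. \<exists>j. \<exists>\<eta>>0. \<forall>q a. q \<noteq> 0 \<longrightarrow> dist q q1 < \<delta> \<longrightarrow> a \<in> Car \<longrightarrow> N j (a - a1) < \<eta> \<longrightarrow>
        (q, a) \<in> {x \<in> punctured_plane \<times> Car. Q i (fst x) (snd x - a0) < e}"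
      by (intro exI[of _ \<delta>] conjI exI[of _ i] exI[of _ \<eta>]) auto
  qed auto
  from openin_pt_image[OF this] show ?thesis
    by (simp add: conj_assoc)
qed

text \<open>Open sets of \<open>TQ\<close> contain \<open>Q\<close>-balls by \<open>TQ_nbhd\<close>,
  and \<open>Q\<close>-balls are traces of open sets by \<open>openin_nm_ball\<close>, which rests
  on \<open>Q_continuous\<close>.\<close>

lemma fib_topology:
  assumes q: "q \<noteq> 0"
  shows "subtopology TQ (carrier (fib q)) = seminorm_topology (fib q) (range nm)"
proof -
  interpret f: seminorm_sequence "fib q" nm
    by (rule seminorm_sequence_fib[OF q])
  have nmd: "nm i (pt q a \<ominus>\<^bsub>fib q\<^esub> pt q b) = Q i q (a - b)" if "a \<in> Car" "b \<in> Car" for i a b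
    using q that by (simp add: fib_minus nm_pt Car_diff)
  have open_iff: "openin (seminorm_topology (fib q) (range nm)) W \<longleftrightarrow> W \<subseteq> carrier (fib q) \<and>
      (\<forall>a0\<in>Car. pt q a0 \<in> W \<longrightarrow> (\<exists>i. \<exists>e>0. \<forall>a\<in>Car. Q i q (a - a0) < e \<longrightarrow> pt q a \<in> W))" for W
    unfolding f.openin_iff
  proof (rule conj_cong[OF refl])
    assume "W \<subseteq> carrier (fib q)"
    then have "(\<forall>u\<in>W. R u) \<longleftrightarrow> (\<forall>a0\<in>Car. pt q a0 \<in> W \<longrightarrow> R (pt q a0))" for R
      unfolding fib_carrier[OF q] by blast
    then show "(\<forall>u\<in>W. \<exists>i. \<exists>e>0. \<forall>v\<in>carrier (fib q). nm i (v \<ominus>\<^bsub>fib q\<^esub> u) < e \<longrightarrow> v \<in> W) \<longleftrightarrow>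
      (\<forall>a0\<in>Car. pt q a0 \<in> W \<longrightarrow> (\<exists>i. \<exists>e>0. \<forall>a\<in>Car. Q i q (a - a0) < e \<longrightarrow> pt q a \<in> W))"
      unfolding fib_carrier[OF q] ball_simps(9)
      by (simp add: nmd cong: ball_cong)
  qed
  show ?thesis
    unfolding topology_eq
  proof (intro allI iffI)
    fix W assume "openin (subtopology TQ (carrier (fib q))) W"
    then obtain T where T: "openin TQ T" "W = T \<inter> carrier (fib q)"
      by (auto simp: openin_subtopology)
    show "openin (seminorm_topology (fib q) (range nm)) W"
      unfolding open_iff
    proof (intro conjI ballI impI)
      fix a0 assume a0: "a0 \<in> Car" and "pt q a0 \<in> W"
      then have "pt q a0 \<in> T"
        using T by simp
      then obtain \<delta> i e where "\<delta> > 0" "e > 0"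
          "\<And>p a. p \<noteq> 0 \<Longrightarrow> dist p q < \<delta> \<Longrightarrow> a \<in> Car \<Longrightarrow> Q i p (a - a0) < e \<Longrightarrow> pt p a \<in> T"
        using TQ_nbhd[OF T(1) q a0] by metis
      then have "\<forall>a\<in>Car. Q i q (a - a0) < e \<longrightarrow> pt q a \<in> W"
        using q T(2) by (simp add: fib_carrier)
      with \<open>e > 0\<close> show "\<exists>i. \<exists>e>0. \<forall>a\<in>Car. Q i q (a - a0) < e \<longrightarrow> pt q a \<in> W"
        by blast
    qed (use T in auto)
  next
    fix W assume W: "openin (seminorm_topology (fib q) (range nm)) W"
    then have sub: "W \<subseteq> carrier (fib q)"
      by (simp add: open_iff)
    show "openin (subtopology TQ (carrier (fib q))) W"
    proof (subst openin_subopen, intro ballI)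
      fix w assume w: "w \<in> W"
      then obtain a0 where a0: "a0 \<in> Car" "w = pt q a0"
        using sub q by (auto simp: fib_carrier)
      obtain i e where e: "e > 0" "\<And>a. a \<in> Car \<Longrightarrow> Q i q (a - a0) < e \<Longrightarrow> pt q a \<in> W"
        using W w a0 unfolding open_iff by blast
      let ?T = "{pt q a | q a. q \<noteq> 0 \<and> a \<in> Car \<and> Q i q (a - a0) < e}"
      have "openin (subtopology TQ (carrier (fib q))) (carrier (fib q) \<inter> ?T)"
        by (rule openin_subtopology_Int2[OF openin_nm_ball[OF a0(1)]])
      moreover have "w \<in> carrier (fib q) \<inter> ?T"
      proof -
        have "w \<in> ?T"
          unfolding a0(2) using q a0(1) e(1) by (intro CollectI exI[of _ q] exI[of _ a0]) simp
        with w sub show ?thesis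
          by blast
      qed
      moreover have "carrier (fib q) \<inter> ?T \<subseteq> W"
      proof
        fix v assume "v \<in> carrier (fib q) \<inter> ?T"
        then obtain p a where v: "v = pt p a" "a \<in> Car" "Q i p (a - a0) < e" "v \<in> carrier (fib q)"
          by blast
        then have "p = q"
          using q by (auto simp: fib_carrier_iff)
        with v show "v \<in> W"
          using e(2) by simp
      qed
      ultimately show "\<exists>T. openin (subtopology TQ (carrier (fib q))) T \<and> w \<in> T \<and> T \<subseteq> W"
        by blast
    qed
  qed
qed

text \<open>
  Completeness of a quotient: a rapidly Cauchy subsequence is lifted to the free algebra along
  lifts of its consecutive differences.
\<close>

lemma fib_complete:
  assumes q: "q \<noteq> 0" and \<sigma>: "range \<sigma> \<subseteq> carrier (fib q)"
    and cauchy: "\<forall>k. \<forall>\<epsilon>>0. \<exists>M. \<forall>i\<ge>M. \<forall>j\<ge>M. nm k (\<sigma> i \<ominus>\<^bsub>fib q\<^esub> \<sigma> j) < \<epsilon>"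
  shows "\<exists>u. limitin (seminorm_topology (fib q) (range nm)) \<sigma> u sequentially"
proof -
  interpret f: seminorm_sequence "fib q" nm
    by (rule seminorm_sequence_fib[OF q])
  have "\<forall>i. \<exists>a. a \<in> Car \<and> \<sigma> i = pt q a"
    using \<sigma> fib_carrier[OF q] by blast
  then obtain x where x: "\<And>i. x i \<in> Car" "\<And>i. \<sigma> i = pt q (x i)"
    by metis
  have nmd: "nm k (\<sigma> i \<ominus>\<^bsub>fib q\<^esub> \<sigma> j) = Q k q (x i - x j)" for i j k
    using q x by (simp add: fib_minus nm_pt Car_diff)
  have Qc: "\<exists>M. \<forall>i\<ge>M. \<forall>j\<ge>M. Q k q (x i - x j) < \<epsilon>" if "0 < \<epsilon>" for k \<epsilon>
    using cauchy that unfolding nmd by blast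
  then have "\<forall>k. \<exists>M. \<forall>i\<ge>M. \<forall>j\<ge>M. Q k q (x i - x j) < (1 / 2) ^ k"
    by simp
  then obtain M where M: "\<And>k i j. i \<ge> M k \<Longrightarrow> j \<ge> M k \<Longrightarrow> Q k q (x i - x j) < (1 / 2) ^ k"
    by metis
  \<comment> \<open>The maximum puts \<open>s k\<close> beyond all thresholds up to the
    \<open>k\<close>-th, and the summand \<open>k\<close> makes \<open>s k\<close> tend to
    infinity.\<close>
  define s where "s k = k + Max (M ` {..k})" for k
  have s: "M j \<le> s k" if "j \<le> k" for j k
  proof -
    have "M j \<le> Max (M ` {..k})"
      using that by (intro Max_ge) auto
    then show ?thesis
      by (simp add: s_def)
  qed
  have "\<forall>k. \<exists>d. d \<in> Car \<and> symb q d = symb q (x (s (Suc k)) - x (s k)) \<and> N k d < (1 / 2) ^ k"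
  proof
    fix k
    have "Q k q (x (s (Suc k)) - x (s k)) < (1 / 2) ^ k"
      by (rule M) (simp_all add: s)
    then show "\<exists>d. d \<in> Car \<and> symb q d = symb q (x (s (Suc k)) - x (s k)) \<and> N k d < (1 / 2) ^ k"
      using Q_lessE Car_diff[OF x(1) x(1)] by metis
  qed
  then obtain d where d: "\<And>k. d k \<in> Car" "\<And>k. symb q (d k) = symb q (x (s (Suc k)) - x (s k))"
      "\<And>k. N k (d k) < (1 / 2) ^ k"
    by metis
  \<comment> \<open>The lifts telescope: \<open>y m\<close> has the symbol of
    \<open>x (s m)\<close>, and its increments are small in the norms themselves, not only modulo
    the kernel.\<close>
  define y where "y m = x (s 0) + (\<Sum>k<m. d k)" for m
  have y_Car: "y m \<in> Car" for m
    unfolding y_def by (intro Car_add x Car_sum d)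
  have y_symb: "symb q (y m) = symb q (x (s m))" for m
  proof (induction m)
    case (Suc m)
    have "y (Suc m) = y m + d m"
      by (simp add: y_def add.assoc)
    then have "symb q (y (Suc m)) = symb q (y m) + symb q (d m)"
      by (simp only: symb_add)
    then show ?case
      unfolding Suc.IH d(2) symb_diff by simp
  qed (simp add: y_def)
  have y_step: "N i (y (m + l) - y m) \<le> 2 * (1 / 2) ^ m" if "i \<le> m" for i m l
  proof -
    have "N i (y (m + l) - y m) \<le> 2 * (1 / 2) ^ m - 2 * (1 / 2) ^ (m + l)"
    proof (induction l)
      case (Suc l)
      have eq: "y (m + Suc l) - y m = (y (m + l) - y m) + d (m + l)"
        by (simp add: y_def algebra_simps)
      have "N i (d (m + l)) \<le> N (m + l) (d (m + l))"
        using that by (intro N_mono d) simp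
      then have "N i (y (m + Suc l) - y m) \<le> N i (y (m + l) - y m) + (1 / 2) ^ (m + l)"
        unfolding eq using N_add[OF Car_diff[OF y_Car y_Car] d(1), of i "m + l" m "m + l"] d(3)[of "m + l"] by linarith
      moreover have "2 * (1 / 2 :: real) ^ (m + l) = (1 / 2) ^ (m + l) + 2 * (1 / 2) ^ (m + Suc l)"
        by simp
      ultimately show ?case
        using Suc.IH by linarith
    qed (simp only: add_0_right diff_self N_zero order_refl)
    moreover have "(0::real) \<le> 2 * (1 / 2) ^ (m + l)"
      by simp
    ultimately show ?thesis
      by linarith
  qed
  have small: "\<exists>m\<ge>i. 2 * (1 / 2 :: real) ^ m < e" if "0 < e" for i e
  proof -
    have "\<forall>\<^sub>F m in sequentially. (1 / 2 :: real) ^ m < e / 2"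
      using LIMSEQ_power_zero[of "1 / 2 :: real"] that by (intro order_tendstoD(2)) auto
    then obtain m0 where "\<And>m. m \<ge> m0 \<Longrightarrow> (1 / 2 :: real) ^ m < e / 2"
      by (auto simp: eventually_sequentially)
    then have "(1 / 2 :: real) ^ max i m0 < e / 2"
      by simp
    then show ?thesis
      by (intro exI[of _ "max i m0"]) simp
  qed
  have "\<exists>M. \<forall>m\<ge>M. \<forall>l\<ge>M. N i (y m - y l) < e" if e: "0 < e" for i e
  proof -
    obtain m0 where m0: "m0 \<ge> i" "2 * (1 / 2 :: real) ^ m0 < e / 2"
      using small[of "e / 2" i] e by auto
    have near: "N i (y m - y m0) < e / 2" if "m \<ge> m0" for m
      using y_step[OF m0(1), of "m - m0"] m0(2) that by simp
    have "N i (y m - y l) < e" if "m \<ge> m0" "l \<ge> m0" for m l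
      using N_triangle[OF y_Car y_Car y_Car, of i m l m0] near[OF that(1)] near[OF that(2)]
        N_minus_commute[OF y_Car y_Car, of i m0 l] by linarith
    then show ?thesis
      by blast
  qed
  from Car_complete[OF y_Car this]
  obtain a where a: "a \<in> Car" "\<And>i e. 0 < e \<Longrightarrow> \<exists>M. \<forall>m\<ge>M. N i (y m - a) < e"
    by blast
  have "limitin (seminorm_topology (fib q) (range nm)) \<sigma> (pt q a) sequentially"
    unfolding f.limitin_iff
  proof (intro conjI allI impI)
    show "pt q a \<in> carrier (fib q)"
      using q a by (simp add: fib_carrier)
    fix i and e :: real assume e: "0 < e"
    obtain M0 where M0: "\<And>j l. j \<ge> M0 \<Longrightarrow> l \<ge> M0 \<Longrightarrow> Q i q (x j - x l) < e / 2"
      using Qc[of "e / 2" i] e by auto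
    obtain M1 where M1: "\<And>m. m \<ge> M1 \<Longrightarrow> N i (y m - a) < e / 2"
      using a(2)[of "e / 2" i] e by auto
    let ?m = "max M0 M1"
    have "Q i q (x j - a) < e" if j: "j \<ge> M0" for j
    proof -
      have c: "x j - x (s ?m) \<in> Car" "x (s ?m) - a \<in> Car" "y ?m - a \<in> Car"
        using x y_Car a by (simp_all add: Car_diff)
      have "Q i q (x (s ?m) - a) = Q i q (y ?m - a)"
        by (rule Q_cong) (simp add: symb_diff y_symb)
      also have "\<dots> < e / 2"
        using Q_le_self[OF c(3), of i q] M1[of ?m] by simp
      finally have "Q i q (x (s ?m) - a) < e / 2" .
      moreover have "Q i q (x j - x (s ?m)) < e / 2"
        using j by (intro M0) (simp_all add: s_def)
      ultimately show ?thesis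
        using Q_add[OF c(1,2), of i q] by simp
    qed
    then have "\<sigma> j \<in> carrier (fib q) \<and> nm i (\<sigma> j \<ominus>\<^bsub>fib q\<^esub> pt q a) < e" if "j \<ge> M0" for j
      using that q x a by (simp add: fib_minus nm_pt Car_diff fib_carrier)
    then show "\<forall>\<^sub>F j in sequentially. \<sigma> j \<in> carrier (fib q) \<and> nm i (\<sigma> j \<ominus>\<^bsub>fib q\<^esub> pt q a) < e"
      by (rule eventually_sequentiallyI)
  qed
  then show ?thesis
    by blast
qed

text \<open>Continuity of the product is inherited from the bundle; completeness and separation come
  from \<open>fib_complete\<close> and \<open>Q_eq_0\<close>.\<close>

lemma frechet_fib:
  assumes q: "q \<noteq> 0"
  shows "frechet_algebra (fib q) (subtopology TQ (carrier (fib q)))"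
proof -
  interpret f: seminorm_sequence "fib q" nm
    by (rule seminorm_sequence_fib[OF q])
  let ?T = "subtopology TQ (carrier (fib q))"
  have haus: "Hausdorff_space (seminorm_topology (fib q) (range nm))"
  proof (rule f.Hausdorff)
    fix u assume u: "u \<in> carrier (fib q)" and z: "\<And>i. nm i u = 0"
    obtain a where a: "a \<in> Car" "u = pt q a"
      using u q by (auto simp: fib_carrier)
    have "symb q a = 0"
      using z[of 0] a q by (intro Q_eq_0[OF a(1), of 0]) (simp add: nm_pt)
    then show "u = \<zero>\<^bsub>fib q\<^esub>"
      using a q Car_zero by (simp add: fib_zero pt_eq_iff)
  qed
  have sub: "carrier (fib q) \<times> carrier (fib q) \<subseteq> fibered_square B"
    using q by (auto simp: fib_carrier_iff fibered_square_def)
  have "continuous_map (prod_topology ?T ?T) TQ (\<lambda>(u, v). u \<otimes>\<^bsub>fib (fst u)\<^esub> v)"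
    unfolding prod_topology_subtopology subtopology_subtopology
    by (rule continuous_map_from_subtopology_mono[OF continuous_mult])
      (use sub in auto)
  then have "continuous_map (prod_topology ?T ?T) TQ (\<lambda>(u, v). u \<otimes>\<^bsub>fib q\<^esub> v)"
    by (rule continuous_map_eq) (use q in \<open>auto simp: fib_carrier_iff\<close>)
  then have mult: "continuous_map (prod_topology ?T ?T) ?T (\<lambda>(u, v). u \<otimes>\<^bsub>fib q\<^esub> v)"
  proof (rule continuous_map_into_subtopology)
    show "(\<lambda>(u, v). u \<otimes>\<^bsub>fib q\<^esub> v) \<in> topspace (prod_topology ?T ?T) \<rightarrow> carrier (fib q)"
      using q by (auto simp: fib_carrier fib_mult Car_conv)
  qed
  show ?thesis
    unfolding frechet_algebra_def
  proof (intro conjI exI[of _ nm] allI impI)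
    show "complex_algebra (fib q)"
      by (rule complex_algebra_fib[OF q])
    show "seminorm_on (fib q) (nm k)" for k
      by (rule f.seminorm)
    show "?T = seminorm_topology (fib q) (range nm)"
      by (rule fib_topology[OF q])
    show "Hausdorff_space ?T"
      using haus by (simp add: fib_topology[OF q])
    show "\<exists>u. limitin ?T \<sigma> u sequentially"
      if "range \<sigma> \<subseteq> carrier (fib q) \<and> (\<forall>k. \<forall>\<epsilon>>0. \<exists>N. \<forall>i\<ge>N. \<forall>j\<ge>N. nm k (\<sigma> i \<ominus>\<^bsub>fib q\<^esub> \<sigma> j) < \<epsilon>)" for \<sigma>
      unfolding fib_topology[OF q] using that by (intro fib_complete[OF q]) auto
  qed (rule mult)
qed

text \<open>\<open>Q\<close> is submultiplicative, but a product of two cut-offs does not bound a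
  single one. So \<open>V\<close> is taken with \<open>Suc k\<close>: where \<open>cut k\<close> is
  nonzero, \<open>cut (Suc k)\<close> is at least \<open>1\<close>, and membership in
  \<open>V\<close> bounds \<open>Q\<close> itself.\<close>

lemma mult_unif:
  assumes "U \<in> unif B"
  shows "\<exists>V\<in>unif B. \<forall>u\<in>V. \<forall>v\<in>V. fst u = fst v \<longrightarrow> u \<otimes>\<^bsub>fib (fst u)\<^esub> v \<in> U"
proof -
  obtain k i e where U: "0 < e" "ubox k i e \<subseteq> U"
    using assms by (auto simp: mem_unif)
  \<comment> \<open>With both fibre norms below \<open>d\<close>, one is bounded by \<open>d\<close>
    and the other by \<open>1\<close>; \<open>real k * d < e\<close> absorbs the cut-off.\<close>
  define d where "d = min 1 (e / (real k + 1))"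
  have d: "0 < d" "d \<le> 1" "real k * d < e"
  proof -
    show "0 < d" "d \<le> 1"
      using U(1) by (simp_all add: d_def)
    have "real k * d \<le> real k * (e / (real k + 1))"
      by (intro mult_left_mono) (simp_all add: d_def)
    also have "\<dots> < e"
      using U(1) by (simp add: field_simps)
    finally show "real k * d < e" .
  qed
  have "u \<otimes>\<^bsub>fib (fst u)\<^esub> v \<in> U" if uv: "u \<in> ubox (Suc k) i d" "v \<in> ubox (Suc k) i d" "fst u = fst v" for u v
  proof -
    obtain q a where a: "q \<noteq> 0" "a \<in> Car" "u = pt q a"
      using uv(1) ubox_subset by (blast elim: E_totalE)
    obtain q' b where b: "q' \<noteq> 0" "b \<in> Car" "v = pt q' b"
      using uv(2) ubox_subset by (blast elim: E_totalE)
    have qq: "q' = q"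
      using uv(3) a b by simp
    have small: "cut (Suc k) q * Q i q a < d" "cut (Suc k) q * Q i q b < d"
      using uv a b qq by (simp_all add: ubox_def bn_pt)
    have "cut k q * Q i q (conv a b) < e"
    proof (cases "cut k q = 0")
      case False
      then have c: "1 \<le> cut (Suc k) q"
        by (rule cut_Suc)
      have "Q i q a \<le> cut (Suc k) q * Q i q a" "Q i q b \<le> cut (Suc k) q * Q i q b"
        using mult_right_mono[OF c Q_nonneg[OF a(2)], of i q] mult_right_mono[OF c Q_nonneg[OF b(2)], of i q] by simp_all
      then have le: "Q i q a \<le> d" "Q i q b \<le> 1"
        using small d(2) by linarith+
      have "Q i q (conv a b) \<le> d * 1"
        using Q_conv[OF a(2) b(2), of i q] mult_mono[OF le, of] d(1) Q_nonneg[OF b(2), of i q] by linarith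
      then have "cut k q * Q i q (conv a b) \<le> real k * d"
        using d(1) by (intro mult_mono cut_le) (simp_all add: Q_nonneg Car_conv a b)
      with d(3) show ?thesis
        by linarith
    qed (use U(1) in simp)
    then have "pt q (conv a b) \<in> ubox k i e"
      using a b by (simp add: ubox_def bn_pt Car_conv pt_E_total)
    then show ?thesis
      using U(2) a b qq by (auto simp: fib_mult)
  qed
  then show ?thesis
    using ubox_unif[OF d(1)] by blast
qed

lemma frechet_algebra_bundle_B: "frechet_algebra_bundle B"
  unfolding frechet_algebra_bundle_def B_simps
  using locally_convex_B frechet_fib continuous_mult mult_unif by simp

end

section \<open>The free polydisk and the free ball\<close>

lemma seminorm_topology_cofinal:
  fixes M :: "(complex, 'a, 'm) module_scheme"
  assumes PQ: "\<And>\<nu>. \<nu> \<in> P \<Longrightarrow> \<exists>\<mu>\<in>P'. \<forall>u\<in>carrier M. \<nu> u \<le> \<mu> u"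
    and QP: "\<And>\<nu>. \<nu> \<in> P' \<Longrightarrow> \<exists>\<mu>\<in>P. \<forall>u\<in>carrier M. \<nu> u \<le> \<mu> u"
    and minus: "\<And>u v. u \<in> carrier M \<Longrightarrow> v \<in> carrier M \<Longrightarrow> u \<ominus>\<^bsub>M\<^esub> v \<in> carrier M"
  shows "seminorm_topology M P = seminorm_topology M P'"
proof -
  have le: "openin (seminorm_topology M R') W"
    if R: "\<And>\<nu>. \<nu> \<in> R \<Longrightarrow> \<exists>\<mu>\<in>R'. \<forall>u\<in>carrier M. \<nu> u \<le> \<mu> u" and W: "openin (seminorm_topology M R) W" for R R' W
    unfolding openin_seminorm_topology
  proof (intro conjI ballI)
    show sub: "W \<subseteq> carrier M"
      using W unfolding openin_seminorm_topology by (rule conjunct1)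
    fix u assume u: "u \<in> W"
    obtain Q \<epsilon> where Q: "finite Q" "Q \<subseteq> R" "0 < \<epsilon>" "{v \<in> carrier M. \<forall>\<nu>\<in>Q. \<nu> (v \<ominus>\<^bsub>M\<^esub> u) < \<epsilon>} \<subseteq> W"
      using bspec[OF conjunct2[OF W[unfolded openin_seminorm_topology]] u] by (elim exE conjE)
    have "\<forall>\<nu>\<in>Q. \<exists>\<mu>. \<mu> \<in> R' \<and> (\<forall>u\<in>carrier M. \<nu> u \<le> \<mu> u)"
      using R Q(2) by blast
    then obtain f where f: "\<And>\<nu>. \<nu> \<in> Q \<Longrightarrow> f \<nu> \<in> R'" "\<And>\<nu> u. \<nu> \<in> Q \<Longrightarrow> u \<in> carrier M \<Longrightarrow> \<nu> u \<le> f \<nu> u"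
      by metis
    have "v \<in> W" if v: "v \<in> carrier M" "\<forall>\<nu>\<in>f ` Q. \<nu> (v \<ominus>\<^bsub>M\<^esub> u) < \<epsilon>" for v
    proof -
      have "v \<ominus>\<^bsub>M\<^esub> u \<in> carrier M"
        using v(1) u sub by (intro minus) auto
      then have "\<forall>\<nu>\<in>Q. \<nu> (v \<ominus>\<^bsub>M\<^esub> u) < \<epsilon>"
        using v(2) f(2) by (auto intro: le_less_trans)
      then show ?thesis
        using Q(4) v(1) by blast
    qed
    then show "\<exists>Q \<epsilon>. finite Q \<and> Q \<subseteq> R' \<and> 0 < \<epsilon> \<and> {v \<in> carrier M. \<forall>\<nu>\<in>Q. \<nu> (v \<ominus>\<^bsub>M\<^esub> u) < \<epsilon>} \<subseteq> W"
      using Q(1,3) f(1) by (intro exI[of _ "f ` Q"] exI[of _ \<epsilon>]) auto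
  qed
  show ?thesis
    unfolding topology_eq using le[of P P'] le[of P' P] PQ QP by blast
qed

lemma (in graded_series) series_algebra_eq_F:
  assumes C: "C = Car"
    and "\<And>\<nu>. \<nu> \<in> P \<Longrightarrow> \<exists>i. \<forall>a\<in>Car. \<nu> a \<le> N i a"
    and "\<And>i. \<exists>\<nu>\<in>P. \<forall>a\<in>Car. N i a \<le> \<nu> a"
  shows "series_algebra C P = F"
proof -
  have "seminorm_topology VF P = seminorm_topology VF (range N)"
  proof (rule seminorm_topology_cofinal)
    show "u \<ominus>\<^bsub>VF\<^esub> v \<in> carrier VF" if "u \<in> carrier VF" "v \<in> carrier VF" for u v
      using that by (simp add: Car_diff)
  qed (use assms in auto)
  then show ?thesis
    by (simp add: F_eq series_algebra_Car C)
qed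

lemma exhausting_radii:
  fixes r :: ereal assumes "0 < r"
  obtains R :: "nat \<Rightarrow> real" where "\<And>i. 0 < R i" "\<And>i. ereal (R i) < r" "\<And>i. R i \<le> R (Suc i)"
    "\<And>\<rho>. ereal \<rho> < r \<Longrightarrow> \<exists>i. \<rho> \<le> R i"
proof (cases r)
  case (real x)
  then have x: "0 < x"
    using assms by simp
  show thesis
  \<comment> \<open>\<open>real i + 2\<close> makes already the first radius positive, namely
    \<open>x / 2\<close>.\<close>
  proof (rule that[of "\<lambda>i. x - x / (real i + 2)"])
    fix i
    have "x / (real i + 2) \<le> x / 2"
      using x by (intro divide_left_mono) simp_all
    moreover have "0 < x / (real i + 2)"
      using x by simp
    ultimately have "0 < x - x / (real i + 2)" "x - x / (real i + 2) < x"
      using x by linarith+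
    then show "0 < x - x / (real i + 2)" "ereal (x - x / (real i + 2)) < r"
      unfolding real less_ereal.simps .
    show "x - x / (real i + 2) \<le> x - x / (real (Suc i) + 2)"
      using x by (intro diff_left_mono divide_left_mono) auto
  next
    fix \<rho> assume "ereal \<rho> < r"
    then have \<rho>: "0 < x - \<rho>"
      using real by simp
    obtain i where "x / (x - \<rho>) \<le> real i"
      using real_arch_simple by blast
    then have "x / (real i + 2) \<le> x - \<rho>"
      using \<rho> x by (simp add: field_simps)
    then show "\<exists>i. \<rho> \<le> x - x / (real i + 2)"
      by (intro exI[of _ i]) simp
  qed
next
  case PInf
  show thesis
  proof (rule that[of "\<lambda>i. real i + 1"])
    fix \<rho> :: real
    obtain i where "\<rho> \<le> real i"
      using real_arch_simple by blast
    then show "\<exists>i. \<rho> \<le> real i + 1"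
      by (intro exI[of _ i]) simp
  qed (use PInf in auto)
qed (use assms in auto)

subsection \<open>The polydisk\<close>

text \<open>The number of maximal constant blocks of the word, as a natural number:
  \<open>switches\<close> is \<open>-1\<close> on the empty word, so the exponent of
  \<open>\<tau>\<close> is never negative.\<close>

definition sw :: "nat list \<Rightarrow> nat" where
  "sw \<alpha> = nat (switches \<alpha> + 1)"

lemma sw_eq: "sw \<alpha> = (if \<alpha> = [] then 0 else Suc (card {i. i + 1 < length \<alpha> \<and> \<alpha> ! i \<noteq> \<alpha> ! (i + 1)}))"
proof (cases "2 \<le> length \<alpha>")
  case True
  then show ?thesis
    by (auto simp: sw_def switches_def nat_add_distrib)
next
  case False
  then have "{i. i + 1 < length \<alpha> \<and> \<alpha> ! i \<noteq> \<alpha> ! (i + 1)} = {}"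
    by auto
  moreover have "length \<alpha> = 0 \<or> length \<alpha> = 1"
    using False by linarith
  ultimately show ?thesis
    using False by (auto simp: sw_def switches_def)
qed

lemma switches_sw: "switches \<alpha> + 1 = int (sw \<alpha>)"
  by (auto simp: sw_def switches_def)

lemma sw_Nil [simp]: "sw [] = 0"
  and sw_single [simp]: "sw [x] = 1"
  by (simp_all add: sw_eq)

lemma sw_Cons_Cons [simp]: "sw (x # y # \<alpha>) = (if x \<noteq> y then 1 else 0) + sw (y # \<alpha>)"
proof -
  let ?S = "\<lambda>\<alpha>. {i. i + 1 < length \<alpha> \<and> \<alpha> ! i \<noteq> (\<alpha> ! (i + 1) :: nat)}"
  have S: "?S (x # y # \<alpha>) = (if x \<noteq> y then {0} else {}) \<union> Suc ` ?S (y # \<alpha>)"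
    unfolding set_eq_iff
  proof
    fix i
    show "i \<in> ?S (x # y # \<alpha>) \<longleftrightarrow> i \<in> (if x \<noteq> y then {0} else {}) \<union> Suc ` ?S (y # \<alpha>)"
      by (cases i) auto
  qed
  have "finite (?S (y # \<alpha>))"
    by (rule finite_subset[of _ "{..length (y # \<alpha>)}"]) auto
  then have "card (?S (x # y # \<alpha>)) = (if x \<noteq> y then 1 else 0) + card (?S (y # \<alpha>))"
    unfolding S by (subst card_Un_disjoint) (auto simp: card_image)
  then show ?thesis
    unfolding sw_eq by simp
qed

text \<open>Joining two words can merge the blocks that meet but never creates one. With
  \<open>\<tau> \<ge> 1\<close> this makes the weights submultiplicative.\<close>

lemma sw_append: "sw (\<alpha> @ \<beta>) \<le> sw \<alpha> + sw \<beta>"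
proof (induction \<alpha>)
  case (Cons x \<alpha>)
  show ?case
  proof (cases \<alpha>)
    case Nil
    then show ?thesis
      by (cases \<beta>) auto
  next
    case (Cons y \<gamma>)
    with Cons.IH show ?thesis
      by simp
  qed
qed simp

lemma polydisk_term_eq: "polydisk_term \<rho> \<tau> c \<alpha> = cmod (c \<alpha>) * \<rho> ^ length \<alpha> * \<tau> ^ sw \<alpha>"
  by (simp add: polydisk_term_def switches_sw)

text \<open>Cutting at position \<open>j\<close> is a bijection onto pairs of words, with
  concatenation as its inverse.\<close>

lemma sum_words_of_length_split:
  assumes "j \<le> d"
  shows "(\<Sum>\<gamma>\<in>words_of_length n d. f (take j \<gamma>) (drop j \<gamma>)) =
    (\<Sum>\<alpha>\<in>words_of_length n j. \<Sum>\<beta>\<in>words_of_length n (d - j). f \<alpha> \<beta>)"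
proof -
  have "(\<Sum>\<gamma>\<in>words_of_length n d. f (take j \<gamma>) (drop j \<gamma>)) =
      (\<Sum>(\<alpha>, \<beta>)\<in>words_of_length n j \<times> words_of_length n (d - j). f \<alpha> \<beta>)"
    by (rule sum.reindex_bij_witness[where i = "\<lambda>(\<alpha>, \<beta>). \<alpha> @ \<beta>" and j = "\<lambda>\<gamma>. (take j \<gamma>, drop j \<gamma>)"])
      (use assms in \<open>auto simp: mem_words_of_length subset_iff dest: in_set_takeD in_set_dropD\<close>)
  then show ?thesis
    by (simp add: sum.cartesian_product)
qed

text \<open>A weighted \<open>l^1\<close> norm in each degree. The parameters \<open>\<rho>\<close>
  and \<open>\<tau>\<close> run together as \<open>R i\<close> and \<open>real i + 1\<close>, which
  is cofinal among the admissible pairs once the radii \<open>R i\<close> exhaust the interval up to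
  \<open>r\<close>.\<close>

lemma graded_series_polydisk:
  assumes R: "\<And>i. 0 < R i" "\<And>i. R i \<le> R (Suc i)"
  shows "graded_series n (\<lambda>i d a. \<Sum>\<alpha>\<in>words_of_length n d. polydisk_term (R i) (real i + 1) a \<alpha>)"
    (is "graded_series n ?p")
proof
  have pos: "0 < R i ^ length \<alpha> * (real i + 1) ^ sw \<alpha>" for i \<alpha>
    using R(1) by simp
  have nn: "0 \<le> polydisk_term (R i) (real i + 1) a \<alpha>" for i a \<alpha>
    using pos[of i \<alpha>] by (simp add: polydisk_term_eq mult.assoc)
  fix i d and a b :: free_series
  show "0 \<le> ?p i d a"
    by (intro sum_nonneg nn)
  show "?p i d (a + b) \<le> ?p i d a + ?p i d b"
    unfolding sum.distrib[symmetric]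
  proof (rule sum_mono)
    fix \<alpha>
    have "cmod (a \<alpha> + b \<alpha>) * (R i ^ length \<alpha> * (real i + 1) ^ sw \<alpha>)
        \<le> (cmod (a \<alpha>) + cmod (b \<alpha>)) * (R i ^ length \<alpha> * (real i + 1) ^ sw \<alpha>)"
      using pos[of i \<alpha>] by (intro mult_right_mono norm_triangle_ineq) simp
    then show "polydisk_term (R i) (real i + 1) (a + b) \<alpha> \<le>
        polydisk_term (R i) (real i + 1) a \<alpha> + polydisk_term (R i) (real i + 1) b \<alpha>"
      by (simp add: polydisk_term_eq algebra_simps)
  qed
  show "?p i d a \<le> K * ?p i d b"
    if "0 \<le> K" "\<And>\<alpha>. \<alpha> \<in> words_of_length n d \<Longrightarrow> cmod (a \<alpha>) \<le> K * cmod (b \<alpha>)" for K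
    unfolding sum_distrib_left
  proof (rule sum_mono)
    fix \<alpha> assume "\<alpha> \<in> words_of_length n d"
    then have "cmod (a \<alpha>) * (R i ^ length \<alpha> * (real i + 1) ^ sw \<alpha>)
        \<le> (K * cmod (b \<alpha>)) * (R i ^ length \<alpha> * (real i + 1) ^ sw \<alpha>)"
      using pos[of i \<alpha>] that by (intro mult_right_mono) auto
    then show "polydisk_term (R i) (real i + 1) a \<alpha> \<le> K * polydisk_term (R i) (real i + 1) b \<alpha>"
      by (simp add: polydisk_term_eq mult.assoc)
  qed
  show "\<exists>K\<ge>0. \<forall>a. \<forall>\<alpha>\<in>words_of_length n d. cmod (a \<alpha>) \<le> K * ?p i d a"
  proof (intro exI conjI allI ballI)
    show "0 \<le> 1 / R i ^ d"
      using R(1)[of i] by simp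
    fix a \<alpha> assume \<alpha>: "\<alpha> \<in> words_of_length n d"
    have "cmod (a \<alpha>) * R i ^ d * 1 \<le> polydisk_term (R i) (real i + 1) a \<alpha>"
      unfolding polydisk_term_eq using \<alpha> R(1)[of i]
      by (intro mult_mono) (auto simp: mem_words_of_length)
    also have "\<dots> \<le> ?p i d a"
      by (rule member_le_sum[OF \<alpha>]) (simp_all add: nn finite_words_of_length)
    finally show "cmod (a \<alpha>) \<le> 1 / R i ^ d * ?p i d a"
      using R(1)[of i] by (simp add: field_simps)
  qed
  show "?p i d a \<le> ?p (Suc i) d a"
  proof (rule sum_mono)
    fix \<alpha>
    show "polydisk_term (R i) (real i + 1) a \<alpha> \<le> polydisk_term (R (Suc i)) (real (Suc i) + 1) a \<alpha>"
      unfolding polydisk_term_eq using R(1)[of i] R(1)[of "Suc i"] R(2)[of i]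
      by (intro mult_mono power_mono) auto
  qed
  show "?p i d (conv a b) \<le> (\<Sum>j\<le>d. ?p i j a * ?p i (d - j) b)"
  proof -
    let ?t = "polydisk_term (R i) (real i + 1)"
    have "?p i d (conv a b) \<le> (\<Sum>\<gamma>\<in>words_of_length n d. \<Sum>j\<le>d. ?t a (take j \<gamma>) * ?t b (drop j \<gamma>))"
    proof (rule sum_mono)
      fix \<gamma> assume \<gamma>: "\<gamma> \<in> words_of_length n d"
      have "?t (conv a b) \<gamma> \<le> (\<Sum>j\<le>d. cmod (a (take j \<gamma>)) * cmod (b (drop j \<gamma>))) * (R i ^ length \<gamma> * (real i + 1) ^ sw \<gamma>)"
        unfolding polydisk_term_eq mult.assoc using \<gamma> pos[of i \<gamma>]
        by (intro mult_right_mono) (auto simp: conv_def mem_words_of_length norm_mult intro: order_trans[OF norm_sum])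
      also have "\<dots> \<le> (\<Sum>j\<le>d. ?t a (take j \<gamma>) * ?t b (drop j \<gamma>))"
        unfolding sum_distrib_right
      proof (rule sum_mono)
        fix j assume "j \<in> {..d}"
        then have len: "length \<gamma> = length (take j \<gamma>) + length (drop j \<gamma>)"
          using \<gamma> by (simp add: mem_words_of_length)
        have sw: "sw \<gamma> \<le> sw (take j \<gamma>) + sw (drop j \<gamma>)"
          using sw_append[of "take j \<gamma>" "drop j \<gamma>"] by simp
        have "R i ^ length \<gamma> * (real i + 1) ^ sw \<gamma>
            \<le> (R i ^ length (take j \<gamma>) * R i ^ length (drop j \<gamma>)) * ((real i + 1) ^ sw (take j \<gamma>) * (real i + 1) ^ sw (drop j \<gamma>))"
          unfolding power_add[symmetric] len[symmetric] using R(1)[of i]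
          by (intro mult_left_mono power_increasing sw) auto
        then have "(cmod (a (take j \<gamma>)) * cmod (b (drop j \<gamma>))) * (R i ^ length \<gamma> * (real i + 1) ^ sw \<gamma>)
            \<le> (cmod (a (take j \<gamma>)) * cmod (b (drop j \<gamma>))) *
              ((R i ^ length (take j \<gamma>) * R i ^ length (drop j \<gamma>)) * ((real i + 1) ^ sw (take j \<gamma>) * (real i + 1) ^ sw (drop j \<gamma>)))"
          by (rule mult_left_mono) simp
        also have "\<dots> = ?t a (take j \<gamma>) * ?t b (drop j \<gamma>)"
          unfolding polydisk_term_eq by (simp only: ac_simps)
        finally show "cmod (a (take j \<gamma>)) * cmod (b (drop j \<gamma>)) * (R i ^ length \<gamma> * (real i + 1) ^ sw \<gamma>)
            \<le> ?t a (take j \<gamma>) * ?t b (drop j \<gamma>)" .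
      qed
      finally show "?t (conv a b) \<gamma> \<le> (\<Sum>j\<le>d. ?t a (take j \<gamma>) * ?t b (drop j \<gamma>))" .
    qed
    also have "\<dots> = (\<Sum>j\<le>d. \<Sum>\<gamma>\<in>words_of_length n d. ?t a (take j \<gamma>) * ?t b (drop j \<gamma>))"
      by (rule sum.swap)
    also have "\<dots> = (\<Sum>j\<le>d. ?p i j a * ?p i (d - j) b)"
      by (intro sum.cong refl) (simp add: sum_words_of_length_split[where f = "\<lambda>\<alpha> \<beta>. ?t a \<alpha> * ?t b \<beta>"] sum_product)
    finally show ?thesis .
  qed
qed

text \<open>All terms are nonnegative and each degree has finitely many words, so unconditional
  summation may be grouped by degree.\<close>

lemma
  fixes f :: "nat list \<Rightarrow> real"
  assumes f: "\<And>\<alpha>. 0 \<le> f \<alpha>"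
  shows summable_on_words_iff: "f summable_on words n \<longleftrightarrow> summable (\<lambda>d. \<Sum>\<alpha>\<in>words_of_length n d. f \<alpha>)"
    and infsum_words: "f summable_on words n \<Longrightarrow>
      (\<Sum>\<^sub>\<infinity>\<alpha>\<in>words n. f \<alpha>) = (\<Sum>d. \<Sum>\<alpha>\<in>words_of_length n d. f \<alpha>)"
proof -
  let ?g = "\<lambda>d. \<Sum>\<alpha>\<in>words_of_length n d. f \<alpha>"
  let ?S = "SIGMA d:UNIV. words_of_length n d"
  have g: "0 \<le> ?g d" for d
    by (intro sum_nonneg f)
  have inj: "inj_on snd ?S"
    by (auto simp: inj_on_def mem_words_of_length)
  have im: "snd ` ?S = words n"
    by (force simp: words_def)
  have 1: "f summable_on words n \<longleftrightarrow> (\<lambda>x. f (snd x)) summable_on ?S"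
    unfolding im[symmetric] by (subst summable_on_reindex[OF inj]) (simp add: o_def)
  have g_on: "summable ?g \<longleftrightarrow> ?g summable_on UNIV"
    using g by (simp add: summable_on_UNIV_nonneg_real_iff)
  have inner: "infsum (\<lambda>\<alpha>. f (snd (d, \<alpha>))) (words_of_length n d) = ?g d" for d
    using finite_words_of_length by simp
  show iff: "f summable_on words n \<longleftrightarrow> summable ?g"
  proof
    assume "f summable_on words n"
    then have "(\<lambda>x. f (snd x)) summable_on ?S"
      using 1 by simp
    then have "(\<lambda>d. infsum (\<lambda>\<alpha>. f (snd (d, \<alpha>))) (words_of_length n d)) summable_on UNIV"
      by (rule summable_on_Sigma_banach[where f = "\<lambda>d \<alpha>. f (snd (d, \<alpha>))", simplified case_prod_unfold prod.collapse])
    then show "summable ?g"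
      unfolding inner g_on .
  next
    assume "summable ?g"
    then have "?g summable_on UNIV"
      unfolding g_on .
    then have "(\<lambda>x. f (snd x)) summable_on ?S"
      by (intro summable_on_SigmaI[where g = ?g]) (auto intro!: has_sum_finiteI finite_words_of_length f)
    then show "f summable_on words n"
      using 1 by simp
  qed
  assume s: "f summable_on words n"
  have "(\<Sum>\<^sub>\<infinity>\<alpha>\<in>words n. f \<alpha>) = (\<Sum>\<^sub>\<infinity>x\<in>?S. f (snd x))"
    unfolding im[symmetric] by (subst infsum_reindex[OF inj]) (simp add: o_def)
  also have "\<dots> = (\<Sum>\<^sub>\<infinity>d. \<Sum>\<^sub>\<infinity>\<alpha>\<in>words_of_length n d. f \<alpha>)"
    using infsum_Sigma'_banach[of "\<lambda>d \<alpha>. f \<alpha>" UNIV "words_of_length n"] s[unfolded 1]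
    by (simp add: case_prod_unfold)
  also have "\<dots> = (\<Sum>\<^sub>\<infinity>d. ?g d)"
    using finite_words_of_length by simp
  also have "\<dots> = (\<Sum>d. ?g d)"
    using s unfolding iff g_on by (metis has_sum_imp_sums has_sum_infsum sums_unique)
  finally show "(\<Sum>\<^sub>\<infinity>\<alpha>\<in>words n. f \<alpha>) = (\<Sum>d. ?g d)" .
qed

lemma polydisk_bundle:
  assumes r: "0 < r"
  shows "frechet_algebra_bundle (E_polydisk n r)" "continuous_bundle (E_polydisk n r)"
proof -
  obtain R :: "nat \<Rightarrow> real" where R: "\<And>i. 0 < R i" "\<And>i. ereal (R i) < r" "\<And>i. R i \<le> R (Suc i)"
    "\<And>\<rho>. ereal \<rho> < r \<Longrightarrow> \<exists>i. \<rho> \<le> R i"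
    using exhausting_radii[OF r] by blast
  interpret graded_series n "\<lambda>i d a. \<Sum>\<alpha>\<in>words_of_length n d. polydisk_term (R i) (real i + 1) a \<alpha>"
    by (rule graded_series_polydisk[where R = R, OF R(1,3)])
  have nn: "0 \<le> polydisk_term \<rho> \<tau> a \<alpha>" if "0 < \<rho>" "1 \<le> \<tau>" for \<rho> \<tau> a \<alpha>
    using that by (simp add: polydisk_term_eq)
  have R_mono: "R i \<le> R j" if "i \<le> j" for i j
    using that R(3) by (rule lift_Suc_mono_le[rotated])
  \<comment> \<open>One index dominates both parameters; this gives the equality of the carriers as
    well as the cofinality of the norms.\<close>
  have dom: "\<exists>i. \<forall>a \<alpha>. polydisk_term \<rho> \<tau> a \<alpha> \<le> polydisk_term (R i) (real i + 1) a \<alpha>"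
    if \<rho>: "0 < \<rho>" "ereal \<rho> < r" "1 \<le> \<tau>" for \<rho> \<tau>
  proof -
    obtain i where i: "\<rho> \<le> R i"
      using R(4)[OF \<rho>(2)] by blast
    obtain j where j: "\<tau> \<le> real j"
      using real_arch_simple by blast
    have "polydisk_term \<rho> \<tau> a \<alpha> \<le> polydisk_term (R (max i j)) (real (max i j) + 1) a \<alpha>" for a \<alpha>
      unfolding polydisk_term_eq
      using \<rho> i j R_mono[of i "max i j"] by (intro mult_mono power_mono) auto
    then show ?thesis
      by blast
  qed
  have C: "{c. (\<forall>\<alpha>. \<alpha> \<notin> words n \<longrightarrow> c \<alpha> = 0) \<and>
         (\<forall>\<rho> \<tau>. 0 < \<rho> \<and> ereal \<rho> < r \<and> 1 \<le> \<tau> \<longrightarrow> polydisk_term \<rho> \<tau> c summable_on words n)} = Car"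
    unfolding Car_def
  proof (intro Collect_cong conj_cong refl iffI allI impI)
    fix c i assume "\<forall>\<rho> \<tau>. 0 < \<rho> \<and> ereal \<rho> < r \<and> 1 \<le> \<tau> \<longrightarrow> polydisk_term \<rho> \<tau> c summable_on words n"
    then have "polydisk_term (R i) (real i + 1) c summable_on words n"
      using R(1,2) by simp
    then show "summable (\<lambda>d. \<Sum>\<alpha>\<in>words_of_length n d. polydisk_term (R i) (real i + 1) c \<alpha>)"
      using summable_on_words_iff[of "polydisk_term (R i) (real i + 1) c" n] nn R(1) by simp
  next
    fix c and \<rho> \<tau> :: real assume s: "\<forall>i. summable (\<lambda>d. \<Sum>\<alpha>\<in>words_of_length n d. polydisk_term (R i) (real i + 1) c \<alpha>)"
      and \<rho>: "0 < \<rho> \<and> ereal \<rho> < r \<and> 1 \<le> \<tau>"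
    then obtain i where i: "\<And>a \<alpha>. polydisk_term \<rho> \<tau> a \<alpha> \<le> polydisk_term (R i) (real i + 1) a \<alpha>"
      using dom by blast
    have "polydisk_term (R i) (real i + 1) c summable_on words n"
      using s summable_on_words_iff[of "polydisk_term (R i) (real i + 1) c" n] nn R(1) by simp
    then show "polydisk_term \<rho> \<tau> c summable_on words n"
      by (rule summable_on_comparison_test) (use i \<rho> nn in auto)
  qed
  have N: "(\<Sum>\<^sub>\<infinity>\<alpha>\<in>words n. polydisk_term (R i) (real i + 1) a \<alpha>) = N i a" if "a \<in> Car" for i a
    unfolding N_def
    using Car_summable[OF that, of i] summable_on_words_iff[of "polydisk_term (R i) (real i + 1) a" n] nn R(1)
    by (intro infsum_words) simp_all
  have "free_polydisk n r = F"
    unfolding free_polydisk_def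
  proof (rule series_algebra_eq_F[OF C])
    fix i
    show "\<exists>\<nu>\<in>{(\<lambda>c. \<Sum>\<^sub>\<infinity>\<alpha>\<in>words n. polydisk_term \<rho> \<tau> c \<alpha>) | \<rho> \<tau>. 0 < \<rho> \<and> ereal \<rho> < r \<and> 1 \<le> \<tau>}. \<forall>a\<in>Car. N i a \<le> \<nu> a"
    proof (rule bexI)
      show "\<forall>a\<in>Car. N i a \<le> (\<Sum>\<^sub>\<infinity>\<alpha>\<in>words n. polydisk_term (R i) (real i + 1) a \<alpha>)"
        using N by simp
      show "(\<lambda>c. \<Sum>\<^sub>\<infinity>\<alpha>\<in>words n. polydisk_term (R i) (real i + 1) c \<alpha>) \<in>
          {(\<lambda>c. \<Sum>\<^sub>\<infinity>\<alpha>\<in>words n. polydisk_term \<rho> \<tau> c \<alpha>) | \<rho> \<tau>. 0 < \<rho> \<and> ereal \<rho> < r \<and> 1 \<le> \<tau>}"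
        using R(1,2) by (intro CollectI exI[of _ "R i"] exI[of _ "real i + 1"]) simp
    qed
  next
    fix \<nu> assume "\<nu> \<in> {(\<lambda>c. \<Sum>\<^sub>\<infinity>\<alpha>\<in>words n. polydisk_term \<rho> \<tau> c \<alpha>) | \<rho> \<tau>. 0 < \<rho> \<and> ereal \<rho> < r \<and> 1 \<le> \<tau>}"
    then obtain \<rho> \<tau> where \<nu>: "\<nu> = (\<lambda>c. \<Sum>\<^sub>\<infinity>\<alpha>\<in>words n. polydisk_term \<rho> \<tau> c \<alpha>)" and \<rho>: "0 < \<rho>" "ereal \<rho> < r" "1 \<le> \<tau>"
      by blast
    obtain i where i: "\<And>a \<alpha>. polydisk_term \<rho> \<tau> a \<alpha> \<le> polydisk_term (R i) (real i + 1) a \<alpha>"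
      using dom[OF \<rho>] by blast
    have "\<nu> a \<le> N i a" if a: "a \<in> Car" for a
    proof -
      have s: "polydisk_term (R i) (real i + 1) a summable_on words n"
        using Car_summable[OF a, of i] summable_on_words_iff[of "polydisk_term (R i) (real i + 1) a" n] nn R(1) by simp
      have "polydisk_term \<rho> \<tau> a summable_on words n"
        using s by (rule summable_on_comparison_test) (use i \<rho> nn in auto)
      then have "\<nu> a \<le> (\<Sum>\<^sub>\<infinity>\<alpha>\<in>words n. polydisk_term (R i) (real i + 1) a \<alpha>)"
        unfolding \<nu> by (rule infsum_mono[OF _ s]) (rule i)
      then show ?thesis
        by (simp add: N[OF a])
    qed
    then show "\<exists>i. \<forall>a\<in>Car. \<nu> a \<le> N i a"
      by blast
  qed
  then show "frechet_algebra_bundle (E_polydisk n r)" "continuous_bundle (E_polydisk n r)"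
    using frechet_algebra_bundle_B continuous_bundle_B by (simp_all add: E_polydisk_def)
qed

subsection \<open>The ball\<close>

lemma ball_term_eq: "ball_term n \<rho> a d = L2_set (\<lambda>\<alpha>. cmod (a \<alpha>)) (words_of_length n d) * \<rho> ^ d"
  by (simp add: ball_term_def L2_set_def)

lemma L2_set_sum_le:
  assumes "finite J" shows "L2_set (\<lambda>x. \<Sum>j\<in>J. f j x) S \<le> (\<Sum>j\<in>J. L2_set (f j) S)"
  using assms
proof (induction J)
  case (insert j J)
  have "L2_set (\<lambda>x. f j x + (\<Sum>j\<in>J. f j x)) S \<le> L2_set (f j) S + L2_set (\<lambda>x. \<Sum>j\<in>J. f j x) S"
    by (rule L2_set_triangle_ineq)
  with insert show ?case
    by simp
qed (simp add: L2_set_def)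

text \<open>For a fixed cut \<open>j\<close> the convolution term is the tensor product of a
  component of degree \<open>j\<close> with one of degree \<open>d - j\<close>, and its
  \<open>l^2\<close> norm is the product of their norms; Minkowski's inequality adds the
  cuts.\<close>

lemma graded_series_ball:
  assumes R: "\<And>i. 0 < R i" "\<And>i. R i \<le> R (Suc i)"
  shows "graded_series n (\<lambda>i d a. ball_term n (R i) a d)"
proof
  fix i d and a b :: free_series
  let ?W = "words_of_length n"
  have Rd: "0 < R i ^ d" for i d
    using R(1) by simp
  show "0 \<le> ball_term n (R i) a d"
    using Rd[of i d] by (simp add: ball_term_eq L2_set_nonneg)
  show "ball_term n (R i) (a + b) d \<le> ball_term n (R i) a d + ball_term n (R i) b d"
  proof -
    have "L2_set (\<lambda>\<alpha>. cmod ((a + b) \<alpha>)) (?W d) \<le> L2_set (\<lambda>\<alpha>. cmod (a \<alpha>) + cmod (b \<alpha>)) (?W d)"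
      by (rule L2_set_mono) (simp_all add: norm_triangle_ineq)
    also have "\<dots> \<le> L2_set (\<lambda>\<alpha>. cmod (a \<alpha>)) (?W d) + L2_set (\<lambda>\<alpha>. cmod (b \<alpha>)) (?W d)"
      by (rule L2_set_triangle_ineq)
    finally show ?thesis
      unfolding ball_term_eq distrib_right[symmetric] using Rd[of i d] by (intro mult_right_mono) auto
  qed
  show "ball_term n (R i) a d \<le> K * ball_term n (R i) b d"
    if "0 \<le> K" "\<And>\<alpha>. \<alpha> \<in> ?W d \<Longrightarrow> cmod (a \<alpha>) \<le> K * cmod (b \<alpha>)" for K
  proof -
    have "L2_set (\<lambda>\<alpha>. cmod (a \<alpha>)) (?W d) \<le> L2_set (\<lambda>\<alpha>. K * cmod (b \<alpha>)) (?W d)"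
      by (rule L2_set_mono) (use that in auto)
    also have "\<dots> = K * L2_set (\<lambda>\<alpha>. cmod (b \<alpha>)) (?W d)"
      using that(1) by (simp add: L2_set_right_distrib)
    finally show ?thesis
      unfolding ball_term_eq mult.assoc[symmetric] using Rd[of i d] by (intro mult_right_mono) auto
  qed
  show "\<exists>K\<ge>0. \<forall>a. \<forall>\<alpha>\<in>?W d. cmod (a \<alpha>) \<le> K * ball_term n (R i) a d"
  proof (intro exI conjI allI ballI)
    show "0 \<le> 1 / R i ^ d"
      using Rd[of i d] by simp
    fix a \<alpha> assume "\<alpha> \<in> ?W d"
    then have "cmod (a \<alpha>) \<le> L2_set (\<lambda>\<alpha>. cmod (a \<alpha>)) (?W d)"
      using member_le_L2_set[OF finite_words_of_length, of \<alpha> n d "\<lambda>\<alpha>. cmod (a \<alpha>)"] by simp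
    then show "cmod (a \<alpha>) \<le> 1 / R i ^ d * ball_term n (R i) a d"
      using R(1)[of i] by (simp add: ball_term_eq)
  qed
  show "ball_term n (R i) a d \<le> ball_term n (R (Suc i)) a d"
    unfolding ball_term_eq using R(1)[of i] R(2)[of i]
    by (intro mult_left_mono power_mono L2_set_nonneg) auto
  show "ball_term n (R i) (conv a b) d \<le> (\<Sum>j\<le>d. ball_term n (R i) a j * ball_term n (R i) b (d - j))"
  proof -
    have "L2_set (\<lambda>\<gamma>. cmod (conv a b \<gamma>)) (?W d) \<le> L2_set (\<lambda>\<gamma>. \<Sum>j\<le>d. cmod (a (take j \<gamma>)) * cmod (b (drop j \<gamma>))) (?W d)"
      by (rule L2_set_mono)
        (auto simp: conv_def mem_words_of_length norm_mult intro!: order_trans[OF norm_sum])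
    also have "\<dots> \<le> (\<Sum>j\<le>d. L2_set (\<lambda>\<gamma>. cmod (a (take j \<gamma>)) * cmod (b (drop j \<gamma>))) (?W d))"
      by (rule L2_set_sum_le) simp
    also have "\<dots> = (\<Sum>j\<le>d. L2_set (\<lambda>\<alpha>. cmod (a \<alpha>)) (?W j) * L2_set (\<lambda>\<alpha>. cmod (b \<alpha>)) (?W (d - j)))"
    proof (rule sum.cong[OF refl])
      fix j assume "j \<in> {..d}"
      then have "(\<Sum>\<gamma>\<in>?W d. (cmod (a (take j \<gamma>)))\<^sup>2 * (cmod (b (drop j \<gamma>)))\<^sup>2)
          = (\<Sum>\<alpha>\<in>?W j. (cmod (a \<alpha>))\<^sup>2) * (\<Sum>\<beta>\<in>?W (d - j). (cmod (b \<beta>))\<^sup>2)"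
        by (simp add: sum_words_of_length_split[where f = "\<lambda>\<alpha> \<beta>. (cmod (a \<alpha>))\<^sup>2 * (cmod (b \<beta>))\<^sup>2"] sum_product)
      then show "L2_set (\<lambda>\<gamma>. cmod (a (take j \<gamma>)) * cmod (b (drop j \<gamma>))) (?W d)
          = L2_set (\<lambda>\<alpha>. cmod (a \<alpha>)) (?W j) * L2_set (\<lambda>\<alpha>. cmod (b \<alpha>)) (?W (d - j))"
        by (simp add: L2_set_def power_mult_distrib real_sqrt_mult)
    qed
    finally have "L2_set (\<lambda>\<gamma>. cmod (conv a b \<gamma>)) (?W d) * R i ^ d \<le>
        (\<Sum>j\<le>d. L2_set (\<lambda>\<alpha>. cmod (a \<alpha>)) (?W j) * L2_set (\<lambda>\<alpha>. cmod (b \<alpha>)) (?W (d - j))) * R i ^ d"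
      using Rd[of i d] by (intro mult_right_mono) auto
    also have "\<dots> = (\<Sum>j\<le>d. ball_term n (R i) a j * ball_term n (R i) b (d - j))"
      unfolding sum_distrib_right
    proof (rule sum.cong[OF refl])
      fix j assume "j \<in> {..d}"
      then have "R i ^ d = R i ^ j * R i ^ (d - j)"
        by (simp flip: power_add)
      then show "L2_set (\<lambda>\<alpha>. cmod (a \<alpha>)) (?W j) * L2_set (\<lambda>\<alpha>. cmod (b \<alpha>)) (?W (d - j)) * R i ^ d
          = ball_term n (R i) a j * ball_term n (R i) b (d - j)"
        by (simp add: ball_term_eq ac_simps)
    qed
    finally show ?thesis
      by (simp add: ball_term_eq)
  qed
qed

lemma ball_bundle:
  assumes r: "0 < r"
  shows "frechet_algebra_bundle (E_ball n r)" "continuous_bundle (E_ball n r)"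
proof -
  obtain R :: "nat \<Rightarrow> real" where R: "\<And>i. 0 < R i" "\<And>i. ereal (R i) < r" "\<And>i. R i \<le> R (Suc i)"
    "\<And>\<rho>. ereal \<rho> < r \<Longrightarrow> \<exists>i. \<rho> \<le> R i"
    using exhausting_radii[OF r] by blast
  interpret graded_series n "\<lambda>i d a. ball_term n (R i) a d"
    by (rule graded_series_ball[where R = R, OF R(1,3)])
  have mono: "ball_term n \<rho> a d \<le> ball_term n \<rho>' a d" and nn: "0 \<le> ball_term n \<rho> a d"
    if "0 < \<rho>" "\<rho> \<le> \<rho>'" for \<rho> \<rho>' a d
    unfolding ball_term_eq using that by (auto intro!: mult_left_mono power_mono L2_set_nonneg mult_nonneg_nonneg)
  have C: "{c. (\<forall>\<alpha>. \<alpha> \<notin> words n \<longrightarrow> c \<alpha> = 0) \<and>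
         (\<forall>\<rho>. 0 < \<rho> \<and> ereal \<rho> < r \<longrightarrow> summable (ball_term n \<rho> c))} = Car"
    unfolding Car_def
  proof (intro Collect_cong conj_cong refl iffI allI impI)
    fix c \<rho> assume s: "\<forall>i. summable (\<lambda>d. ball_term n (R i) c d)" and \<rho>: "0 < \<rho> \<and> ereal \<rho> < r"
    obtain i where i: "\<rho> \<le> R i"
      using R(4) \<rho> by blast
    have "summable (ball_term n (R i) c)"
      using s by simp
    moreover have "norm (ball_term n \<rho> c d) \<le> ball_term n (R i) c d" for d
      using mono[of \<rho> "R i" c d] nn[of \<rho> "R i" c d] \<rho> i by simp
    ultimately show "summable (ball_term n \<rho> c)"
      by (rule summable_comparison_test'[where N = 0])
  qed (use R in auto)
  have "free_ball n r = F"
    unfolding free_ball_def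
  proof (rule series_algebra_eq_F[OF C])
    fix i
    show "\<exists>\<nu>\<in>{(\<lambda>c. \<Sum>d. ball_term n \<rho> c d) | \<rho>. 0 < \<rho> \<and> ereal \<rho> < r}. \<forall>a\<in>Car. N i a \<le> \<nu> a"
    proof (rule bexI)
      show "(\<lambda>c. \<Sum>d. ball_term n (R i) c d) \<in> {(\<lambda>c. \<Sum>d. ball_term n \<rho> c d) | \<rho>. 0 < \<rho> \<and> ereal \<rho> < r}"
        using R(1,2) by blast
    qed (simp add: N_def)
  next
    fix \<nu> assume "\<nu> \<in> {(\<lambda>c. \<Sum>d. ball_term n \<rho> c d) | \<rho>. 0 < \<rho> \<and> ereal \<rho> < r}"
    then obtain \<rho> where \<nu>: "\<nu> = (\<lambda>c. \<Sum>d. ball_term n \<rho> c d)" and \<rho>: "0 < \<rho>" "ereal \<rho> < r"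
      by blast
    obtain i where i: "\<rho> \<le> R i"
      using R(4)[OF \<rho>(2)] by blast
    have "\<nu> a \<le> N i a" if a: "a \<in> Car" for a
    proof -
      have "summable (ball_term n \<rho> a)"
        using a \<rho> unfolding C[symmetric] by blast
      then show ?thesis
        unfolding \<nu> N_def by (intro suminf_le mono \<rho> i Car_summable a)
    qed
    then show "\<exists>i. \<forall>a\<in>Car. \<nu> a \<le> N i a"
      by blast
  qed
  then show "frechet_algebra_bundle (E_ball n r)" "continuous_bundle (E_ball n r)"
    using frechet_algebra_bundle_B continuous_bundle_B by (simp_all add: E_ball_def)
qed

theorem corollary7p4:
  fixes n :: nat and r :: ereal
  assumes "0 < r"
  shows "frechet_algebra_bundle (E_polydisk n r) \<and> continuous_bundle (E_polydisk n r) \<and>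
         frechet_algebra_bundle (E_ball n r) \<and> continuous_bundle (E_ball n r)"
  using polydisk_bundle[OF assms] ball_bundle[OF assms] by blast

end
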